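(* Let $f$ be a continuous map on an infra-solvmanifold of type $(\mathrm{R})$ with an affine homotopy lift $(d,D)$. Then $$N^\infty(f)=\mathrm{sp}\Big(\bigwedge D_*\Big)$$ provided that $1$ is not in the spectrum of $D_*$.
   Context: A connected, simply connected solvable Lie group $S$ with Lie algebra $\mathfrak{S}$ is of type $(\mathrm{R})$ if for every $X\in\mathfrak{S}$ all eigenvalues of $\mathrm{ad}\,X$ are real. Let $C$ be a compact subgroup of $\mathrm{Aut}(S)$ and let $\Pi\subset S\rtimes C$ be a torsion-free discrete subgroup which is a finite extension of the lattice $\Gamma=\Pi\cap S$ of $S$. Then $M=\Pi\backslash S$ is called an infra-solvmanifold of type $(\mathrm{R})$. $S\rtimes\mathrm{Endo}(S)$ acts on $S$ by $(d,D)(x)=d\,D(x)$. An affine homotopy lift of a continuous map $f:M\to M$ is an element $(d,D)\in S\rtimes\mathrm{Endo}(S)$ such that the affine map $(d,D):S\to S$ induces a continuous map on $M$ homotopic to $f$, with $\phi(\alpha)\circ(d,D)=(d,D)\circ\alpha$ for all $\alpha\in\Pi$, where $\phi:\Pi\to\Pi$ is the homomorphism induced by $f$. $D_*$ denotes the differential of $D$ on $\mathfrak{S}$. $N(f)$ is the Nielsen number: the number of fixed point classes of $f$ (sets $p(\mathrm{Fix}(\tilde f))$ for lifts $\tilde f$ of $f$ to the universal cover $p$, two lifts being identified when conjugate by a deck transformation) of nonzero fixed point index. For a sequence of complex numbers, $\mathrm{Growth}(a_n)=\max\{1,\limsup_n|a_n|^{1/n}\}$, and the asymptotic Nielsen number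 is $N^\infty(f)=\mathrm{Growth}(N(f^n))$. $\bigwedge D_*=\bigoplus_{\ell=0}^m\bigwedge^\ell D_*$ is the operator induced by $D_*$ on the exterior algebra of $\mathfrak{S}$ ($m=\dim\mathfrak{S}$), and $\mathrm{sp}$ denotes the spectral radius. *)

theory Defs
  imports "HOL-Analysis.Analysis" "HOL-Homology.Homology" "HOL-Algebra.Solvable_Groups" "HOL-Algebra.Bij"
    "HOL-Algebra.Group_Action"
begin

section \<open>Lie groups\<close>

text \<open>For an open set \<open>S\<close>, \<open>Ck_on k S f\<close> says that \<open>f\<close> is of class \<open>C\<^sup>k\<close> on \<open>S\<close>
  (all iterated directional derivatives up to order \<open>k\<close> exist and are continuous).\<close>

primrec Ck_on ::
  "nat \<Rightarrow> 'a::real_normed_vector set \<Rightarrow> ('a \<Rightarrow> 'b::real_normed_vector) \<Rightarrow> bool" where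
  "Ck_on 0 S f \<longleftrightarrow> continuous_on S f"
| "Ck_on (Suc k) S f \<longleftrightarrow>
     (\<forall>x\<in>S. f differentiable (at x)) \<and> (\<forall>v. Ck_on k S (\<lambda>x. frechet_derivative f (at x) v))"

definition smooth_on :: "'a::real_normed_vector set \<Rightarrow> ('a \<Rightarrow> 'b::real_normed_vector) \<Rightarrow> bool"
  where "smooth_on S f \<longleftrightarrow> (\<forall>k. Ck_on k S f)"

type_synonym ('s, 'n) chart = "'s set \<times> ('s \<Rightarrow> real ^ 'n)"

definition chart_inv :: "('s, 'n) chart \<Rightarrow> real ^ 'n \<Rightarrow> 's"
  where "chart_inv c = inv_into (fst c) (snd c)"

definition is_chart :: "('s::topological_space, 'n::finite) chart \<Rightarrow> bool"
  where "is_chart c \<longleftrightarrow> open (fst c) \<and> open (snd c ` fst c) \<and>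
    homeomorphism (fst c) (snd c ` fst c) (snd c) (chart_inv c)"

definition smooth_atlas :: "('s::topological_space, 'n::finite) chart set \<Rightarrow> bool"
  where "smooth_atlas \<A> \<longleftrightarrow> (\<forall>c\<in>\<A>. is_chart c) \<and> (\<Union>c\<in>\<A>. fst c) = UNIV \<and>
    (\<forall>c\<in>\<A>. \<forall>c'\<in>\<A>. smooth_on (snd c ` (fst c \<inter> fst c')) (snd c' \<circ> chart_inv c))"

definition smooth_map ::
  "('s::topological_space, 'n::finite) chart set \<Rightarrow> ('s \<Rightarrow> 's) \<Rightarrow> bool"
  where "smooth_map \<A> F \<longleftrightarrow> continuous_on UNIV F \<and>
    (\<forall>c\<in>\<A>. \<forall>c'\<in>\<A>. smooth_on (snd c ` (fst c \<inter> F -` fst c')) (snd c' \<circ> F \<circ> chart_inv c))"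

definition smooth_map2 ::
  "('s::topological_space, 'n::finite) chart set \<Rightarrow> ('s \<Rightarrow> 's \<Rightarrow> 's) \<Rightarrow> bool"
  where "smooth_map2 \<A> F \<longleftrightarrow> continuous_on UNIV (\<lambda>(x, y). F x y) \<and>
    (\<forall>c\<in>\<A>. \<forall>c'\<in>\<A>. \<forall>c''\<in>\<A>.
       smooth_on {(u, v). u \<in> snd c ` fst c \<and> v \<in> snd c' ` fst c' \<and>
                          F (chart_inv c u) (chart_inv c' v) \<in> fst c''}
         (\<lambda>(u, v). snd c'' (F (chart_inv c u) (chart_inv c' v))))"

text \<open>The underlying manifold is the whole type \<open>'s\<close>; its dimension is \<open>CARD('n)\<close>.\<close>

locale lie_group = group G
  for G :: "'s::{t2_space, second_countable_topology} monoid" (structure) +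
  fixes \<A> :: "('s, 'n::finite) chart set"
  assumes carrier_UNIV: "carrier G = UNIV"
    and atlas: "smooth_atlas \<A>"
    and smooth_mult: "smooth_map2 \<A> (\<lambda>x y. x \<otimes> y)"
    and smooth_inv: "smooth_map \<A> (\<lambda>x. inv x)"

definition lie_End ::
  "'s monoid \<Rightarrow> ('s::topological_space, 'n::finite) chart set \<Rightarrow> ('s \<Rightarrow> 's) set"
  where "lie_End G \<A> = {D \<in> hom G G. smooth_map \<A> D}"

text \<open>The Lie algebra is the tangent space at the identity, identified with \<open>real ^ 'n\<close> by the
  derivative of one fixed chart around the identity.  Another chart changes all the operators below
  by conjugation with one and the same linear isomorphism.\<close>

definition one_chart :: "'s monoid \<Rightarrow> ('s, 'n) chart set \<Rightarrow> ('s, 'n) chart"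
  where "one_chart G \<A> = (SOME c. c \<in> \<A> \<and> \<one>\<^bsub>G\<^esub> \<in> fst c)"

definition lie_differential ::
  "'s monoid \<Rightarrow> ('s, 'n::finite) chart set \<Rightarrow> ('s \<Rightarrow> 's) \<Rightarrow> real ^ 'n \<Rightarrow> real ^ 'n"
  where "lie_differential G \<A> D = (let c = one_chart G \<A> in
    frechet_derivative (snd c \<circ> D \<circ> chart_inv c) (at (snd c \<one>\<^bsub>G\<^esub>)))"

definition lie_Ad ::
  "'s monoid \<Rightarrow> ('s, 'n::finite) chart set \<Rightarrow> 's \<Rightarrow> real ^ 'n \<Rightarrow> real ^ 'n"
  where "lie_Ad G \<A> g = lie_differential G \<A> (\<lambda>x. g \<otimes>\<^bsub>G\<^esub> x \<otimes>\<^bsub>G\<^esub> inv\<^bsub>G\<^esub> g)"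

text \<open>\<open>lie_ad G \<A> X Y\<close> is the Lie bracket \<open>[X, Y]\<close>: \<open>ad\<close> is the derivative of \<open>Ad\<close> at the
  identity.\<close>

definition lie_ad ::
  "'s monoid \<Rightarrow> ('s, 'n::finite) chart set \<Rightarrow> real ^ 'n \<Rightarrow> real ^ 'n \<Rightarrow> real ^ 'n"
  where "lie_ad G \<A> X Y = (let c = one_chart G \<A> in
    frechet_derivative (\<lambda>u. lie_Ad G \<A> (chart_inv c u) Y) (at (snd c \<one>\<^bsub>G\<^esub>)) X)"


section \<open>Spectra of real operators and the exterior algebra\<close>

text \<open>Eigenvalues of a real linear operator are those of its complexification.\<close>

definition complex_spectrum :: "(real ^ 'k \<Rightarrow> real ^ 'k) \<Rightarrow> complex set"
  where "complex_spectrum T =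
    {z. \<exists>v::complex ^ 'k. v \<noteq> 0 \<and> (\<chi> i j. complex_of_real (matrix T $ i $ j)) *v v = z *s v}"

definition spectral_rad :: "(real ^ 'k \<Rightarrow> real ^ 'k) \<Rightarrow> real"
  where "spectral_rad T = Max (cmod ` complex_spectrum T)"

text \<open>The exterior algebra of \<open>real ^ 'n\<close> is \<open>real ^ 'n set\<close>: the basis vector indexed by
  \<open>I = {i\<^sub>1 < \<dots> < i\<^sub>l}\<close> is \<open>e i\<^sub>1 \<and> \<dots> \<and> e i\<^sub>l\<close>, and the \<open>l\<close>-th exterior power is the span of
  the basis vectors with \<open>card I = l\<close>.  The sign in the product of two basis vectors is that of
  the permutation sorting the concatenation of \<open>I\<close> and \<open>J\<close>.\<close>

definition wedge_basis :: "'n set \<Rightarrow> 'n set \<Rightarrow> real ^ ('n::{finite, linorder}) set"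
  where "wedge_basis I J = (if I \<inter> J = {}
    then (- 1) ^ card {(i, j). i \<in> I \<and> j \<in> J \<and> j < i} *\<^sub>R axis (I \<union> J) 1 else 0)"

definition wedge ::
  "real ^ 'n set \<Rightarrow> real ^ 'n set \<Rightarrow> real ^ ('n::{finite, linorder}) set"
  where "wedge u v = (\<Sum>I\<in>UNIV. \<Sum>J\<in>UNIV. (u $ I * v $ J) *\<^sub>R wedge_basis I J)"

definition ext_embed :: "(real, 'n::{finite, linorder}) vec \<Rightarrow> real ^ 'n set"
  where "ext_embed x = (\<Sum>i\<in>UNIV. x $ i *\<^sub>R axis {i} 1)"

text \<open>The unital algebra endomorphism induced by \<open>T\<close>, which maps \<open>e i\<^sub>1 \<and> \<dots> \<and> e i\<^sub>l\<close> to
  \<open>T (e i\<^sub>1) \<and> \<dots> \<and> T (e i\<^sub>l)\<close> and is the direct sum of all exterior powers of \<open>T\<close>.\<close>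

definition ext_map ::
  "((real, 'n::{finite, linorder}) vec \<Rightarrow> (real, 'n) vec) \<Rightarrow> real ^ 'n set \<Rightarrow> real ^ 'n set"
  where "ext_map T u = (\<Sum>I\<in>UNIV. u $ I *\<^sub>R
    foldr wedge (map (\<lambda>i. ext_embed (T (axis i 1))) (sorted_list_of_set I)) (axis {} 1))"


section \<open>Fixed point index and Nielsen number\<close>

text \<open>\<open>local_degree N U g k\<close>: the map \<open>g\<close> from an open subset \<open>U\<close> of Euclidean \<open>N\<close>-space \<open>E\<close>,
  with compact zero set \<open>K\<close>, has degree \<open>k\<close> over \<open>0\<close>.  As in Dold's definition, the composite
  \<open>H(E, E - B) \<rightarrow> H(E, E - K) \<cong> H(U, U - K) \<rightarrow> H(E, E - 0)\<close> (inclusion, inverse of excision,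
  and \<open>g\<close>, all in degree \<open>N\<close>), for a ball \<open>B\<close> about \<open>0\<close> containing \<open>K\<close>, is \<open>k\<close> times the
  isomorphism induced by the inclusion.  The homology groups are written multiplicatively.\<close>

definition local_degree ::
  "nat \<Rightarrow> (nat \<Rightarrow> real) set \<Rightarrow> ((nat \<Rightarrow> real) \<Rightarrow> (nat \<Rightarrow> real)) \<Rightarrow> int \<Rightarrow> bool"
  where "local_degree N U g k \<longleftrightarrow>
    (let E = Euclidean_space N; EU = subtopology E U; o0 = (\<lambda>i. 0); K = {x \<in> U. g x = o0} in
     openin E U \<and> continuous_map EU E g \<and> compactin E K \<and>
     (\<forall>R\<ge>0. let B = {x \<in> topspace E. (\<Sum>i<N. (x i)\<^sup>2) \<le> R\<^sup>2} in K \<subseteq> B \<longrightarrow>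
       (\<forall>z \<in> carrier (relative_homology_group (int N) E (topspace E - B)).
        \<forall>w \<in> carrier (relative_homology_group (int N) EU (U - K)).
          hom_induced (int N) EU (U - K) E (topspace E - K) id w =
          hom_induced (int N) E (topspace E - B) E (topspace E - K) id z \<longrightarrow>
          hom_induced (int N) EU (U - K) E (topspace E - {o0}) g w =
          hom_induced (int N) E (topspace E - B) E (topspace E - {o0}) id z
            [^]\<^bsub>relative_homology_group (int N) E (topspace E - {o0})\<^esub> k)))"

text \<open>Fixed point index (Dold) of a self-map \<open>f\<close> of a compact Euclidean neighbourhood retract
  \<open>X\<close>, for instance a closed manifold, at a compact set \<open>F\<close> that is relatively open in the fixed
  point set: for an embedding \<open>i\<close> of \<open>X\<close> as a retract (by \<open>r\<close>) of an open set \<open>O'\<close>, and an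
  isolating neighbourhood \<open>V\<close> of \<open>F\<close>, it is the degree over \<open>0\<close> of \<open>y \<mapsto> y - i (f (r y))\<close> on
  the preimage of \<open>V\<close> under \<open>r\<close>.  The value does not depend on the choices.\<close>

definition fixed_point_index :: "'m topology \<Rightarrow> ('m \<Rightarrow> 'm) \<Rightarrow> 'm set \<Rightarrow> int"
  where "fixed_point_index X f F = (THE k. \<exists>N i r O' V.
    continuous_map X (Euclidean_space N) i \<and>
    openin (Euclidean_space N) O' \<and> i ` topspace X \<subseteq> O' \<and>
    continuous_map (subtopology (Euclidean_space N) O') X r \<and> (\<forall>x\<in>topspace X. r (i x) = x) \<and>
    openin X V \<and> {x \<in> V. f x = x} = F \<and>
    local_degree N {y \<in> O'. r y \<in> V} (\<lambda>y j. y j - i (f (r y)) j) k)"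

text \<open>In the following definitions \<open>p\<close> is a universal covering of \<open>X\<close>, defined on a whole type.\<close>

definition lifts :: "('s::topological_space \<Rightarrow> 'm) \<Rightarrow> ('m \<Rightarrow> 'm) \<Rightarrow> ('s \<Rightarrow> 's) set"
  where "lifts p f = {g. continuous_on UNIV g \<and> (\<forall>x. p (g x) = f (p x))}"

definition deck_transformations :: "('s::topological_space \<Rightarrow> 'm) \<Rightarrow> ('s \<Rightarrow> 's) set"
  where "deck_transformations p = {h. (\<exists>h'. homeomorphism UNIV UNIV h h') \<and> p \<circ> h = p}"

definition lift_conj ::
  "('s::topological_space \<Rightarrow> 'm) \<Rightarrow> ('m \<Rightarrow> 'm) \<Rightarrow> (('s \<Rightarrow> 's) \<times> ('s \<Rightarrow> 's)) set"
  where "lift_conj p f = {(g, g'). g \<in> lifts p f \<and> g' \<in> lifts p f \<and>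
    (\<exists>h \<in> deck_transformations p. g' \<circ> h = h \<circ> g)}"

text \<open>Fixed point classes are counted by lifting classes.  Conjugate lifts \<open>g\<close> give the same set
  \<open>p ` {x. g x = x}\<close>.  For compact \<open>X\<close> only finitely many classes are counted, so \<open>card\<close> is
  the true number.\<close>

definition nielsen_number ::
  "'m topology \<Rightarrow> ('s::topological_space \<Rightarrow> 'm) \<Rightarrow> ('m \<Rightarrow> 'm) \<Rightarrow> nat"
  where "nielsen_number X p f = card {c \<in> lifts p f // lift_conj p f.
    \<exists>g\<in>c. fixed_point_index X f (p ` {x. g x = x}) \<noteq> 0}"

definition growth :: "(nat \<Rightarrow> complex) \<Rightarrow> ereal"
  where "growth a = max 1 (limsup (\<lambda>n. ereal (root n (cmod (a n)))))"

definition asymptotic_nielsen_number ::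
  "'m topology \<Rightarrow> ('s::topological_space \<Rightarrow> 'm) \<Rightarrow> ('m \<Rightarrow> 'm) \<Rightarrow> ereal"
  where "asymptotic_nielsen_number X p f = growth (\<lambda>n. of_nat (nielsen_number X p (f ^^ n)))"


section \<open>Infra-solvmanifolds of type (R)\<close>

definition quotient_topology :: "('s::topological_space \<Rightarrow> 'm) \<Rightarrow> 'm topology"
  where "quotient_topology p = topology (\<lambda>U. U \<subseteq> range p \<and> open (p -` U))"

lemma openin_quotient_topology:
  "openin (quotient_topology p) U \<longleftrightarrow> U \<subseteq> range p \<and> open (p -` U)"
proof -
  have "istopology (\<lambda>U. U \<subseteq> range p \<and> open (p -` U))"
    by (force simp: istopology_def vimage_Union intro!: open_UN)
  then show ?thesis
    by (simp add: quotient_topology_def)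
qed

lemma topspace_quotient_topology: "topspace (quotient_topology p) = range p"
proof -
  have "p -` range p = UNIV"
    by auto
  then have "openin (quotient_topology p) (range p)"
    by (simp add: openin_quotient_topology)
  then show ?thesis
    by (meson openin_quotient_topology openin_subset openin_topspace subset_antisym)
qed

lemma quotient_map_quotient_topology: "quotient_map euclidean (quotient_topology p) p"
  by (auto simp: quotient_map_def topspace_quotient_topology openin_quotient_topology vimage_def)

definition compact_open_topology :: "('a::topological_space \<Rightarrow> 'b::topological_space) topology"
  where "compact_open_topology =
    topology_generated_by {{F. F ` K \<subseteq> U} | K U. compact K \<and> open U}"

text \<open>The semidirect product of \<open>G\<close> with a monoid \<open>H\<close> of endomorphisms of \<open>G\<close> (under
  composition), and its action on \<open>G\<close>.\<close>

definition semidirect :: "'s monoid \<Rightarrow> ('s \<Rightarrow> 's) set \<Rightarrow> ('s \<times> ('s \<Rightarrow> 's)) monoid"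
  where "semidirect G H = \<lparr>carrier = carrier G \<times> H,
    mult = (\<lambda>(a, A) (b, B). (a \<otimes>\<^bsub>G\<^esub> A b, A \<circ> B)), one = (\<one>\<^bsub>G\<^esub>, id)\<rparr>"

definition affine_act :: "'s monoid \<Rightarrow> 's \<times> ('s \<Rightarrow> 's) \<Rightarrow> 's \<Rightarrow> 's"
  where "affine_act G = (\<lambda>(d, D) x. d \<otimes>\<^bsub>G\<^esub> D x)"

definition discrete_subset :: "'a topology \<Rightarrow> 'a set \<Rightarrow> bool"
  where "discrete_subset X A \<longleftrightarrow> subtopology X A = discrete_topology A"

text \<open>As usual for solvable Lie groups, a lattice is a discrete cocompact subgroup.\<close>

definition lattice_subgroup :: "'s::topological_space monoid \<Rightarrow> 's set \<Rightarrow> bool"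
  where "lattice_subgroup G \<Gamma> \<longleftrightarrow> subgroup \<Gamma> G \<and> discrete_subset euclidean \<Gamma> \<and>
    compact_space (quotient_topology (\<lambda>x. \<Gamma> #>\<^bsub>G\<^esub> x))"

definition translation_part :: "('s \<times> ('s \<Rightarrow> 's)) set \<Rightarrow> 's set"
  where "translation_part P = {a. (a, id) \<in> P}"

locale simply_connected_solvable_lie_group_R = lie_group G \<A>
  for G :: "'s::{t2_space, second_countable_topology} monoid" (structure)
    and \<A> :: "('s, 'n::finite) chart set" +
  assumes connected: "connected (UNIV :: 's set)"
    and simply_connected: "simply_connected (UNIV :: 's set)"
    and solvable: "solvable G"
    and type_R: "\<And>X. complex_spectrum (lie_ad G \<A> X) \<subseteq> \<real>"

locale infra_solvmanifold_R = simply_connected_solvable_lie_group_R G \<A>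
  for G :: "'s::{t2_space, second_countable_topology} monoid" (structure)
    and \<A> :: "('s, 'n::finite) chart set" +
  fixes C :: "('s \<Rightarrow> 's) set" and P :: "('s \<times> ('s \<Rightarrow> 's)) set"
  assumes C_subgroup: "subgroup C (AutoGroup G)"
    and C_smooth: "C \<subseteq> lie_End G \<A>"
    and C_compact: "compactin compact_open_topology C"
    and P_subgroup: "subgroup P (semidirect G C)"
    and P_torsion_free:
      "\<And>\<alpha> n::nat. \<alpha> \<in> P \<Longrightarrow> n > 0 \<Longrightarrow> \<alpha> [^]\<^bsub>semidirect G C\<^esub> n = \<one>\<^bsub>semidirect G C\<^esub> \<Longrightarrow>
         \<alpha> = \<one>\<^bsub>semidirect G C\<^esub>"
    and P_discrete: "discrete_subset (prod_topology euclidean compact_open_topology) P"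
    and lattice: "lattice_subgroup G (translation_part P)"
    and finite_extension:
      "finite (rcosets\<^bsub>(semidirect G C)\<lparr>carrier := P\<rparr>\<^esub> (translation_part P \<times> {id}))"

definition infra_proj ::
  "'s monoid \<Rightarrow> ('s \<Rightarrow> 's) set \<Rightarrow> ('s \<times> ('s \<Rightarrow> 's)) set \<Rightarrow> 's \<Rightarrow> 's set"
  where "infra_proj G C P = orbit ((semidirect G C)\<lparr>carrier := P\<rparr>) (affine_act G)"

abbreviation infra_manifold ::
  "'s::topological_space monoid \<Rightarrow> ('s \<Rightarrow> 's) set \<Rightarrow> ('s \<times> ('s \<Rightarrow> 's)) set \<Rightarrow> 's set topology"
  where "infra_manifold G C P \<equiv> quotient_topology (infra_proj G C P)"

text \<open>The homomorphism \<open>\<phi>\<close> induced by \<open>f\<close> is determined by the choice of a lift \<open>g\<close> of \<open>f\<close>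
  through \<open>\<phi>(\<alpha>) \<circ> g = g \<circ> \<alpha>\<close>.\<close>

definition induced_hom ::
  "'s::topological_space monoid \<Rightarrow> ('s \<Rightarrow> 's) set \<Rightarrow> ('s \<times> ('s \<Rightarrow> 's)) set \<Rightarrow> ('s set \<Rightarrow> 's set) \<Rightarrow>
   ('s \<times> ('s \<Rightarrow> 's) \<Rightarrow> 's \<times> ('s \<Rightarrow> 's)) \<Rightarrow> bool"
  where "induced_hom G C P f \<phi> \<longleftrightarrow>
    \<phi> \<in> hom ((semidirect G C)\<lparr>carrier := P\<rparr>) ((semidirect G C)\<lparr>carrier := P\<rparr>) \<and>
    (\<exists>g \<in> lifts (infra_proj G C P) f. \<forall>\<alpha>\<in>P. affine_act G (\<phi> \<alpha>) \<circ> g = g \<circ> affine_act G \<alpha>)"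

definition affine_homotopy_lift ::
  "'s monoid \<Rightarrow> ('s::topological_space, 'n::finite) chart set \<Rightarrow> ('s \<Rightarrow> 's) set \<Rightarrow>
   ('s \<times> ('s \<Rightarrow> 's)) set \<Rightarrow> ('s set \<Rightarrow> 's set) \<Rightarrow> 's \<Rightarrow> ('s \<Rightarrow> 's) \<Rightarrow> bool"
  where "affine_homotopy_lift G \<A> C P f d D \<longleftrightarrow>
    (d, D) \<in> carrier (semidirect G (lie_End G \<A>)) \<and>
    (\<exists>h. continuous_map (infra_manifold G C P) (infra_manifold G C P) h \<and>
       (\<forall>x. h (infra_proj G C P x) = infra_proj G C P (affine_act G (d, D) x)) \<and>
       homotopic_with (\<lambda>_. True) (infra_manifold G C P) (infra_manifold G C P) h f) \<and>
    (\<exists>\<phi>. induced_hom G C P f \<phi> \<and>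
       (\<forall>\<alpha>\<in>P. affine_act G (\<phi> \<alpha>) \<circ> affine_act G (d, D) =
               affine_act G (d, D) \<circ> affine_act G \<alpha>))"

end

theory Submission
 imports Defs "HOL-Computational_Algebra.Fundamental_Theorem_Algebra"
begin

text \<open>The iterate \<open>f^n\<close> is homotopic to a map \<open>h^n\<close> with the affine lift \<open>x \<mapsto> b (D^n x)\<close>, and the Nielsen number
 is a homotopy invariant.  For the upper bound, the itinerary of a point of a compact fundamental set \<open>F\<close> under \<open>D^q\<close>
 takes at most \<open>K N^(n div q)\<close> values, where \<open>N\<close> is bounded by the largest minor of \<open>D\<^sub>*^q\<close>, which grows like the
 spectral radius on the exterior algebra.  Points of \<open>F\<close> with the same itinerary cannot be fixed by two different
 lifts of \<open>h^n\<close>.  For the lower bound, \<open>y \<mapsto> y (b (D^n y))^-1\<close> multiplies volumes by \<open>|det (1 - D\<^sub>*^n)|\<close>, so that by the pigeonhole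
 principle about that many orbits of the lattice consist of points that it sends into the lattice; since \<open>D^n\<close> has no fixed point besides the identity,
 each of them is alone in its class, and its index is \<open>1\<close> or \<open>-1\<close>.  Finally \<open>|det (1 - D\<^sub>*^n)| = \<Prod>|1 - z^n|\<close>, over the
 eigenvalues \<open>z\<close>, exceeds a multiple of the product of the \<open>max 1 |z|^n\<close> for infinitely many \<open>n\<close>.\<close>

section \<open>Local degree\<close>

text \<open>Only growth matters, as constants disappear under the \<open>n\<close>-th root. Each
  covering step of the upper bound costs a factor \<open>(24 m)^m\<close>, \<open>m\<close> the
  dimension, besides a minor; to keep it from being raised to the power \<open>n\<close>, the step
  is made with \<open>D^q\<close>, and \<open>q\<close> is so large that \<open>(r / t)^q\<close>
  absorbs the factor, where \<open>s < t < r\<close> and \<open>s\<close> is the spectral radius. In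
  the lower bound the obstacle is eigenvalues \<open>z\<close> of modulus one, for which
  \<open>1 - z^n\<close> may be small or zero: recurrence yields infinitely many \<open>n\<close>
  with all these \<open>z^(n-1)\<close> near \<open>1\<close>, so that \<open>1 - z^n\<close> is
  near \<open>1 - z\<close>, which is nonzero by the hypothesis on the spectrum. That
  \<open>D^n\<close> fixes only the identity comes from simple connectivity, through a covering of
  the group by itself. \<open>fixed_point_index\<close> is a definite description over all Euclidean
  retractions, so a value can be read off only if every retraction gives it; the degree theory
  therefore keeps the retraction as a parameter. The index of a nondegenerate fixed point is found
  from formal properties of the degree, by deforming \<open>1 - L\<close>, \<open>L\<close> the
  derivative, to a diagonal matrix of signs.\<close>

abbreviation (input) ascii_iff (infixr "<->" 25) where "A <-> B == (A :: bool) = B"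

abbreviation "eucl == Euclidean_space"

abbreviation "ecar N == topspace (Euclidean_space N)"

abbreviation "esub N == subtopology (Euclidean_space N)"

abbreviation "cylinder == prod_topology (top_of_set {0..1 :: real})"

abbreviation det1 :: "(real ^ 'n => real ^ 'n) => real"
 where "det1 L == det (matrix (%u. u - L u))"

definition eball :: "nat => real => (nat => real) set"
 where "eball N R = {x : ecar N. (SUM i<N. (x i)\<^sup>2) <= R\<^sup>2}"

lemma eball_mono: "0 <= R ==> R <= R' ==> eball N R <= eball N R'"
 unfolding eball_def using power_mono by (smt (verit) Collect_mono_iff)

lemma zero_in_eball: "(%i. 0) : eball N R"
 by (simp add: eball_def topspace_Euclidean_space)

lemma eball_0: "eball N 0 = {%i. 0}"
proof -
 have "x = (%i. 0)" if "x : ecar N" "(SUM i<N. (x i)\<^sup>2) <= 0" for x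
 proof
  fix i
  have "ALL i:{..<N}. (x i)\<^sup>2 = 0"
  using that(2) by (metis (no_types, lifting) antisym finite_lessThan sum_nonneg sum_nonneg_eq_0_iff zero_le_power2)
  thus "x i = 0" using that(1) by (cases "i < N") (auto simp: topspace_Euclidean_space)
 qed
 thus ?thesis by (auto simp: eball_def topspace_Euclidean_space)
qed

lemma cmap_eucl_coord: "continuous_map (eucl N) euclideanreal (%x. x i)"
 by (metis continuous_map_Euclidean_space_iff continuous_on_product_coordinates continuous_on_subset subset_UNIV)

lemma cmap_eucl_iff:
 "continuous_map X (eucl N) f <->
  (ALL i. continuous_map X euclideanreal (%x. f x i)) & f : topspace X \<rightarrow> ecar N"
 unfolding Euclidean_space_def by (auto simp: continuous_map_in_subtopology continuous_map_componentwise_UNIV)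

lemma cmap_eucl_sqnorm:
 "continuous_map (eucl N) euclideanreal (%x. SUM i<N. (x i)\<^sup>2)"
 by (intro continuous_intros cmap_eucl_coord) auto

lemma hausdorff_eucl: "Hausdorff_space (eucl N)"
 unfolding Euclidean_space_def by (intro Hausdorff_space_subtopology) (simp add: Hausdorff_space_product_topology)

lemma compactin_imp_subset_eball:
 assumes "compactin (eucl N) K"
 obtains R where "0 <= R" "K <= eball N R"
proof -
 have "compactin euclideanreal ((%x. SUM i<N. (x i)\<^sup>2) ` K)"
  by (rule image_compactin[OF assms cmap_eucl_sqnorm])
 hence "bdd_above ((%x. SUM i<N. (x i)\<^sup>2) ` K)"
  unfolding compactin_euclidean_iff by (intro bounded_imp_bdd_above compact_imp_bounded)
 then obtain b where b: "ALL y:(%x. SUM i<N. (x i)\<^sup>2) ` K. y <= b" unfolding bdd_above_def by (rule exE)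
 have "1 <= max 1 b" "b <= max 1 b" by auto
 hence "b <= max 1 b * max 1 b" by (smt (verit) mult_le_cancel_left1)
 hence "b <= (max 1 b)\<^sup>2" by (simp add: power2_eq_square)
 hence "K <= eball N (max 1 b)" using b compactin_subset_topspace[OF assms] unfolding eball_def by fastforce
 thus ?thesis using that[of "max 1 b"] by simp
qed

text \<open>Pushing points radially away from the origin by at least \<open>R'\<close> deforms the complement of a
 ball into the complement of a larger one.\<close>

lemma trivial_group_eball_annulus:
 assumes "0 <= R" "R <= R'"
 shows "trivial_group (relative_homology_group p (esub N (ecar N - eball N R)) (ecar N - eball N R'))"
  (is "trivial_group (relative_homology_group p ?X ?S)")
proof -
 define nrm where "nrm x = sqrt (SUM i<N. (x i)\<^sup>2)" for x :: "nat => real"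
 define F where "F = (%(t, x :: nat => real) i. (1 + (1 - t) * (R' / nrm x)) * x i)"
 have SX: "subtopology ?X ?S = esub N ?S"
  using eball_mono[OF assms] by (simp add: subtopology_subtopology) (metis Diff_mono inf.absorb_iff2 order_refl)
 have inX: "x : topspace ?X <-> x : ecar N & R < nrm x" for x
 proof -
  have "(SUM i<N. (x i)\<^sup>2) = (nrm x)\<^sup>2" by (simp add: nrm_def sum_nonneg)
  moreover have "nrm x >= 0" by (simp add: nrm_def sum_nonneg)
  ultimately show ?thesis using assms by (auto simp: eball_def power_mono_iff not_le)
 qed
 have inS: "x : ?S <-> x : ecar N & R' < nrm x" for x
 proof -
  have "(SUM i<N. (x i)\<^sup>2) = (nrm x)\<^sup>2" by (simp add: nrm_def sum_nonneg)
  moreover have "nrm x >= 0" by (simp add: nrm_def sum_nonneg)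
  ultimately show ?thesis using assms by (auto simp: eball_def power_mono_iff not_le)
 qed
 have nrm_F: "nrm (F (t, x)) = (1 + (1 - t) * (R' / nrm x)) * nrm x" if "t : {0..1}" "nrm x >= 0" for t x
 proof -
  have "0 <= 1 + (1 - t) * (R' / nrm x)" using that assms by simp
  thus ?thesis unfolding nrm_def F_def
  by (simp add: power_mult_distrib flip: sum_distrib_left) (simp add: real_sqrt_mult)
 qed
 have cn: "continuous_map (eucl N) euclideanreal nrm" unfolding nrm_def by (intro continuous_intros cmap_eucl_sqnorm)
 have cF: "continuous_map (cylinder (esub N A)) (eucl N) F" if "!!x. x : ecar N Int A ==> nrm x ~= 0" for A
 proof -
  let ?P = "cylinder (esub N A)"
  have c2: "continuous_map ?P (eucl N) snd" using continuous_map_snd continuous_map_into_fulltopology by blast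
  have c1: "continuous_map ?P euclideanreal fst" using continuous_map_fst continuous_map_into_fulltopology by blast
  have cc: "continuous_map ?P euclideanreal (%z. snd z i)" for i
  using continuous_map_compose[OF c2 cmap_eucl_coord] by (simp add: o_def)
  have cnn: "continuous_map ?P euclideanreal (%z. nrm (snd z))"
  using continuous_map_compose[OF c2 cn] by (simp add: o_def)
  have "continuous_map ?P euclideanreal (%z. F z i)" for i unfolding F_def case_prod_beta using that
  by (intro continuous_intros c1 cc cnn continuous_map_real_divide) auto
  moreover have "F : topspace ?P \<rightarrow> ecar N" by (auto simp: F_def topspace_Euclidean_space)
  ultimately show ?thesis by (simp add: cmap_eucl_iff)
 qed
 have grow: "nrm (F (t, x)) >= nrm x" if "t : {0..1}" "nrm x > 0" for t x
 proof -
  have "0 <= (1 - t) * (R' / nrm x) * nrm x" using that assms by simp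
  thus ?thesis using that by (simp add: nrm_F distrib_right)
 qed
 have FX: "F (t, x) : topspace ?X" if "t : {0..1}" "x : topspace ?X" for t x
 proof -
  have "nrm x > 0" "x : ecar N" "R < nrm x" using that(2) inX assms by auto
  thus ?thesis using grow[OF that(1)] inX[of "F (t, x)"] by (force simp: F_def topspace_Euclidean_space)
 qed
 have FS: "F (t, x) : ?S" if "t : {0..1}" "x : ?S" for t x
 proof -
  have "nrm x > 0" "x : ecar N" "R' < nrm x" using that(2) inS assms by auto
  thus ?thesis using grow[OF that(1)] inS[of "F (t, x)"] by (force simp: F_def topspace_Euclidean_space)
 qed
 have F0: "F (0, x) : ?S" if "x : topspace ?X" for x
 proof -
  have p: "nrm x > 0" "x : ecar N" using that inX assms by auto
  hence "nrm (F (0, x)) = nrm x + R'" by (simp add: nrm_F field_simps)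
  thus ?thesis using p inS[of "F (0, x)"] by (force simp: F_def topspace_Euclidean_space)
 qed
 have F1: "F (1, x) = x" for x by (simp add: F_def)
 have nzX: "nrm x ~= 0" if "x : ecar N Int (ecar N - eball N R)" for x using that inX[of x] assms by auto
 have nzS: "nrm x ~= 0" if "x : ecar N Int ?S" for x using that inS[of x] assms by auto
 let ?I = "top_of_set {0..1::real}"
 have hX: "continuous_map (prod_topology ?I ?X) ?X F"
  using cF[OF nzX] FX by (auto simp: continuous_map_in_subtopology Pi_iff)
 have hS: "continuous_map (prod_topology ?I (subtopology ?X ?S)) (subtopology ?X ?S) F"
  unfolding SX using cF[OF nzS] FS by (auto simp: continuous_map_in_subtopology Pi_iff)
 show ?thesis
 proof (rule trivial_relative_homology_group_gen)
  have "continuous_map ?X (prod_topology ?I ?X) (%x. (0, x))" by (simp add: continuous_map_pairwise o_def)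
  from continuous_map_compose[OF this hX]
  have "continuous_map ?X ?X (%x. F (0, x))" by (simp add: o_def)
  thus "continuous_map ?X (subtopology ?X ?S) (%x. F (0, x))" using F0 by (auto simp: continuous_map_in_subtopology)
  show "homotopic_with (%h. True) (subtopology ?X ?S) (subtopology ?X ?S) (%x. F (0, x)) id"
  unfolding homotopic_with_def using hS F1 by (intro exI[of _ F]) auto
  show "homotopic_with (%k. True) ?X ?X (%x. F (0, x)) id"
  unfolding homotopic_with_def using hX F1 by (intro exI[of _ F]) auto
 qed
qed

text \<open>Homology relative to the complement of \<open>K\<close>, in the top degree
  \<open>N\<close>, is handled as homology along \<open>K\<close>. Hiding the pairs behind five
  names lets restriction to a smaller \<open>K\<close>, passage between open sets and induced maps
  compose by rewriting.\<close>

definition hom_rel :: "nat => (nat => real) set => (nat => real) set => ((nat => real) chain) set monoid"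
 where "hom_rel N U K = relative_homology_group (int N) (esub N U) (U - K)"

definition hom_loc :: "nat => (nat => real) set => ((nat => real) chain) set monoid"
 where "hom_loc N K = relative_homology_group (int N) (eucl N) (ecar N - K)"

abbreviation "hom0 N == hom_loc N {%i. 0}"

definition hom_res :: "nat => (nat => real) set => (nat => real) set => ((nat => real) chain) set => ((nat => real) chain) set"
 where "hom_res N A B = hom_induced (int N) (eucl N) (ecar N - A) (eucl N) (ecar N - B) id"

definition hom_emb :: "nat => (nat => real) set => (nat => real) set => (nat => real) set => (nat => real) set
  => ((nat => real) chain) set => ((nat => real) chain) set"
 where "hom_emb N V L U K = hom_induced (int N) (esub N V) (V - L) (esub N U) (U - K) id"

definition hom_map :: "nat => (nat => real) set => (nat => real) set => (nat => real) set => ((nat => real) => nat => real)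
  => ((nat => real) chain) set => ((nat => real) chain) set"
 where "hom_map N U K L g = hom_induced (int N) (esub N U) (U - K) (eucl N) (ecar N - L) g"

lemma comm_group_hom_rel [simp]: "comm_group (hom_rel N U K)"
 and comm_group_hom_loc [simp]: "comm_group (hom_loc N K)" by (simp_all add: hom_rel_def hom_loc_def)

lemma group_hom_rel [simp]: "group (hom_rel N U K)"
 and group_hom_loc [simp]: "group (hom_loc N K)" by (simp_all add: hom_rel_def hom_loc_def)

lemma hom_res_hom: "hom_res N A B : hom (hom_loc N A) (hom_loc N B)"
 and hom_emb_hom: "hom_emb N V L U K : hom (hom_rel N V L) (hom_rel N U K)"
 and hom_map_hom: "hom_map N U K L g : hom (hom_rel N U K) (hom_loc N L)"
 by (simp_all add: hom_rel_def hom_loc_def hom_res_def hom_emb_def hom_map_def hom_induced_hom)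

lemma hom_res_carrier [simp]: "hom_res N A B x : carrier (hom_loc N B)"
 and hom_emb_carrier [simp]: "hom_emb N V L U K x : carrier (hom_rel N U K)"
 and hom_map_carrier [simp]: "hom_map N U K L g x : carrier (hom_loc N L)"
 by (simp_all add: hom_rel_def hom_loc_def hom_res_def hom_emb_def hom_map_def hom_induced_carrier)

lemma hom_res_trans:
 assumes "C <= B" "B <= A" shows "hom_res N B C (hom_res N A B x) = hom_res N A C x"
 unfolding hom_res_def using assms by (subst hom_induced_compose') auto

lemma continuous_map_sub_id:
 "V <= U ==> continuous_map (subtopology X V) (subtopology X U) id"
 by (auto simp: continuous_map_in_subtopology continuous_map_from_subtopology)

lemma hom_map_emb:
 assumes "V <= U" "V - L <= U - K" "continuous_map (esub N U) (eucl N) g" "g : U - K \<rightarrow> ecar N - T"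
 shows "hom_map N U K T g (hom_emb N V L U K w) = hom_map N V L T g w" unfolding hom_map_def hom_emb_def
 using assms by (subst hom_induced_compose') (auto simp: continuous_map_sub_id)

lemma hom_emb_emb:
 assumes "V <= U" "V - L <= U - K" "W <= V" "W - J <= V - L"
 shows "hom_emb N V L U K (hom_emb N W J V L w) = hom_emb N W J U K w" unfolding hom_emb_def
 using assms by (subst hom_induced_compose') (auto simp: continuous_map_sub_id)

lemma hom_map_id_emb:
 assumes "V <= U" "V - L <= U - K" "U <= ecar N" "T <= K"
 shows "hom_map N U K T id (hom_emb N V L U K w) = hom_map N V L T id w"
 using assms by (intro hom_map_emb) (auto simp: continuous_map_from_subtopology)

lemma hom_res_map:
 assumes "L <= T" "T <= K" "U <= ecar N" shows "hom_res N T L (hom_map N U K T id w) = hom_map N U K L id w"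
 unfolding hom_map_def hom_res_def
 using assms by (subst hom_induced_compose') (auto simp: continuous_map_from_subtopology)

text \<open>In the exact sequence of the triple formed by the space and the complements of the two
  balls, the term after the smaller ball is the homology of the annulus pair, which vanishes by
  pushing outwards.\<close>

lemma hom_res_eball_surj:
 assumes "0 <= R" "R <= R'"
 shows "hom_res N (eball N R') (eball N R) ` carrier (hom_loc N (eball N R')) = carrier (hom_loc N (eball N R))"
proof -
 let ?S = "ecar N - eball N R" and ?T = "ecar N - eball N R'"
 have TS: "?T <= ?S" using eball_mono[OF assms] by blast
 have "hom_relboundary (int N) (eucl N) ?S ?T c = \<one>\<^bsub>relative_homology_group (int N - 1) (esub N ?S) ?T\<^esub>" for c
  using trivial_group_eball_annulus[OF assms, where p = "int N - 1" and N = N]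
  hom_relboundary[of "int N" "eucl N" ?S ?T c] by (auto simp: trivial_group_def)
 thus ?thesis using homology_exactness_triple_1[OF TS, of "int N" "eucl N"]
  by (auto simp: kernel_def hom_res_def hom_loc_def)
qed

text \<open>\<open>fund N K ze ka\<close>: the classes \<open>ze\<close> at the origin and \<open>ka\<close> along \<open>K\<close> are restrictions of one class
 along a ball, that is, they are given by the same orientation of the Euclidean space.\<close>

definition fund :: "nat => (nat => real) set => ((nat => real) chain) set => ((nat => real) chain) set => bool"
 where "fund N K ze ka <-> (EX R>=0. EX z:carrier (hom_loc N (eball N R)). K <= eball N R &
  ze = hom_res N (eball N R) {%i. 0} z & ka = hom_res N (eball N R) K z)"

lemma fund_mono:
 assumes "fund N K ze ka" "K' <= K" shows "fund N K' ze (hom_res N K K' ka)"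
proof -
 obtain R z where "R >= 0" "z : carrier (hom_loc N (eball N R))" "K <= eball N R"
  "ze = hom_res N (eball N R) {%i. 0} z" "ka = hom_res N (eball N R) K z" using assms(1) unfolding fund_def by blast
 thus ?thesis unfolding fund_def using assms(2) hom_res_trans[OF assms(2), of "eball N R" N z]
  by (intro exI[of _ R] conjI bexI[of _ z]) auto
qed

text \<open>The class on a ball that witnesses \<open>fund\<close> lifts to every larger ball by
  \<open>hom_res_eball_surj\<close>, and a large enough ball contains the compact set
  \<open>K'\<close>.\<close>

lemma fund_extend:
 assumes "fund N K ze ka" "K <= K'" "compactin (eucl N) K'"
 obtains ka' where "fund N K' ze ka'" "hom_res N K' K ka' = ka"
proof -
 obtain R z where R: "R >= 0" "z : carrier (hom_loc N (eball N R))" "K <= eball N R"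
  "ze = hom_res N (eball N R) {%i. 0} z" "ka = hom_res N (eball N R) K z" using assms(1) unfolding fund_def by blast
 obtain R1 where R1: "R1 >= 0" "K' <= eball N R1" using compactin_imp_subset_eball[OF assms(3)] .
 define R' where "R' = max R R1"
 have R': "R <= R'" "0 <= R'" "eball N R <= eball N R'" "K' <= eball N R'"
  using R1 R(1) eball_mono[of R1 R' N] eball_mono[of R R' N] by (auto simp: R'_def)
 then obtain z' where z': "z' : carrier (hom_loc N (eball N R'))" "hom_res N (eball N R') (eball N R) z' = z"
  using hom_res_eball_surj[OF R(1) R'(1), of N] R(2) by (metis imageE)
 show ?thesis
 proof
  show "fund N K' ze (hom_res N (eball N R') K' z')"
  unfolding fund_def using R' z' R hom_res_trans[of "{%i. 0}" "eball N R" "eball N R'" N z'] zero_in_eball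
  by (intro exI[of _ R'] conjI bexI[of _ z']) auto
  show "hom_res N K' K (hom_res N (eball N R') K' z') = ka" using R' z' R hom_res_trans assms(2) by metis
 qed
qed

lemma fund_carrier: "fund N K ze ka ==> ze : carrier (hom0 N) & ka : carrier (hom_loc N K)"
 unfolding fund_def by auto

text \<open>The local group at the origin is infinite cyclic, by descending to dimension
  \<open>0\<close>; its generator extends over every ball and hence along every compact set.
  Injectivity of its powers is what makes degrees unique.\<close>

lemma fund_generator:
 obtains ze where "ze : carrier (hom0 N)"
  "inj (%k::int. ze [^]\<^bsub>hom0 N\<^esub> k)"
  "!!K. compactin (eucl N) K ==> EX ka. fund N K ze ka"
proof -
 let ?o = "{%i. 0} :: (nat => real) set"
 have clo: "closedin (eucl n) ?o" for n
  using closedin_Hausdorff_singleton[OF hausdorff_eucl] by (simp add: topspace_Euclidean_space)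
 have e0: "ecar 0 = ?o" by (auto simp: topspace_Euclidean_space)
 have "relative_homology_group 0 (eucl 0) {} \<cong> integer_group" by (rule homology_coefficients[OF e0])
 moreover have "relative_homology_group 0 (eucl 0) {} \<cong> hom_loc N ?o"
  using relative_homology_group_Euclidean_complement_step[OF clo, of 0 0 N] e0 by (simp add: hom_loc_def)
 ultimately have "integer_group \<cong> hom_loc N ?o"
  using group.iso_sym group_relative_homology_group iso_trans by blast
 then obtain h where h: "h : iso integer_group (hom_loc N ?o)" unfolding is_iso_def by blast
 interpret group_hom integer_group "hom_loc N ?o" h using h by (simp add: group_hom_def group_hom_axioms_def iso_def)
 have pow: "h 1 [^]\<^bsub>hom_loc N ?o\<^esub> k = h k" for k :: int using hom_int_pow[of 1 k] by simp
 show ?thesis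
 proof
  show "h 1 : carrier (hom_loc N ?o)" by simp
  show "inj (%k::int. h 1 [^]\<^bsub>hom_loc N ?o\<^esub> k)"
  unfolding pow using h by (auto simp: iso_def bij_betw_def)
  fix K assume "compactin (eucl N) K"
  then obtain R where R: "0 <= R" "K <= eball N R" using compactin_imp_subset_eball by blast
  hence "h 1 : hom_res N (eball N R) ?o ` carrier (hom_loc N (eball N R))"
  using hom_res_eball_surj[of 0 R N] by (simp add: eball_0)
  then obtain z where z: "z : carrier (hom_loc N (eball N R))" "h 1 = hom_res N (eball N R) ?o z" by (rule imageE)
  thus "EX ka. fund N K (h 1) ka" unfolding fund_def using R z by (intro exI conjI bexI[of _ z]) auto
 qed
qed

text \<open>The degree over \<open>0\<close> computed with a compact set \<open>K\<close> that contains the zeros.\<close>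

definition deg_along ::
 "nat => (nat => real) set => (nat => real) set => ((nat => real) => nat => real) => int => bool"
 where "deg_along N U K g k <-> (ALL ze ka. ALL w:carrier (hom_rel N U K). fund N K ze ka --> hom_map N U K K id w = ka -->
  hom_map N U K {%i. 0} g w = ze [^]\<^bsub>hom0 N\<^esub> k)"

text \<open>\<open>K\<close> may be larger than the zero set: during a homotopy the zeros move, and
  one compact set has to contain all of them.\<close>

definition pzeros ::
 "nat => (nat => real) set => (nat => real) set => ((nat => real) => nat => real) => bool"
 where "pzeros N U K g <-> openin (eucl N) U & continuous_map (esub N U) (eucl N) g &
  compactin (eucl N) K & {x : U. g x = (%i. 0)} <= K & K <= U"

text \<open>The ball and the class on it enter the definition only through the restrictions to the
  origin and to the zero set, which is exactly what \<open>fund\<close> records.\<close>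

lemma local_degree_eq:
 "local_degree N U g k <-> pzeros N U {x : U. g x = (%i. 0)} g & deg_along N U {x : U. g x = (%i. 0)} g k"
proof -
 have "deg_along N U K g k <-> (ALL R>=0. K <= eball N R -->
  (ALL z : carrier (hom_loc N (eball N R)). ALL w : carrier (hom_rel N U K).
  hom_map N U K K id w = hom_res N (eball N R) K z -->
  hom_map N U K {%i. 0} g w = hom_res N (eball N R) {%i. 0} z [^]\<^bsub>hom0 N\<^esub> k))" for K
 proof (intro iffI allI impI ballI)
  fix R z w assume L: "deg_along N U K g k" and R: "R >= 0" "K <= eball N R"
  "z : carrier (hom_loc N (eball N R))" "w : carrier (hom_rel N U K)" "hom_map N U K K id w = hom_res N (eball N R) K z"
  have "fund N K (hom_res N (eball N R) {%i. 0} z) (hom_res N (eball N R) K z)"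
  unfolding fund_def using R by (intro exI conjI bexI[of _ z]) auto
  thus "hom_map N U K {%i. 0} g w = hom_res N (eball N R) {%i. 0} z [^]\<^bsub>hom0 N\<^esub> k"
  using L R unfolding deg_along_def by simp
 next
  assume A: "ALL R>=0. K <= eball N R -->
  (ALL z : carrier (hom_loc N (eball N R)). ALL w : carrier (hom_rel N U K).
  hom_map N U K K id w = hom_res N (eball N R) K z -->
  hom_map N U K {%i. 0} g w = hom_res N (eball N R) {%i. 0} z [^]\<^bsub>hom0 N\<^esub> k)"
  show "deg_along N U K g k" unfolding deg_along_def
  proof (intro allI ballI impI)
  fix ze ka w assume w: "w : carrier (hom_rel N U K)" and f: "fund N K ze ka" and e: "hom_map N U K K id w = ka"
  obtain R z where "R >= 0" "z : carrier (hom_loc N (eball N R))" "K <= eball N R"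
  "ze = hom_res N (eball N R) {%i. 0} z" "ka = hom_res N (eball N R) K z" using f unfolding fund_def by blast
  thus "hom_map N U K {%i. 0} g w = ze [^]\<^bsub>hom0 N\<^esub> k" using A w e by simp
  qed
 qed
 thus ?thesis unfolding local_degree_def pzeros_def Let_def hom_map_def hom_res_def hom_loc_def hom_rel_def eball_def
  by auto
qed

text \<open>Excision of the complement of \<open>U\<close>, which is closed and lies inside the open
  complement of \<open>K\<close>.\<close>

lemma hom_map_id_iso:
 assumes "openin (eucl N) U" "compactin (eucl N) K" "K <= U"
 shows "hom_map N U K K id : iso (hom_rel N U K) (hom_loc N K)"
proof -
 have cl: "closedin (eucl N) K" using assms(2) hausdorff_eucl compactin_imp_closedin by blast
 have "eucl N closure_of (ecar N - U) <= eucl N interior_of (ecar N - K)"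
 proof -
  have "eucl N closure_of (ecar N - U) = ecar N - U"
  using assms(1) by (simp add: closure_of_closedin openin_closedin_eq)
  moreover have "eucl N interior_of (ecar N - K) = ecar N - K" using cl by (simp add: interior_of_openin openin_diff)
  ultimately show ?thesis using assms(3) by auto
 qed
 hence "hom_induced (int N) (esub N (ecar N - (ecar N - U))) (ecar N - K - (ecar N - U)) (esub N (ecar N)) (ecar N - K) id
  : iso (relative_homology_group (int N) (esub N (ecar N - (ecar N - U))) (ecar N - K - (ecar N - U)))
  (relative_homology_group (int N) (esub N (ecar N)) (ecar N - K))" by (intro homology_excision_axiom) auto
 moreover have "ecar N - (ecar N - U) = U" "ecar N - K - (ecar N - U) = U - K"
  using openin_subset[OF assms(1)] by auto
 ultimately show ?thesis by (simp add: hom_map_def hom_rel_def hom_loc_def)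
qed

lemma hom_map_id_lift:
 assumes "openin (eucl N) U" "compactin (eucl N) K" "K <= U" "ka : carrier (hom_loc N K)"
 obtains w where "w : carrier (hom_rel N U K)" "hom_map N U K K id w = ka"
proof -
 have "ka : hom_map N U K K id ` carrier (hom_rel N U K)"
  using hom_map_id_iso[OF assms(1-3)] assms(4) by (simp add: iso_def bij_betw_def)
 thus thesis using that by (elim imageE) simp
qed

lemma hom_map_id_inj:
 assumes "openin (eucl N) U" "compactin (eucl N) K" "K <= U"
  "w : carrier (hom_rel N U K)" "w' : carrier (hom_rel N U K)" "hom_map N U K K id w = hom_map N U K K id w'"
 shows "w = w'"
proof -
 have "inj_on (hom_map N U K K id) (carrier (hom_rel N U K))"
  using hom_map_id_iso[OF assms(1-3)] by (simp add: iso_def bij_betw_def)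
 thus ?thesis using assms(4-6) by (meson inj_onD)
qed

lemma pzeros_map:
 assumes "pzeros N U K g" shows "g : U - K \<rightarrow> ecar N - {%i. 0}" "U <= ecar N"
proof -
 show U: "U <= ecar N" using assms openin_subset unfolding pzeros_def by blast
 hence t: "topspace (esub N U) = U" by auto
 have "g : topspace (esub N U) \<rightarrow> ecar N"
  using assms unfolding pzeros_def by (intro continuous_map_funspace) simp
 hence "g : U \<rightarrow> ecar N" unfolding t .
 thus "g : U - K \<rightarrow> ecar N - {%i. 0}" using assms unfolding pzeros_def by auto
qed

text \<open>A class along \<open>K'\<close> restricts to \<open>K\<close>. Conversely, a class along
  \<open>K\<close> extends to \<open>K'\<close> by \<open>fund_extend\<close> and lifts to
  \<open>U\<close> by excision; injectivity of excision identifies the restriction of this lift with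
  the given class.\<close>

lemma deg_along_shrink:
 assumes p: "pzeros N U K g" "pzeros N U K' g" and K: "K <= K'" shows "deg_along N U K g k <-> deg_along N U K' g k"
proof -
 note m = pzeros_map[OF p(1)]
 have o: "openin (eucl N) U" "continuous_map (esub N U) (eucl N) g"
  "compactin (eucl N) K" "K <= U" "compactin (eucl N) K'" "K' <= U" using p by (auto simp: pzeros_def)
 have sub: "U - K' <= U - K" using K by auto
 have inc: "hom_map N U K K id (hom_emb N U K' U K w) = hom_res N K' K (hom_map N U K' K' id w)" for w
  using hom_res_map[OF K order_refl m(2)] hom_map_id_emb[OF order_refl sub m(2) order_refl] by simp
 have mp: "hom_map N U K {%i. 0} g (hom_emb N U K' U K w) = hom_map N U K' {%i. 0} g w" for w
  using hom_map_emb[OF order_refl sub o(2) m(1)] by simp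
 show ?thesis
 proof
  assume L: "deg_along N U K g k"
  show "deg_along N U K' g k" unfolding deg_along_def
  proof (intro allI ballI impI)
  fix ze ka w assume w: "w : carrier (hom_rel N U K')" and f: "fund N K' ze ka" and e: "hom_map N U K' K' id w = ka"
  show "hom_map N U K' {%i. 0} g w = ze [^]\<^bsub>hom0 N\<^esub> k"
  using L fund_mono[OF f K] inc[of w] mp[of w] e unfolding deg_along_def by auto
  qed
 next
  assume L: "deg_along N U K' g k"
  show "deg_along N U K g k" unfolding deg_along_def
  proof (intro allI ballI impI)
  fix ze ka w assume w: "w : carrier (hom_rel N U K)" and f: "fund N K ze ka" and e: "hom_map N U K K id w = ka"
  obtain ka' where k': "fund N K' ze ka'" "hom_res N K' K ka' = ka" using fund_extend[OF f K o(5)] .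
  obtain w' where w': "w' : carrier (hom_rel N U K')" "hom_map N U K' K' id w' = ka'"
  using hom_map_id_lift[OF o(1) o(5,6)] fund_carrier[OF k'(1)] by blast
  have "hom_map N U K K id (hom_emb N U K' U K w') = hom_map N U K K id w" using inc[of w'] w' k' e by simp
  hence "hom_emb N U K' U K w' = w" using hom_map_id_inj[OF o(1) o(3,4) _ w] by simp
  thus "hom_map N U K {%i. 0} g w = ze [^]\<^bsub>hom0 N\<^esub> k"
  using L k' w' mp[of w'] unfolding deg_along_def by auto
  qed
 qed
qed

lemma deg_along_homotopic:
 assumes "homotopic_with (%h. h : U - K \<rightarrow> ecar N - {%i. 0}) (esub N U) (eucl N) f g"
 shows "deg_along N U K f k <-> deg_along N U K g k"
 using homology_homotopy_axiom[OF assms] unfolding deg_along_def hom_map_def by simp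

lemma deg_along_cong:
 assumes "!!x. x : U ==> f x = g x" "U <= ecar N" shows "deg_along N U K f k <-> deg_along N U K g k"
proof -
 have "hom_map N U K {%i. 0} f = hom_map N U K {%i. 0} g"
  unfolding hom_map_def using assms by (intro hom_induced_eq) auto
 thus ?thesis by (simp add: deg_along_def)
qed

lemma hom_emb_lift:
 assumes "openin (eucl N) V" "openin (eucl N) U" "compactin (eucl N) K" "K <= V" "V <= U" "w : carrier (hom_rel N U K)"
 obtains w' where "w' : carrier (hom_rel N V K)" "hom_emb N V K U K w' = w"
proof -
 have sub: "V - K <= U - K" "U <= ecar N" using assms openin_subset by blast+
 obtain w' where w': "w' : carrier (hom_rel N V K)" "hom_map N V K K id w' = hom_map N U K K id w"
  using hom_map_id_lift[OF assms(1,3,4) hom_map_carrier] .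
 have "hom_map N U K K id (hom_emb N V K U K w') = hom_map N U K K id w"
  using hom_map_id_emb[OF assms(5) sub order_refl] w' by simp
 hence "hom_emb N V K U K w' = w"
  by (rule hom_map_id_inj[OF assms(2,3) order_trans[OF assms(4,5)] hom_emb_carrier assms(6)])
 thus ?thesis using that w' by blast
qed

text \<open>By excision every class over \<open>U\<close> along \<open>K\<close> comes from
  \<open>V\<close>, and \<open>g\<close> has the same effect on both.\<close>

lemma deg_along_localize:
 assumes p: "pzeros N U K g" and V: "openin (eucl N) V" "K <= V" "V <= U"
 shows "deg_along N V K g k <-> deg_along N U K g k"
proof -
 note m = pzeros_map[OF p]
 have o: "openin (eucl N) U" "continuous_map (esub N U) (eucl N) g" "compactin (eucl N) K" "K <= U"
  using p by (auto simp: pzeros_def)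
 have sub: "V - K <= U - K" using V by auto
 have inc: "hom_map N U K K id (hom_emb N V K U K w) = hom_map N V K K id w" for w
  using hom_map_id_emb[OF V(3) sub m(2) order_refl] .
 have mp: "hom_map N U K {%i. 0} g (hom_emb N V K U K w) = hom_map N V K {%i. 0} g w" for w
  using hom_map_emb[OF V(3) sub o(2) m(1)] .
 have lift: "EX w':carrier (hom_rel N V K). hom_emb N V K U K w' = w" if "w : carrier (hom_rel N U K)" for w
  using hom_emb_lift[OF V(1) o(1,3) V(2,3) that] by blast
 show ?thesis unfolding deg_along_def using inc mp lift hom_emb_carrier by metis
qed

lemma deg_along_unique:
 assumes p: "pzeros N U K g" and k: "deg_along N U K g k" "deg_along N U K g k'" shows "k = k'"
proof -
 have o: "openin (eucl N) U" "compactin (eucl N) K" "K <= U" using p by (auto simp: pzeros_def)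
 obtain ze where z: "inj (%k::int. ze [^]\<^bsub>hom0 N\<^esub> k)"
  "!!K. compactin (eucl N) K ==> EX ka. fund N K ze ka" using fund_generator by blast
 then obtain ka where f: "fund N K ze ka" using o by blast
 then obtain w where w: "w : carrier (hom_rel N U K)" "hom_map N U K K id w = ka"
  using hom_map_id_lift[OF o] fund_carrier by blast
 hence "ze [^]\<^bsub>hom0 N\<^esub> k = ze [^]\<^bsub>hom0 N\<^esub> k'" using k f unfolding deg_along_def by metis
 thus ?thesis using z(1) by (simp add: inj_def)
qed

text \<open>The map factors through the pair \<open>(V, V)\<close>, whose homology vanishes.\<close>

lemma hom_map_trivial:
 assumes "V <= ecar N - T" shows "hom_map N V L T id w = \<one>\<^bsub>hom_loc N T\<^esub>"
proof -
 have V: "topspace (esub N V) = V" using assms by auto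
 have "hom_emb N V L V {} w = \<one>\<^bsub>hom_rel N V {}\<^esub>"
 proof -
  have "trivial_group (hom_rel N V {})" using trivial_relative_homology_group_topspace[of "int N" "esub N V"] V
  by (simp add: hom_rel_def)
  thus ?thesis using hom_emb_carrier[of N V L V "{}" w] by (simp add: trivial_group_def)
 qed
 moreover have "hom_map N V {} T id (hom_emb N V L V {} w) = hom_map N V L T id w"
  using assms by (intro hom_map_emb) (auto simp: continuous_map_from_subtopology)
 ultimately show ?thesis using hom_one[OF hom_map_hom[of N V "{}" T id]] by simp
qed

text \<open>The class \<open>w\<close> is restricted to \<open>K1\<close> and carried by excision
  into \<open>U1\<close>. What is left of \<open>w\<close> after removing this part \<open>a\<close>
  dies along \<open>K1\<close>, so by the exact sequence of the triple it comes from
  \<open>U - K1\<close> along \<open>K2\<close>, and by excision from \<open>U2\<close>. This is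
  additivity at the level of classes.\<close>

lemma hom_rel_split:
 assumes p: "pzeros N U (K1 Un K2) g"
  and U: "openin (eucl N) U1" "openin (eucl N) U2" "U1 <= U" "U2 <= U" "U1 Int U2 = {}"
  and K: "compactin (eucl N) K1" "compactin (eucl N) K2" "K1 <= U1" "K2 <= U2"
  and w: "w : carrier (hom_rel N U (K1 Un K2))"
 obtains w1 w2 where "w1 : carrier (hom_rel N U1 K1)" "w2 : carrier (hom_rel N U2 K2)"
  "hom_map N U1 K1 K1 id w1 = hom_res N (K1 Un K2) K1 (hom_map N U (K1 Un K2) (K1 Un K2) id w)"
  "hom_map N U2 K2 K2 id w2 = hom_res N (K1 Un K2) K2 (hom_map N U (K1 Un K2) (K1 Un K2) id w)"
  "hom_map N U (K1 Un K2) {%i. 0} g w =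
  hom_map N U1 K1 {%i. 0} g w1 \<otimes>\<^bsub>hom0 N\<^esub> hom_map N U2 K2 {%i. 0} g w2"
proof -
 let ?K = "K1 Un K2"
 note m = pzeros_map[OF p]
 have o: "openin (eucl N) U" "continuous_map (esub N U) (eucl N) g" "compactin (eucl N) ?K" "?K <= U"
  using p by (auto simp: pzeros_def)
 have dis: "U1 Int K2 = {}" "U2 Int K1 = {}" using U K by auto
 let ?v = "hom_emb N U ?K U K1 w"
 have K1U: "K1 <= U" using K U by auto
 obtain w1 where w1: "w1 : carrier (hom_rel N U1 K1)" "hom_emb N U1 K1 U K1 w1 = ?v"
  using hom_emb_lift[OF U(1) o(1) K(1) K(3) U(3) hom_emb_carrier] .
 define a where "a = hom_emb N U1 K1 U ?K w1"
 define u where "u = w \<otimes>\<^bsub>hom_rel N U ?K\<^esub> inv\<^bsub>hom_rel N U ?K\<^esub> a"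
 interpret GU: comm_group "hom_rel N U ?K" by simp
 interpret G1: group "hom_rel N U K1" by simp
 have a: "a : carrier (hom_rel N U ?K)" by (simp add: a_def)
 have u: "u : carrier (hom_rel N U ?K)" using a w by (simp add: u_def)
 have wau: "w = a \<otimes>\<^bsub>hom_rel N U ?K\<^esub> u"
  using a w by (simp add: u_def GU.m_comm[of w] flip: GU.m_assoc)
 interpret h1: group_hom "hom_rel N U ?K" "hom_rel N U K1" "hom_emb N U ?K U K1"
  by (simp add: group_hom_def group_hom_axioms_def hom_emb_hom)
 have "hom_emb N U ?K U K1 a = ?v" unfolding a_def w1(2)[symmetric] using U dis by (intro hom_emb_emb) auto
 hence "hom_emb N U ?K U K1 u = \<one>\<^bsub>hom_rel N U K1\<^esub>" using a w by (simp add: u_def)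
 hence uk: "u : kernel (hom_rel N U ?K) (hom_rel N U K1) (hom_emb N U ?K U K1)" using u by (simp add: kernel_def)
 have "subtopology (esub N U) (U - K1) = esub N (U - K1)" by (simp add: subtopology_subtopology Int_absorb1)
 moreover have "U - K1 - K2 = U - ?K" by auto
 ultimately have "kernel (hom_rel N U ?K) (hom_rel N U K1) (hom_emb N U ?K U K1)
  = hom_emb N (U - K1) K2 U ?K ` carrier (hom_rel N (U - K1) K2)"
  using homology_exactness_triple_3[of "U - ?K" "U - K1" "int N" "esub N U"]
  by (simp add: hom_rel_def hom_emb_def) blast
 then obtain u2 where u2: "u2 : carrier (hom_rel N (U - K1) K2)" "hom_emb N (U - K1) K2 U ?K u2 = u"
  using uk by (metis imageE)
 have opU: "openin (eucl N) (U - K1)" using o(1) K(1) hausdorff_eucl compactin_imp_closedin openin_diff by blast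
 have U2U: "U2 <= U - K1" using U dis by auto
 obtain w2 where w2: "w2 : carrier (hom_rel N U2 K2)" "hom_emb N U2 K2 (U - K1) K2 w2 = u2"
  using hom_emb_lift[OF U(2) opU K(2) K(4) U2U u2(1)] .
 define b where "b = hom_emb N U2 K2 U ?K w2"
 have "b = u" unfolding b_def using u2 w2 hom_emb_emb[of "U - K1" U K2 ?K U2 K2 N w2] U2U by auto
 hence wab: "w = a \<otimes>\<^bsub>hom_rel N U ?K\<^esub> b" using wau by simp
 have b: "b : carrier (hom_rel N U ?K)" by (simp add: b_def)
 have mp: "hom_map N U ?K L f w = hom_map N U ?K L f a \<otimes>\<^bsub>hom_loc N L\<^esub> hom_map N U ?K L f b" for L f
  using hom_mult[OF hom_map_hom a b] by (simp add: wab)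
 have sub1: "U1 - K1 <= U - ?K" and sub2: "U2 - K2 <= U - ?K" using U dis by auto
 have t1: "hom_map N U ?K L id a = hom_map N U1 K1 L id w1" if "L <= ?K" for L
  unfolding a_def using hom_map_id_emb[OF U(3) sub1 m(2) that] .
 have t2: "hom_map N U ?K L id b = hom_map N U2 K2 L id w2" if "L <= ?K" for L
  unfolding b_def using hom_map_id_emb[OF U(4) sub2 m(2) that] .
 have z1: "hom_map N U2 K2 K1 id w2 = \<one>\<^bsub>hom_loc N K1\<^esub>"
  using dis U m by (intro hom_map_trivial) auto
 have z2: "hom_map N U1 K1 K2 id w1 = \<one>\<^bsub>hom_loc N K2\<^esub>"
  using dis U m by (intro hom_map_trivial) auto
 show ?thesis
 proof
  show "w1 : carrier (hom_rel N U1 K1)" "w2 : carrier (hom_rel N U2 K2)" by fact+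
  show "hom_map N U1 K1 K1 id w1 = hom_res N ?K K1 (hom_map N U ?K ?K id w)"
  using hom_res_map[of K1 ?K ?K U N w] mp[of K1 id] t1[of K1] t2[of K1] z1 m group.is_monoid[THEN monoid.r_one, OF group_hom_loc hom_map_carrier] by simp
  show "hom_map N U2 K2 K2 id w2 = hom_res N ?K K2 (hom_map N U ?K ?K id w)"
  using hom_res_map[of K2 ?K ?K U N w] mp[of K2 id] t1[of K2] t2[of K2] z2 m group.is_monoid[THEN monoid.l_one, OF group_hom_loc hom_map_carrier] by simp
  show "hom_map N U ?K {%i. 0} g w =
  hom_map N U1 K1 {%i. 0} g w1 \<otimes>\<^bsub>hom0 N\<^esub> hom_map N U2 K2 {%i. 0} g w2"
  using mp[of "{%i. 0}" g] hom_map_emb[OF U(3) sub1 o(2) m(1), of w1] hom_map_emb[OF U(4) sub2 o(2) m(1), of w2]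
  by (simp add: a_def b_def)
 qed
qed

text \<open>\<open>deg_along\<close> is a relation without a general existence statement, so
  additivity is given in subtractive form: the degrees over the whole set and over the first piece
  produce one for the second.\<close>

lemma deg_along_diff:
 assumes p: "pzeros N U (K1 Un K2) g"
  and U: "openin (eucl N) U1" "openin (eucl N) U2" "U1 <= U" "U2 <= U" "U1 Int U2 = {}"
  and K: "compactin (eucl N) K1" "compactin (eucl N) K2" "K1 <= U1" "K2 <= U2"
  and k: "deg_along N U (K1 Un K2) g k" "deg_along N U1 K1 g l" shows "deg_along N U2 K2 g (k - l)"
 unfolding deg_along_def
proof (intro allI ballI impI)
 let ?K = "K1 Un K2"
 have o: "openin (eucl N) U" "compactin (eucl N) ?K" "?K <= U" using p by (auto simp: pzeros_def)
 fix ze ka2 v assume v: "v : carrier (hom_rel N U2 K2)" and f: "fund N K2 ze ka2" and e: "hom_map N U2 K2 K2 id v = ka2"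
 obtain ka where ka: "fund N ?K ze ka" "hom_res N ?K K2 ka = ka2" using fund_extend[OF f _ o(2)] by auto
 obtain w where w: "w : carrier (hom_rel N U ?K)" "hom_map N U ?K ?K id w = ka"
  using hom_map_id_lift[OF o] fund_carrier[OF ka(1)] by blast
 obtain w1 w2 where ww: "w1 : carrier (hom_rel N U1 K1)" "w2 : carrier (hom_rel N U2 K2)"
  "hom_map N U1 K1 K1 id w1 = hom_res N ?K K1 ka"
  "hom_map N U2 K2 K2 id w2 = hom_res N ?K K2 ka"
  "hom_map N U ?K {%i. 0} g w =
  hom_map N U1 K1 {%i. 0} g w1 \<otimes>\<^bsub>hom0 N\<^esub> hom_map N U2 K2 {%i. 0} g w2"
  using hom_rel_split[OF p U K w(1)] w(2) by metis
 have "w2 = v" using hom_map_id_inj[OF U(2) K(2) K(4) ww(2) v] ww(4) ka(2) e by simp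
 moreover have "hom_map N U1 K1 {%i. 0} g w1 = ze [^]\<^bsub>hom0 N\<^esub> l"
  using k(2) ww(1,3) fund_mono[OF ka(1), of K1] unfolding deg_along_def by auto
 moreover have "hom_map N U ?K {%i. 0} g w = ze [^]\<^bsub>hom0 N\<^esub> k"
  using k(1) w ka(1) unfolding deg_along_def by auto
 ultimately have eq: "ze [^]\<^bsub>hom0 N\<^esub> k =
  ze [^]\<^bsub>hom0 N\<^esub> l \<otimes>\<^bsub>hom0 N\<^esub> hom_map N U2 K2 {%i. 0} g v" using ww(5) by simp
 interpret G: comm_group "hom0 N" by simp
 have ze: "ze : carrier (hom0 N)" using fund_carrier[OF f] by simp
 have "ze [^]\<^bsub>hom0 N\<^esub> l \<otimes>\<^bsub>hom0 N\<^esub> ze [^]\<^bsub>hom0 N\<^esub> (k - l)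
  = ze [^]\<^bsub>hom0 N\<^esub> k" using ze G.int_pow_mult[of ze l "k - l"] by simp
 thus "hom_map N U2 K2 {%i. 0} g v = ze [^]\<^bsub>hom0 N\<^esub> (k - l)"
  using eq ze by (metis G.Units_eq G.Units_l_cancel G.int_pow_closed hom_map_carrier)
qed

lemma pzeros_exact:
 assumes "pzeros N U K g" shows "pzeros N U {x : U. g x = (%i. 0)} g"
proof -
 have o: "openin (eucl N) U" "continuous_map (esub N U) (eucl N) g"
  "compactin (eucl N) K" "{x : U. g x = (%i. 0)} <= K" "K <= U" using assms by (auto simp: pzeros_def)
 have t: "topspace (esub N U) = U" using openin_subset[OF o(1)] by auto
 have "closedin (eucl N) {%i. 0}"
  using closedin_Hausdorff_singleton[OF hausdorff_eucl] by (simp add: topspace_Euclidean_space)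
 hence "closedin (esub N U) {x : topspace (esub N U). g x : {%i. 0}}"
  by (rule closedin_continuous_map_preimage[OF o(2)])
 hence "closedin (esub N U) {x : U. g x = (%i. 0)}" unfolding t by simp
 moreover have "compactin (esub N U) K" using o by (simp add: compactin_subtopology)
 ultimately have "compactin (esub N U) {x : U. g x = (%i. 0)}" using closed_compactin o(4) by blast
 thus ?thesis using o by (simp add: pzeros_def compactin_subtopology)
qed

lemma deg_along_homotopy:
 fixes h :: "real \<times> (nat => real) => nat => real"
 assumes c: "continuous_map (cylinder (esub N U)) (eucl N) h"
  and U: "U <= ecar N" and z: "!!t x. t : {0..1} ==> x : U ==> h (t, x) = (%i. 0) ==> x : K"
  and f: "!!x. x : U ==> h (0, x) = f x" and g: "!!x. x : U ==> h (1, x) = g x"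
 shows "deg_along N U K f k <-> deg_along N U K g k"
proof -
 have m: "h (t, x) : ecar N" if "t : {0..1}" "x : U" for t x
 proof -
  have "h : topspace (cylinder (esub N U)) \<rightarrow> ecar N" by (rule continuous_map_funspace[OF c])
  thus ?thesis using that U by auto
 qed
 have "homotopic_with (%h. h : U - K \<rightarrow> ecar N - {%i. 0}) (esub N U) (eucl N)
  (%x. h (0, x)) (%x. h (1, x))" unfolding homotopic_with_def by (rule exI[where x = h]) (use c z m in auto)
 hence "deg_along N U K (%x. h (0, x)) k <-> deg_along N U K (%x. h (1, x)) k" by (rule deg_along_homotopic)
 moreover have "deg_along N U K (%x. h (0, x)) k <-> deg_along N U K f k" by (intro deg_along_cong f U)
 moreover have "deg_along N U K (%x. h (1, x)) k <-> deg_along N U K g k" by (intro deg_along_cong g U)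
 ultimately show ?thesis by blast
qed

lemma deg_along_empty:
 assumes "pzeros N U {} g" shows "deg_along N U {} g 0"
proof -
 note m = pzeros_map[OF assms]
 have o: "openin (eucl N) U" "continuous_map (esub N U) (eucl N) g" using assms by (auto simp: pzeros_def)
 have V: "topspace (esub N U) = U" using m by auto
 have "trivial_group (hom_rel N U {})" using trivial_relative_homology_group_topspace[of "int N" "esub N U"] V
  by (simp add: hom_rel_def)
 hence "hom_map N U {} {%i. 0} g w = \<one>\<^bsub>hom0 N\<^esub>" if "w : carrier (hom_rel N U {})" for w
  using that hom_one[OF hom_map_hom[of N U "{}" "{%i. 0}" g]] by (simp add: trivial_group_def)
 thus ?thesis by (simp add: deg_along_def)
qed

lemma pzeros_translation:
 assumes "openin (eucl N) U" "c : U" shows "pzeros N U {c} (%x i. x i - c i)"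
proof -
 have c: "c : ecar N" using assms openin_subset by blast
 have "continuous_map (eucl N) (eucl N) (%x i. x i - c i)"
  using c by (intro continuous_map_Euclidean_space_diff) (auto simp: continuous_map_const)
 thus ?thesis using assms c by (auto simp: pzeros_def continuous_map_from_subtopology fun_eq_iff)
qed

lemma sqnorm_triangle_scaled:
 assumes "c : eball N R" "0 <= t" "t <= 1" shows "(%i. t * c i) : eball N R"
proof -
 have "t\<^sup>2 * (c i)\<^sup>2 <= (c i)\<^sup>2" for i using assms by (simp add: mult_left_le_one_le power_le_one)
 hence "(SUM i<N. (t * c i)\<^sup>2) <= (SUM i<N. (c i)\<^sup>2)" by (intro sum_mono) (simp add: power_mult_distrib)
 thus ?thesis using assms by (auto simp: eball_def topspace_Euclidean_space)
qed

text \<open>Outside a ball around the origin that contains \<open>c\<close> none of the maps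
  \<open>x - t c\<close> vanishes, so the translation is homotopic there to the identity, which
  sends the class on the ball to its restriction at the origin.\<close>

lemma deg_along_translation:
 assumes U: "openin (eucl N) U" "c : U" shows "deg_along N U {c} (%x i. x i - c i) 1"
proof -
 let ?g = "%x i. x i - c i"
 have c: "c : ecar N" using assms openin_subset by blast
 have pE: "pzeros N (ecar N) {c} ?g" using c by (intro pzeros_translation) auto
 have "deg_along N (ecar N) {c} ?g 1" unfolding deg_along_def
 proof (intro allI ballI impI)
  fix ze ka w assume w: "w : carrier (hom_rel N (ecar N) {c})" and f: "fund N {c} ze ka"
  and e: "hom_map N (ecar N) {c} {c} id w = ka"
  obtain R z where R: "R >= 0" "z : carrier (hom_loc N (eball N R))" "c : eball N R"
  "ze = hom_res N (eball N R) {%i. 0} z" "ka = hom_res N (eball N R) {c} z" using f unfolding fund_def by blast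
  have "w = ka" using e w by (simp add: hom_map_def hom_rel_def hom_induced_id)
  let ?H = "%L. hom_induced (int N) (eucl N) (ecar N - eball N R) (eucl N) (ecar N - {%i. 0}) L z"
  let ?P = "cylinder (eucl N)"
  have cg: "continuous_map (eucl N) (eucl N) ?g"
  using c by (intro continuous_map_Euclidean_space_diff) (auto simp: continuous_map_const)
  have "hom_map N (ecar N) {c} {%i. 0} ?g w = ?H (?g o id)"
  unfolding \<open>w = ka\<close> R(5) hom_map_def hom_res_def using R(3) cg c by (simp only: subtopology_topspace)
  (subst hom_induced_compose', auto simp: fun_eq_iff topspace_Euclidean_space)
  also have "... = ?H id"
  proof -
  have nz: "(%i. x i - t * c i) ~= (%i. 0)" if "x : ecar N - eball N R" "t : {0..1}" for x t
  proof
  assume "(%i. x i - t * c i) = (%i. 0)"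
  hence "x = (%i. t * c i)" by (simp add: fun_eq_iff)
  thus False using that sqnorm_triangle_scaled[OF R(3), of t] by auto
  qed
  have c1: "continuous_map ?P euclideanreal fst" using continuous_map_fst continuous_map_into_fulltopology by blast
  have c2: "continuous_map ?P euclideanreal (%z. snd z i)" for i
  using continuous_map_compose[OF continuous_map_snd cmap_eucl_coord] by (simp add: o_def)
  have "continuous_map ?P (eucl N) (%z i. snd z i - fst z * c i)" unfolding cmap_eucl_iff using c
  by (auto intro!: continuous_intros c1 c2 simp: topspace_Euclidean_space)
  hence "homotopic_with (%h. h : ecar N - eball N R \<rightarrow> ecar N - {%i. 0}) (eucl N) (eucl N) id ?g"
  unfolding homotopic_with_def using nz c
  by (intro exI[of _ "%z i. snd z i - fst z * c i"]) (auto simp: topspace_Euclidean_space)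
  thus ?thesis by (simp add: homology_homotopy_axiom)
  qed
  also have "... = ze" by (simp add: R(4) hom_res_def)
  also have "ze = ze [^]\<^bsub>hom0 N\<^esub> (1::int)" using fund_carrier[OF f] by (simp add: group.int_pow_1)
  finally show "hom_map N (ecar N) {c} {%i. 0} ?g w = ze [^]\<^bsub>hom0 N\<^esub> (1::int)" .
 qed
 thus ?thesis using deg_along_localize[OF pE U(1)] U openin_subset by blast
qed

section \<open>Neighbourhood retracts\<close>

text \<open>A map from a closed set into a space covered by finitely many charts onto Euclidean spaces extends
 to a neighbourhood: it is extended over one chart after the other with Tietze's theorem.\<close>

lemma chart_extension_step:
 fixes A Z :: "'y::{metric_space,second_countable_topology} set" and ph :: "'m => 'e::euclidean_space"
 assumes U: "openin X U" and ph: "homeomorphic_maps (subtopology X U) euclidean ph ps"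
  and Z: "closed Z" and G: "continuous_map (top_of_set Z) X G"
  and A: "closed A" "A <= Z" "G ` A <= U" and B: "B <= interior Z"
 obtains Z' G' where "closed Z'" "Z <= Z'" "continuous_map (top_of_set Z') X G'"
  "!!y. y : Z ==> G' y = G y" "A Un B <= interior Z'"
proof -
 have UX: "U <= topspace X" using U openin_subset by blast
 have GZ: "G y : topspace X" if "y : Z" for y using continuous_map_funspace[OF G] that by auto
 have "openin (top_of_set Z) {y : topspace (top_of_set Z). G y : U}" by (rule openin_continuous_map_preimage[OF G U])
 moreover have "Z - (Z - {y : Z. G y : U}) = {y : topspace (top_of_set Z). G y : U}" by auto
 ultimately have "closedin (top_of_set Z) (Z - {y : Z. G y : U})"
  by (simp only: closedin_def topspace_euclidean_subtopology Diff_subset simp_thms)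
 hence cC: "closed (Z - {y : Z. G y : U})" (is "closed ?C") by (rule closedin_closed_trans[OF _ Z])
 \<comment> \<open>\<open>?C\<close> is the part of \<open>Z\<close> that \<open>G\<close> does not
   send into the chart. The closure \<open>T\<close> of a neighbourhood of \<open>A\<close> avoids
   it, so on \<open>T Int Z\<close> the map can be read in the chart and extended in Euclidean
   coordinates.\<close>
 have "A Int ?C = {}" using A by auto
 then obtain V W where VW: "open V" "open W" "A <= V" "?C <= W" "V Int W = {}" using t4_space[OF A(1) cC] by blast
 define T where "T = closure V"
 have T: "closed T" "T Int W = {}" using VW open_Int_closure_eq_empty[of W V] by (auto simp: T_def Int_commute)
 have TU: "G y : U" if "y : T Int Z" for y using that T VW(4) by blast
 have cph: "continuous_map (subtopology X U) euclidean ph" and cps: "continuous_map euclidean (subtopology X U) ps"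
  and psph: "!!u. u : U ==> ps (ph u) = u" and psU: "!!v. ps v : U"
  using ph UX continuous_map_funspace[of euclidean "subtopology X U" ps] unfolding homeomorphic_maps_def by auto
 have "continuous_map (top_of_set (T Int Z)) (subtopology X U) G"
  using TU G by (auto simp: continuous_map_in_subtopology intro: continuous_map_from_subtopology_mono)
 from continuous_map_compose[OF this cph] have "continuous_on (T Int Z) (%y. ph (G y))" by (simp add: o_def)
 moreover have "closedin (top_of_set UNIV) (T Int Z)" using T Z by (simp add: closed_Int)
 ultimately obtain F where F: "continuous_on UNIV F" "!!y. y : T Int Z ==> F y = ph (G y)"
  using Tietze_unbounded by metis
 let ?G = "%y. if y : Z then G y else ps (F y)"
 have cF: "continuous_map (top_of_set T) X (%y. ps (F y))"
 proof -
  have "continuous_map (top_of_set T) euclidean F" using F(1) continuous_on_subset by auto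
  from continuous_map_compose[OF this cps] show ?thesis by (simp add: o_def continuous_map_in_subtopology)
 qed
 show ?thesis
 proof
  show "closed (Z Un T)" using Z T by auto
  show "Z <= Z Un T" by auto
  show "?G y = G y" if "y : Z" for y using that by simp
  show "continuous_map (top_of_set (Z Un T)) X ?G" unfolding continuous_map_closedin
  proof (intro conjI allI impI)
  show "?G : topspace (top_of_set (Z Un T)) \<rightarrow> topspace X" using GZ subsetD[OF UX psU] by auto
  next
  fix C assume C: "closedin X C"
  have "closedin (top_of_set Z) {y : topspace (top_of_set Z). G y : C}"
  by (rule closedin_continuous_map_preimage[OF G C])
  hence 1: "closed {y : Z. G y : C}" using closedin_closed_trans[OF _ Z] by simp
  have "closedin (top_of_set T) {y : topspace (top_of_set T). ps (F y) : C}"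
  by (rule closedin_continuous_map_preimage[OF cF C])
  hence 2: "closed {y : T. ps (F y) : C}" using closedin_closed_trans[OF _ T(1)] by simp
  have "ps (F y) = G y" if "y : T Int Z" for y using F(2)[OF that] psph[OF TU[OF that]] by simp
  hence eq: "{y : topspace (top_of_set (Z Un T)). ?G y : C} = {y : Z. G y : C} Un {y : T. ps (F y) : C}" by auto
  have "{y : Z. G y : C} Un {y : T. ps (F y) : C} <= Z Un T" by auto
  thus "closedin (top_of_set (Z Un T)) {y : topspace (top_of_set (Z Un T)). ?G y : C}"
  unfolding eq using closed_subset closed_Un[OF 1 2] by blast
  qed
  show "A Un B <= interior (Z Un T)"
  proof -
  have "V <= interior T" unfolding T_def by (rule interior_maximal[OF closure_subset VW(1)])
  thus ?thesis using VW(3) B interior_mono[of Z "Z Un T"] interior_mono[of T "Z Un T"] by auto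
  qed
 qed
qed

text \<open>\<open>A' i\<close> is the part of \<open>A\<close> sent to the closed core
  \<open>C i\<close>; these parts are closed and cover \<open>A\<close>. The step for
  \<open>i\<close> puts \<open>A' i\<close> into the interior of the domain and keeps what was
  interior before.\<close>

lemma charts_extension:
 fixes A :: "'y::{metric_space,second_countable_topology} set" and ph :: "'i => 'm => 'e::euclidean_space"
 assumes I: "finite I" and U: "!!i. i : I ==> openin X (U i)"
  and ph: "!!i. i : I ==> homeomorphic_maps (subtopology X (U i)) euclidean (ph i) (ps i)"
  and A: "closed A" and g: "continuous_map (top_of_set A) X g"
  and C: "!!i. i : I ==> closedin X (C i)" "!!i. i : I ==> C i <= U i" "g ` A <= (UN i:I. C i)"
 obtains Z G where "open Z" "A <= Z" "continuous_map (top_of_set Z) X G" "!!y. y : A ==> G y = g y"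
proof -
 define A' where "A' i = {y : A. g y : C i}" for i
 have A': "closed (A' i)" if "i : I" for i
 proof -
  have "closedin (top_of_set A) {y : topspace (top_of_set A). g y : C i}"
  by (rule closedin_continuous_map_preimage[OF g C(1)[OF that]])
  thus ?thesis unfolding A'_def using closedin_closed_trans[OF _ A] by simp
 qed
 have "EX Z G. closed Z & A <= Z & continuous_map (top_of_set Z) X G & (ALL y:A. G y = g y) &
  (UN i:J. A' i) <= interior Z" if "J <= I" for J using finite_subset[OF that I] that
 proof (induction J rule: finite_induct)
  case empty
  thus ?case using A g by (intro exI[of _ A] exI[of _ g]) auto
 next
  case (insert i J)
  then obtain Z G where Z: "closed Z" "A <= Z" "continuous_map (top_of_set Z) X G" "!!y. y : A ==> G y = g y"
  "(UN i:J. A' i) <= interior Z" by auto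
  have i: "i : I" using insert by auto
  have "G ` A' i <= U i" using Z(4) C(2)[OF i] by (auto simp: A'_def)
  moreover have "A' i <= Z" using Z(2) by (auto simp: A'_def)
  ultimately obtain Z' G' where Z': "closed Z'" "Z <= Z'" "continuous_map (top_of_set Z') X G'"
  "!!y. y : Z ==> G' y = G y" "A' i Un (UN i:J. A' i) <= interior Z'"
  using chart_extension_step[OF U[OF i] ph[OF i] Z(1,3) A'[OF i] _ _ Z(5)] by metis
  have "A <= Z'" "ALL y:A. G' y = g y" using Z' Z by auto
  thus ?case using Z' by (intro exI[of _ Z'] exI[of _ G']) auto
 qed
 then obtain Z G where Z: "closed Z" "A <= Z" "continuous_map (top_of_set Z) X G" "ALL y:A. G y = g y"
  "(UN i:I. A' i) <= interior Z" by (meson order_refl)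
 have "A <= (UN i:I. A' i)" using C(3) by (auto simp: A'_def)
 hence "A <= interior Z" using Z(5) by (rule order_trans)
 moreover have "continuous_map (top_of_set (interior Z)) X G"
  by (rule continuous_map_from_subtopology_mono[OF Z(3) interior_subset])
 ultimately show ?thesis using that[of "interior Z" G] Z(4) by simp
qed

text \<open>For a neighbourhood \<open>V\<close> of \<open>0\<close>, the points where
  \<open>F\<close> leaves \<open>V\<close> form a closed bounded, hence compact, set of coordinates.
  Its image is compact and therefore closed in the Hausdorff space, not only in the chart.\<close>

lemma continuous_map_extend_zero:
 fixes ph :: "'m => 'e::euclidean_space" and F :: "'e => real"
 assumes X: "Hausdorff_space X" and U: "openin X U" and ph: "homeomorphic_maps (subtopology X U) euclidean ph ps"
  and F: "continuous_on UNIV F" "(F \<longlongrightarrow> 0) at_infinity"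
 shows "continuous_map X euclideanreal (%x. if x : U then F (ph x) else 0)"
proof -
 have UX: "U <= topspace X" using U openin_subset by blast
 have cph: "continuous_map (subtopology X U) euclidean ph" and cps: "continuous_map euclidean (subtopology X U) ps"
  and psph: "!!u. u : U ==> ps (ph u) = u" and phps: "!!v. ph (ps v) = v" and psU: "!!v. ps v : U"
  using ph UX continuous_map_funspace[of euclidean "subtopology X U" ps] unfolding homeomorphic_maps_def by auto
 have cpsX: "continuous_map euclidean X ps" using cps by (simp add: continuous_map_in_subtopology)
 let ?f = "%x. if x : U then F (ph x) else 0"
 have "openin X {x : topspace X. ?f x : V}" if V: "open V" for V
 proof (cases "0 : V")
  case False
  have "continuous_map euclidean euclideanreal F" using F(1) by simp
  from continuous_map_compose[OF cph this] have c: "continuous_map (subtopology X U) euclideanreal (%x. F (ph x))"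
  by (simp add: o_def)
  have "openin (subtopology X U) {x : topspace (subtopology X U). F (ph x) : V}"
  by (rule openin_continuous_map_preimage[OF c]) (use V in simp)
  moreover have "{x : topspace (subtopology X U). F (ph x) : V} = {x : topspace X. ?f x : V}" using False UX by auto
  ultimately show ?thesis using U openin_trans_full by metis
 next
  case True
  obtain e where e: "e > 0" "ball 0 e <= V" using True V by (meson open_contains_ball)
  have "eventually (%v. F v : ball 0 e) at_infinity" using F(2) e(1) by (auto simp: tendsto_iff dist_commute)
  then obtain b where b: "!!v. norm v >= b ==> F v : ball 0 e" unfolding eventually_at_infinity by blast
  have "{v. F v ~: V} <= cball 0 b"
  proof
  fix v assume "v : {v. F v ~: V}"
  hence "F v ~: ball 0 e" using e(2) by auto
  hence "~ b <= norm v" using b by blast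
  thus "v : cball 0 b" by simp
  qed
  hence "bounded {v. F v ~: V}" using bounded_subset bounded_cball by blast
  moreover have "closed {v. F v ~: V}"
  proof -
  have "closed (F -` (- V))"
  using F(1) V by (intro continuous_closed_vimage) (auto simp: continuous_on_eq_continuous_at)
  thus ?thesis by (simp add: vimage_def)
  qed
  ultimately have "compactin euclidean {v. F v ~: V}" by (simp add: compact_eq_bounded_closed)
  hence "compactin X (ps ` {v. F v ~: V})" by (rule image_compactin[OF _ cpsX])
  hence "closedin X (ps ` {v. F v ~: V})" using X compactin_imp_closedin by blast
  moreover have "{x : topspace X. ?f x : V} = topspace X - ps ` {v. F v ~: V}"
  proof (rule equalityI; rule subsetI)
  fix x assume x: "x : {x : topspace X. ?f x : V}"
  have "x ~: ps ` {v. F v ~: V}" using x psU phps by auto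
  thus "x : topspace X - ps ` {v. F v ~: V}" using x by blast
  next
  fix x assume x: "x : topspace X - ps ` {v. F v ~: V}"
  have "F (ph x) : V" if "x : U"
  proof (rule ccontr)
  assume "F (ph x) ~: V"
  hence "ps (ph x) : ps ` {v. F v ~: V}" by blast
  thus False using x psph[OF that] by simp
  qed
  thus "x : {x : topspace X. ?f x : V}" using x True by auto
  qed
  ultimately show ?thesis by (simp add: openin_diff)
 qed
 thus ?thesis by (simp add: continuous_map_def)
qed

text \<open>An injective continuous map of a compact space into Euclidean space is an embedding; its
  inverse is a map from a compact set into a space covered by finitely many charts, so it extends to
  a neighbourhood, and this extension is the retraction.\<close>

theorem compact_manifold_ENR:
 fixes X :: "'m topology"
 assumes X: "compact_space X" "Hausdorff_space X"
  and charts: "!!x. x : topspace X ==> EX U ph ps. openin X U & x : U &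
  homeomorphic_maps (subtopology X U) (euclidean :: 'e::euclidean_space topology) ph ps"
 obtains N i r Q where "continuous_map X (eucl N) i" "openin (eucl N) Q"
  "i ` topspace X <= Q" "continuous_map (esub N Q) X r" "!!x. x : topspace X ==> r (i x) = x"
proof -
 obtain U ph ps where U: "!!x. x : topspace X ==> openin X (U x)" "!!x. x : topspace X ==> x : U x"
  and ph: "!!x. x : topspace X ==> homeomorphic_maps (subtopology X (U x)) (euclidean :: 'e topology) (ph x) (ps x)"
  using charts by metis
 have UX: "U x <= topspace X" if "x : topspace X" for x using U(1)[OF that] openin_subset by blast
 have cph: "continuous_map (subtopology X (U x)) euclidean (ph x)" and cps: "continuous_map euclidean X (ps x)"
  and psph: "!!u. u : U x ==> ps x (ph x u) = u" and phps: "!!v. ph x (ps x v) = v" and psU: "!!v. ps x v : U x"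
  if "x : topspace X" for x
  using ph[OF that] UX[OF that] continuous_map_funspace[of euclidean "subtopology X (U x)" "ps x"]
  unfolding homeomorphic_maps_def by (auto simp: continuous_map_in_subtopology)
 define B where "B x = {u : U x. ph x u : ball (ph x x) 1}" for x
 have B: "openin X (B x)" if "x : topspace X" for x
 proof -
  have "openin (subtopology X (U x)) {u : topspace (subtopology X (U x)). ph x u : ball (ph x x) 1}"
  by (rule openin_continuous_map_preimage[OF cph[OF that]]) simp
  moreover have "{u : topspace (subtopology X (U x)). ph x u : ball (ph x x) 1} = B x"
  using UX[OF that] by (auto simp: B_def)
  ultimately show ?thesis using U(1)[OF that] openin_trans_full by metis
 qed
 have "EX \<F>. finite \<F> & \<F> <= B ` topspace X & topspace X <= \<Union>\<F>"
  using X(1) unfolding compact_space_alt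
 proof (rule allE[where x = "B ` topspace X"], elim impE)
  show "Ball (B ` topspace X) (openin X) & topspace X <= \<Union> (B ` topspace X)" using B U(2) by (auto simp: B_def)
 qed
 then obtain I where I: "finite I" "I <= topspace X" "topspace X <= (UN x:I. B x)" by (metis finite_subset_image)
 define C where "C x = ps x ` cball (ph x x) 1" for x
 have C: "closedin X (C x)" "C x <= U x" "B x <= C x" if "x : topspace X" for x
 proof -
  have "compactin X (C x)" unfolding C_def by (rule image_compactin[OF _ cps[OF that]]) simp
  thus "closedin X (C x)" using X(2) compactin_imp_closedin by blast
  show "C x <= U x" using psU[OF that] by (auto simp: C_def)
  show "B x <= C x"
  proof
  fix u assume u: "u : B x"
  hence "ps x (ph x u) = u" "ph x u : cball (ph x x) 1" using psph[OF that] by (auto simp: B_def)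
  thus "u : C x" unfolding C_def by (metis imageI)
  qed
 qed
 define q where "q = 1 / 2"
 \<comment> \<open>Both kinds of functions vanish at infinity and so extend by zero to all of
   \<open>X\<close>. \<open>F0\<close> is nowhere zero and thus detects the chart, and inside the
   chart the quotient of \<open>F1 b\<close> by \<open>F0\<close> is the coordinate along
   \<open>b\<close>, so together they separate points.\<close>
 define F0 :: "'e => real" where "F0 v = 1 / (1 + (norm v)\<^sup>2)" for v
 define F1 :: "'e => 'e => real" where "F1 b v = (v \<bullet> b) * F0 v" for b v
 have pos: "1 + (norm v)\<^sup>2 > 0" for v :: 'e by (simp add: add_pos_nonneg)
 have F0: "continuous_on UNIV F0" "(F0 \<longlongrightarrow> 0) at_infinity" "!!v. F0 v ~= 0"
 proof -
  show "continuous_on UNIV F0" unfolding F0_def using pos by (intro continuous_intros) (metis less_irrefl)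
  show "(F0 \<longlongrightarrow> 0) at_infinity"
  proof (rule tendstoI)
  fix e :: real assume e: "e > 0"
  have "dist (F0 v) 0 < e" if "norm v >= max 1 (2 / e)" for v
  proof -
  have "norm v >= 1" "norm v >= 2 / e" using that by auto
  hence "2 / e <= (norm v)\<^sup>2" by (smt (verit) mult_le_cancel_left1 power2_eq_square)
  hence "1 / e < 1 + (norm v)\<^sup>2" using e by (smt (verit) divide_strict_right_mono)
  hence "1 / (1 + (norm v)\<^sup>2) < e" using e pos[of v] by (simp add: field_simps)
  thus ?thesis using pos[of v] by (simp add: F0_def)
  qed
  thus "\<forall>\<^sub>F v in at_infinity. dist (F0 v) 0 < e" unfolding eventually_at_infinity by blast
  qed
  show "F0 v ~= 0" for v using pos[of v] by (simp add: F0_def)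
 qed
 have F1: "continuous_on UNIV (F1 b)" "(F1 b \<longlongrightarrow> 0) at_infinity" if "b : Basis" for b
 proof -
  show "continuous_on UNIV (F1 b)" unfolding F1_def by (intro continuous_intros F0)
  show "(F1 b \<longlongrightarrow> 0) at_infinity"
  proof (rule tendstoI)
  fix e :: real assume e: "e > 0"
  have "dist (F1 b v) 0 < e" if "norm v >= max 1 (2 / e)" for v
  proof -
  have v: "norm v >= 1" "norm v >= 2 / e" using that by auto
  have "\<bar>v \<bullet> b\<bar> <= norm v" using that Basis_le_norm \<open>b : Basis\<close> by blast
  hence "\<bar>F1 b v\<bar> <= norm v / (1 + (norm v)\<^sup>2)"
  using pos[of v] by (simp add: F1_def F0_def abs_mult divide_right_mono)
  also have "... < e"
  proof -
  have "norm v * 2 <= norm v * (e * norm v)" using v e by (intro mult_left_mono) (auto simp: field_simps)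
  hence "norm v < e * (1 + (norm v)\<^sup>2)" using v e by (simp add: power2_eq_square algebra_simps)
  thus ?thesis using pos[of v] by (simp add: field_simps)
  qed
  finally show ?thesis by simp
  qed
  thus "\<forall>\<^sub>F v in at_infinity. dist (F1 b v) 0 < e" unfolding eventually_at_infinity by blast
  qed
 qed
 define f where "f x u = (if u : U x then F0 (ph x u) else 0)" for x u
 define f' where "f' = (%(x, b) u. if u : U x then F1 b (ph x u) else 0)"
 have cf: "continuous_map X euclideanreal (f x)" if "x : I" for x
 proof -
  have x: "x : topspace X" using that I(2) by blast
  show ?thesis unfolding f_def by (rule continuous_map_extend_zero[OF X(2) U(1)[OF x] ph[OF x] F0(1,2)])
 qed
 have cf': "continuous_map X euclideanreal (f' z)" if zI: "z : I \<times> Basis" for z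
 proof -
  obtain x b where z: "z = (x, b)" "x : topspace X" "b : Basis" using zI I(2) by blast
  show ?thesis unfolding f'_def z(1) prod.case
  by (rule continuous_map_extend_zero[OF X(2) U(1)[OF z(2)] ph[OF z(2)] F1[OF z(3)]])
 qed
 define FS where "FS = f ` I Un f' ` (I \<times> Basis)"
 have "finite FS" using I by (simp add: FS_def)
 then obtain fs where fs: "set fs = FS" by (rule exE[OF finite_list])
 define N where "N = length fs"
 define i where "i u = (%j. if j < N then (fs ! j) u else 0)" for u
 have ci: "continuous_map X (eucl N) i" unfolding i_def continuous_map_componentwise_Euclidean_space
 proof (intro allI impI)
  fix j assume "j < N"
  hence "fs ! j : FS" unfolding fs[symmetric] N_def by (rule nth_mem)
  thus "continuous_map X euclideanreal (%u. (fs ! j) u)" unfolding FS_def using cf cf' by (elim UnE imageE) simp_all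
 qed
 have inj: "inj_on i (topspace X)"
 proof
  fix u v assume uv: "u : topspace X" "v : topspace X" "i u = i v"
  have eq: "h u = h v" if "h : FS" for h
  proof -
  have "EX j<length fs. fs ! j = h" using that fs in_set_conv_nth[of h fs] by simp
  then obtain j where "j < N" "fs ! j = h" unfolding N_def by (elim exE conjE)
  thus ?thesis using fun_cong[OF uv(3), of j] by (simp add: i_def)
  qed
  obtain x where x: "x : I" "u : B x" using subsetD[OF I(3) uv(1)] by (rule UN_E)
  have u: "u : U x" using x by (auto simp: B_def)
  have "f x u = f x v" using eq x by (simp add: FS_def)
  hence v: "v : U x" "F0 (ph x u) = F0 (ph x v)" using u F0(3) by (auto simp: f_def split: if_splits)
  have phuv: "ph x u = ph x v"
  proof (rule euclidean_eqI)
  fix b :: 'e assume b: "b : Basis"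
  have "f' (x, b) u = f' (x, b) v" using b x by (intro eq) (simp add: FS_def)
  thus "ph x u \<bullet> b = ph x v \<bullet> b" using u v F0(3) by (simp add: f'_def F1_def)
  qed
  have "u = ps x (ph x u)" by (rule psph[OF subsetD[OF I(2) x(1)] u, symmetric])
  also have "... = v" unfolding phuv by (rule psph[OF subsetD[OF I(2) x(1)] v(1)])
  finally show "u = v" .
 qed
 have emb: "embedding_map X (eucl N) i"
 proof (rule continuous_imp_embedding_map)
  show "Hausdorff_space (eucl N)" unfolding Euclidean_space_def
  by (intro Hausdorff_space_subtopology) (simp add: Hausdorff_space_product_topology)
 qed (use X ci inj in auto)
 define A where "A = i ` topspace X"
 have cA: "compactin (eucl N) A"
  unfolding A_def using X(1) by (intro image_compactin[OF _ ci]) (simp add: compact_space_def)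
 have eE: "Euclidean_space N = top_of_set (ecar N)" by (simp add: Euclidean_space_def euclidean_product_topology)
 have A: "A <= ecar N" using cA compactin_subset_topspace by blast
 have "compactin (top_of_set (ecar N)) A" by (subst eE[symmetric]) (rule cA)
 hence "compact A" by (simp add: compactin_subtopology)
 hence clA: "closed A" by (rule compact_imp_closed)
 obtain g where g: "homeomorphic_maps X (esub N A) i g"
  using emb unfolding embedding_map_def homeomorphic_map_maps A_def by (elim exE)
 have "continuous_map (esub N A) X g" using g by (simp add: homeomorphic_maps_def)
 moreover have "esub N A = top_of_set A" using A by (subst eE) (simp add: subtopology_subtopology Int_absorb1)
 ultimately have cg: "continuous_map (top_of_set A) X g" by simp
 have gi: "g (i x) = x" if "x : topspace X" for x using g that by (simp add: homeomorphic_maps_def)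
 have "g ` A <= (UN x:I. C x)" using I(2,3) C(3) gi unfolding A_def by fastforce
 note gA = this
 have UI: "openin X (U x)" "homeomorphic_maps (subtopology X (U x)) euclidean (ph x) (ps x)"
  "closedin X (C x)" "C x <= U x" if "x : I" for x using U(1) ph C subsetD[OF I(2) that] by simp_all
 obtain Z G where Z: "open Z" "A <= Z" "continuous_map (top_of_set Z) X G" "!!y. y : A ==> G y = g y"
  by (rule charts_extension[OF I(1) UI(1,2) clA cg UI(3,4) gA]) (assumption | rule that)+
 show ?thesis
 proof
  show "openin (eucl N) (ecar N Int Z)" by (subst eE) (use Z(1) in auto)
  show "continuous_map X (eucl N) i" by fact
  show "i ` topspace X <= ecar N Int Z" using A Z(2) by (simp add: A_def)
  show "continuous_map (esub N (ecar N Int Z)) X G"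
  by (subst (1) eE) (use Z(3) in \<open>simp add: subtopology_subtopology continuous_map_from_subtopology_mono\<close>)
  show "G (i x) = x" if "x : topspace X" for x using Z(4) gi that by (simp add: A_def)
 qed
qed

section \<open>Lifting of homotopies\<close>

text \<open>Enough of a covering map for the lifting arguments below: over small open sets there is a
 continuous section through every point, and the map is locally injective.\<close>

definition sec_cover :: "('s::topological_space => 'm) => 'm topology => bool"
 where "sec_cover p X <-> continuous_map euclidean X p &
  (ALL m:topspace X. EX T. openin X T & m : T & (ALL x. p x : T -->
  (EX q. continuous_map (subtopology X T) euclidean q & q (p x) = x & (ALL y:T. p (q y) = y)))) &
  (ALL x. EX V. open V & x : V & inj_on p V)"

lemma sec_cover_local_unique:
 fixes p :: "'s::topological_space => 'm" and g h :: "'z::topological_space => 's"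
 assumes p: "sec_cover p X" and g: "continuous_on A g" and h: "continuous_on A h"
  and eq: "!!z. z : A ==> p (g z) = p (h z)" and a: "a : A" "g a = h a"
 obtains U where "open U" "a : U" "!!z. z : A Int U ==> g z = h z"
proof -
 obtain V where V: "open V" "g a : V" "inj_on p V" using p unfolding sec_cover_def by meson
 obtain U1 where U1: "open U1" "U1 Int A = g -` V Int A" using g V(1) unfolding continuous_on_open_invariant by blast
 obtain U2 where U2: "open U2" "U2 Int A = h -` V Int A" using h V(1) unfolding continuous_on_open_invariant by blast
 show ?thesis
 proof
  show "open (U1 Int U2)" using U1 U2 by blast
  show "a : U1 Int U2" using U1(2) U2(2) a V(2) by auto
  fix z assume "z : A Int (U1 Int U2)"
  hence "z : A" "g z : V" "h z : V" using U1(2) U2(2) by blast+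
  thus "g z = h z" using eq V(3) by (auto dest: inj_onD)
 qed
qed

lemma sec_cover_unique:
 fixes p :: "'s::t2_space => 'm" and g h :: "'z::topological_space => 's"
 assumes p: "sec_cover p X" and g: "continuous_on A g" and h: "continuous_on A h"
  and eq: "!!z. z : A ==> p (g z) = p (h z)" and a: "a : A" "g a = h a" and A: "connected A" and b: "b : A"
 shows "g b = h b"
proof -
 let ?E = "{z : A. g z = h z}"
 have "openin (top_of_set A) ?E"
 proof (subst openin_subopen, clarify)
  fix x assume x: "x : A" "g x = h x"
  obtain U where U: "open U" "x : U" "!!z. z : A Int U ==> g z = h z"
  using sec_cover_local_unique[OF p g h eq x] by blast
  thus "EX T. openin (top_of_set A) T & x : T & T <= ?E" using x by (intro exI[of _ "A Int U"]) auto
 qed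
 moreover have "closedin (top_of_set A) ?E"
 proof -
  have "closedin (top_of_set A) (A Int (%z. (g z, h z)) -` {y. EX x. y = (x, x)})"
  by (intro continuous_closedin_preimage closed_diagonal continuous_intros g h)
  moreover have "A Int (%z. (g z, h z)) -` {y. EX x. y = (x, x)} = ?E" by auto
  ultimately show ?thesis by simp
 qed
 ultimately have "?E = {} \<or> ?E = A" using connected_clopen[THEN iffD1, OF A] by blast
 thus ?thesis using a b by blast
qed

lemma continuous_map_section:
 assumes "continuous_map (top_of_set A) X K" "K ` A <= T" "continuous_map (subtopology X T) euclidean q"
 shows "continuous_on A (%z. q (K z))"
proof -
 have "continuous_map (top_of_set A) (subtopology X T) K" using assms by (auto simp: continuous_map_in_subtopology)
 from continuous_map_compose[OF this assms(3)] show ?thesis by (simp add: o_def)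
qed

text \<open>\<open>Q tu\<close> says that a lift exists over \<open>{0..tu}\<close> times some
  neighbourhood of \<open>z0\<close>, which may shrink as \<open>tu\<close> grows. Near any
  \<open>tu0\<close> the homotopy stays in one set with sections, so \<open>Q\<close> is locally
  constant and the connected interval carries it from \<open>0\<close> to \<open>1\<close>.\<close>

lemma sec_cover_lift_local:
 fixes p :: "'s::t2_space => 'm" and K :: "real \<times> 'z::topological_space => 'm"
 assumes p: "sec_cover p X" and K: "continuous_map (top_of_set ({0..1} \<times> UNIV)) X K"
  and k: "continuous_on UNIV k" "!!z. p (k z) = K (0, z)"
 obtains U H where "open U" "z0 : U" "continuous_on ({0..1} \<times> U) H"
  "!!t z. t : {0..1} ==> z : U ==> p (H (t, z)) = K (t, z)" "!!z. z : U ==> H (0, z) = k z"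
proof -
 define L where "L tu U H <-> open U & z0 : U & continuous_on ({0..tu} \<times> U) H &
  (ALL t:{0..tu}. ALL z:U. p (H (t, z)) = K (t, z)) & (ALL z:U. H (0, z) = k z)" for tu U H
 define Q where "Q tu <-> (EX U H. L tu U H)" for tu
 have top: "K (t, z) : topspace X" if "t : {0..1}" for t z using continuous_map_funspace[OF K] that by auto
 have Qmono: "Q tu'" if Qt: "Q tu" and that: "tu' <= tu" for tu tu'
 proof -
  obtain U H where "L tu U H" using Qt unfolding Q_def by blast
  hence H: "open U" "z0 : U" "continuous_on ({0..tu} \<times> U) H"
  "ALL t:{0..tu}. ALL z:U. p (H (t, z)) = K (t, z)" "ALL z:U. H (0, z) = k z" by (simp_all add: L_def)
  have "{0..tu'} \<times> U <= {0..tu} \<times> U" using that by auto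
  hence "continuous_on ({0..tu'} \<times> U) H" using H(3) continuous_on_subset by blast
  hence "L tu' U H" unfolding L_def using H that by simp
  thus ?thesis unfolding Q_def by (intro exI)
 qed
 have step: "EX T. openin (top_of_set {0..1}) T & tu0 : T & (ALL x:T. ALL y:T. Q x --> Q y)" if tu0: "tu0 : {0..1}" for tu0
 proof -
  obtain T where T: "openin X T" "K (tu0, z0) : T"
  "!!x. p x : T ==> EX q. continuous_map (subtopology X T) euclidean q & q (p x) = x & (ALL y:T. p (q y) = y)"
  using p top[OF tu0, of z0] unfolding sec_cover_def by meson
  have "openin (top_of_set ({0..1} \<times> UNIV)) {y : topspace (top_of_set ({0..1} \<times> UNIV)). K y : T}"
  by (rule openin_continuous_map_preimage[OF K T(1)])
  then obtain W where W: "open W" "{y : {0..1} \<times> UNIV. K y : T} = ({0..1} \<times> UNIV) Int W"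
  unfolding openin_open by (auto simp: Int_commute)
  have "(tu0, z0) : W" using W(2) tu0 T(2) by blast
  then obtain I U' where IU: "open I" "open U'" "tu0 : I" "z0 : U'" "I \<times> U' <= W"
  using W(1) by (metis open_prod_elim mem_Sigma_iff)
  obtain ep where ep: "ep > 0" "ball tu0 ep <= I" using IU by (meson open_contains_ball)
  have KT: "K (t, z) : T" if "t : {0..1} Int ball tu0 ep" "z : U'" for t z using that W(2) IU ep by blast
  have QQ: "Q y" if x: "x : {0..1} Int ball tu0 ep" and y: "y : {0..1} Int ball tu0 ep" and Qx: "Q x" for x y
  proof (cases "y <= x")
  case True
  thus ?thesis using Qmono Qx by blast
  next
  case False
  obtain U H where "L x U H" using Qx unfolding Q_def by blast
  hence H: "open U" "z0 : U" "continuous_on ({0..x} \<times> U) H"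
  "!!t z. t:{0..x} ==> z:U ==> p (H (t, z)) = K (t, z)" "!!z. z:U ==> H (0, z) = k z" by (simp_all add: L_def)
  have x0: "x : {0..x}" "x : {0..1}" using x by auto
  have pH: "p (H (x, z0)) = K (x, z0)" using H(4)[OF x0(1) H(2)] .
  obtain q where q: "continuous_map (subtopology X T) euclidean q" "q (K (x, z0)) = H (x, z0)" "!!y. y : T ==> p (q y) = y"
  using T(3)[of "H (x, z0)"] KT[OF x IU(4)] pH by auto
  have c1: "continuous_on (U Int U') (%z. H (x, z))"
  by (rule continuous_on_compose2[OF H(3)]) (use x in \<open>auto intro!: continuous_intros\<close>)
  have cK: "continuous_map (top_of_set A) X K" if "A <= {0..1} \<times> UNIV" for A
  using K that by (metis continuous_map_from_subtopology_mono)
  have cqK: "continuous_on ({x..y} \<times> (U Int U')) (%w. q (K w))"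
  proof (rule continuous_map_section[OF cK _ q(1)])
  show "{x..y} \<times> (U Int U') <= {0..1} \<times> UNIV" using x y by auto
  show "K ` ({x..y} \<times> (U Int U')) <= T"
  proof clarify
  fix t z assume t: "t : {x..y}" "z : U" "z : U'"
  have "t : {0..1} Int ball tu0 ep" using t(1) x y by (auto simp: dist_real_def)
  thus "K (t, z) : T" using KT t(3) by blast
  qed
  qed
  have c2: "continuous_on (U Int U') (%z. q (K (x, z)))"
  by (rule continuous_on_compose2[OF cqK]) (use False in \<open>auto intro!: continuous_intros\<close>)
  \<comment> \<open>The old lift and the section are known to agree only at \<open>(x, z0)\<close>.
    Local uniqueness gives a neighbourhood on which they agree along the whole slice at
    \<open>x\<close>, so that they can be glued there.\<close>
  obtain V where V: "open V" "z0 : V" "!!z. z : U Int U' Int V ==> H (x, z) = q (K (x, z))"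
  proof (rule sec_cover_local_unique[OF p c1 c2])
  show "z0 : U Int U'" using H IU by blast
  show "H (x, z0) = q (K (x, z0))" using q by simp
  show "p (H (x, z)) = p (q (K (x, z)))" if "z : U Int U'" for z using that H(4)[OF x0(1)] q(3)[OF KT[OF x]] by simp
  qed blast
  let ?U = "U Int U' Int V" and ?H = "%w. if fst w <= x then H w else q (K w)"
  have "continuous_on ({0..x} \<times> ?U Un {x..y} \<times> ?U) ?H"
  proof (rule continuous_on_cases_local)
  have "{0..x} \<times> ?U = ({0..x} \<times> ?U Un {x..y} \<times> ?U) Int ({..x} \<times> UNIV)"
  using False x by auto
  thus "closedin (top_of_set ({0..x} \<times> ?U Un {x..y} \<times> ?U)) ({0..x} \<times> ?U)"
  by (metis closed_Times closed_UNIV closed_atMost closedin_closed_Int)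
  have "{x..y} \<times> ?U = ({0..x} \<times> ?U Un {x..y} \<times> ?U) Int ({x..} \<times> UNIV)"
  using False x by auto
  thus "closedin (top_of_set ({0..x} \<times> ?U Un {x..y} \<times> ?U)) ({x..y} \<times> ?U)"
  by (metis closed_Times closed_UNIV closed_atLeast closedin_closed_Int)
  show "continuous_on ({0..x} \<times> ?U) H" by (rule continuous_on_subset[OF H(3)]) auto
  show "continuous_on ({x..y} \<times> ?U) (%w. q (K w))" by (rule continuous_on_subset[OF cqK]) auto
  show "H w = q (K w)" if "w : {0..x} \<times> ?U & ~ fst w <= x \<or> w : {x..y} \<times> ?U & fst w <= x" for w
  proof -
  have "fst w = x" "snd w : ?U" using that by auto
  thus ?thesis using V(3)[of "snd w"] by (metis prod.collapse)
  qed
  qed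
  moreover have "{0..x} \<times> ?U Un {x..y} \<times> ?U = {0..y} \<times> ?U" using False x by auto
  ultimately have "continuous_on ({0..y} \<times> ?U) ?H" by simp
  moreover have "p (?H (t, z)) = K (t, z)" if "t : {0..y}" "z : ?U" for t z
  proof (cases "t <= x")
  case True
  thus ?thesis using H(4) that by simp
  next
  case False
  hence "t : {0..1} Int ball tu0 ep" using that x y by (auto simp: dist_real_def)
  thus ?thesis using False KT q(3) that by simp
  qed
  moreover have "open ?U" "z0 : ?U" using H IU V by auto
  moreover have "?H (0, z) = k z" if "z : ?U" for z using that H(5) x by auto
  ultimately have "L y ?U ?H" unfolding L_def by blast
  thus "Q y" unfolding Q_def by (intro exI)
  qed
  show ?thesis
  proof (intro exI conjI ballI impI)
  show "openin (top_of_set {0..1}) ({0..1} Int ball tu0 ep)" by (simp add: openin_open_Int)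
  show "tu0 : {0..1} Int ball tu0 ep" using tu0 ep(1) by simp
  qed (rule QQ)
 qed
 have "Q 0"
 proof -
  have "continuous_on ({0..0::real} \<times> UNIV) (%w. k (snd w))"
  by (rule continuous_on_compose2[OF k(1)]) (auto intro!: continuous_intros)
  hence "L 0 UNIV (%w. k (snd w))" unfolding L_def using k(2) by auto
  thus ?thesis unfolding Q_def by (intro exI)
 qed
 have "Q 1" by (rule connected_induction_simple[where S = "{0..1::real}" and a = 0 and P = Q])
  (use step \<open>Q 0\<close> in auto)
 then obtain U H where "L 1 U H" unfolding Q_def by blast
 hence "open U" "z0 : U" "continuous_on ({0..1} \<times> U) H"
  "!!t z. t : {0..1} ==> z : U ==> p (H (t, z)) = K (t, z)" "!!z. z : U ==> H (0, z) = k z" by (simp_all add: L_def)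
 thus ?thesis by (rule that)
qed

theorem sec_cover_lift_homotopy:
 fixes p :: "'s::t2_space => 'm" and K :: "real \<times> 'z::t2_space => 'm"
 assumes p: "sec_cover p X" and K: "continuous_map (top_of_set ({0..1} \<times> UNIV)) X K"
  and k: "continuous_on UNIV k" "!!z. p (k z) = K (0, z)"
 obtains H where "continuous_on ({0..1} \<times> UNIV) H"
  "!!t z. t : {0..1} ==> p (H (t, z)) = K (t, z)" "!!z. H (0, z) = k z"
proof -
 have "EX U H. open U & z0 : U & continuous_on ({0..1} \<times> U) H &
  (ALL t:{0..1}. ALL z:U. p (H (t, z)) = K (t, z)) & (ALL z:U. H (0, z) = k z)" for z0
  using sec_cover_lift_local[OF p K k, of z0] by metis
 then obtain U L where L: "!!z0. open (U z0)" "!!z0. z0 : U z0" "!!z0. continuous_on ({0..1} \<times> U z0) (L z0)"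
  "!!z0 t z. t:{0..1} ==> z:U z0 ==> p (L z0 (t, z)) = K (t, z)" "!!z0 z. z:U z0 ==> L z0 (0, z) = k z" by metis
 \<comment> \<open>Every \<open>z\<close> uses the local lift around itself. Two local lifts over
   the same \<open>z\<close> agree along the interval by uniqueness, so \<open>H\<close> coincides
   with \<open>L z0\<close> near \<open>z0\<close>.\<close>
 define H where "H = (%(t, z). L z (t, z))"
 have agree: "H (t, z) = L z0 (t, z)" if t: "t : {0..1}" and z: "z : U z0" for t z z0
 proof -
  have c: "continuous_on {0..1} (%t. L w (t, z))" if "z : U w" for w
  by (rule continuous_on_compose2[OF L(3)[of w]]) (use that in \<open>auto intro!: continuous_intros\<close>)
  have "L z (t, z) = L z0 (t, z)" by (rule sec_cover_unique[OF p c c, where a = 0 and b = t]) (use L z t in auto)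
  thus ?thesis by (simp add: H_def)
 qed
 show ?thesis
 proof
  show "continuous_on ({0..1} \<times> UNIV) H" unfolding continuous_on_eq_continuous_within
  proof
  fix w :: "real \<times> 'z" assume w: "w : {0..1} \<times> UNIV"
  let ?z = "snd w"
  have "continuous_on ({0..1} \<times> U ?z) H"
  using agree by (intro continuous_on_cong[THEN iffD1, OF refl _ L(3)[of ?z]]) auto
  moreover have "w : {0..1} \<times> U ?z" using w L(2) by (metis SigmaE SigmaI snd_conv)
  ultimately have "continuous (at w within {0..1} \<times> U ?z) H"
  unfolding continuous_on_eq_continuous_within by blast
  moreover have "at w within {0..1} \<times> U ?z = at w within {0..1} \<times> UNIV"
  by (rule at_within_nhd[where S = "UNIV \<times> U ?z"])
  (use L(1,2) \<open>w : {0..1} \<times> U ?z\<close> in \<open>auto intro: open_Times\<close>)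
  ultimately show "continuous (at w within {0..1} \<times> UNIV) H" by simp
  qed
  show "p (H (t, z)) = K (t, z)" if "t : {0..1}" for t z using L(2,4) that by (simp add: H_def)
  show "H (0, z) = k z" for z using L(2,5) by (simp add: H_def)
 qed
qed

section \<open>Lie group endomorphisms\<close>

text \<open>Strict differentiability: the estimate compares two arbitrary points near
  \<open>z\<close>. It therefore controls the derivative of \<open>f\<close> at every nearby point
  where it exists (\<open>sderiv_near\<close>), which ordinary differentiability at \<open>z\<close>
  does not.\<close>

definition sderiv :: "('a::real_normed_vector => 'b::real_normed_vector) => ('a => 'b) => 'a => bool"
 where "sderiv f f' z <-> bounded_linear f' &
  (ALL ep>0. EX dl>0. ALL x:ball z dl. ALL y:ball z dl. norm (f x - f y - f' (x - y)) <= ep * norm (x - y))"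

lemma sderivD:
 assumes "sderiv f f' z" "ep > 0"
 obtains dl where "dl > 0" "!!x y. x : ball z dl ==> y : ball z dl ==> norm (f x - f y - f' (x - y)) <= ep * norm (x - y)"
 using assms unfolding sderiv_def by meson

lemma sderiv_linear: "sderiv f f' z ==> bounded_linear f'"
 by (simp add: sderiv_def)

lemma sderiv_has_derivative:
 assumes "sderiv f f' z" shows "(f has_derivative f') (at z)" unfolding has_derivative_at_alt
proof (intro conjI allI impI)
 show "bounded_linear f'" using assms by (simp add: sderiv_def)
 fix e :: real assume "0 < e"
 then obtain dl where dl: "dl > 0" "!!x y. x : ball z dl ==> y : ball z dl ==> norm (f x - f y - f' (x - y)) <= e * norm (x - y)"
  using sderivD[OF assms] by blast
 thus "EX d>0. ALL y. norm (y - z) < d --> norm (f y - f z - f' (y - z)) <= e * norm (y - z)"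
  by (intro exI[of _ dl]) (auto simp: dist_norm norm_minus_commute)
qed

lemma sderiv_lipschitz:
 assumes "sderiv f f' z"
 obtains dl L where "dl > 0" "L > 0" "!!x y. x : ball z dl ==> y : ball z dl ==> norm (f x - f y) <= L * norm (x - y)"
proof -
 interpret bounded_linear f' by (rule sderiv_linear[OF assms])
 obtain K where K: "K > 0" "!!x. norm (f' x) <= norm x * K" using pos_bounded by blast
 obtain dl where dl: "dl > 0" "!!x y. x : ball z dl ==> y : ball z dl ==> norm (f x - f y - f' (x - y)) <= 1 * norm (x - y)"
  using sderivD[OF assms, of 1] by auto
 show ?thesis
 proof
  show "norm (f x - f y) <= (K + 1) * norm (x - y)" if "x : ball z dl" "y : ball z dl" for x y
  using dl(2)[OF that] K(2)[of "x - y"] norm_triangle_ineq[of "f x - f y - f' (x - y)" "f' (x - y)"]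
  by (simp add: algebra_simps)
 qed (use dl K in auto)
qed

lemma sderiv_compose:
 assumes f: "sderiv f f' z" and g: "sderiv g g' (f z)" shows "sderiv (%x. g (f x)) (%x. g' (f' x)) z"
 unfolding sderiv_def
proof (intro conjI allI impI)
 show "bounded_linear (%x. g' (f' x))" by (rule bounded_linear_compose[OF sderiv_linear[OF g] sderiv_linear[OF f]])
 fix ep :: real assume ep: "ep > 0"
 interpret g: bounded_linear g' by (rule sderiv_linear[OF g])
 obtain K where K: "K > 0" "!!x. norm (g' x) <= norm x * K" using g.pos_bounded by blast
 obtain dl1 L where L: "dl1 > 0" "L > 0" "!!x y. x : ball z dl1 ==> y : ball z dl1 ==> norm (f x - f y) <= L * norm (x - y)"
  using sderiv_lipschitz[OF f] by blast
 obtain dl2 where dl2: "dl2 > 0" "!!x y. x : ball z dl2 ==> y : ball z dl2 ==> norm (f x - f y - f' (x - y)) <= ep / (2 * K) * norm (x - y)"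
  using sderivD[OF f, of "ep / (2 * K)"] ep K by auto
 obtain dl3 where dl3: "dl3 > 0" "!!x y. x : ball (f z) dl3 ==> y : ball (f z) dl3 ==> norm (g x - g y - g' (x - y)) <= ep / (2 * L) * norm (x - y)"
  using sderivD[OF g, of "ep / (2 * L)"] ep L by auto
 define dl where "dl = min (min dl1 dl2) (dl3 / L)"
 have "norm (g (f x) - g (f y) - g' (f' (x - y))) <= ep * norm (x - y)" if xy: "x : ball z dl" "y : ball z dl" for x y
 proof -
  have near: "f w : ball (f z) dl3" if "w : ball z dl" for w
  proof -
  have "norm (f w - f z) <= L * norm (w - z)" using that L by (intro L(3)) (auto simp: dl_def)
  also have "... < dl3" using that L by (simp add: dl_def dist_norm norm_minus_commute field_simps)
  finally show ?thesis by (simp add: dist_norm norm_minus_commute)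
  qed
  have 1: "norm (g (f x) - g (f y) - g' (f x - f y)) <= ep / 2 * norm (x - y)"
  proof -
  have "norm (g (f x) - g (f y) - g' (f x - f y)) <= ep / (2 * L) * norm (f x - f y)" using dl3 near xy by blast
  also have "... <= ep / (2 * L) * (L * norm (x - y))"
  using xy L ep by (intro mult_left_mono L(3)) (auto simp: dl_def)
  finally show ?thesis using L by simp
  qed
  have 2: "norm (g' (f x - f y - f' (x - y))) <= ep / 2 * norm (x - y)"
  proof -
  have "norm (g' (f x - f y - f' (x - y))) <= norm (f x - f y - f' (x - y)) * K" by (rule K(2))
  also have "... <= ep / (2 * K) * norm (x - y) * K" using xy K by (intro mult_right_mono dl2(2)) (auto simp: dl_def)
  finally show ?thesis using K by simp
  qed
  have "g (f x) - g (f y) - g' (f' (x - y)) = (g (f x) - g (f y) - g' (f x - f y)) + g' (f x - f y - f' (x - y))"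
  by (simp add: g.diff)
  hence "norm (g (f x) - g (f y) - g' (f' (x - y))) <= norm (g (f x) - g (f y) - g' (f x - f y)) + norm (g' (f x - f y - f' (x - y)))"
  using norm_triangle_ineq by metis
  thus ?thesis using 1 2 by simp
 qed
 moreover have "dl > 0" using L dl2 dl3 by (simp add: dl_def)
 ultimately show "EX dl>0. ALL x:ball z dl. ALL y:ball z dl. norm (g (f x) - g (f y) - g' (f' (x - y))) <= ep * norm (x - y)"
  by blast
qed

lemma sderiv_Pair:
 assumes f: "sderiv f f' z" and g: "sderiv g g' z" shows "sderiv (%x. (f x, g x)) (%x. (f' x, g' x)) z"
 unfolding sderiv_def
proof (intro conjI allI impI)
 show "bounded_linear (%x. (f' x, g' x))" by (rule bounded_linear_Pair[OF sderiv_linear[OF f] sderiv_linear[OF g]])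
 fix ep :: real assume ep: "ep > 0"
 obtain dl1 where dl1: "dl1 > 0" "!!x y. x : ball z dl1 ==> y : ball z dl1 ==> norm (f x - f y - f' (x - y)) <= ep / 2 * norm (x - y)"
  using sderivD[OF f, of "ep / 2"] ep by auto
 obtain dl2 where dl2: "dl2 > 0" "!!x y. x : ball z dl2 ==> y : ball z dl2 ==> norm (g x - g y - g' (x - y)) <= ep / 2 * norm (x - y)"
  using sderivD[OF g, of "ep / 2"] ep by auto
 show "EX dl>0. ALL x:ball z dl. ALL y:ball z dl. norm ((f x, g x) - (f y, g y) - (f' (x - y), g' (x - y))) <= ep * norm (x - y)"
 proof (intro exI conjI ballI)
  show "min dl1 dl2 > 0" using dl1 dl2 by simp
  fix x y assume "x : ball z (min dl1 dl2)" "y : ball z (min dl1 dl2)"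
  hence "norm (f x - f y - f' (x - y)) <= ep / 2 * norm (x - y)" "norm (g x - g y - g' (x - y)) <= ep / 2 * norm (x - y)"
  using dl1 dl2 by auto
  thus "norm ((f x, g x) - (f y, g y) - (f' (x - y), g' (x - y))) <= ep * norm (x - y)"
  using norm_Pair_le[of "f x - f y - f' (x - y)" "g x - g y - g' (x - y)"] by simp
 qed
qed

lemma sderiv_bounded_linear: "bounded_linear f ==> sderiv f f z"
 unfolding sderiv_def by (auto simp: linear_simps intro: exI[of _ 1])

lemma sderiv_shift:
 assumes "sderiv f f' (a + z)" shows "sderiv (%x. f (a + x)) f' z" unfolding sderiv_def
proof (intro conjI allI impI)
 show "bounded_linear f'" by (rule sderiv_linear[OF assms])
 fix ep :: real assume "ep > 0"
 then obtain dl where dl: "dl > 0" "!!x y. x : ball (a + z) dl ==> y : ball (a + z) dl ==> norm (f x - f y - f' (x - y)) <= ep * norm (x - y)"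
  using sderivD[OF assms] by blast
 show "EX dl>0. ALL x:ball z dl. ALL y:ball z dl. norm (f (a + x) - f (a + y) - f' (x - y)) <= ep * norm (x - y)"
  using dl(1) dl(2)[of "a + x" "a + y" for x y] by (intro exI[of _ dl]) auto
qed

lemma sderiv_diff_const:
 assumes "sderiv f f' z" shows "sderiv (%x. f x - c) f' z" using assms unfolding sderiv_def by simp

lemma sderiv_cong:
 assumes "sderiv f f' z" "open S" "z : S" "!!x. x : S ==> f x = g x" shows "sderiv g f' z" unfolding sderiv_def
proof (intro conjI allI impI)
 show "bounded_linear f'" by (rule sderiv_linear[OF assms(1)])
 fix ep :: real assume "ep > 0"
 then obtain dl where dl: "dl > 0" "!!x y. x : ball z dl ==> y : ball z dl ==> norm (f x - f y - f' (x - y)) <= ep * norm (x - y)"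
  using sderivD[OF assms(1)] by blast
 obtain e where e: "e > 0" "ball z e <= S" using assms(2,3) by (meson open_contains_ball)
 show "EX dl>0. ALL x:ball z dl. ALL y:ball z dl. norm (g x - g y - f' (x - y)) <= ep * norm (x - y)"
 proof (intro exI conjI ballI)
  show "min dl e > 0" using dl e by simp
  fix x y assume "x : ball z (min dl e)" "y : ball z (min dl e)"
  thus "norm (g x - g y - f' (x - y)) <= ep * norm (x - y)"
  using dl(2)[of x y] assms(4)[of x] assms(4)[of y] subsetD[OF e(2), of x] subsetD[OF e(2), of y] by simp
 qed
qed

text \<open>Continuity of the directional derivatives along a basis makes the derivative close to
  the one at \<open>z\<close> in operator norm; the mean value inequality on a ball, applied to
  \<open>f\<close> minus its linear part at \<open>z\<close>, does the rest.\<close>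

lemma Ck_on_1_sderiv:
 fixes f :: "'a::euclidean_space => 'b::real_normed_vector"
 assumes f: "Ck_on 1 S f" and S: "open S" "z : S" shows "sderiv f (frechet_derivative f (at z)) z"
 unfolding sderiv_def
proof (intro conjI allI impI)
 have d: "(f has_derivative frechet_derivative f (at x)) (at x)" if "x : S" for x
  using f that frechet_derivative_works by auto
 have c: "continuous_on S (%x. frechet_derivative f (at x) v)" for v using f by simp
 let ?D = "%x. frechet_derivative f (at x)"
 show bl: "bounded_linear (?D z)" using d[OF S(2)] has_derivative_bounded_linear by blast
 fix ep :: real assume ep: "ep > 0"
 have "ALL b:Basis. EX dl>0. ALL x:S. dist x z < dl --> norm (?D x b - ?D z b) <= ep / DIM('a)"
 proof
  fix b :: 'a
  have "ep / DIM('a) > 0" using ep by simp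
  thus "EX dl>0. ALL x:S. dist x z < dl --> norm (?D x b - ?D z b) <= ep / DIM('a)"
  using c[of b] S(2) unfolding continuous_on_iff dist_norm by (metis less_imp_le)
 qed
 then obtain dl where dl: "!!b. b : Basis ==> dl b > 0"
  "!!b x. b : Basis ==> x : S ==> dist x z < dl b ==> norm (?D x b - ?D z b) <= ep / DIM('a)" by metis
 obtain e where e: "e > 0" "ball z e <= S" using S by (meson open_contains_ball)
 define r where "r = min e (Min (dl ` Basis))"
 have r: "r > 0" "r <= e" "!!b. b : Basis ==> r <= dl b" using e dl(1) by (auto simp: r_def min.coboundedI2)
 have on: "onorm (%v. ?D x v - ?D z v) <= ep" if x: "x : ball z r" for x
 proof (rule onorm_bound)
  show "0 <= ep" using ep by simp
  fix v :: 'a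
  have xS: "x : S" using x e r by auto
  interpret Dx: bounded_linear "?D x" using d[OF xS] has_derivative_bounded_linear by blast
  interpret Dz: bounded_linear "?D z" by (rule bl)
  have "?D x v - ?D z v = (SUM b:Basis. (v \<bullet> b) *\<^sub>R (?D x b - ?D z b))"
  proof -
  have "?D x v = ?D x (SUM b:Basis. (v \<bullet> b) *\<^sub>R b)" "?D z v = ?D z (SUM b:Basis. (v \<bullet> b) *\<^sub>R b)"
  by (simp_all add: euclidean_representation)
  thus ?thesis by (simp add: Dx.sum Dz.sum Dx.scaleR Dz.scaleR scaleR_diff_right sum_subtractf)
  qed
  also have "norm ... <= (SUM b:(Basis::'a set). norm v * (ep / DIM('a)))"
  proof (rule sum_norm_le)
  fix b :: 'a assume b: "b : Basis"
  have "norm (?D x b - ?D z b) <= ep / DIM('a)" using dl(2)[OF b xS] x r(3)[OF b] by (simp add: dist_commute)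
  thus "norm ((v \<bullet> b) *\<^sub>R (?D x b - ?D z b)) <= norm v * (ep / DIM('a))"
  using mult_mono[OF Basis_le_norm[OF b, of v] \<open>norm (?D x b - ?D z b) <= _\<close>] by simp
  qed
  also have "... = ep * norm v" by simp
  finally show "norm (?D x v - ?D z v) <= ep * norm v" .
 qed
 have "norm (f x - f y - ?D z (x - y)) <= ep * norm (x - y)" if "x : ball z r" "y : ball z r" for x y
 proof -
  interpret Dz: bounded_linear "?D z" by (rule bl)
  have "norm ((f x - ?D z x) - (f y - ?D z y)) <= ep * norm (x - y)"
  proof (rule differentiable_bound[OF convex_ball _ on])
  fix w assume w: "w : ball z r"
  hence "w : S" using e r by auto
  hence "((%w. f w - ?D z w) has_derivative (%v. ?D w v - ?D z v)) (at w)"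
  by (intro has_derivative_diff d bounded_linear_imp_has_derivative bl)
  thus "((%w. f w - ?D z w) has_derivative (%v. ?D w v - ?D z v)) (at w within ball z r)"
  by (rule has_derivative_at_withinI)
  qed (use that in auto)
  thus ?thesis by (simp add: Dz.diff algebra_simps)
 qed
 thus "EX dl>0. ALL x:ball z dl. ALL y:ball z dl. norm (f x - f y - ?D z (x - y)) <= ep * norm (x - y)"
  using r(1) by blast
qed

lemma has_derivative_norm_le_lip:
 fixes g :: "'a::real_normed_vector => 'b::real_normed_vector"
 assumes g: "(g has_derivative g') (at x)" and d: "d > 0"
  and lip: "!!y. norm (y - x) < d ==> norm (g y - g x) <= et * norm (y - x)" shows "norm (g' v) <= et * norm v"
proof (cases "v = 0")
 case True
 interpret bounded_linear g' by (rule has_derivative_bounded_linear[OF g])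
 show ?thesis using True zero by simp
next
 case False
 interpret bounded_linear g' by (rule has_derivative_bounded_linear[OF g])
 show ?thesis
 proof (rule field_le_epsilon)
  fix e :: real assume "e > 0"
  hence "e / norm v > 0" using False by simp
  then obtain d' where d': "d' > 0" "!!y. norm (y - x) < d' ==> norm (g y - g x - g' (y - x)) <= e / norm v * norm (y - x)"
  using g unfolding has_derivative_at_alt by blast
  define s where "s = min d d' / (2 * norm v)"
  have s: "s > 0" "s * norm v < d" "s * norm v < d'" using d d'(1) False by (auto simp: s_def)
  let ?y = "x + s *\<^sub>R v"
  have 1: "norm (g ?y - g x - s *\<^sub>R g' v) <= e / norm v * (s * norm v)"
  using d'(2)[of ?y] s by (simp add: scaleR)
  have 2: "norm (g ?y - g x) <= et * (s * norm v)" using lip[of ?y] s by simp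
  have "norm (s *\<^sub>R g' v) <= norm (g ?y - g x) + norm (g ?y - g x - s *\<^sub>R g' v)"
  using norm_triangle_ineq4[of "g ?y - g x" "g ?y - g x - s *\<^sub>R g' v"] by simp
  hence "s * norm (g' v) <= s * (et * norm v + e)" using 1 2 s False by (simp add: algebra_simps)
  thus "norm (g' v) <= et * norm v + e" using s(1) by simp
 qed
qed

text \<open>On the ball \<open>f - f'\<close> has Lipschitz constant \<open>et\<close>, which bounds
  its derivative at every point.\<close>

lemma sderiv_near:
 assumes f: "!!x y. x : ball z dl ==> y : ball z dl ==> norm (f x - f y - f' (x - y)) <= et * norm (x - y)"
  and F: "(f has_derivative F) (at x)" and f': "bounded_linear f'" and x: "x : ball z dl"
 shows "norm (F v - f' v) <= et * norm v"
proof (rule has_derivative_norm_le_lip)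
 show "((%y. f y - f' y) has_derivative (%v. F v - f' v)) (at x)"
  by (intro has_derivative_diff F bounded_linear_imp_has_derivative f')
 show "dl - dist z x > 0" using x by simp
 fix y assume "norm (y - x) < dl - dist z x"
 hence "y : ball z dl" using dist_triangle[of z y x] by (simp add: dist_norm norm_minus_commute)
 thus "norm (f y - f' y - (f x - f' x)) <= et * norm (y - x)"
  using f[OF _ x] by (simp add: linear_simps[OF f'] algebra_simps)
qed

section \<open>The group operations in coordinates around the identity\<close>

context lie_group begin

abbreviation (input) mult_ascii (infixl "*." 70) where "x *. y == x \<otimes> y"

lemma in_carrier [simp, intro!]: "x : carrier G"
 by (simp add: carrier_UNIV)

lemma mult_inv_cancel [simp]: "x *. (inv x *. y) = y" "inv x *. (x *. y) = y"
 by (simp_all flip: m_assoc)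

lemma one_chart: "one_chart G \<A> : \<A>" "\<one> : fst (one_chart G \<A>)"
proof -
 have "EX c. c : \<A> & \<one> : fst c" using atlas unfolding smooth_atlas_def by (metis UNIV_I UN_E)
 hence "one_chart G \<A> : \<A> & \<one> : fst (one_chart G \<A>)" unfolding one_chart_def by (rule someI_ex)
 thus "one_chart G \<A> : \<A>" "\<one> : fst (one_chart G \<A>)" by simp_all
qed

text \<open>The chart is shifted to send the identity to \<open>0\<close>. The shift does not affect
  derivatives, so those taken at \<open>0\<close> agree with
  \<open>lie_differential\<close>.\<close>

definition crd :: "'s => real ^ 'n"
 where "crd x = snd (one_chart G \<A>) x - snd (one_chart G \<A>) \<one>"

definition loc :: "real ^ 'n => 's"
 where "loc v = chart_inv (one_chart G \<A>) (snd (one_chart G \<A>) \<one> + v)"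

definition nbh :: "'s set"
 where "nbh = fst (one_chart G \<A>)"

definition cdom :: "(real ^ 'n) set"
 where "cdom = crd ` nbh"

lemma one_chart_homeo:
 "open nbh" "open (snd (one_chart G \<A>) ` nbh)"
 "homeomorphism nbh (snd (one_chart G \<A>) ` nbh) (snd (one_chart G \<A>)) (chart_inv (one_chart G \<A>))"
 using atlas one_chart unfolding smooth_atlas_def is_chart_def nbh_def by auto

lemma nbh: "open nbh" "\<one> : nbh"
 using one_chart_homeo one_chart by (auto simp: nbh_def)

lemma cdom_eq: "cdom = (%y. y - snd (one_chart G \<A>) \<one>) ` snd (one_chart G \<A>) ` nbh"
 by (auto simp: cdom_def crd_def)

lemma cdom: "open cdom" "0 : cdom"
proof -
 show "open cdom" unfolding cdom_eq using open_translation_subtract one_chart_homeo(2) by blast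
 show "0 : cdom" unfolding cdom_def using nbh(2) by (intro image_eqI[of _ _ \<one>]) (simp_all add: crd_def)
qed

lemma in_cdom: "v : cdom <-> snd (one_chart G \<A>) \<one> + v : snd (one_chart G \<A>) ` nbh"
proof -
 have "v : (%y. y - k) ` A <-> k + v : A" for k :: "real ^ 'n" and A by (auto simp: image_iff algebra_simps)
 thus ?thesis unfolding cdom_eq by blast
qed

lemma crd_loc: "v : cdom ==> crd (loc v) = v"
 using homeomorphism_apply2[OF one_chart_homeo(3)] unfolding in_cdom loc_def crd_def by simp

lemma loc_crd: "x : nbh ==> loc (crd x) = x"
 using homeomorphism_apply1[OF one_chart_homeo(3)] unfolding loc_def crd_def by simp

lemma crd_cdom: "x : nbh ==> crd x : cdom"
 by (simp add: cdom_def)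

lemma loc_nbh: "v : cdom ==> loc v : nbh"
 using loc_crd unfolding cdom_def by (metis imageE)

lemma crd_one [simp]: "crd \<one> = 0"
 by (simp add: crd_def)

lemma loc_zero [simp]: "loc 0 = \<one>"
 using loc_crd nbh(2) by fastforce

lemma continuous_loc: "continuous_on cdom loc"
proof -
 have 1: "continuous_on cdom (%v. snd (one_chart G \<A>) \<one> + v)" by (intro continuous_intros)
 have 2: "continuous_on (snd (one_chart G \<A>) ` nbh) (chart_inv (one_chart G \<A>))"
  using one_chart_homeo(3) by (simp add: homeomorphism_def)
 have 3: "(%v. snd (one_chart G \<A>) \<one> + v) ` cdom <= snd (one_chart G \<A>) ` nbh" using in_cdom by blast
 show ?thesis unfolding loc_def by (rule continuous_on_compose2[OF 2 1 3])
qed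

lemma continuous_crd: "continuous_on nbh crd"
 using one_chart_homeo(3) unfolding crd_def homeomorphism_def by (intro continuous_intros) auto

lemma open_loc_image:
 assumes "open W" "W <= cdom" shows "open (loc ` W)"
proof -
 have "loc ` W = nbh Int crd -` W" using assms crd_loc loc_crd loc_nbh by (force simp: image_def)
 moreover have "open (nbh Int crd -` W)" using continuous_open_preimage[OF continuous_crd nbh(1) assms(1)] .
 ultimately show ?thesis by simp
qed

lemma continuous_mult_group: "continuous_on A f ==> continuous_on A g ==> continuous_on A (%x. f x *. g x)"
proof -
 assume "continuous_on A f" "continuous_on A g"
 hence "continuous_on A (%x. (f x, g x))" by (rule continuous_on_Pair)
 moreover have "continuous_on UNIV (%(x, y). x *. y)" using smooth_mult by (simp add: smooth_map2_def)
 ultimately show ?thesis using continuous_on_compose2[of UNIV "%(x, y). x *. y" A "%x. (f x, g x)"] by simp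
qed

lemma continuous_inv_group: "continuous_on A f ==> continuous_on A (%x. inv (f x))"
proof -
 assume "continuous_on A f"
 moreover have "continuous_on UNIV (%x. inv x)" using smooth_inv by (simp add: smooth_map_def)
 ultimately show ?thesis using continuous_on_compose2[of UNIV "%x. inv x" A f] by simp
qed

lemmas group_cont = continuous_mult_group continuous_inv_group continuous_intros

definition mulc :: "(real ^ 'n) \<times> (real ^ 'n) => real ^ 'n"
 where "mulc = (%(u, v). crd (loc u *. loc v))"

definition invc :: "real ^ 'n => real ^ 'n"
 where "invc u = crd (inv (loc u))"

definition mul_dom :: "((real ^ 'n) \<times> (real ^ 'n)) set"
 where "mul_dom = {(u, v). u : cdom & v : cdom & loc u *. loc v : nbh}"

definition inv_dom :: "(real ^ 'n) set"
 where "inv_dom = {u. u : cdom & inv (loc u) : nbh}"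

lemma open_mul_dom: "open mul_dom"
proof -
 have "continuous_on (cdom \<times> cdom) (%p. loc (fst p) *. loc (snd p))"
  by (intro group_cont continuous_on_compose2[OF continuous_loc]) auto
 hence "open ((cdom \<times> cdom) Int (%p. loc (fst p) *. loc (snd p)) -` nbh)"
  by (rule continuous_open_preimage[OF _ open_Times[OF cdom(1) cdom(1)] nbh(1)])
 moreover have "(cdom \<times> cdom) Int (%p. loc (fst p) *. loc (snd p)) -` nbh = mul_dom"
  by (auto simp: mul_dom_def)
 ultimately show ?thesis by simp
qed

lemma open_inv_dom: "open inv_dom"
proof -
 have "continuous_on cdom (%u. inv (loc u))" by (intro group_cont continuous_loc)
 hence "open (cdom Int (%u. inv (loc u)) -` nbh)" by (rule continuous_open_preimage[OF _ cdom(1) nbh(1)])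
 moreover have "cdom Int (%u. inv (loc u)) -` nbh = inv_dom" by (auto simp: inv_dom_def)
 ultimately show ?thesis by simp
qed

lemma zero_mul_dom: "u : cdom ==> (u, 0) : mul_dom" "u : cdom ==> (0, u) : mul_dom" "(0, 0) : mul_dom"
 and zero_inv_dom: "0 : inv_dom" using cdom nbh loc_nbh by (auto simp: mul_dom_def inv_dom_def)

lemma loc_mulc: "(u, v) : mul_dom ==> loc (mulc (u, v)) = loc u *. loc v"
 by (simp add: mulc_def mul_dom_def loc_crd)

lemma loc_invc: "u : inv_dom ==> loc (invc u) = inv (loc u)"
 by (simp add: invc_def inv_dom_def loc_crd)

lemma mulc_sderiv:
 assumes "p : mul_dom" shows "EX f'. sderiv mulc f' p"
proof -
 let ?c = "one_chart G \<A>" and ?k = "snd (one_chart G \<A>) \<one>"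
 let ?f = "%(u, v). snd ?c (chart_inv ?c u *. chart_inv ?c v)"
 let ?S = "{(u, v). u : snd ?c ` fst ?c & v : snd ?c ` fst ?c & chart_inv ?c u *. chart_inv ?c v : fst ?c}"
 have "smooth_on ?S ?f" using smooth_mult one_chart(1) unfolding smooth_map2_def by blast
 hence C: "Ck_on 1 ?S ?f" unfolding smooth_on_def by blast
 have S: "q : mul_dom <-> (?k, ?k) + q : ?S" for q by (cases q) (simp add: mul_dom_def in_cdom loc_def nbh_def)
 have "(%q. (?k, ?k) + q) ` mul_dom = ?S"
 proof (rule equalityI; rule subsetI)
  fix z assume "z : (%q. (?k, ?k) + q) ` mul_dom"
  then obtain q where "q : mul_dom" "z = (?k, ?k) + q" by (rule imageE)
  thus "z : ?S" using S[of q] by (simp only:)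
 next
  fix z assume z: "z : ?S"
  have "z - (?k, ?k) : mul_dom" unfolding S using z by (simp only: add_diff_eq add_diff_cancel_left')
  thus "z : (%q. (?k, ?k) + q) ` mul_dom" by (intro image_eqI[of _ _ "z - (?k, ?k)"]) simp_all
 qed
 hence "open ?S" using open_translation[OF open_mul_dom, of "(?k, ?k)"] by simp
 hence "sderiv ?f (frechet_derivative ?f (at ((?k, ?k) + p))) ((?k, ?k) + p)"
  by (rule Ck_on_1_sderiv[OF C _ iffD1[OF S assms]])
 hence "sderiv (%q. ?f ((?k, ?k) + q) - ?k) (frechet_derivative ?f (at ((?k, ?k) + p))) p"
  by (intro sderiv_diff_const sderiv_shift)
 moreover have "(%q. ?f ((?k, ?k) + q) - ?k) = mulc" by (auto simp: mulc_def crd_def loc_def fun_eq_iff)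
 ultimately show ?thesis by auto
qed

lemma invc_sderiv:
 assumes "u : inv_dom" shows "EX f'. sderiv invc f' u"
proof -
 let ?c = "one_chart G \<A>" and ?k = "snd (one_chart G \<A>) \<one>"
 let ?f = "snd ?c o (%x. inv x) o chart_inv ?c"
 let ?S = "snd ?c ` (fst ?c Int (%x. inv x) -` fst ?c)"
 have "smooth_on ?S ?f" using smooth_inv one_chart(1) unfolding smooth_map_def by blast
 hence C: "Ck_on 1 ?S ?f" unfolding smooth_on_def by blast
 have S: "?S = (%q. ?k + q) ` inv_dom"
 proof
  show "?S <= (%q. ?k + q) ` inv_dom"
  proof
  fix z assume "z : ?S"
  then obtain x where x: "x : nbh" "inv x : nbh" "z = snd ?c x" by (auto simp: nbh_def)
  hence "crd x : inv_dom" by (simp add: inv_dom_def crd_cdom loc_crd)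
  thus "z : (%q. ?k + q) ` inv_dom" using x by (intro image_eqI[of _ _ "crd x"]) (simp_all add: crd_def)
  qed
  show "(%q. ?k + q) ` inv_dom <= ?S"
  proof
  fix z assume "z : (%q. ?k + q) ` inv_dom"
  then obtain q where q: "q : cdom" "inv (loc q) : nbh" "z = ?k + q" by (auto simp: inv_dom_def)
  thus "z : ?S" using crd_loc[OF q(1)] loc_nbh[OF q(1)]
  by (intro image_eqI[of _ _ "loc q"]) (auto simp: nbh_def crd_def algebra_simps)
  qed
 qed
 hence "open ?S" using open_translation[OF open_inv_dom] by simp
 moreover have "?k + u : ?S" unfolding S using assms by blast
 ultimately have "sderiv ?f (frechet_derivative ?f (at (?k + u))) (?k + u)" by (intro Ck_on_1_sderiv[OF C])
 hence "sderiv (%q. ?f (?k + q) - ?k) (frechet_derivative ?f (at (?k + u))) u"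
  by (intro sderiv_diff_const sderiv_shift)
 moreover have "(%q. ?f (?k + q) - ?k) = invc" by (auto simp: invc_def crd_def loc_def fun_eq_iff)
 ultimately show ?thesis by auto
qed

lemma sderiv_unique:
 fixes z :: "'a::euclidean_space"
 shows "sderiv f f' z ==> sderiv f f'' z ==> f' = f''" using has_derivative_unique sderiv_has_derivative by blast

text \<open>Along each of the two axes \<open>mulc\<close> is the identity near \<open>0\<close>,
  and this determines a linear map on the product.\<close>

lemma mulc_sderiv_0: "sderiv mulc (%(a, b). a + b) (0, 0)"
proof -
 obtain M where M: "sderiv mulc M (0, 0)" using mulc_sderiv zero_mul_dom(3) by blast
 interpret bounded_linear M by (rule sderiv_linear[OF M])
 have l: "sderiv (%u::real^'n. (u, 0::real^'n)) (%u. (u, 0)) 0" and r: "sderiv (%u::real^'n. (0::real^'n, u)) (%u. (0, u)) 0"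
  by (intro sderiv_bounded_linear bounded_linear_Pair bounded_linear_ident bounded_linear_zero)+
 have id: "sderiv (%u::real^'n. u) (%u. u) 0" by (intro sderiv_bounded_linear bounded_linear_ident)
 have "sderiv (%u. mulc (u, 0)) (%u. M (u, 0)) 0" using sderiv_compose[OF l M] .
 hence "sderiv (%u. u) (%u. M (u, 0)) 0" by (rule sderiv_cong[OF _ cdom]) (simp add: mulc_def crd_loc)
 hence 1: "M (u, 0) = u" for u using sderiv_unique[OF id] by metis
 have "sderiv (%u. mulc (0, u)) (%u. M (0, u)) 0" using sderiv_compose[OF r M] .
 hence "sderiv (%u. u) (%u. M (0, u)) 0" by (rule sderiv_cong[OF _ cdom]) (simp add: mulc_def crd_loc)
 hence 2: "M (0, u) = u" for u using sderiv_unique[OF id] by metis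
 have "M (a, b) = a + b" for a b using add[of "(a, 0)" "(0, b)"] 1 2 by simp
 hence "M = (%(a, b). a + b)" by (auto simp: fun_eq_iff)
 thus ?thesis using M by simp
qed

lemma invc_zero [simp]: "invc 0 = 0" and mulc_zero [simp]: "mulc (0, 0) = 0"
 by (simp_all add: invc_def mulc_def)

text \<open>Differentiating the constant product of an element with its inverse gives
  \<open>u + N u = 0\<close>.\<close>

lemma invc_sderiv_0: "sderiv invc uminus 0"
proof -
 obtain N where N: "sderiv invc N 0" using invc_sderiv zero_inv_dom by blast
 have "sderiv (%u. (u, invc u)) (%u. (u, N u)) 0" by (intro sderiv_Pair N sderiv_bounded_linear bounded_linear_ident)
 hence "sderiv (%u. mulc (u, invc u)) (%u. u + N u) 0"
  using sderiv_compose[of "%u. (u, invc u)" _ 0 mulc] mulc_sderiv_0 by fastforce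
 hence "sderiv (%u. 0) (%u. u + N u) 0" by (rule sderiv_cong[OF _ open_inv_dom zero_inv_dom])
  (simp add: mulc_def loc_invc)
 moreover have "sderiv (%u::real^'n. 0::real^'n) (%u. 0) 0" by (intro sderiv_bounded_linear bounded_linear_zero)
 ultimately have "(%u. u + N u) = (%u. 0)" by (rule sderiv_unique)
 hence "N = uminus" by (auto simp: fun_eq_iff add_eq_0_iff)
 thus ?thesis using N by simp
qed

end

section \<open>Conjugations and endomorphisms differentiable at the identity\<close>

context lie_group begin

definition divc :: "(real ^ 'n) \<times> (real ^ 'n) => real ^ 'n"
 where "divc = (%(a, b). crd (inv (loc a) *. loc b))"

definition div_dom :: "((real ^ 'n) \<times> (real ^ 'n)) set"
 where "div_dom = {(a, b). a : inv_dom & b : cdom & inv (loc a) *. loc b : nbh}"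

definition cjc :: "(real ^ 'n) \<times> (real ^ 'n) => real ^ 'n"
 where "cjc = (%(u, v). crd (loc u *. loc v *. inv (loc u)))"

definition cj_dom :: "((real ^ 'n) \<times> (real ^ 'n)) set"
 where "cj_dom = {(u, v). (u, v) : mul_dom & u : inv_dom & loc u *. loc v *. inv (loc u) : nbh}"

lemma inv_dom_subset: "inv_dom <= cdom"
 by (auto simp: inv_dom_def)

lemma continuous_loc': "continuous_on A f ==> f ` A <= cdom ==> continuous_on A (%x. loc (f x))"
 by (rule continuous_on_compose2[OF continuous_loc])

lemma open_div_dom: "open div_dom"
proof -
 have "continuous_on (inv_dom \<times> cdom) (%p. inv (loc (fst p)) *. loc (snd p))"
  using inv_dom_subset by (intro group_cont continuous_loc') auto
 hence "open ((inv_dom \<times> cdom) Int (%p. inv (loc (fst p)) *. loc (snd p)) -` nbh)"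
  by (rule continuous_open_preimage[OF _ open_Times[OF open_inv_dom cdom(1)] nbh(1)])
 moreover have "(inv_dom \<times> cdom) Int (%p. inv (loc (fst p)) *. loc (snd p)) -` nbh = div_dom"
  by (auto simp: div_dom_def)
 ultimately show ?thesis by simp
qed

lemma open_cj_dom: "open cj_dom"
proof -
 have "continuous_on (mul_dom Int inv_dom \<times> UNIV) (%p. loc (fst p) *. loc (snd p) *. inv (loc (fst p)))"
  by (intro group_cont continuous_loc') (auto simp: mul_dom_def)
 hence "open ((mul_dom Int inv_dom \<times> UNIV) Int (%p. loc (fst p) *. loc (snd p) *. inv (loc (fst p))) -` nbh)"
  by (rule continuous_open_preimage[OF _ open_Int[OF open_mul_dom open_Times[OF open_inv_dom open_UNIV]] nbh(1)])
 moreover have "(mul_dom Int inv_dom \<times> UNIV) Int (%p. loc (fst p) *. loc (snd p) *. inv (loc (fst p))) -` nbh = cj_dom"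
  by (auto simp: cj_dom_def)
 ultimately show ?thesis by simp
qed

lemma zero_div_dom: "(0, 0) : div_dom" and zero_cj_dom: "(0, 0) : cj_dom"
 using cdom nbh zero_inv_dom zero_mul_dom by (auto simp: div_dom_def cj_dom_def)

lemma invc_cdom: "u : inv_dom ==> invc u : cdom"
 by (simp add: inv_dom_def invc_def crd_cdom)

lemma divc_eq: "p : div_dom ==> divc p = mulc (invc (fst p), snd p)"
 by (auto simp: divc_def div_dom_def mulc_def loc_invc)

lemma div_dom_mul: "p : div_dom ==> (invc (fst p), snd p) : mul_dom"
 by (auto simp: div_dom_def mul_dom_def loc_invc invc_cdom)

lemma sderiv_fst: "sderiv fst fst z" and sderiv_snd: "sderiv snd snd z"
 by (intro sderiv_bounded_linear bounded_linear_fst bounded_linear_snd)+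

lemma divc_sderiv_gen:
 assumes p: "p : div_dom" and N: "sderiv invc N (fst p)" and M: "sderiv mulc M (invc (fst p), snd p)"
 shows "sderiv divc (%x. M (N (fst x), snd x)) p"
proof -
 have "sderiv (%p. (invc (fst p), snd p)) (%x. (N (fst x), snd x)) p"
  by (intro sderiv_Pair sderiv_snd sderiv_compose[OF sderiv_fst N])
 from sderiv_compose[OF this M]
 have "sderiv (%p. mulc (invc (fst p), snd p)) (%x. M (N (fst x), snd x)) p" .
 thus ?thesis by (rule sderiv_cong[OF _ open_div_dom p]) (simp add: divc_eq)
qed

lemma divc_sderiv: "p : div_dom ==> EX f'. sderiv divc f' p"
proof -
 assume p: "p : div_dom"
 hence "fst p : inv_dom" by (auto simp: div_dom_def)
 then obtain N where N: "sderiv invc N (fst p)" using invc_sderiv by blast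
 obtain M where M: "sderiv mulc M (invc (fst p), snd p)" using mulc_sderiv[OF div_dom_mul[OF p]] by blast
 show ?thesis by (rule exI) (rule divc_sderiv_gen[OF p N M])
qed

lemma divc_sderiv_0: "sderiv divc (%(a, b). b - a) (0, 0)"
proof -
 have "sderiv divc (%x. (%(a, b). a + b) (- fst x, snd x)) (0, 0)"
  using divc_sderiv_gen[OF zero_div_dom, of uminus "%(a, b). a + b"] invc_sderiv_0 mulc_sderiv_0 by simp
 moreover have "(%x. (%(a, b). a + b) (- fst x, snd x)) = (%(a :: real^'n, b). b - a)" by (auto simp: fun_eq_iff)
 ultimately show ?thesis by simp
qed

lemma cjc_sderiv_gen:
 assumes p: "p : cj_dom" and N: "sderiv invc N (fst p)" and M: "sderiv mulc M p"
  and M': "sderiv mulc M' (mulc p, invc (fst p))" shows "sderiv cjc (%x. M' (M x, N (fst x))) p"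
proof -
 have "sderiv (%p. (mulc p, invc (fst p))) (%x. (M x, N (fst x))) p"
  by (intro sderiv_Pair M sderiv_compose[OF sderiv_fst N])
 from sderiv_compose[OF this M']
 have "sderiv (%p. mulc (mulc p, invc (fst p))) (%x. M' (M x, N (fst x))) p" .
 thus ?thesis by (rule sderiv_cong[OF _ open_cj_dom p])
  (auto simp: cj_dom_def cjc_def mulc_def[of ] loc_mulc[unfolded mulc_def, simplified] loc_invc mul_dom_def loc_crd)
qed

lemma cjc_sderiv: "p : cj_dom ==> EX f'. sderiv cjc f' p"
proof -
 assume p: "p : cj_dom"
 obtain u v where uv: "p = (u, v)" "(u, v) : mul_dom" "u : inv_dom" "loc u *. loc v *. inv (loc u) : nbh"
  using p by (auto simp: cj_dom_def)
 obtain N where N: "sderiv invc N (fst p)" using invc_sderiv uv by auto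
 obtain M where M: "sderiv mulc M p" using mulc_sderiv uv by auto
 have "(mulc p, invc (fst p)) : mul_dom" using uv loc_mulc[OF uv(2)] loc_invc[OF uv(3)] invc_cdom[OF uv(3)]
  by (auto simp: mul_dom_def mulc_def crd_cdom)
 then obtain M' where "sderiv mulc M' (mulc p, invc (fst p))" using mulc_sderiv by blast
 thus ?thesis using cjc_sderiv_gen[OF p N M] by blast
qed

lemma cjc_sderiv_0: "sderiv cjc snd (0, 0)"
proof -
 have "sderiv cjc (%x. (%(a, b). a + b) ((%(a, b). a + b) x, - fst x)) (0, 0)"
  using cjc_sderiv_gen[OF zero_cj_dom, of uminus "%(a, b). a + b" "%(a, b). a + b"] invc_sderiv_0 mulc_sderiv_0
  by simp
 moreover have "(%x. (%(a, b). a + b) ((%(a, b). a + b) x, - fst x)) = (snd :: (real^'n) \<times> (real^'n) => real^'n)"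
  by (auto simp: fun_eq_iff)
 ultimately show ?thesis by simp
qed

text \<open>Differentiability is asked only at the identity: translations carry it to all other
  points, and for composites and conjugations it can be shown in the one chart around the
  identity.\<close>

definition diff_end :: "('s => 's) => (real ^ 'n => real ^ 'n) => bool"
 where "diff_end D L <-> D : hom G G & continuous_on UNIV D & ((%v. crd (D (loc v))) has_derivative L) (at 0)"

lemma diff_end_mult: "diff_end D L ==> D (x *. y) = D x *. D y"
 by (simp add: diff_end_def hom_mult)

lemma hom_GG: "D : hom G G ==> group_hom G G D"
 by (simp add: group_hom_def group_hom_axioms_def is_group)

lemma diff_end_one: "diff_end D L ==> D \<one> = \<one>"
 using hom_GG group_hom.hom_one unfolding diff_end_def by blast

lemma diff_end_inv: "diff_end D L ==> D (inv x) = inv (D x)"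
 using hom_GG group_hom.hom_inv unfolding diff_end_def by (metis in_carrier)

lemma diff_end_linear: "diff_end D L ==> bounded_linear L"
 by (auto simp: diff_end_def has_derivative_bounded_linear)

lemma diff_end_unique: "diff_end D L ==> diff_end D L' ==> L = L'"
 using has_derivative_unique unfolding diff_end_def by blast

lemma open_loc_vimage:
 assumes "continuous_on UNIV F" "open W" shows "open {v : cdom. F (loc v) : W}"
proof -
 have "continuous_on cdom (%v. F (loc v))" by (rule continuous_on_compose2[OF assms(1) continuous_loc]) auto
 from continuous_open_preimage[OF this cdom(1) assms(2)] show ?thesis by (simp add: vimage_def Int_def)
qed

lemma diff_end_compose:
 assumes D: "diff_end D L" and E: "diff_end E K" shows "diff_end (%x. D (E x)) (%v. L (K v))" unfolding diff_end_def
proof (intro conjI)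
 show "(%x. D (E x)) : hom G G" using D E by (auto simp: hom_def diff_end_mult)
 show "continuous_on UNIV (%x. D (E x))"
  using D E unfolding diff_end_def by (metis continuous_on_compose2 subset_UNIV)
 have e0: "crd (E (loc 0)) = 0" using diff_end_one[OF E] by simp
 have "((%v. crd (D (loc (crd (E (loc v)))))) has_derivative (%v. L (K v))) (at 0)"
  using has_derivative_compose[of "%v. crd (E (loc v))" K 0 UNIV "%v. crd (D (loc v))" L] D E e0
  unfolding diff_end_def by simp
 thus "((%v. crd (D (E (loc v)))) has_derivative (%v. L (K v))) (at 0)"
 proof (rule has_derivative_transform_within_open)
  show "open {v : cdom. E (loc v) : nbh}" using E nbh(1) by (intro open_loc_vimage) (auto simp: diff_end_def)
  show "0 : {v : cdom. E (loc v) : nbh}" using cdom nbh diff_end_one[OF E] by simp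
 qed (simp add: loc_crd)
qed

lemma diff_end_id: "diff_end (%x. x) (%v. v)"
 unfolding diff_end_def
proof (intro conjI)
 have "((%v. v) has_derivative (%v. v)) (at 0)" by simp
 thus "((%v. crd (loc v)) has_derivative (%v. v)) (at 0)"
  by (rule has_derivative_transform_within_open[OF _ cdom]) (simp add: crd_loc)
qed (auto simp: hom_def)

lemma diff_end_funpow: "diff_end D L ==> diff_end (D ^^ k) (L ^^ k)"
proof (induction k)
 case 0
 thus ?case using diff_end_id by (simp add: id_def)
next
 case (Suc k)
 thus ?case using diff_end_compose[of D L "D ^^ k" "L ^^ k"] by (simp add: o_def)
qed

lemma lie_End_diff_end:
 assumes "D : lie_End G \<A>" shows "diff_end D (lie_differential G \<A> D)" unfolding diff_end_def
proof (intro conjI)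
 show h: "D : hom G G" using assms by (simp add: lie_End_def)
 show c: "continuous_on UNIV D" using assms by (simp add: lie_End_def smooth_map_def)
 have D1: "D \<one> = \<one>" using group_hom.hom_one[OF hom_GG[OF h]] .
 let ?c = "one_chart G \<A>" and ?k = "snd (one_chart G \<A>) \<one>"
 let ?f = "snd ?c o D o chart_inv ?c"
 let ?S = "snd ?c ` (fst ?c Int D -` fst ?c)"
 have "smooth_on ?S ?f" using assms one_chart(1) unfolding lie_End_def smooth_map_def by blast
 hence C: "Ck_on 1 ?S ?f" unfolding smooth_on_def by blast
 have "?k : ?S" using one_chart(2) D1 by auto
 moreover have "ALL x:?S. ?f differentiable (at x)" using C unfolding One_nat_def Ck_on.simps by (rule conjunct1)
 ultimately have "(?f has_derivative frechet_derivative ?f (at ?k)) (at ?k)"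
  unfolding frechet_derivative_works[symmetric] by blast
 hence "(?f has_derivative lie_differential G \<A> D) (at (?k + 0))" by (simp add: lie_differential_def Let_def)
 moreover have "((%v. ?k + v) has_derivative (%v. v)) (at 0)" by (auto intro!: derivative_eq_intros)
 ultimately have "((%v. ?f (?k + v)) has_derivative lie_differential G \<A> D) (at 0)"
  using has_derivative_compose[of "%v. ?k + v" "%v. v" 0 UNIV ?f "lie_differential G \<A> D"] by simp
 hence "((%v. ?f (?k + v) - ?k) has_derivative lie_differential G \<A> D) (at 0)"
  using has_derivative_diff[OF _ has_derivative_const[of ?k], of "%v. ?f (?k + v)"] by simp
 thus "((%v. crd (D (loc v))) has_derivative lie_differential G \<A> D) (at 0)" by (simp add: crd_def loc_def o_def)
qed

text \<open>A connected group is generated by any neighbourhood of the identity. \<open>P\<close>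
  passes from \<open>g\<close> to the translate of \<open>V\<close> by \<open>g\<close>, and read
  backwards its failure spreads as well, so the set where \<open>P\<close> holds and its complement
  are both open.\<close>

lemma group_generated_by_nbhd:
 assumes con: "connected (UNIV :: 's set)" and V: "open V" "\<one> : V" and "P \<one>"
  and step: "!!g v. P g ==> v : V ==> P (g *. v)" shows "P g"
proof -
 have translate: "open {h. a *. h : W}" if "open W" for a W
 proof -
  have "continuous_on UNIV (%h. a *. h)" by (intro group_cont)
  from continuous_open_preimage[OF this open_UNIV that] show ?thesis by (simp add: vimage_def)
 qed
 have "open {g. P g}"
 proof (subst open_subopen, clarify)
  fix g assume g: "P g"
  have "!!h. inv g *. h : V ==> P h" using step[OF g] by (metis inv_solve_left in_carrier)
  thus "EX T. open T & g : T & T <= {g. P g}"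
  using V by (intro exI[of _ "{h. inv g *. h : V}"]) (auto intro: translate)
 qed
 moreover have "open {g. ~ P g}"
 proof (subst open_subopen, clarify)
  fix g assume g: "~ P g"
  have "~ P h" if "inv h *. g : V" for h using step[of h "inv h *. g"] that g by (metis inv_solve_left in_carrier)
  moreover have "open {h. inv h *. g : V}"
  proof -
  have "continuous_on UNIV (%h. inv h *. g)" by (intro group_cont)
  from continuous_open_preimage[OF this open_UNIV V(1)] show ?thesis by (simp add: vimage_def)
  qed
  ultimately show "EX T. open T & g : T & T <= {g. ~ P g}" using V by (intro exI[of _ "{h. inv h *. g : V}"]) auto
 qed
 ultimately have "{g. P g} = {} \<or> {g. P g} = UNIV"
  using con unfolding connected_clopen by (metis Collect_neg_eq closed_def closed_closedin open_openin subtopology_UNIV)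
 thus ?thesis using \<open>P \<one>\<close> by auto
qed

definition cj :: "'s => 's => 's"
 where "cj g x = g *. x *. inv g"

lemma cj_mult: "cj (g *. h) x = cj g (cj h x)"
 by (simp add: cj_def m_assoc inv_mult_group)

lemma cj_one [simp]: "cj \<one> x = x"
 by (simp add: cj_def)

lemma cj_hom: "cj g : hom G G"
 by (auto simp: hom_def cj_def m_assoc)

lemma continuous_cj: "continuous_on UNIV (cj g)"
 unfolding cj_def by (intro group_cont)

text \<open>In coordinates conjugation has the second projection as strict derivative at the origin.
  At \<open>(u, 0)\<close> with \<open>u\<close> small its partial derivative in the second variable
  is therefore within \<open>et\<close> of the identity.\<close>

lemma cj_small:
 assumes "et > 0"
 obtains V where "open V" "\<one> : V"
  "!!g. g : V ==> EX L. diff_end (cj g) L & (ALL v. norm (L v - v) <= et * norm v)"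
proof -
 obtain dl where dl: "dl > 0" "!!x y. x : ball (0, 0) dl ==> y : ball (0, 0) dl ==>
  norm (cjc x - cjc y - snd (x - y)) <= et * norm (x - y)" using sderivD[OF cjc_sderiv_0 assms] by blast
 have "open (inv_dom Int ball 0 dl)" "0 : inv_dom Int ball 0 dl" using open_inv_dom zero_inv_dom dl(1) by auto
 hence V: "open (loc ` (inv_dom Int ball 0 dl))" "\<one> : loc ` (inv_dom Int ball 0 dl)"
  using open_loc_image[of "inv_dom Int ball 0 dl"] inv_dom_subset by (auto intro: image_eqI[of _ _ 0])
 have "EX L. diff_end (cj g) L & (ALL v. norm (L v - v) <= et * norm v)" if g: "g : loc ` (inv_dom Int ball 0 dl)" for g
 proof -
  obtain u where u: "u : inv_dom" "u : ball 0 dl" "g = loc u" using g by auto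
  have p: "(u, 0) : cj_dom" using u(1) zero_mul_dom(1)[of u] inv_dom_subset nbh by (auto simp: cj_dom_def)
  obtain F where F: "sderiv cjc F (u, 0)" using cjc_sderiv[OF p] by blast
  have pr: "((%v::real^'n. (u, v)) has_derivative (%v. (0, v))) (at 0)" by (intro derivative_intros)
  have "((%v. cjc (u, v)) has_derivative (%v. F (0, v))) (at 0)"
  using has_derivative_compose[OF pr, of cjc F] sderiv_has_derivative[OF F] by simp
  hence der: "((%v. crd (cj g (loc v))) has_derivative (%v. F (0, v))) (at 0)" by (simp add: cjc_def cj_def u(3))
  hence "diff_end (cj g) (%v. F (0, v))" by (simp add: diff_end_def cj_hom continuous_cj)
  moreover have "norm (F (0, v) - v) <= et * norm v" for v
  using sderiv_near[where z = "(0, 0)" and dl = dl and v = "(0, v)", OF dl(2) sderiv_has_derivative[OF F] bounded_linear_snd] u(2)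
  by (simp add: dist_norm norm_Pair)
  ultimately show ?thesis by blast
 qed
 thus ?thesis using that V by blast
qed

end

section \<open>The adjoint representation and twisted conjugation\<close>

context simply_connected_solvable_lie_group_R begin

lemma cj_diff_end: "EX L. diff_end (cj g) L"
proof -
 obtain V where V: "open V" "\<one> : V" "!!g. g : V ==> EX L. diff_end (cj g) L"
  using cj_small[of 1] by (metis zero_less_one)
 show ?thesis
 proof (rule group_generated_by_nbhd[OF connected V(1,2)])
  show "EX L. diff_end (cj \<one>) L" by (rule V(3)[OF V(2)])
  fix g v assume g: "EX L. diff_end (cj g) L" and v: "v : V"
  obtain L where L: "diff_end (cj g) L" using g by (rule exE)
  obtain M where M: "diff_end (cj v) M" using V(3)[OF v] by (rule exE)
  have "diff_end (cj (g *. v)) (%w. L (M w))" using diff_end_compose[OF L M] unfolding cj_mult[symmetric] .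
  thus "EX L. diff_end (cj (g *. v)) L" by (intro exI)
 qed
qed

text \<open>The adjoint representation, obtained from \<open>diff_end\<close> so that its functional
  equations follow from uniqueness of the derivative.\<close>

definition Ad :: "'s => real ^ 'n => real ^ 'n"
 where "Ad g = (SOME L. diff_end (cj g) L)"

lemma Ad: "diff_end (cj g) (Ad g)"
 unfolding Ad_def using cj_diff_end by (rule someI_ex)

lemma Ad_eq: "diff_end (cj g) L ==> L = Ad g"
 using Ad diff_end_unique by blast

lemma Ad_mult: "Ad (g *. h) v = Ad g (Ad h v)"
proof -
 have "diff_end (cj (g *. h)) (%v. Ad g (Ad h v))"
  using diff_end_compose[OF Ad Ad, of g h] unfolding cj_mult[symmetric] .
 from fun_cong[OF Ad_eq[OF this], of v] show ?thesis by simp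
qed

lemma Ad_one [simp]: "Ad \<one> v = v"
proof -
 have "cj \<one> = (%x. x)" by (simp add: fun_eq_iff)
 hence "diff_end (cj \<one>) (%v. v)" using diff_end_id by simp
 from fun_cong[OF Ad_eq[OF this], of v] show ?thesis by simp
qed

lemma Ad_linear: "bounded_linear (Ad g)"
 using Ad diff_end_linear by blast

lemma Ad_inv [simp]: "Ad g (Ad (inv g) v) = v" "Ad (inv g) (Ad g v) = v"
 by (simp_all flip: Ad_mult)

lemma Ad_near_one:
 assumes "et > 0"
 obtains V where "open V" "\<one> : V" "!!g v. g : V ==> norm (Ad g v - v) <= et * norm v"
proof -
 obtain V where V: "open V" "\<one> : V"
  "!!g. g : V ==> EX L. diff_end (cj g) L & (ALL v. norm (L v - v) <= et * norm v)" using cj_small[OF assms] by blast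
 show ?thesis
 proof (rule that[OF V(1,2)])
  fix g v assume "g : V"
  from V(3)[OF this] obtain L where L: "diff_end (cj g) L" "ALL v. norm (L v - v) <= et * norm v" by (elim exE conjE)
  show "norm (Ad g v - v) <= et * norm v" using L(2) unfolding Ad_eq[OF L(1)] by (rule spec)
 qed
qed

text \<open>Both sides are the differential of \<open>E o cj x = cj (E x) o E\<close>.\<close>

lemma Ad_end: "diff_end E L ==> Ad (E x) (L v) = L (Ad x v)"
proof -
 assume E: "diff_end E L"
 have "(%y. E (cj x y)) = (%y. cj (E x) (E y))" using E by (simp add: cj_def diff_end_mult diff_end_inv fun_eq_iff)
 hence "diff_end (%y. cj (E x) (E y)) (%v. L (Ad x v))" using diff_end_compose[OF E Ad, of x] by simp
 from fun_cong[OF diff_end_unique[OF this diff_end_compose[OF Ad E, of "E x"]], of v] show ?thesis by simp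
qed

lemma div_end_derivative:
 assumes D: "diff_end D L" shows "((%u. crd (inv (D (loc u)) *. loc u)) has_derivative (%u. u - L u)) (at 0)"
proof -
 have d: "((%u. (crd (D (loc u)), u)) has_derivative (%u. (L u, u))) (at 0)"
  using D by (intro has_derivative_Pair) (auto simp: diff_end_def)
 have "((%u. divc (crd (D (loc u)), u)) has_derivative (%u. u - L u)) (at 0)"
  using has_derivative_compose[OF d, of divc "%(a, b). b - a"] sderiv_has_derivative[OF divc_sderiv_0]
  diff_end_one[OF D] by simp
 thus ?thesis
 proof (rule has_derivative_transform_within_open)
  show "open {v : cdom. D (loc v) : nbh}" using D nbh(1) by (intro open_loc_vimage) (auto simp: diff_end_def)
  show "0 : {v : cdom. D (loc v) : nbh}" using cdom nbh diff_end_one[OF D] by simp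
 qed (simp add: divc_def loc_crd)
qed

text \<open>\<open>twist E t x\<close> is the image of \<open>t\<close> under the twisted conjugation by \<open>x\<close>.  At \<open>x\<close> its derivative is,
 after a left translation, \<open>1 - Ad (inv u) L\<close> with \<open>u = twist E t x\<close>.\<close>

definition twist :: "('s => 's) => 's => 's => 's"
 where "twist E t x = inv (E x) *. t *. x"

lemma twist_mult:
 assumes E: "diff_end E L" shows "twist E t (x *. y) = twist E (twist E t x) y"
 using E by (simp add: twist_def diff_end_mult inv_mult_group m_assoc)

lemma twist_one: "diff_end E L ==> twist E t \<one> = t"
 by (simp add: twist_def diff_end_one)

lemma continuous_twist: "diff_end E L ==> continuous_on A (twist E t)"
proof -
 assume "diff_end E L"
 hence "continuous_on A E" unfolding diff_end_def using continuous_on_subset by blast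
 thus ?thesis unfolding twist_def by (intro group_cont)
qed

text \<open>After a left translation the twist is \<open>inv (ps y) *. y\<close> for the single
  endomorphism \<open>ps = cj (inv tht) o E\<close>, so its derivative is an instance of
  \<open>div_end_derivative\<close>.\<close>

lemma twist_local:
 assumes "diff_end E L" shows "inv tht *. twist E tht y = inv (cj (inv tht) (E y)) *. y"
 by (simp add: twist_def cj_def inv_mult_group m_assoc)

lemma twist_derivative:
 assumes E: "diff_end E L"
 shows "((%u. crd (inv tht *. twist E tht (loc u))) has_derivative (%u. u - Ad (inv tht) (L u))) (at 0)"
 using div_end_derivative[OF diff_end_compose[OF Ad E, of "inv tht"]] twist_local[OF E] by simp

text \<open>Sussmann's open mapping theorem at a point: a continuous map whose derivative at one
  point has a right inverse covers a neighbourhood of the value there. It asks for nothing about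
  derivatives elsewhere.\<close>

lemma twist_open_at:
 assumes E: "diff_end E L" and surj: "surj (%u. u - Ad (inv tht) (L u))" and W: "open W" "\<one> : W"
 obtains V where "open V" "tht : V" "V <= twist E tht ` W"
proof -
 let ?F = "%u. crd (inv tht *. twist E tht (loc u))" and ?M = "%u. u - Ad (inv tht) (L u)"
 have cF: "continuous_on UNIV (%x. inv tht *. twist E tht x)" using E by (intro group_cont continuous_twist)
 define S where "S = {v : cdom. inv tht *. twist E tht (loc v) : nbh} Int {v : cdom. loc v : W}"
 have S: "open S" "0 : S" using open_loc_vimage[OF cF nbh(1)] open_loc_vimage[OF continuous_on_id W(1)] cdom nbh W(2)
  by (auto simp: S_def twist_one[OF E])
 have lin: "linear ?M" using has_derivative_linear[OF twist_derivative[OF E]] .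
 obtain g where g: "linear g" "?M o g = id" using linear_surjective_right_inverse[OF lin surj] by blast
 have cS: "continuous_on S ?F"
 proof (rule continuous_on_compose2[OF continuous_crd])
  show "continuous_on S (%u. inv tht *. twist E tht (loc u))"
  by (rule continuous_on_compose2[OF cF continuous_on_subset[OF continuous_loc]]) (auto simp: S_def)
 qed (auto simp: S_def)
 have "?F 0 : interior (?F ` S)"
  using S by (intro sussmann_open_mapping[OF S(1) cS S(2) twist_derivative[OF E] _ g(2)])
  (auto simp: g(1) linear_linear interior_open)
 hence zero: "0 : interior (?F ` S)" by (simp add: twist_one[OF E])
 have "?F ` S <= cdom" by (auto simp: S_def crd_cdom)
 hence sub: "interior (?F ` S) <= cdom" by (rule order_trans[OF interior_subset])
 have O: "open (loc ` interior (?F ` S))" "\<one> : loc ` interior (?F ` S)"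
  using open_loc_image[OF open_interior sub] imageI[OF zero, of loc] by (simp_all only: loc_zero)
 let ?V = "{y. inv tht *. y : loc ` interior (?F ` S)}"
 show ?thesis
 proof
  have "continuous_on UNIV (%y. inv tht *. y)" by (intro group_cont)
  from continuous_open_preimage[OF this open_UNIV O(1)] show "open ?V" by (simp add: vimage_def)
  show "tht : ?V" using O(2) by simp
  show "?V <= twist E tht ` W"
  proof
  fix y assume "y : ?V"
  then obtain w where w: "w : interior (?F ` S)" "inv tht *. y = loc w" by blast
  from subsetD[OF interior_subset w(1)] obtain u where u: "w = ?F u" "u : S" by (rule imageE)
  hence "inv tht *. y = inv tht *. twist E tht (loc u)" using w(2) u by (simp add: S_def loc_crd)
  hence "tht *. (inv tht *. y) = tht *. (inv tht *. twist E tht (loc u))" by simp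
  hence "y = twist E tht (loc u)" by simp
  thus "y : twist E tht ` W" using u(2) by (auto simp: S_def)
  qed
 qed
qed

text \<open>By \<open>Ad_end\<close> the map on the left is conjugate to \<open>1 - L\<close> under
  \<open>Ad x\<close>, whatever \<open>x\<close> is.\<close>

lemma det_twist:
 assumes E: "diff_end E L" shows "det (matrix (%u. u - Ad (inv (twist E \<one> x)) (L u))) = det1 L"
proof -
 have L: "linear L" and A: "linear (Ad g)" for g using diff_end_linear[OF E] Ad_linear by (auto simp: linear_linear)
 have "u - Ad (inv (twist E \<one> x)) (L u) = Ad (inv x) (Ad x u - L (Ad x u))" for u
 proof -
  have "Ad (inv (twist E \<one> x)) (L u) = Ad (inv x) (Ad (E x) (L u))"
  by (simp add: twist_def inv_mult_group flip: Ad_mult)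
  also have "... = Ad (inv x) (L (Ad x u))" by (simp add: Ad_end[OF E])
  finally show ?thesis by (simp add: linear_diff[OF A])
 qed
 hence "(%u. u - Ad (inv (twist E \<one> x)) (L u)) = Ad (inv x) o ((%u. u - L u) o Ad x)" by (simp add: fun_eq_iff)
 moreover have "linear (%u. u - L u)" by (intro linear_compose_sub linear_ident L)
 ultimately have "matrix (%u. u - Ad (inv (twist E \<one> x)) (L u))
  = matrix (Ad (inv x)) ** (matrix (%u. u - L u) ** matrix (Ad x))" by (simp add: matrix_compose A linear_compose)
 moreover have "matrix (Ad (inv x)) ** matrix (Ad x) = mat 1"
 proof -
  have "Ad (inv x) o Ad x = id" by (simp add: fun_eq_iff)
  thus ?thesis by (metis A matrix_compose matrix_id_mat_1)
 qed
 hence "det (matrix (Ad (inv x))) * det (matrix (Ad x)) = 1" by (metis det_I det_mul)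
 ultimately show ?thesis by (simp add: det_mul)
qed

lemma continuous_det: "continuous_on UNIV (det :: real ^ 'k ^ 'k => real)"
 unfolding det_def by (intro continuous_intros)

text \<open>Lang's argument: the orbit of \<open>1\<close> is open because the derivative is invertible on it, and closed because
 the determinant of the derivative is constant on it.\<close>

theorem twist_surj:
 assumes E: "diff_end E L" and L: "det1 L ~= 0" shows "EX x. twist E \<one> x = t"
proof -
 define O1 where "O1 = range (twist E \<one>)"
 have LL: "linear L" and A: "linear (Ad g)" for g using diff_end_linear[OF E] Ad_linear by (auto simp: linear_linear)
 have lin: "linear (%u. u - Ad g (L u))" for g
  using linear_compose_sub[OF linear_ident linear_compose[OF LL A]] by (simp add: o_def)
 have surj: "surj (%u. u - Ad g (L u))" if "det (matrix (%u. u - Ad g (L u))) ~= 0" for g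
 proof -
  let ?f = "%u. u - Ad g (L u)"
  have "invertible (matrix ?f)" using that by (simp add: invertible_det_nz)
  then obtain B where B: "matrix ?f ** B = mat 1" unfolding invertible_def by (elim exE conjE)
  have "?f (B *v u) = u" for u
  proof -
  have "?f (B *v u) = matrix ?f *v (B *v u)" by (rule fun_cong[OF matrix_vector_mul(2)[OF lin], symmetric])
  thus ?thesis by (simp add: matrix_vector_mul_assoc B)
  qed
  thus ?thesis by (rule surjI)
 qed
 have move: "tht *. (inv tht *. y) = y" for tht y by simp
 have "open O1"
 proof (subst open_subopen, clarify)
  fix tht assume "tht : O1"
  then obtain x where x: "tht = twist E \<one> x" by (auto simp: O1_def)
  hence "surj (%u. u - Ad (inv tht) (L u))" using surj det_twist[OF E] L by simp
  then obtain V where V: "open V" "tht : V" "V <= twist E tht ` UNIV" using twist_open_at[OF E _ open_UNIV] by blast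
  moreover have "twist E tht y = twist E \<one> (x *. y)" for y by (simp add: twist_mult[OF E] x)
  ultimately show "EX T. open T & tht : T & T <= O1" unfolding O1_def by (intro exI[of _ V]) auto
 qed
 moreover have "open (- O1)"
 proof (subst open_subopen, clarify)
  fix t assume t: "t ~: O1"
  show "EX T. open T & t : T & T <= - O1"
  proof (cases "det (matrix (%u. u - Ad (inv t) (L u))) = 0")
  case False
  then obtain V where V: "open V" "t : V" "V <= twist E t ` UNIV" using twist_open_at[OF E surj open_UNIV] by blast
  \<comment> \<open>Twisting is a group action: if a point reached from \<open>t\<close> lay on the
    orbit of \<open>1\<close>, then \<open>t\<close> itself would lie on it.\<close>
  have "V Int O1 = {}"
  proof (rule ccontr)
  assume "V Int O1 ~= {}"
  then obtain z where z: "z : V" "z : O1" by auto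
  from subsetD[OF V(3) z(1)] obtain y where y: "z = twist E t y" by (rule imageE)
  from z(2) obtain x where "z = twist E \<one> x" unfolding O1_def by (rule imageE)
  hence "twist E t y = twist E \<one> x" using y by simp
  hence "twist E (twist E t y) (inv y) = twist E (twist E \<one> x) (inv y)" by simp
  hence "t = twist E \<one> (x *. inv y)" by (simp add: twist_one[OF E] flip: twist_mult[OF E])
  thus False using t by (auto simp: O1_def)
  qed
  thus ?thesis using V by blast
  next
  case True
  \<comment> \<open>The determinant vanishes at \<open>t\<close>, so near \<open>t\<close> it stays
    smaller in absolute value than \<open>?c\<close>, which is its value on the whole orbit; hence
    no point near \<open>t\<close> is on the orbit.\<close>
  let ?m = "%g. matrix (%u. u - Ad g (L u))" and ?c = "det1 L"
  have "isCont (det :: real ^ 'n ^ 'n => real) (?m (inv t))"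
  using continuous_det[where 'k = 'n] by (simp add: continuous_on_eq_continuous_at)
  then obtain dl where dl: "dl > 0" "!!B. dist B (?m (inv t)) < dl ==> dist (det B) 0 < \<bar>?c\<bar>"
  unfolding continuous_at_eps_delta using True L by (metis zero_less_abs_iff)
  obtain K where K: "K > 0" "!!v. norm (Ad (inv t) (L v)) <= norm v * K"
  using bounded_linear.pos_bounded[OF bounded_linear_compose[OF Ad_linear diff_end_linear[OF E]]] by blast
  \<comment> \<open>The matrices will differ by at most \<open>et * K\<close> in each of the
    \<open>CARD('n)\<close> squared entries, so their distance is at most
    \<open>dl / 2\<close>.\<close>
  define et where "et = dl / (2 * K * real CARD('n) * real CARD('n))"
  have et: "et > 0" using dl K by (simp add: et_def)
  obtain V where V: "open V" "\<one> : V" "!!g v. g : V ==> norm (Ad g v - v) <= et * norm v"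
  using Ad_near_one[OF et] by blast
  let ?T = "{y. inv y *. t : V}"
  have "continuous_on UNIV (%y. inv y *. t)" by (intro group_cont)
  from continuous_open_preimage[OF this open_UNIV V(1)] have "open ?T" by (simp add: vimage_def)
  moreover have "t : ?T" using V by simp
  moreover have "?T <= - O1"
  proof
  fix y assume y: "y : ?T"
  have "Ad (inv y) (L v) = Ad (inv y *. t) (Ad (inv t) (L v))" for v by (simp add: m_assoc flip: Ad_mult)
  hence close: "norm (Ad (inv y) (L v) - Ad (inv t) (L v)) <= et * (norm v * K)" for v
  using V(3)[of "inv y *. t" "Ad (inv t) (L v)"] y K(2)[of v] et
  by (smt (verit) mem_Collect_eq mult_le_cancel_left_pos)
  have "norm (?m (inv y) - ?m (inv t)) <= (SUM i:UNIV. norm ((?m (inv y) - ?m (inv t)) $ i))"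
  unfolding norm_vec_def by (intro L2_set_le_sum) simp
  also have "... <= (SUM i:(UNIV::'n set). SUM j:(UNIV::'n set). \<bar>(?m (inv y) - ?m (inv t)) $ i $ j\<bar>)"
  by (intro sum_mono norm_le_l1_cart)
  also have "... <= (SUM i:(UNIV::'n set). SUM j:(UNIV::'n set). et * K)"
  proof (intro sum_mono)
  fix i j :: 'n
  have "(?m (inv y) - ?m (inv t)) $ i $ j = (Ad (inv t) (L (axis j 1)) - Ad (inv y) (L (axis j 1))) $ i"
  by (simp add: matrix_def)
  thus "\<bar>(?m (inv y) - ?m (inv t)) $ i $ j\<bar> <= et * K"
  using component_le_norm_cart[of "Ad (inv y) (L (axis j 1)) - Ad (inv t) (L (axis j 1))" i] close[of "axis j 1"]
  by (simp add: norm_axis_1)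
  qed
  also have "... < dl" using dl K by (simp add: et_def)
  finally have "dist (det (?m (inv y))) 0 < \<bar>?c\<bar>" by (intro dl(2)) (simp add: dist_norm)
  thus "y : - O1" using det_twist[OF E] by (auto simp: O1_def)
  qed
  ultimately show ?thesis by blast
  qed
 qed
 ultimately have "O1 Int UNIV = {} \<or> - O1 Int UNIV = {}" by (intro connectedD[OF connected]) auto
 hence "O1 = UNIV" by (auto simp: O1_def)
 hence "t : range (twist E \<one>)" by (simp add: O1_def)
 thus ?thesis by auto
qed

end

section \<open>Triviality of fixed points of endomorphisms\<close>

lemma linear_det_inj:
 fixes f :: "real ^ 'n => real ^ 'n"
 assumes "linear f" "det (matrix f) ~= 0" shows "inj f"
proof -
 have "invertible (matrix f)" using assms(2) by (simp add: invertible_det_nz)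
 then obtain B where B: "B ** matrix f = mat 1" unfolding invertible_def by (elim exE conjE)
 have "B *v f u = u" for u using fun_cong[OF matrix_vector_mul(2)[OF assms(1)], of u, symmetric] B
  by (simp add: matrix_vector_mul_assoc)
 thus ?thesis by (rule inj_on_inverseI)
qed

context simply_connected_solvable_lie_group_R begin

lemma open_ltrans: "open W ==> open {h. a *. h : W}"
proof -
 assume "open W"
 moreover have "continuous_on UNIV (%h. a *. h)" by (intro group_cont)
 ultimately have "open (UNIV Int (%h. a *. h) -` W)" by (intro continuous_open_preimage) auto
 thus ?thesis by (simp add: vimage_def)
qed

lemma open_right_translate: "open W ==> open {h. h *. a : W}"
proof -
 assume "open W"
 moreover have "continuous_on UNIV (%h. h *. a)" by (intro group_cont)
 ultimately have "open (UNIV Int (%h. h *. a) -` W)" by (intro continuous_open_preimage) auto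
 thus ?thesis by (simp add: vimage_def)
qed

lemma small_quotients:
 assumes "open V" "\<one> : V"
 obtains W where "open W" "\<one> : W" "!!a b. a : W ==> b : W ==> a *. inv b : V" "W <= V"
proof -
 have "continuous_on UNIV (%p. fst p *. inv (snd p))" by (intro group_cont)
 hence o: "open (UNIV Int (%p. fst p *. inv (snd p)) -` V)" using assms by (intro continuous_open_preimage) auto
 have m: "(\<one>, \<one>) : UNIV Int (%p. fst p *. inv (snd p)) -` V" using assms by simp
 obtain A B where AB: "open A" "open B" "(\<one>, \<one>) : A \<times> B" "A \<times> B <= UNIV Int (%p. fst p *. inv (snd p)) -` V"
  by (rule open_prod_elim[OF o m]) (rule that; assumption)
 show ?thesis
 proof
  show "open (A Int B Int V)" "\<one> : A Int B Int V" "A Int B Int V <= V" using AB assms by auto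
  show "a *. inv b : V" if "a : A Int B Int V" "b : A Int B Int V" for a b
  using subsetD[OF AB(4), of "(a, b)"] that by simp
 qed
qed

text \<open>\<open>1 - L\<close> is bounded below by some \<open>c > 0\<close>, while in coordinates
  \<open>E\<close> deviates from \<open>L\<close> by at most \<open>c / 2\<close> times the norm
  near the identity, too little for a second fixed point.\<close>

lemma fixed_isolated:
 assumes E: "diff_end E L" and L: "det1 L ~= 0"
 obtains V where "open V" "\<one> : V" "!!h. h : V ==> E h = h ==> h = \<one>"
proof -
 have LL: "linear L" using diff_end_linear[OF E] by (simp add: linear_linear)
 have lin: "linear (%u. u - L u)" by (intro linear_compose_sub linear_ident LL)
 obtain c where c: "c > 0" "!!v. c * norm v <= norm (v - L v)"
  using linear_inj_bounded_below_pos[OF lin linear_det_inj[OF lin L]] by metis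
 have "((%v. crd (E (loc v))) has_derivative L) (at 0)" using E by (simp add: diff_end_def)
 then obtain d where d: "d > 0" "!!v. norm (v - 0) < d ==> norm (crd (E (loc v)) - crd (E (loc 0)) - L (v - 0)) <= c / 2 * norm (v - 0)"
  using c(1) unfolding has_derivative_at_alt by (metis half_gt_zero)
 show ?thesis
 proof
  show "open (loc ` (cdom Int ball 0 d))" using cdom by (intro open_loc_image) auto
  show "\<one> : loc ` (cdom Int ball 0 d)" using cdom d by (intro image_eqI[of _ _ 0]) auto
  fix h assume "h : loc ` (cdom Int ball 0 d)" "E h = h"
  then obtain v where v: "v : cdom" "norm v < d" "h = loc v" "E (loc v) = loc v" by auto
  hence "norm (v - L v) <= c / 2 * norm v" using d(2)[of v] diff_end_one[OF E] by (simp add: crd_loc)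
  hence "c * norm v <= c / 2 * norm v" using c(2) order_trans by blast
  hence "v = 0" using c(1) by simp
  thus "h = \<one>" using v by simp
 qed
qed

text \<open>The fibres are the right cosets of the group of fixed points of \<open>E\<close>; the
  covering argument rests on this.\<close>

lemma twist_one_eq_iff:
 assumes E: "diff_end E L" shows "twist E \<one> x = twist E \<one> y <-> E (y *. inv x) = y *. inv x"
proof -
 have "twist E \<one> x = twist E \<one> y <-> inv (E x) *. x = inv (E y) *. y" by (simp add: twist_def)
 also have "... <-> E y *. inv (E x) = y *. inv x"
 proof
  assume "inv (E x) *. x = inv (E y) *. y"
  hence "E y *. (inv (E x) *. x) *. inv x = y *. inv x" by simp
  thus "E y *. inv (E x) = y *. inv x" by (simp add: m_assoc)
 next
  assume "E y *. inv (E x) = y *. inv x"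
  hence "inv (E y) *. (E y *. inv (E x)) *. x = inv (E y) *. (y *. inv x) *. x" by simp
  thus "inv (E x) *. x = inv (E y) *. y" by (simp add: m_assoc)
 qed
 finally show ?thesis using E by (simp add: diff_end_mult diff_end_inv)
qed

text \<open>The invertible derivative makes the map open, and discreteness of the fixed points makes
  it injective on small sets. One inverse branch gives a section; multiplying it from the left by
  fixed points of \<open>E\<close> gives the sections through the other points of the fibre.\<close>

lemma twist_sec_cover:
 assumes E: "diff_end E L" and L: "det1 L ~= 0" shows "sec_cover (twist E \<one>) euclidean"
proof -
 let ?ps = "twist E \<one>"
 obtain V where V: "open V" "\<one> : V" "!!h. h : V ==> E h = h ==> h = \<one>"
  by (rule fixed_isolated[OF E L]) (assumption | rule that)+
 obtain W where W: "open W" "\<one> : W" "!!a b. a : W ==> b : W ==> a *. inv b : V"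
  by (rule small_quotients[OF V(1,2)]) (rule that; assumption)
 define N where "N x = {z. z *. inv x : W}" for x
 have N: "open (N x)" "x : N x" "inj_on ?ps (N x)" for x
 proof -
  show "open (N x)" unfolding N_def by (rule open_right_translate[OF W(1)])
  show "x : N x" using W(2) by (simp add: N_def)
  show "inj_on ?ps (N x)"
  proof
  fix y z assume yz: "y : N x" "z : N x" "?ps y = ?ps z"
  hence "(z *. inv x) *. inv (y *. inv x) : V" unfolding N_def by (intro W(3)) auto
  hence "z *. inv y : V" by (simp add: inv_mult_group m_assoc)
  moreover have "E (z *. inv y) = z *. inv y" using twist_one_eq_iff[OF E] yz(3) by blast
  ultimately have "z *. inv y = \<one>" by (rule V(3))
  thus "y = z" by (metis in_carrier inv_equality inv_inv)
  qed
 qed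
 have LL: "linear L" and A: "linear (Ad g)" for g using diff_end_linear[OF E] Ad_linear by (auto simp: linear_linear)
 have lin: "linear (%u. u - Ad g (L u))" for g
  using linear_compose_sub[OF linear_ident linear_compose[OF LL A]] by (simp add: o_def)
 have openmap: "open (?ps ` O1)" if O1: "open O1" for O1
 proof (subst open_subopen, clarify)
  fix x assume x: "x : O1"
  have "det (matrix (%u. u - Ad (inv (?ps x)) (L u))) ~= 0" using det_twist[OF E] L by simp
  hence s: "surj (%u. u - Ad (inv (?ps x)) (L u))"
  using linear_injective_imp_surjective[OF lin linear_det_inj[OF lin]] by simp
  have "\<one> : {h. x *. h : O1}" using x by simp
  then obtain V' where V': "open V'" "?ps x : V'" "V' <= twist E (?ps x) ` {h. x *. h : O1}"
  using twist_open_at[OF E s open_ltrans[OF O1]] by metis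
  have "twist E (?ps x) ` {h. x *. h : O1} <= ?ps ` O1" by (auto simp flip: twist_mult[OF E])
  thus "EX T. open T & ?ps x : T & T <= ?ps ` O1" using V' by (intro exI[of _ V']) auto
 qed
 have sec: "EX T. open T & m : T & (ALL x. ?ps x : T --> (EX q. continuous_on T q & q (?ps x) = x & (ALL y:T. ?ps (q y) = y)))" for m
 proof -
  obtain x0 where x0: "?ps x0 = m" using twist_surj[OF E L] by blast
  let ?T = "?ps ` N x0"
  let ?q = "inv_into (N x0) ?ps"
  have cq: "continuous_on ?T ?q"
  proof (rule continuous_on_open_vimage[OF openmap[OF N(1)], THEN iffD2], intro allI impI)
  fix B :: "'s set" assume B: "open B"
  have "?q -` B Int ?T = ?ps ` (B Int N x0)" using N(3) by (auto simp: inv_into_f_f)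
  thus "open (?q -` B Int ?T)" using openmap[OF open_Int[OF B N(1)]] by simp
  qed
  have "EX q. continuous_on ?T q & q (?ps x) = x & (ALL y:?T. ?ps (q y) = y)" if x: "?ps x : ?T" for x
  proof -
  let ?h = "x *. inv (?q (?ps x))"
  have "?ps (?q (?ps x)) = ?ps x" using x by (rule f_inv_into_f)
  hence h: "E ?h = ?h" using twist_one_eq_iff[OF E] by blast
  have hz: "?ps (?h *. z) = ?ps z" for z using twist_one_eq_iff[OF E, of z "?h *. z"] h by (simp add: m_assoc)
  show ?thesis
  proof (intro exI conjI ballI)
  show "continuous_on ?T (%y. ?h *. ?q y)" by (intro group_cont cq)
  show "?h *. ?q (?ps x) = x" by (simp add: m_assoc)
  show "?ps (?h *. ?q y) = y" if "y : ?T" for y unfolding hz using that by (rule f_inv_into_f)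
  qed
  qed
  thus ?thesis using openmap[OF N(1), of x0] x0 N(2) by (intro exI[of _ ?T]) auto
 qed
 have "EX V. open V & x : V & inj_on ?ps V" for x using N[of x] by blast
 thus ?thesis unfolding sec_cover_def using continuous_twist[OF E] sec by auto
qed

text \<open>A path from the identity to \<open>h\<close> becomes a loop under the covering
  \<open>?ps\<close>, and simple connectivity contracts this loop. In the lifted contraction both
  ends lift the same path of base points, and they agree at the time when the loop is constant,
  hence also at the start, where they are the identity and \<open>h\<close>.\<close>

theorem fixed_trivial:
 assumes E: "diff_end E L" and L: "det1 L ~= 0" and h: "E h = h" shows "h = \<one>"
proof -
 let ?ps = "twist E \<one>"
 note cov = twist_sec_cover[OF E L]
 \<comment> \<open>The lifting theorem takes a whole type as parameter space, so paths on the unit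
   interval are extended to the real line by clipping.\<close>
 define clip where "clip t = max 0 (min 1 t)" for t :: real
 have clip: "clip t : {0..1}" "t : {0..1} ==> clip t = t" "continuous_on UNIV clip" for t
  unfolding clip_def by (auto intro!: continuous_intros)
 have "homotopic_loops UNIV (%_. \<one>) (%_. h)" using simply_connected unfolding simply_connected_def
  by (auto simp: path_def pathstart_def pathfinish_def)
 then obtain K1 where K1: "continuous_on ({0..1::real} \<times> {0..1::real}) K1"
  "ALL x:{0..1}. K1 (0, x) = \<one>" "ALL x:{0..1}. K1 (1, x) = h" unfolding homotopic_loops by blast
 define ga where "ga t = K1 (clip t, 0)" for t
 have cga: "continuous_on UNIV ga" unfolding ga_def using clip
  by (intro continuous_on_compose2[OF K1(1)] continuous_intros) auto
 have ga01: "ga 0 = \<one>" "ga 1 = h" using K1 by (simp_all add: ga_def clip)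
 have ps01: "?ps \<one> = \<one>" "?ps h = \<one>"
  using twist_one_eq_iff[OF E, of \<one> h] h twist_one[OF E] by simp_all
 have cps: "continuous_on {0..1} (%t. ?ps (ga t))"
  by (rule continuous_on_compose2[OF continuous_twist[OF E, of UNIV] continuous_on_subset[OF cga]]) auto
 have "homotopic_loops UNIV (%t. ?ps (ga t)) (%_. \<one>)"
  using simply_connected ga01 ps01 cps unfolding simply_connected_def
  by (auto simp: path_def pathstart_def pathfinish_def)
 then obtain K2 where K2: "continuous_on ({0..1::real} \<times> {0..1::real}) K2"
  "ALL x:{0..1}. K2 (0, x) = ?ps (ga x)" "ALL x:{0..1}. K2 (1, x) = \<one>"
  "ALL s:{0..1}. K2 (s, 1) = K2 (s, 0)" unfolding homotopic_loops by (auto simp: pathstart_def pathfinish_def)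
 define K where "K = (%(s, t). K2 (s, clip t))"
 have cK: "continuous_map (top_of_set ({0..1} \<times> UNIV)) euclidean K"
 proof -
  have "continuous_on ({0..1} \<times> UNIV) (%p. K2 (fst p, clip (snd p)))"
  using clip by (intro continuous_on_compose2[OF K2(1)] continuous_intros continuous_on_compose2[OF clip(3)]) auto
  thus ?thesis by (simp add: K_def case_prod_unfold)
 qed
 have ck: "continuous_on UNIV (%t. ga (clip t))" by (rule continuous_on_compose2[OF cga clip(3)]) auto
 have "?ps (ga (clip t)) = K (0, t)" for t using K2(2) clip(1)[of t] by (simp add: K_def)
 from sec_cover_lift_homotopy[OF cov cK ck this]
 obtain H where H: "continuous_on ({0..1} \<times> UNIV) H" "!!t z. t : {0..1} ==> ?ps (H (t, z)) = K (t, z)"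
  "!!z. H (0, z) = ga (clip z)" by metis
 have c1: "continuous_on UNIV (%t. H (1, t))"
  by (rule continuous_on_compose2[OF H(1)]) (auto intro!: continuous_intros)
 have "H (1, 0) = H (1, 1)" by (rule sec_cover_unique[OF cov continuous_on_const c1, where a = 0])
  (use H(2) K2(3) clip in \<open>auto simp: K_def\<close>)
 have c2: "continuous_on {0..1} (%s. H (s, t))" for t
  by (rule continuous_on_compose2[OF H(1)]) (auto intro!: continuous_intros)
 have "H (0, 0) = H (0, 1)" by (rule sec_cover_unique[OF cov c2 c2, where a = 1])
  (use H(2) K2(4) clip \<open>H (1, 0) = H (1, 1)\<close> in \<open>auto simp: K_def\<close>)
 thus ?thesis using H(3) ga01 by (simp add: clip)
qed

lemma twist_inj:
 assumes E: "diff_end E L" and L: "det1 L ~= 0" and eq: "twist E t x = twist E t y" shows "x = y"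
proof -
 obtain z where z: "twist E \<one> z = t" using twist_surj[OF E L] by blast
 hence "twist E \<one> (z *. x) = twist E \<one> (z *. y)" using eq by (simp add: twist_mult[OF E])
 hence "E ((z *. y) *. inv (z *. x)) = (z *. y) *. inv (z *. x)" using twist_one_eq_iff[OF E] by blast
 hence "(z *. y) *. inv (z *. x) = \<one>" by (rule fixed_trivial[OF E L])
 hence "z *. y = z *. x" by (metis in_carrier inv_equality inv_inv)
 thus ?thesis by simp
qed

end

text \<open>The change of variables theorem of the library wants a well-ordered index type.\<close>

typedef 'a idx = "{..<CARD('a::finite)}" by (rule exI[of _ 0]) simp

instantiation idx :: (finite) linorder
begin

definition "less_eq_idx (a :: 'a idx) (b :: 'a idx) <-> Rep_idx a <= Rep_idx b"
definition "less_idx (a :: 'a idx) (b :: 'a idx) <-> Rep_idx a < Rep_idx b"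

instance by standard (auto simp: less_eq_idx_def less_idx_def Rep_idx_inject)

end

instance idx :: (finite) finite
proof
 show "finite (UNIV :: 'a idx set)" by (rule finite_imageD[of Rep_idx])
  (simp_all add: type_definition.Rep_range[OF type_definition_idx] inj_on_def Rep_idx_inject)
qed

instance idx :: (finite) wellorder
proof
 fix Q :: "'a idx => bool" and a :: "'a idx"
 assume step: "!!x. (!!y. y < x ==> Q y) ==> Q x"
 show "Q a" by (induction "Rep_idx a" arbitrary: a rule: less_induct) (auto intro: step simp: less_idx_def)
qed

lemma card_idx: "CARD('a idx) = CARD('a::finite)"
 using type_definition.card[OF type_definition_idx] by simp

definition ix :: "'a idx => 'a::finite"
 where "ix = (SOME f. bij f)"

lemma bij_ix: "bij (ix :: 'a idx => 'a::finite)"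
proof -
 obtain f :: "'a idx => 'a" where "bij_betw f UNIV UNIV"
  using finite_same_card_bij[of "UNIV :: 'a idx set" "UNIV :: 'a set"] card_idx by auto
 thus ?thesis unfolding ix_def by (metis someI)
qed

lemma ix_inv [simp]: "ix (inv_into UNIV ix i) = i" "inv_into UNIV ix (ix k) = k"
 by (rule surj_f_inv_f[OF bij_is_surj[OF bij_ix]]) (rule inv_f_f[OF bij_is_inj[OF bij_ix]])

definition to_ix :: "real ^ 'n => real ^ 'n idx"
 where "to_ix x = (\<chi> k. x $ ix k)"

definition of_ix :: "real ^ 'n idx => real ^ 'n"
 where "of_ix y = (\<chi> i. y $ inv_into UNIV ix i)"

lemma to_of_ix [simp]: "to_ix (of_ix y) = y" "of_ix (to_ix x) = x"
 by (simp_all add: to_ix_def of_ix_def vec_eq_iff)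

lemma linear_to_ix: "linear to_ix" and linear_of_ix: "linear of_ix"
 by (auto intro!: linearI simp: to_ix_def of_ix_def vec_eq_iff)

lemma continuous_to_ix: "continuous_on A to_ix" and continuous_of_ix: "continuous_on A of_ix"
 using linear_to_ix linear_of_ix by (auto intro: linear_continuous_on simp: linear_linear)

lemma to_ix_image: "to_ix ` S = of_ix -` S" and of_ix_image: "of_ix ` T = to_ix -` T"
 by (auto simp: image_iff) (metis to_of_ix)+

lemma open_to_ix: "open S ==> open (to_ix ` S)"
 unfolding to_ix_image by (rule open_vimage[OF _ continuous_of_ix])

section \<open>Volumes of images under differentiable injections\<close>

lemma det_reindex:
 fixes A :: "real ^ 'n ^ 'n"
 shows "det (\<chi> k l. A $ ix k $ ix l) = det A"
proof -
 let ?h = "map_permutation UNIV (ix :: 'n idx => 'n)"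
 have bij: "bij_betw (ix :: 'n idx => 'n) UNIV UNIV" using bij_ix .
 have inj: "inj (ix :: 'n idx => 'n)" using bij_ix by (rule bij_is_inj)
 have "?h = (%p x. if x : UNIV then ix (p (inv_into UNIV ix x)) else x)"
  using bij_is_surj[OF bij_ix] by (auto simp: map_permutation_def restrict_id_def fun_eq_iff)
 hence hbij: "bij_betw ?h {p. p permutes UNIV} {p. p permutes UNIV}" using bij_betw_permutations[OF bij] by simp
 have "det A = (\<Sum>p | p permutes UNIV. of_int (sign p) * (PROD i:UNIV. A $ i $ p i))" by (simp add: det_def)
 also have "... = (\<Sum>p | p permutes (UNIV :: 'n idx set). of_int (sign (?h p)) * (PROD i:UNIV. A $ i $ ?h p i))"
  by (rule sum.reindex_bij_betw[OF hbij, symmetric])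
 also have "... = (\<Sum>p | p permutes (UNIV :: 'n idx set). of_int (sign p) * (PROD k:UNIV. A $ ix k $ ix (p k)))"
 proof (rule sum.cong[OF refl])
  fix p :: "'n idx => 'n idx" assume "p : {p. p permutes UNIV}"
  hence p: "p permutes UNIV" by simp
  have "(PROD i:UNIV. A $ i $ ?h p i) = (PROD k:UNIV. A $ ix k $ ?h p (ix k))"
  by (rule prod.reindex_bij_betw[OF bij, symmetric])
  also have "... = (PROD k:UNIV. A $ ix k $ ix (p k))" by (simp add: map_permutation_apply[OF inj])
  finally show "of_int (sign (?h p)) * (PROD i:UNIV. A $ i $ ?h p i) = of_int (sign p) * (PROD k:UNIV. A $ ix k $ ix (p k))"
  using sign_map_permutation[OF inj p] by simp
 qed
 also have "... = det (\<chi> k l. A $ ix k $ ix l)" by (simp add: det_def)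
 finally show ?thesis ..
qed

lemma prod_Basis_cart: "(PROD b:Basis. x \<bullet> b) = (PROD i:UNIV. x $ i)" for x :: "real ^ 'k"
proof -
 have "Basis = range (%i::'k. axis i (1::real))" by (auto simp: Basis_vec_def)
 moreover have "inj (%i::'k. axis i (1::real))" by (auto simp: inj_on_def axis_eq_axis)
 ultimately show ?thesis
  using prod.reindex[of "%i::'k. axis i (1::real)" UNIV "%b. x \<bullet> b"] by (simp add: inner_axis o_def)
qed

lemma lborel_to_ix: "lborel = distr lborel borel (of_ix :: real ^ 'n idx => real ^ 'n)"
proof (rule lborel_eqI)
 have meas: "(of_ix :: real ^ 'n idx => real ^ 'n) : borel_measurable borel"
  using continuous_of_ix by (rule borel_measurable_continuous_onI)
 fix l u :: "real ^ 'n"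
 assume lu: "!!b. b : Basis ==> l \<bullet> b <= u \<bullet> b"
 have le: "l $ i <= u $ i" for i using lu[of "axis i 1"] by (simp add: inner_axis)
 have "of_ix -` box l u = box (to_ix l) (to_ix u)" by (auto simp: mem_box_cart of_ix_def to_ix_def) (metis ix_inv)+
 hence "emeasure (distr lborel borel of_ix) (box l u) = emeasure lborel (box (to_ix l) (to_ix u))"
  using meas by (simp add: emeasure_distr)
 also have "... = (PROD b:Basis. (to_ix u - to_ix l) \<bullet> b)"
 proof (rule emeasure_lborel_box)
  fix b :: "real ^ 'n idx" assume "b : Basis"
  thus "to_ix l \<bullet> b <= to_ix u \<bullet> b" using le by (auto simp: Basis_vec_def inner_axis to_ix_def)
 qed
 also have "(PROD b:Basis. (to_ix u - to_ix l) \<bullet> b) = (PROD k:UNIV. u $ ix k - l $ ix k)"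
  unfolding prod_Basis_cart by (simp add: to_ix_def)
 also have "... = (PROD i:UNIV. u $ i - l $ i)" by (rule prod.reindex_bij_betw[OF bij_ix])
 also have "... = (PROD b:Basis. (u - l) \<bullet> b)" unfolding prod_Basis_cart by simp
 finally show "emeasure (distr lborel borel of_ix) (box l u) = (PROD b:Basis. (u - l) \<bullet> b)" .
qed simp

lemma measure_to_ix:
 fixes S :: "(real ^ 'n) set"
 assumes "open S" shows "measure lebesgue (to_ix ` S) = measure lebesgue S"
proof -
 have meas: "(of_ix :: real ^ 'n idx => real ^ 'n) : borel_measurable borel"
  using continuous_of_ix by (rule borel_measurable_continuous_onI)
 have "measure lborel S = measure (distr lborel borel of_ix) S" using lborel_to_ix by metis
 also have "... = measure lborel (to_ix ` S)" using meas assms by (simp add: measure_distr to_ix_image)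
 finally show ?thesis using assms open_to_ix[OF assms] by simp
qed

text \<open>Invariance of domain makes the image open, hence measurable; the change of variables
  formula then yields both the integrability of the Jacobian and the measure as its integral. The
  formula is applied to coordinates indexed by \<open>'n idx\<close>.\<close>

theorem measure_image_ge:
 fixes g :: "real ^ 'n => real ^ 'n"
 assumes S: "open S" "bounded S" and g: "!!x. x : S ==> (g has_derivative g' x) (at x)" and inj: "inj_on g S"
  and bd: "bounded (g ` S)" and c: "!!x. x : S ==> c <= \<bar>det (matrix (g' x))\<bar>"
 shows "c * measure lebesgue S <= measure lebesgue (g ` S)" "open (g ` S)"
proof -
 have "continuous_on S g" using g by (meson continuous_at_imp_continuous_on has_derivative_continuous)
 thus og: "open (g ` S)" by (rule invariance_of_domain[OF _ S(1) inj])
 let ?S = "to_ix ` S" and ?g = "%y. to_ix (g (of_ix y)) :: real ^ 'n idx" and ?g' = "%y v. to_ix (g' (of_ix y) (of_ix v))"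
 have img: "?g ` ?S = to_ix ` g ` S" by (simp add: image_image)
 have bnd: "bounded (to_ix ` T)" if "bounded T" for T :: "(real ^ 'n) set"
  by (rule bounded_linear_image[OF that linear_conv_bounded_linear[THEN iffD1, OF linear_to_ix]])
 have mS: "?S : lmeasurable" using open_to_ix[OF S(1)] bnd[OF S(2)] by (simp add: lmeasurable_open)
 have mg: "?g ` ?S : lmeasurable" unfolding img using open_to_ix[OF og] bnd[OF bd] by (simp add: lmeasurable_open)
 have der: "(?g has_derivative ?g' y) (at y within ?S)" if "y : ?S" for y
 proof -
  have y: "of_ix y : S" using that by auto
  have "(of_ix has_derivative of_ix) (at y)" and t: "(to_ix has_derivative to_ix) (at x)" for x :: "real ^ 'n"
  using linear_of_ix linear_to_ix by (auto intro!: bounded_linear_imp_has_derivative simp: linear_linear)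
  from has_derivative_compose[OF has_derivative_compose[OF this(1) g[OF y]] t]
  show ?thesis by (rule has_derivative_at_withinI)
 qed
 have inj': "inj_on ?g ?S" using inj by (auto simp: inj_on_def) (metis to_of_ix(2))
 have dt: "det (matrix (?g' y)) = det (matrix (g' (of_ix y)))" for y
 proof -
  have "inv_into UNIV ix i = l <-> i = ix l" for i and l :: "'n idx" by auto
  hence a: "of_ix (axis l 1) = axis (ix l) 1" for l :: "'n idx" by (simp add: of_ix_def axis_def vec_eq_iff)
  have "matrix (?g' y) = (\<chi> k l. matrix (g' (of_ix y)) $ ix k $ ix l)" unfolding matrix_def to_ix_def a by simp
  thus ?thesis by (simp add: det_reindex)
 qed
 have int: "(%y. \<bar>det (matrix (?g' y))\<bar>) integrable_on ?S"
  using measurable_differentiable_image_eq[OF fmeasurableD[OF mS] der inj'] mg by blast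
 have "c * measure lebesgue ?S = integral ?S (%y. c)"
  using mS by (simp add: lmeasure_integral integral_mult_right[symmetric] del: integral_mult_right)
 also have "... <= integral ?S (%y. \<bar>det (matrix (?g' y))\<bar>)"
  using c mS by (intro integral_le int) (auto simp: dt integrable_on_const)
 also have "... = measure lebesgue (?g ` ?S)"
  using measure_differentiable_image_eq[OF fmeasurableD[OF mS] der inj' int] by simp
 finally show "c * measure lebesgue S <= measure lebesgue (g ` S)"
  unfolding img measure_to_ix[OF S(1)] measure_to_ix[OF og] .
qed

text \<open>Integrates the number of sets that contain a point; this averaging is behind both the
  lower and the upper count.\<close>

lemma measure_pigeonhole:
 fixes B :: "'i => (real ^ 'n) set"
 assumes I: "finite I" and B: "!!i. i : I ==> B i : lmeasurable" "!!i. i : I ==> B i <= T" and T: "T : lmeasurable"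
  and N: "!!w. w : T ==> real (card {i : I. w : B i}) <= N"
 shows "(SUM i:I. measure lebesgue (B i)) <= N * measure lebesgue T"
proof -
 have ii: "indicat_real (B i) integrable_on T" if "i : I" for i
  using B[OF that] by (simp add: integrable_on_indicator Int_absorb2)
 have "(SUM i:I. measure lebesgue (B i)) = (SUM i:I. integral T (indicator (B i)))"
 proof (rule sum.cong[OF refl])
  fix i assume i: "i : I"
  hence "B i Int T = B i" using B(2) by blast
  thus "measure lebesgue (B i) = integral T (indicator (B i))"
  using Equivalence_Lebesgue_Henstock_Integration.integral_indicator[of "B i" T] B(1)[OF i] by simp
 qed
 also have "... = integral T (%w. SUM i:I. indicator (B i) w)" by (rule integral_sum[OF I ii, symmetric])
 also have "... <= integral T (%w. N)"
 proof (rule integral_le)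
  show "(%w. SUM i:I. indicat_real (B i) w) integrable_on T"
  by (rule Henstock_Kurzweil_Integration.integrable_sum[OF I ii])
  show "(%w. N) integrable_on T" using T by (simp add: integrable_on_const)
  fix w assume w: "w : T"
  have "(SUM i:I. indicator (B i) w) = real (card {i : I. w : B i})"
  using I by (simp add: indicator_def sum.If_cases Int_def)
  thus "(SUM i:I. indicator (B i) w) <= N" using N[OF w] by simp
 qed
 also have "... = N * measure lebesgue T"
  using T by (simp add: lmeasure_integral integral_mult_right[symmetric] del: integral_mult_right)
 finally show ?thesis .
qed

lemma det_near_id:
 obtains et where "et > 0" "!!M :: real ^ 'n => real ^ 'n. (!!v. norm (M v - v) <= et * norm v) ==> 1 / 2 <= \<bar>det (matrix M)\<bar>"
proof -
 have "continuous_on UNIV (det :: real ^ 'n ^ 'n => real)" unfolding det_def by (intro continuous_intros)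
 hence "isCont (det :: real ^ 'n ^ 'n => real) (mat 1)" by (simp add: continuous_on_eq_continuous_at)
 hence "ALL e>0. EX d>0. ALL B. dist B (mat 1 :: real ^ 'n ^ 'n) < d --> dist (det B) (det (mat 1 :: real ^ 'n ^ 'n)) < e"
  unfolding continuous_at_eps_delta .
 then obtain dl where dl: "dl > 0" "ALL B. dist B (mat 1 :: real ^ 'n ^ 'n) < dl --> dist (det B) (det (mat 1 :: real ^ 'n ^ 'n)) < 1 / 2"
  by (metis half_gt_zero zero_less_one)
 define et where "et = dl / (2 * real CARD('n) * real CARD('n))"
 show ?thesis
 proof
  show "et > 0" using dl by (simp add: et_def)
  fix M :: "real ^ 'n => real ^ 'n" assume M: "!!v. norm (M v - v) <= et * norm v"
  have "norm (matrix M - mat 1) <= (SUM i:UNIV. norm ((matrix M - mat 1) $ i))"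
  unfolding norm_vec_def by (intro L2_set_le_sum) simp
  also have "... <= (SUM i:(UNIV::'n set). SUM j:(UNIV::'n set). \<bar>(matrix M - mat 1) $ i $ j\<bar>)"
  by (intro sum_mono norm_le_l1_cart)
  also have "... <= (SUM i:(UNIV::'n set). SUM j:(UNIV::'n set). et)"
  proof (intro sum_mono)
  fix i j :: 'n
  have "(matrix M - mat 1) $ i $ j = (M (axis j 1) - axis j 1) $ i" by (simp add: matrix_def mat_def axis_def)
  thus "\<bar>(matrix M - mat 1) $ i $ j\<bar> <= et"
  using component_le_norm_cart[of "M (axis j 1) - axis j 1" i] M[of "axis j 1"] by (simp add: norm_axis_1)
  qed
  also have "... < dl" using dl by (simp add: et_def)
  finally have "dist (det (matrix M)) 1 < 1 / 2" using dl(2) by (simp add: dist_norm)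
  thus "1 / 2 <= \<bar>det (matrix M)\<bar>" by (simp add: dist_real_def abs_if split: if_splits)
 qed
qed

context simply_connected_solvable_lie_group_R begin

lemma loc_near:
 assumes "open V" "\<one> : V"
 obtains r where "r > 0" "cball 0 r <= cdom" "!!u. u : cball 0 r ==> loc u : V"
proof -
 have "open {v : cdom. loc v : V}" "0 : {v : cdom. loc v : V}"
  using open_loc_vimage[OF continuous_on_id assms(1)] cdom assms(2) by auto
 then obtain r where "r > 0" "cball 0 r <= {v : cdom. loc v : V}" using open_contains_cball by blast
 thus ?thesis using that[of r] by blast
qed

text \<open>Collects the local estimates for \<open>twist_measure\<close> under one radius. Left
  multiplication by \<open>w\<close> and left division by \<open>a\<close>, in coordinates, have
  derivatives within \<open>et\<close> of the identity, so passing between the group and the chart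
  distorts volumes by bounded factors only.\<close>

lemma small_radius:
 assumes V: "open V" "\<one> : V" and et: "et > 0"
 obtains r where "r > 0" "cball 0 r <= cdom" "!!u. u : cball 0 r ==> loc u : V"
  "!!w. w : ball 0 r ==> EX La. ((%s. mulc (w, s)) has_derivative La) (at 0) & (ALL v. norm (La v - v) <= et * norm v)"
  "!!a. a : ball 0 r ==> (a, a) : div_dom"
  "!!a. a : ball 0 r ==> EX \<Delta>. ((%b. divc (a, b)) has_derivative \<Delta>) (at a) & (ALL v. norm (\<Delta> v - v) <= et * norm v)"
proof -
 obtain r1 where r1: "r1 > 0" "cball 0 r1 <= cdom" "!!u. u : cball 0 r1 ==> loc u : V"
  by (rule loc_near[OF V]) (rule that; assumption)
 obtain r2 where r2: "r2 > 0" "!!x y. x : ball (0, 0) r2 ==> y : ball (0, 0) r2 ==>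
  norm (mulc x - mulc y - (case x - y of (a, b) => a + b)) <= et * norm (x - y)"
  by (rule sderivD[OF mulc_sderiv_0 et]) (rule that; assumption)
 obtain r3 where r3: "r3 > 0" "!!x y. x : ball (0, 0) r3 ==> y : ball (0, 0) r3 ==>
  norm (divc x - divc y - (case x - y of (a, b) => b - a)) <= et * norm (x - y)"
  by (rule sderivD[OF divc_sderiv_0 et]) (rule that; assumption)
 obtain r4 where r4: "r4 > 0" "ball (0, 0) r4 <= div_dom" using open_div_dom zero_div_dom open_contains_ball by blast
 define r where "r = min (min r1 r2) (min r3 r4) / 2"
 have r: "r > 0" "r < r1" "r < r2" "r < r3" "2 * r <= r3" "2 * r <= r4" using r1 r2 r3 r4 by (auto simp: r_def)
 have blp: "bounded_linear (%(a, b). a + b :: real ^ 'n)" and blm: "bounded_linear (%(a, b). b - a :: real ^ 'n)"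
  using sderiv_linear[OF mulc_sderiv_0] sderiv_linear[OF divc_sderiv_0] by auto
 have dd: "(a, a) : ball (0, 0) (2 * r)" if "a : ball 0 r" for a :: "real ^ 'n"
  using that norm_Pair_le[of "- a" "- a"] by (simp add: dist_norm)
 show ?thesis
 proof
  show "r > 0" "cball 0 r <= cdom" "!!u. u : cball 0 r ==> loc u : V" using r r1 by auto
  show div: "(a, a) : div_dom" if "a : ball 0 r" for a using dd[OF that] r r4 by auto
  show "EX La. ((%s. mulc (w, s)) has_derivative La) (at 0) & (ALL v. norm (La v - v) <= et * norm v)"
  if w: "w : ball 0 r" for w
  proof -
  have "w : cdom" using w r r1(2) by auto
  then obtain F where F: "sderiv mulc F (w, 0)" using mulc_sderiv zero_mul_dom(1) by blast
  have pr: "((%s::real^'n. (w, s)) has_derivative (%s. (0, s))) (at 0)" by (intro derivative_intros)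
  have "((%s. mulc (w, s)) has_derivative (%s. F (0, s))) (at 0)"
  using has_derivative_compose[OF pr, of mulc F] sderiv_has_derivative[OF F] by simp
  moreover have "norm (F (0, v) - v) <= et * norm v" for v
  using sderiv_near[where z = "(0, 0)" and dl = r2 and v = "(0, v)", OF r2(2) sderiv_has_derivative[OF F] blp] w r
  by (simp add: dist_norm norm_Pair)
  ultimately show ?thesis by (intro exI[of _ "%s. F (0, s)"]) simp
  qed
  show "EX \<Delta>. ((%b. divc (a, b)) has_derivative \<Delta>) (at a) & (ALL v. norm (\<Delta> v - v) <= et * norm v)"
  if a: "a : ball 0 r" for a
  proof -
  obtain F where F: "sderiv divc F (a, a)" using divc_sderiv[OF div[OF a]] by blast
  have pr: "((%s::real^'n. (a, s)) has_derivative (%s. (0, s))) (at a)" by (intro derivative_intros)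
  have "((%s. divc (a, s)) has_derivative (%s. F (0, s))) (at a)"
  using has_derivative_compose[OF pr, of divc F] sderiv_has_derivative[OF F] by simp
  moreover have "norm (F (0, v) - v) <= et * norm v" for v
  using sderiv_near[where z = "(0, 0)" and dl = r3 and v = "(0, v)", OF r3(2) sderiv_has_derivative[OF F] blm] dd[OF a] r
  by (simp add: dist_norm norm_Pair)
  ultimately show ?thesis by (intro exI[of _ "%s. F (0, s)"]) simp
  qed
 qed
qed

text \<open>In coordinates \<open>g\<close> is a composite of left division by \<open>a\<close>, a
  twist read at the identity, and left multiplication by the value \<open>g a\<close>. The outer
  factors have determinants of absolute value at least \<open>1 / 2\<close>, hence the
  \<open>4\<close>; the middle one has the determinant of \<open>1 - L\<close> by
  \<open>det_twist\<close>.\<close>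

lemma twist_measure:
 assumes E: "diff_end E L" and L: "det1 L ~= 0"
  and et: "!!M :: real ^ 'n => real ^ 'n. (!!v. norm (M v - v) <= et * norm v) ==> 1 / 2 <= \<bar>det (matrix M)\<bar>"
  and r: "r > 0" "cball 0 r <= cdom"
  "!!w. w : ball 0 r ==> EX La. ((%s. mulc (w, s)) has_derivative La) (at 0) & (ALL v. norm (La v - v) <= et * norm v)"
  "!!a. a : ball 0 r ==> (a, a) : div_dom"
  "!!a. a : ball 0 r ==> EX \<Delta>. ((%b. divc (a, b)) has_derivative \<Delta>) (at a) & (ALL v. norm (\<Delta> v - v) <= et * norm v)"
  and A: "A = {a : ball 0 r. k *. twist E t (loc a) : loc ` ball 0 r}" and g: "g = (%a. crd (k *. twist E t (loc a)))"
 shows "open A" "open (g ` A)" "g ` A <= ball 0 r" "!!a. a : A ==> loc (g a) = k *. twist E t (loc a)"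
  "\<bar>det1 L\<bar> / 4 * measure lebesgue A <= measure lebesgue (g ` A)"
proof -
 have bsub: "ball 0 r <= cdom" using r(2) ball_subset_cball by blast
 have oW: "open (loc ` ball 0 r)" using bsub by (intro open_loc_image) auto
 have ct: "continuous_on UNIV (%x. k *. twist E t x)" using E by (intro group_cont continuous_twist)
 have "A = ball 0 r Int {a : cdom. k *. twist E t (loc a) : loc ` ball 0 r}" using bsub unfolding A by blast
 thus oA: "open A" using open_loc_vimage[OF ct oW] by (simp only:) (rule open_Int[OF open_ball])
 have gA: "g a : ball 0 r" "loc (g a) = k *. twist E t (loc a)" "a : ball 0 r" if aA: "a : A" for a
 proof -
  obtain w where w: "w : ball 0 r" "k *. twist E t (loc a) = loc w" using aA unfolding A by blast
  hence "g a = w" using crd_loc subsetD[OF bsub w(1)] by (simp add: g)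
  thus "g a : ball 0 r" "loc (g a) = k *. twist E t (loc a)" using w by simp_all
  show "a : ball 0 r" using aA unfolding A by blast
 qed
 thus "g ` A <= ball 0 r" "!!a. a : A ==> loc (g a) = k *. twist E t (loc a)" by blast+
 have LL: "linear L" and LA: "linear (Ad h)" for h using diff_end_linear[OF E] Ad_linear by (auto simp: linear_linear)
 have inj: "inj_on g A"
 proof
  fix a b assume ab: "a : A" "b : A" "g a = g b"
  hence "k *. twist E t (loc a) = k *. twist E t (loc b)" using gA(2)[OF ab(1)] gA(2)[OF ab(2)] by simp
  hence "loc a = loc b" using twist_inj[OF E L] by simp
  hence "crd (loc a) = crd (loc b)" by (rule arg_cong)
  thus "a = b" unfolding crd_loc[OF subsetD[OF bsub gA(3)[OF ab(1)]]] crd_loc[OF subsetD[OF bsub gA(3)[OF ab(2)]]] .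
 qed
 have der: "EX g'. (g has_derivative g') (at a) & \<bar>det1 L\<bar> / 4 <= \<bar>det (matrix g')\<bar>" if a: "a : A" for a
 proof -
  let ?tht = "twist E t (loc a)" and ?w = "g a"
  let ?F = "%u. crd (inv ?tht *. twist E ?tht (loc u))" and ?T = "%u. u - Ad (inv ?tht) (L u)"
  obtain La where La: "((%s. mulc (?w, s)) has_derivative La) (at 0)" "!!v. norm (La v - v) <= et * norm v"
  using r(3)[OF gA(1)[OF a]] by blast
  obtain \<Delta> where \<Delta>: "((%b. divc (a, b)) has_derivative \<Delta>) (at a)" "!!v. norm (\<Delta> v - v) <= et * norm v"
  using r(5)[OF gA(3)[OF a]] by blast
  have div0: "divc (a, a) = 0" by (simp add: divc_def)
  have F: "(?F has_derivative ?T) (at 0)" by (rule twist_derivative[OF E])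
  have F0: "?F 0 = 0" by (simp add: twist_one[OF E])
  have d1: "((%b. ?F (divc (a, b))) has_derivative (%v. ?T (\<Delta> v))) (at a)"
  using has_derivative_compose[OF \<Delta>(1), of ?F ?T] F by (simp add: div0 twist_one[OF E])
  have "((%b. mulc (?w, ?F (divc (a, b)))) has_derivative (%v. La (?T (\<Delta> v)))) (at a)"
  using has_derivative_compose[OF d1, of "%s. mulc (?w, s)" La] La(1) by (simp add: div0 F0 twist_one[OF E])
  moreover
  define S where "S = {b : cdom. inv (loc a) *. loc b : nbh} Int {b : cdom. inv ?tht *. twist E t (loc b) : nbh}"
  have "open S"
  proof -
  have "continuous_on UNIV (%x. inv (loc a) *. x)" "continuous_on UNIV (%x. inv ?tht *. twist E t x)"
  using E by (intro group_cont continuous_twist)+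
  thus ?thesis unfolding S_def by (intro open_Int open_loc_vimage[OF _ nbh(1)])
  qed
  moreover have "a : S" using nbh(2) subsetD[OF bsub gA(3)[OF a]] by (simp add: S_def)
  moreover have "mulc (?w, ?F (divc (a, b))) = g b" if "b : S" for b
  proof -
  have b: "b : cdom" "inv (loc a) *. loc b : nbh" "inv ?tht *. twist E t (loc b) : nbh"
  using that by (auto simp: S_def)
  have 1: "loc (divc (a, b)) = inv (loc a) *. loc b" using b by (simp add: divc_def loc_crd)
  have "twist E ?tht (loc (divc (a, b))) = twist E t (loc b)" unfolding 1 by (simp flip: twist_mult[OF E])
  hence "loc (?F (divc (a, b))) = inv ?tht *. twist E t (loc b)" using b(3) by (simp add: loc_crd)
  thus ?thesis using gA(2)[OF a] by (simp add: mulc_def g m_assoc)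
  qed
  ultimately have dg: "(g has_derivative (%v. La (?T (\<Delta> v)))) (at a)"
  by (rule has_derivative_transform_within_open)
  have lin: "linear La" "linear \<Delta>" "linear ?T"
  using has_derivative_linear[OF La(1)] has_derivative_linear[OF \<Delta>(1)] has_derivative_linear[OF F] by auto
  \<comment> \<open>\<open>det_twist\<close> speaks of the orbit of the identity; surjectivity puts
    \<open>?tht\<close> on this orbit.\<close>
  obtain z where "twist E \<one> z = t" using twist_surj[OF E L] by blast
  hence "?tht = twist E \<one> (z *. loc a)" by (simp add: twist_mult[OF E])
  hence dT: "det (matrix ?T) = det1 L" using det_twist[OF E] by metis
  have "matrix (%v. La (?T (\<Delta> v))) = matrix La ** (matrix ?T ** matrix \<Delta>)"
  using matrix_compose[OF linear_compose[OF lin(2,3)] lin(1)] matrix_compose[OF lin(2,3)] by (simp add: o_def)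
  hence "\<bar>det (matrix (%v. La (?T (\<Delta> v))))\<bar> = \<bar>det (matrix La)\<bar> * (\<bar>det1 L\<bar> * \<bar>det (matrix \<Delta>)\<bar>)"
  by (simp add: det_mul abs_mult dT)
  moreover have "1 / 2 * (\<bar>det1 L\<bar> * (1 / 2)) <= \<bar>det (matrix La)\<bar> * (\<bar>det1 L\<bar> * \<bar>det (matrix \<Delta>)\<bar>)"
  by (intro mult_mono et La(2) \<Delta>(2)) auto
  ultimately show ?thesis using dg by (intro exI[of _ "%v. La (?T (\<Delta> v))"]) simp
 qed
 then obtain g' where g': "!!a. a : A ==> (g has_derivative g' a) (at a)"
  "!!a. a : A ==> \<bar>det1 L\<bar> / 4 <= \<bar>det (matrix (g' a))\<bar>" by metis
 have "bounded A" using gA(3) bounded_subset[OF bounded_ball] by blast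
 moreover have "bounded (g ` A)" using gA(1) bounded_subset[OF bounded_ball] by blast
 ultimately show "\<bar>det1 L\<bar> / 4 * measure lebesgue A <= measure lebesgue (g ` A)" "open (g ` A)"
  using measure_image_ge[OF oA _ g'(1) inj _ g'(2)] by blast+
qed

end

section \<open>Counting fixed orbits from below\<close>

lemma card_fibre_ge:
 assumes "finite T" "finite J" "J ~= {}" "!!t. t : T ==> h t : J"
 shows "EX j:J. card T <= card J * card {t : T. h t = j}"
proof (rule ccontr)
 assume *: "~ ?thesis"
 have "(SUM j:J. card J * card {t : T. h t = j}) < (SUM j:J. card T)"
  using assms * by (intro sum_strict_mono) (auto simp: not_le)
 moreover have "(SUM j:J. card {t : T. h t = j}) = card T" using sum.group[of T J h "%_. 1::nat"] assms by auto
 ultimately show False by (simp flip: sum_distrib_left)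
qed

context simply_connected_solvable_lie_group_R begin

text \<open>Solutions of \<open>b *. E y = ga *. y\<close> correspond to common values of different
  twists: if \<open>twist E (inv b *. ga)\<close> takes at \<open>x\<close> the value that the twist
  of the identity takes at \<open>v\<close>, then \<open>y = x *. inv v\<close> is a solution.
  Volumes show that many \<open>ga\<close> share a value with \<open>x\<close> in a small ball, and
  the smallness of the ball keeps the solutions in different orbits of \<open>Ga\<close>.\<close>

theorem many_fixed_orbits:
 assumes Ga: "subgroup Ga G" and W: "open W" "W Int Ga = {\<one>}"
  and F: "compact F" "!!x. EX ga:Ga. EX y:F. x = ga *. y"
 obtains c where "c > 0" "!!E L b. diff_end E L ==> det1 L ~= 0 ==>
  EX Y. finite Y & c * \<bar>det1 L\<bar> <= real (card Y) &
  (ALL y:Y. EX ga:Ga. ga *. (b *. E y) = y) & (ALL y:Y. ALL y':Y. ALL ga:Ga. y' = ga *. y --> y' = y)"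
proof -
 have W1: "\<one> : W" using W(2) by auto
 obtain V where V: "open V" "\<one> : V" "!!a b. a : V ==> b : V ==> a *. inv b : W"
  by (rule small_quotients[OF W(1) W1]) (rule that; assumption)
 obtain et where et: "et > 0" "!!M :: real ^ 'n => real ^ 'n. (!!v. norm (M v - v) <= et * norm v) ==> 1 / 2 <= \<bar>det (matrix M)\<bar>"
  by (rule det_near_id) blast
 obtain r where r: "r > 0" "cball 0 r <= cdom" "!!u. u : cball 0 r ==> loc u : V"
  "!!w. w : ball 0 r ==> EX La. ((%s. mulc (w, s)) has_derivative La) (at 0) & (ALL v. norm (La v - v) <= et * norm v)"
  "!!a. a : ball 0 r ==> (a, a) : div_dom"
  "!!a. a : ball 0 r ==> EX \<Delta>. ((%b. divc (a, b)) has_derivative \<Delta>) (at a) & (ALL v. norm (\<Delta> v - v) <= et * norm v)"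
  by (rule small_radius[OF V(1,2) et(1)]) (rule that; assumption)
 define U where "U = loc ` ball 0 r"
 have bsub: "ball 0 r <= cdom" using r(2) ball_subset_cball by blast
 have oU: "open U" unfolding U_def using bsub by (intro open_loc_image) auto
 have U1: "\<one> : U" unfolding U_def using r(1) loc_zero by (metis centre_in_ball imageI)
 \<comment> \<open>If \<open>b *. E x = ga *. y\<close> with \<open>y\<close> in \<open>F\<close>,
   the twist of \<open>inv b *. ga\<close> at \<open>x\<close> is \<open>inv y *. x\<close>. The
   values that matter thus lie in this compact set, and finitely many translates of the coordinate
   ball \<open>U\<close>, indexed by \<open>J\<close>, cover it.\<close>
 define K where "K = (%(y, v). inv y *. loc v) ` (F \<times> cball 0 r)"
 have cK: "compact K" unfolding K_def split_beta
  by (intro compact_continuous_image group_cont continuous_loc' compact_Times F compact_cball) (use r(2) in auto)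
 have "K <= \<Union>((%k. {h. inv k *. h : U}) ` K)" using U1 by auto
 then obtain J where J: "J <= K" "finite J" "K <= \<Union>((%k. {h. inv k *. h : U}) ` J)"
  by (rule compactE_image[OF cK open_ltrans[OF oU]]) (rule that; assumption)
 have "F ~= {}" using F(2) by blast
 hence Jne: "J ~= {}" using J(3) r(1) unfolding K_def by fastforce
 define m where "m == measure (lebesgue :: (real ^ 'n) measure)"
 have mpos: "m (cball 0 (r / 2)) > 0" "m (ball 0 r) > 0"
  using r(1) content_cball_pos content_ball_pos by (simp_all add: m_def)
 \<comment> \<open>The closed half ball is what finitely many domains \<open>A i\<close> cover, the
   ball of radius \<open>r\<close> receives all images, \<open>4\<close> is the distortion in
   \<open>twist_measure\<close>, and the factor \<open>card J\<close> is lost in choosing a single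
   translate.\<close>
 define c where "c = m (cball 0 (r / 2)) / (4 * m (ball 0 r) * card J)"
 have Jc: "card J > 0" using J(2) Jne by (simp add: card_gt_0_iff)
 show ?thesis
 proof
  show "c > 0" using mpos Jc by (simp add: c_def)
  fix E L b assume E: "diff_end E L" and L: "det1 L ~= 0"
  let ?d = "\<bar>det1 L\<bar>"
  define A where "A = (%(k, ga). {a : ball 0 r. inv k *. twist E (inv b *. ga) (loc a) : loc ` ball 0 r})"
  define g where "g = (%(k, ga) a. crd (inv k *. twist E (inv b *. ga) (loc a)))"
  have A: "open (A i)" "open (g i ` A i)" "g i ` A i <= ball 0 r" "?d / 4 * m (A i) <= m (g i ` A i)"
  and g: "!!a. a : A i ==> loc (g i a) = inv (fst i) *. twist E (inv b *. snd i) (loc a)" for i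
  using twist_measure[OF E L et(2) r(1,2,4,5,6), of "A i" "inv (fst i)" "inv b *. snd i" "g i"]
  by (auto simp: A_def g_def m_def split_beta)
  have cov: "cball 0 (r / 2) <= \<Union>(A ` (J \<times> Ga))"
  proof
  fix a :: "real ^ 'n" assume "a : cball 0 (r / 2)"
  hence a: "a : ball 0 r" using r(1) by auto
  obtain ga y where y: "ga : Ga" "y : F" "b *. E (loc a) = ga *. y" using F(2)[of "b *. E (loc a)"] by blast
  have "inv (b *. E (loc a)) *. ga = inv y" unfolding y(3) by (simp add: inv_mult_group m_assoc)
  hence "twist E (inv b *. ga) (loc a) = inv y *. loc a" by (simp add: twist_def inv_mult_group m_assoc)
  moreover have "inv y *. loc a : K" unfolding K_def using y(2) a by (intro image_eqI[of _ _ "(y, a)"]) auto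
  ultimately obtain k where "k : J" "inv k *. twist E (inv b *. ga) (loc a) : U" using J(3) by auto
  hence "a : A (k, ga)" using a by (simp add: A_def U_def)
  thus "a : \<Union>(A ` (J \<times> Ga))" using \<open>k : J\<close> y(1) by blast
  qed
  obtain T where T: "T <= J \<times> Ga" "finite T" "cball 0 (r / 2) <= \<Union>(A ` T)"
  by (rule compactE_image[OF compact_cball A(1) cov]) (rule that; assumption)
  have lm: "A i : lmeasurable" "g i ` A i : lmeasurable" for i
  proof -
  have "A i <= ball 0 r" by (auto simp: A_def split_beta)
  thus "A i : lmeasurable" "g i ` A i : lmeasurable"
  using A(1-3) by (meson bounded_ball bounded_subset lmeasurable_open)+
  qed
  have "m (cball 0 (r / 2)) <= m (\<Union>(A ` T))"
  unfolding m_def using T(2,3) lm by (intro measure_mono_fmeasurable fmeasurable.finite_UN) auto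
  also have "... <= (SUM i:T. m (A i))" unfolding m_def using T(2) lm by (intro measure_UNION_le) auto
  finally have 1: "m (cball 0 (r / 2)) <= (SUM i:T. m (A i))" .
  \<comment> \<open>A lower bound for the average number of images over a point of the ball.\<close>
  define N where "N = ?d / 4 * m (cball 0 (r / 2)) / m (ball 0 r)"
  have "EX w:ball 0 r. real (card {i : T. w : g i ` A i}) >= N"
  proof (rule ccontr)
  assume no: "~ ?thesis"
  \<comment> \<open>The counts take finitely many values; if all were below \<open>N\<close>, so
    would be their maximum, and this turns the volume comparison into a strict inequality.\<close>
  define N' where "N' = Max ((%w. real (card {i : T. w : g i ` A i})) ` ball 0 r)"
  have "finite ((%w. real (card {i : T. w : g i ` A i})) ` ball 0 r)"
  proof (rule finite_subset)
  show "(%w. real (card {i : T. w : g i ` A i})) ` ball 0 r <= real ` {..card T}"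
  using T(2) by (auto intro!: card_mono)
  qed simp
  hence N': "N' < N" "!!w. w : ball 0 r ==> real (card {i : T. w : g i ` A i}) <= N'"
  using no r(1) by (auto simp: N'_def not_le)
  have "?d / 4 * m (cball 0 (r / 2)) <= (SUM i:T. ?d / 4 * m (A i))"
  unfolding sum_distrib_left[symmetric] using 1 by (intro mult_left_mono) auto
  also have "... <= (SUM i:T. m (g i ` A i))" using A(4) by (rule sum_mono)
  also have "... <= N' * m (ball 0 r)" unfolding m_def by (rule measure_pigeonhole[OF T(2)]) (use lm A(3) N' in auto)
  also have "... < N * m (ball 0 r)" using N'(1) mpos by simp
  finally show False using mpos by (simp add: N_def)
  qed
  then obtain w where w: "w : ball 0 r" "real (card {i : T. w : g i ` A i}) >= N" by blast
  \<comment> \<open>The element \<open>v\<close> chosen below depends on \<open>k\<close>, so all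
    solutions have to come from one \<open>k\<close>.\<close>
  obtain k where k: "k : J" "card {i : T. w : g i ` A i} <= card J * card {i : {i : T. w : g i ` A i}. fst i = k}"
  proof -
  have "fst i : J" if "i : {i : T. w : g i ` A i}" for i using that T(1) by auto
  hence "EX k:J. card {i : T. w : g i ` A i} <= card J * card {i : {i : T. w : g i ` A i}. fst i = k}"
  using card_fibre_ge[of "{i : T. w : g i ` A i}" J fst, OF _ J(2) Jne] T(2) by simp
  thus thesis by (elim bexE) (rule that; assumption)
  qed
  define T' where "T' = {i : {i : T. w : g i ` A i}. fst i = k}"
  have T': "i : T" "snd i : Ga" "w : g i ` A i" "fst i = k" if "i : T'" for i using that T(1) by (auto simp: T'_def)
  obtain v where v: "twist E \<one> v = k *. loc w" using twist_surj[OF E L] by blast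
  have "EX a. a : A i & w = g i a" if "i : T'" for i using T'(3)[OF that] by blast
  hence "EX x. ALL i:T'. x i : A i & w = g i (x i)" by (intro bchoice ballI)
  then obtain x where x': "ALL i:T'. x i : A i & w = g i (x i)" by (elim exE)
  hence x: "!!i. i : T' ==> x i : A i" "!!i. i : T' ==> w = g i (x i)" by blast+
  define y where "y = (%i. loc (x i) *. inv v)"
  have xV: "loc (x i) : V" if "i : T'" for i using x(1)[OF that] r(3) by (auto simp: A_def split_beta)
  have fix1: "b *. E (y i) = snd i *. y i" if i: "i : T'" for i
  proof -
  have "inv (E v) *. v = k *. loc w" using v by (simp add: twist_def)
  also have "k *. loc w = twist E (inv b *. snd i) (loc (x i))" using g[OF x(1)[OF i]] x(2)[OF i] T'(4)[OF i] by simp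
  finally have "b *. (E (loc (x i)) *. (inv (E v) *. v)) = snd i *. loc (x i)" by (simp add: twist_def m_assoc)
  hence "b *. (E (loc (x i)) *. (inv (E v) *. v)) *. inv v = snd i *. loc (x i) *. inv v" by simp
  thus ?thesis by (simp add: y_def diff_end_mult[OF E] diff_end_inv[OF E] m_assoc)
  qed
  have dist: "i = i'" if i: "i : T'" "i' : T'" and dl: "dl : Ga" "y i' = dl *. y i" for i i' dl
  proof -
  have "y i' *. v = dl *. y i *. v" using dl(2) by simp
  hence xx: "loc (x i') = dl *. loc (x i)" by (simp add: y_def m_assoc)
  \<comment> \<open>The quotient of two points of the small ball lies in \<open>W\<close>, where
    \<open>Ga\<close> has only the identity.\<close>
  hence "loc (x i') *. inv (loc (x i)) = dl" by (simp add: m_assoc)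
  hence "dl : W" using V(3)[OF xV xV] i by metis
  hence "dl = \<one>" using W(2) dl(1) by blast
  hence yy: "y i' = y i" using dl(2) by simp
  have e: "b *. E (y i) = snd i' *. y i" using fix1[OF i(2)] unfolding yy .
  have "snd i' *. y i = snd i *. y i" by (rule trans[OF e[symmetric] fix1[OF i(1)]])
  hence "snd i' = snd i" by simp
  thus ?thesis using T'(4)[OF i(1)] T'(4)[OF i(2)] by (simp add: prod_eq_iff)
  qed
  have oneGa: "\<one> : Ga" by (rule subgroup.one_closed[OF Ga])
  have inj: "inj_on y T'" using dist[OF _ _ oneGa] by (intro inj_onI) simp
  have fT: "finite T'" using T(2) by (simp add: T'_def)
  show "EX Y. finite Y & c * ?d <= real (card Y) &
  (ALL y:Y. EX ga:Ga. ga *. (b *. E y) = y) & (ALL y:Y. ALL y':Y. ALL ga:Ga. y' = ga *. y --> y' = y)"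
  proof (intro exI conjI ballI impI)
  show "finite (y ` T')" using fT by simp
  have "real (card {i : T. w : g i ` A i}) <= real (card J * card T')"
  using k(2) unfolding T'_def[symmetric] by (rule of_nat_mono)
  hence "N <= real (card J) * real (card T')" using w(2) by simp
  moreover have "N = c * ?d * card J" using Jc mpos by (simp add: N_def c_def field_simps)
  ultimately show "c * ?d <= real (card (y ` T'))" using Jc by (simp add: card_image[OF inj] mult.commute)
  next
  fix z assume "z : y ` T'"
  then obtain i where i: "i : T'" "z = y i" by blast
  show "EX ga:Ga. ga *. (b *. E z) = z" using subgroup.m_inv_closed[OF Ga T'(2)[OF i(1)]] fix1[OF i(1)]
  by (intro bexI[of _ "inv (snd i)"]) (simp_all add: i(2))
  next
  fix z z' ga assume z: "z : y ` T'" "z' : y ` T'" "ga : Ga" "z' = ga *. z"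
  then obtain i i' where i: "i : T'" "i' : T'" "z = y i" "z' = y i'" by blast
  have "i = i'" by (rule dist[OF i(1,2) z(3)]) (use z(4) in \<open>simp only: i(3,4)\<close>)
  thus "z' = z" by (simp only: i(3,4))
  qed
 qed
qed

end

section \<open>Minors, grids and itineraries: the count from above\<close>

definition sel_cols :: "real ^ 'n ^ 'n => ('n => 'n + 'n) => real ^ 'n ^ 'n"
 where "sel_cols A sg = (\<chi> i j. case sg j of Inl k => A $ i $ k | Inr k => mat 1 $ i $ k)"

text \<open>Selecting unit vectors for some columns reduces the determinant, up to sign, to a minor
  of smaller size. This is therefore the largest absolute value of a minor of \<open>A\<close> of
  any size, with the empty minor \<open>1\<close> among them.\<close>

definition max_minor :: "real ^ 'n ^ 'n => real"
 where "max_minor A = Max (range (%sg. \<bar>det (sel_cols A sg)\<bar>))"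

lemma max_minor_ge: "\<bar>det (sel_cols A sg)\<bar> <= max_minor A"
 unfolding max_minor_def by (intro Max_ge finite_imageI) auto

lemma max_minor_ge_1: "1 <= max_minor A"
 using max_minor_ge[of A Inr] by (simp add: sel_cols_def)

lemma max_minor_attained: obtains sg where "max_minor A = \<bar>det (sel_cols A sg)\<bar>"
proof -
 have "max_minor A : range (%sg. \<bar>det (sel_cols A sg)\<bar>)"
  unfolding max_minor_def by (intro Max_in finite_imageI) auto
 thus ?thesis using that by blast
qed

text \<open>By Cramer's rule the coefficients are quotients of two such determinants, of which the
  denominator is maximal; the same argument produces Auerbach bases.\<close>

lemma maximal_columns_span:
 assumes "max_minor A = \<bar>det (sel_cols A sg)\<bar>"
 shows "EX s. (ALL i. \<bar>s $ i\<bar> <= 1) & sel_cols A sg *v s = (\<chi> i. case c of Inl k => A $ i $ k | Inr k => mat 1 $ i $ k)"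
proof -
 let ?B = "sel_cols A sg" and ?x = "\<chi> i. case c of Inl k => A $ i $ k | Inr k => mat 1 $ i $ k"
 have d: "det ?B ~= 0" using assms max_minor_ge_1[of A] by auto
 define s where "s = (\<chi> k. det (\<chi> i j. if j = k then ?x $ i else ?B $ i $ j) / det ?B)"
 have "?B *v s = ?x" using cramer[OF d] s_def by blast
 moreover have "\<bar>s $ k\<bar> <= 1" for k
 proof -
  have "(\<chi> i j. if j = k then ?x $ i else ?B $ i $ j) = sel_cols A (sg(k := c))"
  by (simp add: sel_cols_def vec_eq_iff)
  hence "\<bar>s $ k\<bar> = \<bar>det (sel_cols A (sg(k := c)))\<bar> / \<bar>det ?B\<bar>" by (simp add: s_def)
  also have "... <= 1" using max_minor_ge[of A "sg(k := c)"] assms d by (simp add: divide_le_eq)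
  finally show ?thesis .
 qed
 ultimately show ?thesis by blast
qed

lemma maximal_columns_cover:
 fixes A :: "real ^ 'n ^ 'n"
 assumes "max_minor A = \<bar>det (sel_cols A sg)\<bar>" and ab: "!!i. \<bar>a $ i\<bar> <= 1" "!!i. \<bar>b $ i\<bar> <= 1"
 shows "EX s. (ALL i. \<bar>s $ i\<bar> <= 2 * real CARD('n)) & A *v a + b = sel_cols A sg *v s"
proof -
 let ?B = "sel_cols A sg"
 obtain s where s: "!!c i. \<bar>s c $ i\<bar> <= 1" "!!c. ?B *v s c = (\<chi> i. case c of Inl k => A $ i $ k | Inr k => mat 1 $ i $ k)"
  using maximal_columns_span[OF assms(1)] by metis
 let ?s = "(SUM k:UNIV. a $ k *\<^sub>R s (Inl k)) + (SUM k:UNIV. b $ k *\<^sub>R s (Inr k))"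
 have "A *v a = (SUM k:UNIV. a $ k *\<^sub>R (?B *v s (Inl k)))"
  unfolding s(2) by (simp add: matrix_vector_mult_def vec_eq_iff mult.commute)
 moreover have "b = (SUM k:UNIV. b $ k *\<^sub>R (?B *v s (Inr k)))"
  unfolding s(2) by (simp add: mat_def vec_eq_iff if_distrib sum.delta cong: if_cong)
 ultimately have "A *v a + b = ?B *v ?s"
  by (simp add: matrix_vector_right_distrib linear_sum[OF matrix_vector_mul_linear] linear_cmul[OF matrix_vector_mul_linear])
 moreover have "\<bar>?s $ i\<bar> <= 2 * real CARD('n)" for i
 proof -
  have "\<bar>(SUM k:UNIV. u $ k *\<^sub>R s (f k)) $ i\<bar> <= real CARD('n)" if "!!i. \<bar>u $ i\<bar> <= 1" for u :: "real ^ 'n" and f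
  proof -
  have "\<bar>(SUM k:UNIV. u $ k *\<^sub>R s (f k)) $ i\<bar> <= (SUM k:UNIV. \<bar>u $ k * s (f k) $ i\<bar>)"
  by simp
  also have "... <= (SUM k:(UNIV::'n set). 1)" using that s(1) by (intro sum_mono) (simp add: abs_mult mult_le_one)
  finally show ?thesis by simp
  qed
  from this[of a Inl, OF ab(1)] this[of b Inr, OF ab(2)] show ?thesis unfolding vector_add_component by linarith
 qed
 ultimately show ?thesis by blast
qed

lemma measure_cube:
 fixes a :: "real ^ 'n"
 assumes "h > 0"
 shows "measure lebesgue (box a (\<chi> i. a $ i + h)) = h ^ CARD('n)" "measure lebesgue (cbox a (\<chi> i. a $ i + h)) = h ^ CARD('n)"
proof -
 have "a : cbox a (\<chi> i. a $ i + h)" using assms by (simp add: mem_box_cart)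
 hence ne: "cbox a (\<chi> i. a $ i + h) ~= {}" by blast
 show 2: "measure lebesgue (cbox a (\<chi> i. a $ i + h)) = h ^ CARD('n)" using content_cbox_cart[OF ne] by simp
 have "measure lborel (box a (\<chi> i. a $ i + h)) = measure lborel (cbox a (\<chi> i. a $ i + h))"
  by (simp add: measure_lborel_box_eq measure_lborel_cbox_eq)
 thus "measure lebesgue (box a (\<chi> i. a $ i + h)) = h ^ CARD('n)" using 2 by simp
qed

text \<open>The cells of side \<open>1 / 2\<close> at the grid points are disjoint, and the inverse
  of the maximal selection \<open>B\<close> sends all of them into a cube of side
  \<open>12 m\<close>. Comparing volumes bounds their number by \<open>(12 m)^m * 2^m\<close> times
  the largest minor.\<close>

lemma grid_count:
 fixes A :: "real ^ 'n ^ 'n"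
 defines "K == {k :: int ^ 'n. EX a b. (ALL i. \<bar>a $ i\<bar> <= 1) & (ALL i. \<bar>b $ i\<bar> <= 2) & (\<chi> i. of_int (k $ i) / 2) = A *v a + b}"
 shows "finite K" "real (card K) <= (24 * real CARD('n)) ^ CARD('n) * max_minor A"
proof -
 obtain sg where sg: "max_minor A = \<bar>det (sel_cols A sg)\<bar>" by (rule max_minor_attained)
 define B where "B = sel_cols A sg"
 define m where "m = real CARD('n)"
 have d: "det B ~= 0" using sg max_minor_ge_1[of A] by (auto simp: B_def)
 then obtain B' where B': "B ** B' = mat 1" "B' ** B = mat 1"
  using invertible_det_nz[of B] unfolding invertible_def by blast
 have dB': "\<bar>det B'\<bar> = 1 / \<bar>det B\<bar>"
  using arg_cong[OF B'(1), of det] d by (simp add: det_mul field_simps flip: abs_mult)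
 define c where "c = (%k :: int ^ 'n. box (\<chi> i. of_int (k $ i) / 2) (\<chi> i. (\<chi> i. of_int (k $ i) / 2) $ i + 1 / 2) :: (real ^ 'n) set)"
 define T :: "(real ^ 'n) set" where "T = cbox (\<chi> i. - (6 * m)) (\<chi> i. (\<chi> i. - (6 * m)) $ i + 12 * m)"
 have mpos: "m > 0" by (simp add: m_def)
 have mT: "measure lebesgue T = (12 * m) ^ CARD('n)" unfolding T_def by (rule measure_cube) (simp add: mpos)
 have mc: "measure lebesgue (c k) = (1 / 2) ^ CARD('n)" for k unfolding c_def by (rule measure_cube) simp
 have cT: "(%x. B' *v x) ` c k <= T" if k: "k : K" for k
 proof (rule image_subsetI)
  fix x assume x: "x : c k"
  obtain a b where ab: "ALL i. \<bar>a $ i\<bar> <= 1" "ALL i. \<bar>b $ i\<bar> <= 2" "(\<chi> i. of_int (k $ i) / 2) = A *v a + b"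
  using k by (auto simp: K_def)
  define w where "w = x - (\<chi> i. of_int (k $ i) / 2)"
  have w: "\<bar>w $ i\<bar> <= 1" for i
  using x by (auto simp: w_def c_def mem_box_cart abs_le_iff dest!: spec[of _ i])
  \<comment> \<open>The position \<open>w\<close> in the cell contributes up to \<open>1\<close>
    besides the \<open>2\<close> of \<open>b\<close>; division by \<open>3\<close> brings
    \<open>b + w\<close> into the unit cube, and undoing it turns coefficients of size
    \<open>2 m\<close> into \<open>6 m\<close>, half the side of the cube.\<close>
  have "\<bar>((1/3) *\<^sub>R a) $ i\<bar> <= 1" "\<bar>((1/3) *\<^sub>R (b + w)) $ i\<bar> <= 1" for i
  using ab(1,2) w[of i] by (auto simp: abs_le_iff dest!: spec[of _ i])
  then obtain s where s: "ALL i. \<bar>s $ i\<bar> <= 2 * m" "A *v ((1/3) *\<^sub>R a) + (1/3) *\<^sub>R (b + w) = B *v s"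
  using maximal_columns_cover[OF sg] unfolding B_def m_def by blast
  have "x = A *v a + b + w" using ab(3) by (simp add: w_def)
  also have "... = 3 *\<^sub>R (A *v ((1/3) *\<^sub>R a) + (1/3) *\<^sub>R (b + w))"
  by (simp add: matrix_vector_mult_scaleR algebra_simps)
  finally have "B' *v x = 3 *\<^sub>R (B' *v (B *v s))" unfolding s(2) by (simp add: matrix_vector_mult_scaleR)
  also have "... = 3 *\<^sub>R s" by (simp add: matrix_vector_mul_assoc B')
  finally have "B' *v x = 3 *\<^sub>R s" .
  thus "B' *v x : T"
  proof -
  have "- (2 * m) <= s $ i & s $ i <= 2 * m" for i using spec[OF s(1), of i] by linarith
  thus ?thesis using \<open>B' *v x = 3 *\<^sub>R s\<close> by (simp add: T_def mem_box_cart)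
  qed
 qed
 have lin: "((%x. B' *v x) has_derivative (%x. B' *v x)) (at x within X)" for x X
  by (simp add: bounded_linear_imp_has_derivative)
 have injB: "inj (%x. B' *v x)" by (rule inj_on_inverseI[of _ "%x. B *v x"]) (simp add: matrix_vector_mul_assoc B')
 have meas: "(%x. B' *v x) ` c k : lmeasurable" "\<bar>det B'\<bar> * (1 / 2) ^ CARD('n) <= measure lebesgue ((%x. B' *v x) ` c k)" for k
 proof -
  have "open (c k)" "bounded (c k)" by (simp_all add: c_def open_box bounded_box)
  moreover from this have "bounded ((%x. B' *v x) ` c k)"
  by (intro bounded_linear_image matrix_vector_mul_bounded_linear)
  ultimately have 1: "\<bar>det B'\<bar> * measure lebesgue (c k) <= measure lebesgue ((%x. B' *v x) ` c k)" "open ((%x. B' *v x) ` c k)"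
  using measure_image_ge[of "c k" "(%x. B' *v x)" "%x. (%x. B' *v x)" "\<bar>det B'\<bar>"] lin inj_on_subset[OF injB] d dB'
  by auto
  thus "\<bar>det B'\<bar> * (1 / 2) ^ CARD('n) <= measure lebesgue ((%x. B' *v x) ` c k)" "(%x. B' *v x) ` c k : lmeasurable"
  using \<open>bounded ((%x. B' *v x) ` c k)\<close> by (simp_all add: mc lmeasurable_open)
 qed
 have cdisj: "k = k'" if "x : c k" "x : c k'" for k k' x
 proof -
  have "k $ i = k' $ i" for i
  proof -
  have "of_int (k $ i) / 2 < x $ i" "x $ i < of_int (k $ i) / 2 + 1 / 2" "of_int (k' $ i) / 2 < x $ i" "x $ i < of_int (k' $ i) / 2 + 1 / 2"
  using that by (auto simp: c_def mem_box_cart)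
  hence "real_of_int (k $ i) < real_of_int (k' $ i) + 1" "real_of_int (k' $ i) < real_of_int (k $ i) + 1" by linarith+
  thus ?thesis by linarith
  qed
  thus ?thesis by (simp add: vec_eq_iff)
 qed
 have bound: "real (card X) <= (24 * m) ^ CARD('n) * max_minor A" if X: "X <= K" "finite X" for X
 proof -
  have one: "card {k : X. w : (%x. B' *v x) ` c k} <= 1" for w
  proof -
  have "k = k'" if "w : (%x. B' *v x) ` c k" "w : (%x. B' *v x) ` c k'" for k k'
  using that cdisj injD[OF injB] by blast
  thus ?thesis using X(2) by (simp add: card_le_Suc0_iff_eq)
  qed
  have "real (card X) * (\<bar>det B'\<bar> * (1 / 2) ^ CARD('n)) = (SUM k:X. \<bar>det B'\<bar> * (1 / 2) ^ CARD('n))"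
  by simp
  also have "... <= (SUM k:X. measure lebesgue ((%x. B' *v x) ` c k))" using meas(2) by (rule sum_mono)
  also have "... <= 1 * measure lebesgue T"
  proof (rule measure_pigeonhole[OF X(2)])
  show "T : lmeasurable" by (simp add: T_def)
  show "(%x. B' *v x) ` c k <= T" if "k : X" for k using cT that X(1) by blast
  show "real (card {k : X. w : (%x. B' *v x) ` c k}) <= 1" for w using one[of w] by simp
  qed (rule meas(1))
  finally have "real (card X) * (1 / \<bar>det B\<bar> * (1 / 2) ^ CARD('n)) <= (12 * m) ^ CARD('n)"
  by (simp add: mT dB')
  hence "real (card X) <= (12 * m) ^ CARD('n) * 2 ^ CARD('n) * \<bar>det B\<bar>"
  using d by (simp add: field_simps power_divide)
  also have "(12 * m) ^ CARD('n) * 2 ^ CARD('n) = (24 * m) ^ CARD('n)" unfolding power_mult_distrib[symmetric] by simp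
  finally show ?thesis by (simp add: sg B_def)
 qed
 hence "card X <= nat \<lfloor>(24 * m) ^ CARD('n) * max_minor A\<rfloor>" if "X <= K" "finite X" for X
  using that by (metis le_nat_floor)
 thus fK: "finite K" using finite_if_finite_subsets_card_bdd by blast
 show "real (card K) <= (24 * real CARD('n)) ^ CARD('n) * max_minor A"
  using bound[OF subset_refl fK] by (simp add: m_def)
qed

lemma norm_le_cube:
 fixes v :: "real ^ 'n"
 assumes "!!i. \<bar>v $ i\<bar> <= e" shows "norm v <= real CARD('n) * e"
proof -
 have "(SUM i:(UNIV::'n set). \<bar>v $ i\<bar>) <= (SUM i:(UNIV::'n set). e)" using assms by (intro sum_mono)
 thus ?thesis using norm_le_l1_cart[of v] by simp
qed

abbreviation cover_bound :: "(real ^ 'n => real ^ 'n) => real"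
 where "cover_bound T == (24 * real CARD('n)) ^ CARD('n) * max_minor (matrix T)"

context simply_connected_solvable_lie_group_R begin

text \<open>On a small cube in the chart \<open>E\<close> is nearly its derivative, so grid points
  counted in \<open>grid_count\<close> suffice: after rounding and dividing by the grid point, the
  remainder is again in the cube. The same cube can therefore be used at every iteration. The
  tolerance \<open>1 / m\<close> compensates for passing between norms and coordinates.\<close>

lemma expanding_cover:
 assumes E: "diff_end E M" and V: "open V" "\<one> : V"
 obtains B Q Y where "open Q" "\<one> : Q" "Q <= B" "B <= V" "finite Y"
  "real (card Y) <= (24 * real CARD('n)) ^ CARD('n) * max_minor (matrix M)" "!!x. x : B ==> EX y:Y. inv y *. E x : B"
proof -
 define m where "m = real CARD('n)"
 have m: "m >= 1" by (simp add: m_def Suc_leI)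
 define F where "F = (%v. crd (E (loc v)))"
 have F: "(F has_derivative M) (at 0)" and F0: "F 0 = 0"
  using E by (simp_all add: F_def diff_end_def diff_end_one[OF E])
 have lin: "bounded_linear M" by (rule diff_end_linear[OF E])
 obtain b where b: "b > 0" "!!v. norm (M v) <= norm v * b" using bounded_linear.pos_bounded[OF lin] by blast
 have "1 / m > 0" using m by simp
 then obtain d1 where d1: "d1 > 0" "!!v. norm v < d1 ==> norm (F v - M v) <= 1 / m * norm v"
  using F unfolding has_derivative_at_alt by (auto simp: F0 dest!: spec[of _ "1 / m"])
 obtain d2 where d2: "d2 > 0" "!!x y. x : ball (0, 0) d2 ==> y : ball (0, 0) d2 ==>
  norm (divc x - divc y - (case x - y of (a, b) => b - a)) <= 1 / m * norm (x - y)"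
  by (rule sderivD[OF divc_sderiv_0 \<open>1 / m > 0\<close>]) (rule that; assumption)
 have "open {v : cdom. E (loc v) : nbh}" "0 : {v : cdom. E (loc v) : nbh}"
  using open_loc_vimage[OF _ nbh(1), of E] E cdom nbh(2) by (auto simp: diff_end_one[OF E] diff_end_def)
 then obtain d3 where d3: "d3 > 0" "ball 0 d3 <= {v : cdom. E (loc v) : nbh}" using open_contains_ball by blast
 obtain d4 where d4: "d4 > 0" "ball (0, 0) d4 <= div_dom" using open_div_dom zero_div_dom open_contains_ball by blast
 obtain d5 where d5: "d5 > 0" "cball 0 d5 <= cdom" "!!u. u : cball 0 d5 ==> loc u : V"
  by (rule loc_near[OF V]) (rule that; assumption)
 define d where "d = Min {d1, d2, d3, d4, d5}"
 have d: "d > 0" "d <= d1" "d <= d2" "d <= d3" "d <= d4" "d <= d5"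
  using d1(1) d2(1) d3(1) d4(1) d5(1) by (auto simp: d_def)
 \<comment> \<open>Images of the cube have norm at most \<open>(b + 1) * (m * e)\<close>, and
   rounding adds at most \<open>m * (e / 2)\<close>; so \<open>R * e < d\<close> keeps the pairs
   \<open>(z, v)\<close> and \<open>(z, z)\<close> below in the range of all local
   estimates.\<close>
 define R where "R = (2 * (b + 1) + 2) * m"
 have R: "R > 0" "m <= R"
 proof -
  show "R > 0" unfolding R_def using b(1) m by (intro mult_pos_pos) auto
  have "1 * m <= (2 * (b + 1) + 2) * m" using b(1) m by (intro mult_right_mono) auto
  thus "m <= R" by (simp add: R_def)
 qed
 define e where "e = d / (2 * R)"
 have e: "e > 0" "R * e < d" using R d by (simp_all add: e_def)
 define Q where "Q = {v :: real ^ 'n. ALL i. \<bar>v $ i\<bar> <= e}"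
 have Qn: "norm v <= m * e" "norm v < d" if "v : Q" for v
 proof -
  show "norm v <= m * e" using norm_le_cube[of v e] that by (simp add: Q_def m_def)
  also have "... <= R * e" using R(2) e(1) by simp
  finally show "norm v < d" using e(2) by simp
 qed
 have Qcdom: "v : cdom" "loc v : V" if "v : Q" for v
  using subsetD[OF d5(2), of v] d5(3)[of v] Qn(2)[OF that] d by auto
 define K where "K = {k :: int ^ 'n. EX a b. (ALL i. \<bar>a $ i\<bar> <= 1) & (ALL i. \<bar>b $ i\<bar> <= 2) & (\<chi> i. of_int (k $ i) / 2) = matrix M *v a + b}"
 define Y where "Y = (%k. loc (\<chi> i. e * (of_int (k $ i) / 2))) ` K"
 have K: "finite K" "real (card K) <= (24 * real CARD('n)) ^ CARD('n) * max_minor (matrix M)"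
  unfolding K_def by (rule grid_count)+
 show thesis
 proof (rule that[of "loc ` ball 0 e" "loc ` Q" Y])
  have be: "ball 0 e <= Q"
  proof
  fix x :: "real ^ 'n" assume "x : ball 0 e"
  hence "\<bar>x $ i\<bar> <= e" for i using component_le_norm_cart[of x i] by simp
  thus "x : Q" by (simp add: Q_def)
  qed
  thus "loc ` ball 0 e <= loc ` Q" by blast
  show "open (loc ` ball 0 e)" using be Qcdom(1) by (intro open_loc_image) auto
  show "\<one> : loc ` ball 0 e" using e(1) by (intro image_eqI[of _ _ 0]) auto
  show "loc ` Q <= V" using Qcdom(2) by blast
  show "finite Y" using K(1) by (simp add: Y_def)
  have "real (card Y) <= real (card K)" unfolding Y_def using card_image_le[OF K(1)] by simp
  thus "real (card Y) <= (24 * real CARD('n)) ^ CARD('n) * max_minor (matrix M)" using K(2) by linarith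
 next
  fix x assume "x : loc ` Q"
  then obtain u where u: "u : Q" "x = loc u" by blast
  define v where "v = F u"
  have un: "norm u < d" "norm u <= m * e" using Qn u by auto
  have "u : ball 0 d3" using un(1) d(4) by simp
  hence "E (loc u) : nbh" using d3(2) by blast
  hence v: "loc v = E x" by (simp add: v_def F_def u(2) loc_crd)
  have err: "norm (v - M u) <= e"
  proof -
  have "norm (v - M u) <= 1 / m * norm u" unfolding v_def using d1(2) un d by auto
  also have "... <= 1 / m * (m * e)" using m un(2) by (intro mult_left_mono) auto
  finally show ?thesis using m by simp
  qed
  \<comment> \<open>Rounding down to the grid of mesh \<open>e / 2\<close> leaves coordinates
    between \<open>0\<close> and \<open>e / 2\<close>; the other half of \<open>e\<close> absorbs
    the deviation of \<open>divc (z, v)\<close> from \<open>v - z\<close>.\<close>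
  define k :: "int ^ 'n" where "k = (\<chi> i. \<lfloor>v $ i / (e / 2)\<rfloor>)"
  define z where "z = (\<chi> i. e * (of_int (k $ i) / 2))"
  have vz: "0 <= (v - z) $ i" "(v - z) $ i <= e / 2" for i
  proof -
  have "real_of_int (k $ i) <= v $ i / (e / 2)" "v $ i / (e / 2) <= real_of_int (k $ i) + 1"
  unfolding k_def by simp_all
  thus "0 <= (v - z) $ i" "(v - z) $ i <= e / 2" using e(1) by (simp_all add: z_def field_simps)
  qed
  have kK: "k : K"
  proof -
  let ?a = "(1 / e) *\<^sub>R u" and ?b = "(\<chi> i. of_int (k $ i) / 2) - M ((1 / e) *\<^sub>R u)"
  have "\<bar>?a $ i\<bar> <= 1" for i using u(1) e(1) by (simp add: Q_def abs_mult field_simps)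
  \<comment> \<open>In units of \<open>e\<close>, the nonlinearity of \<open>E\<close> contributes
    at most \<open>1\<close> and the rounding at most \<open>1 / 2\<close>, within the
    \<open>2\<close> allowed in \<open>grid_count\<close>.\<close>
  moreover have "\<bar>?b $ i\<bar> <= 2" for i
  proof -
  have "\<bar>(v - M u) $ i\<bar> <= e" using err component_le_norm_cart order_trans by blast
  moreover have "e * ?b $ i = (v - M u) $ i - (v - z) $ i"
  using e(1) by (simp add: z_def linear_cmul[OF bounded_linear.linear[OF lin]] field_simps)
  ultimately have "\<bar>e * ?b $ i\<bar> <= 2 * e" using vz[of i] e(1) by linarith
  thus ?thesis using e(1) by (simp add: abs_mult)
  qed
  moreover have "(\<chi> i. of_int (k $ i) / 2) = matrix M *v ?a + ?b"
  using fun_cong[OF matrix_vector_mul(2)[OF bounded_linear.linear[OF lin]]] by simp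
  ultimately show ?thesis unfolding K_def by blast
  qed
  have nvz: "norm (v - z) <= m * (e / 2)"
  using norm_le_cube[of "v - z" "e / 2"] vz by (auto simp: m_def abs_le_iff intro: order_trans)
  have nv: "norm v <= (b + 1) * (m * e)"
  proof -
  have "norm v <= norm (M u) + norm (v - M u)" by norm
  also have "... <= norm u * b + e" using b(2)[of u] err by linarith
  also have "... <= (m * e) * b + m * e" using un(2) b(1) m e(1) by (intro add_mono mult_right_mono) auto
  finally show ?thesis by (simp add: algebra_simps)
  qed
  have nz: "norm z <= norm v + norm (v - z)" by norm
  have "norm z + norm v <= 2 * ((b + 1) * (m * e)) + m * (e / 2)" "norm z + norm z <= 2 * ((b + 1) * (m * e)) + m * e"
  using nz nv nvz by linarith+
  moreover have "2 * ((b + 1) * (m * e)) + m * e <= R * e" "m * (e / 2) <= m * e"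
  using m e(1) by (simp_all add: R_def algebra_simps)
  ultimately have "norm z + norm v < d" "norm z + norm z < d" using e(2) by linarith+
  hence zv: "(z, v) : ball (0, 0) d" "(z, z) : ball (0, 0) d"
  using norm_Pair_le[of "- z" "- v"] norm_Pair_le[of "- z" "- z"] by (simp_all add: dist_norm)
  have "(z, v) : div_dom" using zv(1) d4(2) d by auto
  hence "loc (divc (z, v)) = inv (loc z) *. E x" by (simp add: div_dom_def divc_def loc_crd v)
  moreover have "divc (z, v) : Q" unfolding Q_def mem_Collect_eq
  proof
  fix i
  have "norm (divc (z, v) - (v - z)) <= 1 / m * norm (v - z)"
  using d2(2)[of "(z, v)" "(z, z)"] zv d by (auto simp: divc_def norm_Pair)
  also have "... <= 1 / m * (m * (e / 2))" using m nvz by (intro mult_left_mono) auto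
  finally have "\<bar>(divc (z, v) - (v - z)) $ i\<bar> <= e / 2"
  using m component_le_norm_cart[of "divc (z, v) - (v - z)" i] by simp
  thus "\<bar>divc (z, v) $ i\<bar> <= e" using vz[of i] unfolding vector_minus_component by linarith
  qed
  moreover have "loc z : Y" unfolding Y_def z_def using kK by (rule imageI)
  ultimately show "EX y:Y. inv y *. E x : loc ` Q"
  by (intro bexI[of _ "loc z"] image_eqI[of _ _ "divc (z, v)"]) simp_all
 qed
qed

text \<open>The code of \<open>x\<close> consists of a piece of an initial cover of \<open>F\<close>
  and of the choices that \<open>expanding_cover\<close> makes for \<open>D^q\<close> in
  \<open>n div q\<close> rounds. Points with equal codes have their images in a common translate of
  \<open>B\<close>, so the quotient of the images is small; so is the quotient of the points, since
  the code determines the initial piece.\<close>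

theorem itineraries:
 assumes D: "diff_end D L" and F: "compact F" and V: "open V" "\<one> : V" and q: "q > 0"
 obtains K N where "N > 0" "real N <= cover_bound (L ^^ q)"
  "!!n. EX c :: 's => nat. (ALL x:F. c x < K * N ^ (n div q)) &
  (ALL x:F. ALL y:F. c x = c y --> inv x *. y : V & (D ^^ n) (inv x *. y) : V)"
proof -
 have Dn: "diff_end (D ^^ k) (L ^^ k)" for k by (rule diff_end_funpow[OF D])
 \<comment> \<open>The last \<open>n mod q\<close> iterations follow no code; \<open>V1\<close> is
   so small that fewer than \<open>q\<close> further applications of \<open>D\<close> do not leave
   \<open>V\<close>.\<close>
 define V1 where "V1 = V Int (INT k<q. (D ^^ k) -` V)"
 have V1: "open V1" "\<one> : V1"
  using V Dn diff_end_one[OF Dn] by (auto simp: V1_def diff_end_def intro!: open_INT open_vimage)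
 obtain W where W: "open W" "\<one> : W" "!!a b. a : W ==> b : W ==> a *. inv b : V1"
  by (rule small_quotients[OF V1]) (rule that; assumption)
 define W' where "W' = (%x. inv x) -` W"
 have W': "open W'" "\<one> : W'" using W(1,2) by (auto simp: W'_def intro!: open_vimage group_cont)
 obtain B Q Y where B: "open Q" "\<one> : Q" "Q <= B" "B <= W'" "finite Y"
  "real (card Y) <= cover_bound (L ^^ q)" "!!x. x : B ==> EX y:Y. inv y *. (D ^^ q) x : B"
  by (rule expanding_cover[OF Dn[of q] W']) (rule that; assumption)
 have div: "inv x *. y : V1" if "inv z *. x : B" "inv z *. y : B" for x y z
 proof -
  have "inv (inv z *. x) *. inv (inv (inv z *. y)) : V1" using that B(4) by (intro W(3)) (auto simp: W'_def)
  thus ?thesis by (simp add: inv_mult_group m_assoc)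
 qed
 define N where "N = card Y"
 have N: "N > 0" using B(2,3,5,7) by (auto simp: N_def card_gt_0_iff)
 obtain e where e: "bij_betw e {0..<N} Y" using ex_bij_betw_nat_finite[OF B(5)] unfolding N_def by blast
 have oQ: "open {h. inv z *. h : Q}" for z using open_ltrans[OF B(1)] .
 have "F <= \<Union>((%z. {h. inv z *. h : Q}) ` F)" using B(2) by auto
 then obtain Z where Z: "Z <= F" "finite Z" "F <= \<Union>((%z. {h. inv z *. h : Q}) ` Z)"
  by (rule compactE_image[OF F oQ]) (rule that; assumption)
 define K where "K = card Z"
 obtain z0 where z0: "bij_betw z0 {0..<K} Z" using ex_bij_betw_nat_finite[OF Z(2)] unfolding K_def by blast
 have "EX i<K. inv (z0 i) *. x : B" if xF: "x : F" for x
 proof -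
  obtain z where "z : Z" "inv z *. x : Q" using Z(3) xF by blast
  thus ?thesis using z0 B(3) by (auto simp: bij_betw_def)
 qed
 hence "ALL x:F. EX i. i < K & inv (z0 i) *. x : B" by simp
 from bchoice[OF this] obtain c0 where "ALL x:F. c0 x < K & inv (z0 (c0 x)) *. x : B" ..
 hence c0: "!!x. x : F ==> c0 x < K" "!!x. x : F ==> inv (z0 (c0 x)) *. x : B" by simp_all
 have step: "EX c z. ALL x:F. c x < K * N ^ k & inv (z (c x)) *. (D ^^ (q * k)) x : B & (ALL y:F. c x = c y --> c0 x = c0 y)" for k
 proof (induction k)
  case 0
  thus ?case using c0 by (intro exI[of _ c0] exI[of _ z0]) auto
 next
  case (Suc k)
  then obtain c z where c': "ALL x:F. c x < K * N ^ k & inv (z (c x)) *. (D ^^ (q * k)) x : B & (ALL y:F. c x = c y --> c0 x = c0 y)"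
  by (elim exE)
  hence c: "!!x. x : F ==> c x < K * N ^ k" "!!x. x : F ==> inv (z (c x)) *. (D ^^ (q * k)) x : B"
  "!!x y. x : F ==> y : F ==> c x = c y ==> c0 x = c0 y" by blast+
  have "EX j<N. inv (e j) *. (D ^^ q) (inv (z (c x)) *. (D ^^ (q * k)) x) : B" if xF: "x : F" for x
  proof -
  obtain y where "y : Y" "inv y *. (D ^^ q) (inv (z (c x)) *. (D ^^ (q * k)) x) : B"
  using B(7)[OF c(2)[OF xF]] by blast
  thus ?thesis using e by (auto simp: bij_betw_def)
  qed
  hence "ALL x:F. EX j. j < N & inv (e j) *. (D ^^ q) (inv (z (c x)) *. (D ^^ (q * k)) x) : B" by simp
  from bchoice[OF this] obtain j where "ALL x:F. j x < N & inv (e (j x)) *. (D ^^ q) (inv (z (c x)) *. (D ^^ (q * k)) x) : B" ..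
  hence j: "!!x. x : F ==> j x < N"
  "!!x. x : F ==> inv (e (j x)) *. (D ^^ q) (inv (z (c x)) *. (D ^^ (q * k)) x) : B" by simp_all
  define c' where "c' = (%x. c x * N + j x)"
  \<comment> \<open>Codes are written to base \<open>N\<close>: the last digit is the new choice,
    the quotient is the previous code, and \<open>z'\<close> decodes both.\<close>
  define z' where "z' = (%i. (D ^^ q) (z (i div N)) *. e (i mod N))"
  have dm: "c' x div N = c x" "c' x mod N = j x" if "x : F" for x using j(1)[OF that] by (simp_all add: c'_def)
  show ?case
  proof (intro exI ballI conjI impI)
  fix x assume x: "x : F"
  have "c' x < (c x + 1) * N" using j(1)[OF x] by (simp add: c'_def algebra_simps)
  also have "... <= K * N ^ k * N" using c(1)[OF x] by (intro mult_right_mono) auto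
  finally show "c' x < K * N ^ Suc k" by (simp add: algebra_simps)
  have "(D ^^ q) ((D ^^ (q * k)) x) = (D ^^ (q * Suc k)) x" by (simp add: funpow_add)
  thus "inv (z' (c' x)) *. (D ^^ (q * Suc k)) x : B"
  using j(2)[OF x] by (simp add: z'_def dm[OF x] diff_end_mult[OF Dn] diff_end_inv[OF Dn] inv_mult_group m_assoc)
  fix y assume y: "y : F" "c' x = c' y"
  have "c x = c y" using dm[OF x] dm[OF y(1)] y(2) by simp
  thus "c0 x = c0 y" by (rule c(3)[OF x y(1)])
  qed
 qed
 show ?thesis
 proof
  show "N > 0" by (rule N)
  show "real N <= cover_bound (L ^^ q)" using B(6) by (simp add: N_def)
  fix n
  obtain c z where c': "ALL x:F. c x < K * N ^ (n div q) & inv (z (c x)) *. (D ^^ (q * (n div q))) x : B & (ALL y:F. c x = c y --> c0 x = c0 y)"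
  using step[of "n div q"] by (elim exE)
  hence c: "!!x. x : F ==> c x < K * N ^ (n div q)" "!!x. x : F ==> inv (z (c x)) *. (D ^^ (q * (n div q))) x : B"
  "!!x y. x : F ==> y : F ==> c x = c y ==> c0 x = c0 y" by blast+
  show "EX c. (ALL x:F. c x < K * N ^ (n div q)) &
  (ALL x:F. ALL y:F. c x = c y --> inv x *. y : V & (D ^^ n) (inv x *. y) : V)"
  proof (intro exI[of _ c] conjI ballI impI)
  fix x y assume xy: "x : F" "y : F" "c x = c y"
  have "c0 x = c0 y" by (rule c(3)[OF xy])
  thus "inv x *. y : V" using div[of "z0 (c0 x)" x y] c0(2)[OF xy(1)] c0(2)[OF xy(2)] by (simp add: V1_def)
  have "(D ^^ (q * (n div q))) (inv x *. y) : V1"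
  using div[of "z (c x)" "(D ^^ (q * (n div q))) x" "(D ^^ (q * (n div q))) y"] c(2)[OF xy(1)] c(2)[OF xy(2)] xy(3)
  by (simp add: diff_end_mult[OF Dn] diff_end_inv[OF Dn])
  moreover have "n mod q < q" using q by simp
  ultimately have "(D ^^ (n mod q)) ((D ^^ (q * (n div q))) (inv x *. y)) : V" unfolding V1_def by blast
  moreover have "(D ^^ (n mod q)) ((D ^^ (q * (n div q))) (inv x *. y)) = (D ^^ n) (inv x *. y)"
  by (metis comp_apply funpow_add mod_mult_div_eq)
  ultimately show "(D ^^ n) (inv x *. y) : V" by simp
  qed (rule c(1))
 qed
qed

end

section \<open>Exterior powers\<close>

text \<open>Linear dependence is a property of sets, so a repeated vector, which gives a relation at
  once, is treated apart.\<close>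

lemma linear_relation:
 fixes w :: "nat => complex ^ 'k"
 shows "EX u. (EX i<=CARD('k). u i ~= 0) & (SUM i<=CARD('k). u i *s w i) = 0"
proof (cases "inj_on w {..CARD('k)}")
 case True
 hence "card (w ` {..CARD('k)}) = Suc CARD('k)" by (simp add: card_image)
 hence "vec.dependent (w ` {..CARD('k)})"
  using vec.independent_card_le_dim[of "w ` {..CARD('k)}" UNIV] by (auto simp: card_cart_basis)
 then obtain u where "EX v:w ` {..CARD('k)}. u v ~= 0" "(SUM v:w ` {..CARD('k)}. u v *s v) = 0"
  by (subst (asm) vec.dependent_finite) auto
 thus ?thesis using True by (intro exI[of _ "u o w"]) (auto simp: sum.reindex)
next
 case False
 then obtain i j where ij: "i <= CARD('k)" "j <= CARD('k)" "i ~= j" "w i = w j" by (auto simp: inj_on_def)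
 have "(SUM l<=CARD('k). (if l = i then 1 else if l = j then - 1 else 0) *s w l) =
  (SUM l<=CARD('k). (if l = i then w l else 0) - (if l = j then w l else 0))" using ij(3) by (intro sum.cong) auto
 also have "... = 0" using ij by (simp add: sum_subtractf sum.delta)
 finally show ?thesis using ij(1) by (intro exI[of _ "%l. if l = i then 1 else if l = j then - 1 else 0"]) auto
qed

text \<open>Produces an eigenvector modulo \<open>V\<close> without forming the quotient: take a
  nonzero polynomial \<open>p\<close> of least degree with \<open>p(A) x\<close> in
  \<open>V\<close>, split off a root \<open>a\<close>, and apply the other factor to
  \<open>x\<close>; minimality keeps the result outside \<open>V\<close>.\<close>

lemma quot_eigvec:
 fixes A :: "complex ^ 'k ^ 'k"
 assumes V: "vec.subspace V" and x: "x ~: V"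
 obtains y a where "y ~: V" "A *v y - a *s y : V"
proof -
 define w where "w = (%i. ((*v) A ^^ i) x)"
 define act where "act = (%p. SUM i<=degree p. Polynomial.coeff p i *s w i)"
 have act_eq: "act p = (SUM i<=N. Polynomial.coeff p i *s w i)" if "degree p <= N" for p N
  unfolding act_def using that by (intro sum.mono_neutral_left) (auto simp: coeff_eq_0)
 obtain u where u: "EX i<=CARD('k). u i ~= 0" "(SUM i<=CARD('k). u i *s w i) = 0" using linear_relation by blast
 define p0 where "p0 = (SUM i<=CARD('k). Polynomial.monom (u i) i)"
 have cp: "Polynomial.coeff p0 i = (if i <= CARD('k) then u i else 0)" for i
  by (auto simp: p0_def coeff_sum coeff_monom sum.delta)
 have "p0 ~= 0 & act p0 : V"
 proof
  show "p0 ~= 0" using u(1) cp by (metis coeff_0)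
  have "degree p0 <= CARD('k)" by (rule degree_le) (simp add: cp)
  thus "act p0 : V" using u(2) act_eq vec.subspace_0[OF V] by (simp add: cp)
 qed
 then obtain p where p: "p ~= 0" "act p : V" and min: "!!q. q ~= 0 ==> act q : V ==> degree p <= degree q"
  using ex_has_least_nat[of "%p. p ~= 0 & act p : V" p0 degree] by blast
 have "degree p ~= 0"
 proof
  assume "degree p = 0"
  then obtain c where "p = [:c:]" by (rule degree_eq_zeroE)
  hence "c ~= 0" "c *s x : V" using p by (auto simp: act_def w_def)
  hence "inverse c *s (c *s x) : V" using vec.subspace_scale[OF V] by blast
  moreover have "inverse c *s (c *s x) = x" using \<open>c ~= 0\<close> by (simp add: vector_smult_assoc)
  ultimately show False using x by simp
 qed
 then obtain a where "poly p a = 0" using fundamental_theorem_of_algebra[of p] by (metis constant_degree)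
 then obtain q where q: "p = [:- a, 1:] * q" by (metis dvdE poly_eq_0_iff_dvd)
 have "q ~= 0" using p(1) q by auto
 hence dq: "degree p = Suc (degree q)" by (simp add: q degree_mult_eq del: mult_pCons_left)
 have pq: "p = pCons 0 q - Polynomial.smult a q" by (simp add: q)
 have "act p = (SUM i<=Suc (degree q). Polynomial.coeff (pCons 0 q) i *s w i) - (SUM i<=Suc (degree q). (a * Polynomial.coeff q i) *s w i)"
  unfolding act_def dq by (simp add: pq vec.scale_left_diff_distrib sum_subtractf del: sum.atMost_Suc)
 also have "(SUM i<=Suc (degree q). Polynomial.coeff (pCons 0 q) i *s w i) = (SUM i<=degree q. Polynomial.coeff q i *s (A *v w i))"
  by (simp add: sum.atMost_Suc_shift w_def del: sum.atMost_Suc)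
 also have "... = A *v act q"
  by (simp add: act_def vec.scale_sum_right matrix_vector_mult_scaleR vec.linear_sum[OF matrix_vector_mul_linear_gen] vec.linear_scale[OF matrix_vector_mul_linear_gen])
 also have "(SUM i<=Suc (degree q). (a * Polynomial.coeff q i) *s w i) = a *s act q"
  using act_eq[of q "Suc (degree q)"] by (simp add: vec.scale_sum_right del: sum.atMost_Suc)
 finally have "A *v act q - a *s act q : V" using p(2) by simp
 moreover have "act q ~: V" using min[OF \<open>q ~= 0\<close>] dq by auto
 ultimately show ?thesis using that by blast
qed

text \<open>A basis is built one vector at a time, each an eigenvector modulo the span of its
  predecessors. The index type carries no order, so triangularity refers to a numbering
  \<open>rh\<close> of it.\<close>

theorem triangularise:
 fixes A :: "complex ^ 'k ^ 'k"
 obtains S S' and rh :: "'k => nat" where "inj rh" "S ** S' = mat 1" "S' ** S = mat 1"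
  "!!i j. rh j < rh i ==> (S' ** A ** S) $ i $ j = 0"
proof -
 have "EX b :: nat => complex ^ 'k. ALL i<k. b i ~: vec.span (b ` {..<i}) & A *v b i : vec.span (b ` {..i})" if "k <= CARD('k)" for k
  using that
 proof (induction k)
  case (Suc k)
  then obtain b :: "nat => complex ^ 'k" where b: "!!i. i < k ==> b i ~: vec.span (b ` {..<i}) & A *v b i : vec.span (b ` {..i})"
  by auto
  have "vec.span (b ` {..<k}) ~= UNIV"
  proof
  assume "vec.span (b ` {..<k}) = UNIV"
  hence "CARD('k) = vec.dim (b ` {..<k})" by (metis vec.dim_span vec_dim_card)
  also have "... <= card (b ` {..<k})" by (intro vec.dim_le_card') simp
  also have "... <= k" using card_image_le[of "{..<k}" b] by simp
  finally show False using Suc.prems by simp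
  qed
  then obtain x where "x ~: vec.span (b ` {..<k})" by blast
  then obtain y a where y: "y ~: vec.span (b ` {..<k})" "A *v y - a *s y : vec.span (b ` {..<k})"
  by (rule quot_eigvec[OF vec.subspace_span]) (rule that; assumption)
  define b' where "b' = b(k := y)"
  have b': "b' k = y" "!!i. i < k ==> b' i = b i" by (simp_all add: b'_def)
  have im: "b' ` {..<i} = b ` {..<i}" "i < k ==> b' ` {..i} = b ` {..i}" if "i <= k" for i
  using that b'(2) by (auto intro!: image_cong)
  have "A *v y : vec.span (b' ` {..k})"
  proof -
  have e: "b' ` {..k} = insert y (b ` {..<k})"
  using im(1)[OF order_refl] b'(1) by (simp add: lessThan_Suc_atMost[symmetric] lessThan_Suc)
  have "(A *v y - a *s y) + a *s y : vec.span (insert y (b ` {..<k}))"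
  by (intro vec.span_add vec.span_scale vec.span_base subsetD[OF vec.span_mono y(2)]) auto
  thus ?thesis by (simp add: e)
  qed
  thus ?case using b y(1) im b' by (intro exI[of _ b']) (auto simp: less_Suc_eq)
 qed simp
 from this[OF order_refl] obtain b :: "nat => complex ^ 'k" where
  b: "!!i. i < CARD('k) ==> b i ~: vec.span (b ` {..<i})" "!!i. i < CARD('k) ==> A *v b i : vec.span (b ` {..i})"
  by blast
 obtain rh :: "'k => nat" where rh: "bij_betw rh UNIV {0..<CARD('k)}" using ex_bij_betw_finite_nat[OF finite] by blast
 have rhl: "rh i < CARD('k)" and rhi: "inj rh" for i using rh by (auto simp: bij_betw_def)
 define S where "S = (\<chi> i j. b (rh j) $ i)"
 have Sv: "S *v c = (SUM j:UNIV. c $ j *s b (rh j))" for c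
  by (simp add: S_def matrix_vector_mult_def vec_eq_iff mult.commute)
 have ker: "c = 0" if c: "S *v c = 0" for c
 proof (rule ccontr)
  assume "c ~= 0"
  hence ne: "{j. c $ j ~= 0} ~= {}" by (auto simp: vec_eq_iff)
  have "EX i. c $ i ~= 0 & (ALL j. c $ j ~= 0 --> rh j <= rh i)"
  using ne finite_has_maximal[of "rh ` {j. c $ j ~= 0}"] by (metis (mono_tags, lifting) Max_ge Max_in empty_is_image finite finite_imageI imageE imageI mem_Collect_eq)
  then obtain i where i: "c $ i ~= 0" "!!j. c $ j ~= 0 ==> rh j <= rh i" by blast
  have "c $ i *s b (rh i) = - (SUM j:UNIV - {i}. c $ j *s b (rh j))"
  using c unfolding Sv by (simp add: sum.remove[of _ i] add_eq_0_iff2)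
  also have "... : vec.span (b ` {..<rh i})"
  proof (intro vec.span_neg vec.span_sum)
  fix j assume "j : UNIV - {i}"
  hence "c $ j = 0 \<or> rh j < rh i" using i(2)[of j] inj_eq[OF rhi, of j i] by (auto simp: le_less)
  thus "c $ j *s b (rh j) : vec.span (b ` {..<rh i})"
  proof
  assume "c $ j = 0"
  thus ?thesis by (simp add: vec.span_zero)
  next
  assume "rh j < rh i"
  thus ?thesis by (intro vec.span_scale vec.span_base) auto
  qed
  qed
  finally have "inverse (c $ i) *s (c $ i *s b (rh i)) : vec.span (b ` {..<rh i})" by (rule vec.span_scale)
  thus False using b(1)[OF rhl] i(1) by simp
 qed
 then obtain S' where S': "S' ** S = mat 1" using matrix_left_invertible_ker by blast
 hence S'': "S ** S' = mat 1" by (simp add: matrix_left_right_inverse)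
 have "(S' ** A ** S) $ i $ j = 0" if ij: "rh j < rh i" for i j
 proof -
  have col: "(M ** S) $ i $ j = (M *v b (rh j)) $ i" for M :: "complex ^ 'k ^ 'k" and i j
  by (simp add: matrix_matrix_mult_def matrix_vector_mult_def S_def)
  have sub: "vec.subspace {v. (S' *v v) $ i = 0}"
  by (simp add: vec.subspace_def matrix_vector_right_distrib vector_scalar_commute)
  have "b ` {..rh j} <= {v. (S' *v v) $ i = 0}"
  proof safe
  fix k assume "k <= rh j"
  then obtain l where l: "rh l = k" using rh rhl[of j] by (auto simp: bij_betw_def image_iff set_eq_iff) (metis le_less_trans)
  have "(S' *v b k) $ i = (mat 1 :: complex ^ 'k ^ 'k) $ i $ l" using col[of S' i l] l S' by simp
  thus "(S' *v b k) $ i = 0" using l ij \<open>k <= rh j\<close> by (auto simp: mat_def)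
  qed
  hence "A *v b (rh j) : {v. (S' *v v) $ i = 0}" using vec.span_minimal[OF _ sub] b(2)[OF rhl] by blast
  thus ?thesis by (simp add: col matrix_vector_mul_assoc)
 qed
 thus ?thesis using that[OF rhi S'' S'] by blast
qed

section \<open>Triangular matrices and the growth of powers\<close>

definition mpow :: "'a::comm_ring_1 ^ 'k ^ 'k => nat => 'a ^ 'k ^ 'k"
 where "mpow A n = ((**) A ^^ n) (mat 1)"

lemma mpow_simps [simp]: "mpow A 0 = mat 1" "mpow A (Suc n) = A ** mpow A n"
 by (simp_all add: mpow_def)

definition eigvals :: "complex ^ 'k ^ 'k => complex set"
 where "eigvals A = {z. EX v. v ~= 0 & A *v v = z *s v}"

definition upper_tri :: "('k => nat) => 'a::comm_ring_1 ^ 'k ^ 'k => bool"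
 where "upper_tri rh U <-> (ALL i j. rh j < rh i --> U $ i $ j = 0)"

text \<open>The ranks \<open>rh i\<close> and \<open>rh (p i)\<close> have equal sums, so a
  permutation other than the identity lowers some rank, and its product contains an entry below the
  diagonal.\<close>

lemma det_upper_tri:
 assumes rh: "inj rh" and U: "upper_tri rh U" shows "det U = (PROD i:UNIV. U $ i $ i)"
proof -
 have "of_int (sign p) * (PROD i:UNIV. U $ i $ p i) = 0" if p: "p permutes UNIV" "p ~= id" for p
 proof -
  have "EX i. rh (p i) < rh i"
  proof (rule ccontr)
  assume no: "\<nexists>i. rh (p i) < rh i"
  obtain i where "p i ~= i" using p(2) by (auto simp: fun_eq_iff)
  hence "rh i < rh (p i)" using no inj_eq[OF rh, of i "p i"] by (metis linorder_neqE_nat)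
  hence "(SUM i:UNIV. rh i) < (SUM i:UNIV. rh (p i))" using no by (intro sum_strict_mono_ex1) (auto simp: not_less)
  moreover have "(SUM i:UNIV. rh (p i)) = (SUM i:UNIV. rh i)" using sum.permute[OF p(1), of rh] by (simp add: o_def)
  ultimately show False by simp
  qed
  hence "(PROD i:UNIV. U $ i $ p i) = 0" using U by (auto simp: upper_tri_def intro!: prod_zero)
  thus ?thesis by simp
 qed
 hence "(SUM p:{p. p permutes UNIV}. of_int (sign p) * (PROD i:UNIV. U $ i $ p i)) =
  (SUM p:{id}. of_int (sign p) * (PROD i:UNIV. U $ i $ p i))"
  by (intro sum.mono_neutral_right) (auto simp: finite_permutations permutes_id)
 thus ?thesis by (simp add: det_def)
qed

lemma upper_tri_mult:
 assumes "upper_tri rh U" "upper_tri rh V" "inj rh"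
 shows "upper_tri rh (U ** V)" "(U ** V) $ i $ i = U $ i $ i * V $ i $ i"
proof -
 have 0: "U $ i $ k * V $ k $ j = 0" if "rh j < rh i \<or> (i = j & k ~= i)" for i j k
 proof (cases "rh k < rh i \<or> rh j < rh k")
  case False
  hence "i = j & rh k = rh i" using that by auto
  thus ?thesis using that inj_eq[OF assms(3)] by simp
 qed (use assms(1,2) in \<open>auto simp: upper_tri_def\<close>)
 show "upper_tri rh (U ** V)" using 0 by (simp add: upper_tri_def matrix_matrix_mult_def)
 have "(SUM k:UNIV. U $ i $ k * V $ k $ i) = (SUM k:{i}. U $ i $ k * V $ k $ i)"
  using 0 by (intro sum.mono_neutral_right) auto
 thus "(U ** V) $ i $ i = U $ i $ i * V $ i $ i" by (simp add: matrix_matrix_mult_def)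
qed

lemma upper_tri_power:
 assumes "upper_tri rh U" "inj rh" shows "upper_tri rh (mpow U n)" "mpow U n $ i $ i = (U $ i $ i) ^ n"
proof (induction n)
 case 0
 show "upper_tri rh (mpow U 0)" "mpow U 0 $ i $ i = (U $ i $ i) ^ 0" by (auto simp: upper_tri_def mat_def)
next
 case (Suc n)
 show "upper_tri rh (mpow U (Suc n))" "mpow U (Suc n) $ i $ i = (U $ i $ i) ^ Suc n"
  using upper_tri_mult[OF assms(1) Suc(1) assms(2)] Suc(2) by simp_all
qed

lemma conjugate_power:
 assumes "S ** S' = mat 1" "S' ** S = mat 1" shows "mpow (S' ** A ** S) n = S' ** mpow A n ** S"
proof (induction n)
 case (Suc n)
 have "S' ** A ** S ** (S' ** mpow A n ** S) = S' ** A ** (S ** S') ** mpow A n ** S" by (simp add: matrix_mul_assoc)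
 thus ?case using assms Suc by (simp add: matrix_mul_assoc)
qed (simp add: assms)

lemma unconjugate:
 assumes "S ** S' = mat 1" shows "S ** (S' ** A ** S) ** S' = A"
proof -
 have "S ** (S' ** A ** S) ** S' = (S ** S') ** A ** (S ** S')" by (simp add: matrix_mul_assoc)
 thus ?thesis by (simp add: assms)
qed

lemma det_conjugate:
 fixes S S' A :: "'a::comm_ring_1 ^ 'k ^ 'k"
 assumes "S ** S' = mat 1" shows "det (S' ** A ** S) = det A"
proof -
 have "det (S' ** A ** S) = det (S ** S') * det A" by (simp add: det_mul)
 thus ?thesis by (simp add: assms)
qed

lemma matrix_diff_mult:
 fixes A :: "'a::comm_ring_1 ^ 'k ^ 'k"
 shows "A ** (B - C) = A ** B - A ** C" "(B - C) ** A = B ** A - C ** A"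
 by (simp_all add: matrix_matrix_mult_def vec_eq_iff right_diff_distrib left_diff_distrib sum_subtractf)

lemma eigvalsI_det:
 fixes A :: "complex ^ 'k ^ 'k"
 assumes "det (A - mat z) = 0" shows "z : eigvals A"
proof -
 have "~ invertible (A - mat z)" using assms by (simp add: invertible_det_nz)
 then obtain v where v: "v ~= 0" "(A - mat z) *v v = 0"
  unfolding invertible_left_inverse matrix_left_invertible_ker by blast
 have "(mat z :: complex ^ 'k ^ 'k) *v v = z *s v"
  by (simp add: vec_eq_iff matrix_vector_mult_def mat_def if_distrib[of "%x. x * _"] sum.delta cong: if_cong)
 hence "A *v v = z *s v" using v(2) by (simp add: matrix_vector_mult_diff_rdistrib)
 thus ?thesis using v(1) unfolding eigvals_def by blast
qed

theorem triangular_form: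
 fixes A :: "complex ^ 'k ^ 'k"
 obtains S S' U and rh :: "'k => nat" where "inj rh" "S ** S' = mat 1" "S' ** S = mat 1" "U = S' ** A ** S"
  "upper_tri rh U" "!!i. U $ i $ i : eigvals A"
proof -
 obtain S S' and rh :: "'k => nat" where S: "inj rh" "S ** S' = mat 1" "S' ** S = mat 1"
  "!!i j. rh j < rh i ==> (S' ** A ** S) $ i $ j = 0" by (rule triangularise) (rule that; assumption)
 define U where "U = S' ** A ** S"
 have U: "upper_tri rh U" using S(4) by (simp add: upper_tri_def U_def)
 have "U $ i $ i : eigvals A" for i
 proof (rule eigvalsI_det)
  let ?z = "U $ i $ i"
  have "S' ** mat ?z ** S = mat ?z"
  proof -
  have "S' ** mat ?z = mat ?z ** S'"
  by (simp add: matrix_matrix_mult_def mat_def vec_eq_iff if_distrib[of "%x. x * _"] if_distrib[of "%x. _ * x"] sum.delta sum.delta' mult.commute cong: if_cong)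
  hence "S' ** mat ?z ** S = mat ?z ** (S' ** S)" by (simp add: matrix_mul_assoc)
  thus ?thesis by (simp add: S(3))
  qed
  hence "det (A - mat ?z) = det (U - mat ?z)"
  using det_conjugate[OF S(2), of "A - mat ?z"] by (simp add: matrix_diff_mult U_def)
  also have "... = (PROD j:UNIV. (U - mat ?z) $ j $ j)"
  using U by (intro det_upper_tri[OF S(1)]) (auto simp: upper_tri_def mat_def)
  also have "... = 0" by (intro prod_zero) (auto simp: mat_def)
  finally show "det (A - mat ?z) = 0" .
 qed
 thus ?thesis using that[OF S(1-3) U_def U] by blast
qed

text \<open>Conjugating the triangular form with the diagonal matrix of the \<open>t ^ rh i\<close>
  multiplies the entries above the diagonal by positive powers of \<open>t\<close>, so a small
  \<open>t\<close> brings every row sum down to \<open>r\<close>; the bound then passes through the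
  induction on \<open>n\<close>.\<close>

theorem power_growth:
 fixes A :: "complex ^ 'k ^ 'k"
 assumes s: "!!z. z : eigvals A ==> cmod z <= s" "0 <= s" and r: "s < r"
 shows "EX C. ALL n i j. cmod (mpow A n $ i $ j) <= C * r ^ n"
proof -
 obtain S S' U and rh :: "'k => nat" where S: "inj rh" "S ** S' = mat 1" "S' ** S = mat 1" "U = S' ** A ** S"
  "upper_tri rh U" "!!i. U $ i $ i : eigvals A" by (rule triangular_form) (rule that; assumption)
 define B where "B = (SUM i:UNIV. SUM j:UNIV. cmod (U $ i $ j))"
 have B: "0 <= B" "(SUM j:UNIV. cmod (U $ i $ j)) <= B" for i
  unfolding B_def by (auto intro!: sum_nonneg member_le_sum[of i UNIV "%i. SUM j:UNIV. cmod (U $ i $ j)"])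
 \<comment> \<open>\<open>B\<close> bounds all row sums of \<open>U\<close>, so after scaling the
   off-diagonal entries contribute at most \<open>B * t <= r - s\<close> to a row, and the diagonal
   at most \<open>s\<close>.\<close>
 define t where "t = min 1 ((r - s) / (B + 1))"
 have t: "0 < t" "t <= 1" "B * t <= r - s"
 proof -
  show "0 < t" "t <= 1" using r B(1) by (auto simp: t_def)
  have "B * t <= (B + 1) * ((r - s) / (B + 1))" using B(1) r by (intro mult_mono) (auto simp: t_def)
  thus "B * t <= r - s" using B(1) by simp
 qed
 define w where "w = (%i j. cmod (U $ i $ j) * t ^ rh j / t ^ rh i)"
 have row: "(SUM j:UNIV. w i j) <= r" for i
 proof -
  have "w i j <= (if j = i then s else 0) + cmod (U $ i $ j) * t" for j
  proof (cases "rh i < rh j")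
  case True
  hence "rh j = (rh j - Suc (rh i)) + Suc (rh i)" by simp
  hence "t ^ rh j = t ^ (rh j - Suc (rh i)) * t ^ Suc (rh i)" by (metis power_add)
  hence "t ^ rh j = t ^ (rh j - Suc (rh i)) * t * t ^ rh i" by simp
  also have "... <= 1 * t * t ^ rh i" using t by (intro mult_right_mono power_le_one) auto
  finally have "t ^ rh j / t ^ rh i <= t" using t by (simp add: divide_le_eq)
  hence "cmod (U $ i $ j) * (t ^ rh j / t ^ rh i) <= cmod (U $ i $ j) * t" by (intro mult_left_mono) auto
  thus ?thesis using s(2) True by (auto simp: w_def)
  next
  case False
  show ?thesis
  proof (cases "i = j")
  case True
  hence "w i j = cmod (U $ i $ i)" using t by (simp add: w_def)
  thus ?thesis using s(1)[OF S(6)[of i]] True t by (simp add: add_increasing2)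
  next
  case neq: False
  hence "rh j < rh i" using False inj_eq[OF S(1)] by (metis linorder_neqE_nat)
  thus ?thesis using S(5) neq by (simp add: w_def upper_tri_def)
  qed
  qed
  hence "(SUM j:UNIV. w i j) <= (SUM j:UNIV. (if j = i then s else 0) + cmod (U $ i $ j) * t)" by (rule sum_mono)
  also have "... = s + (SUM j:UNIV. cmod (U $ i $ j)) * t" by (simp add: sum.distrib sum_distrib_right)
  also have "... <= s + B * t" using B(2)[of i] t by (intro add_left_mono mult_right_mono) auto
  also have "... <= r" using t(3) by simp
  finally show ?thesis .
 qed
 have Un: "cmod (mpow U n $ i $ j) <= r ^ n * (t ^ rh i / t ^ rh j)" for n i j
 proof (induction n arbitrary: i)
  case 0
  thus ?case using t by (simp add: mat_def)
 next
  case (Suc n)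
  have "cmod (mpow U (Suc n) $ i $ j) <= (SUM l:UNIV. cmod (U $ i $ l) * cmod (mpow U n $ l $ j))"
  by (simp add: matrix_matrix_mult_def norm_mult flip: norm_mult) (rule norm_sum)
  also have "... <= (SUM l:UNIV. cmod (U $ i $ l) * (r ^ n * (t ^ rh l / t ^ rh j)))"
  using Suc by (intro sum_mono mult_left_mono) auto
  also have "... = r ^ n * (t ^ rh i / t ^ rh j) * (SUM l:UNIV. w i l)"
  using t by (simp add: sum_distrib_left w_def mult_ac)
  also have "... <= r ^ n * (t ^ rh i / t ^ rh j) * r" using row[of i] t r s(2) by (intro mult_left_mono) auto
  finally show ?case by (simp add: mult_ac)
 qed
 define C where "C = (%i j. SUM b:UNIV. (SUM a:UNIV. cmod (S $ i $ a) * (t ^ rh a / t ^ rh b)) * cmod (S' $ b $ j))"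
 have C0: "0 <= C i j" for i j using t by (auto simp: C_def intro!: sum_nonneg mult_nonneg_nonneg divide_nonneg_nonneg)
 have "cmod (mpow A n $ i $ j) <= (SUM i:UNIV. SUM j:UNIV. C i j) * r ^ n" for n i j
 proof -
  have "mpow A n = S ** mpow U n ** S'"
  unfolding S(4) conjugate_power[OF S(2,3)] by (rule unconjugate[OF S(2), symmetric])
  hence "cmod (mpow A n $ i $ j) = cmod (SUM b:UNIV. (SUM a:UNIV. S $ i $ a * mpow U n $ a $ b) * S' $ b $ j)"
  by (simp add: matrix_matrix_mult_def)
  also have "... <= (SUM b:UNIV. (SUM a:UNIV. cmod (S $ i $ a) * cmod (mpow U n $ a $ b)) * cmod (S' $ b $ j))"
  by (intro order_trans[OF norm_sum] sum_mono) (auto simp: norm_mult intro!: mult_right_mono order_trans[OF norm_sum])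
  also have "... <= (SUM b:UNIV. (SUM a:UNIV. cmod (S $ i $ a) * (r ^ n * (t ^ rh a / t ^ rh b))) * cmod (S' $ b $ j))"
  using Un by (intro sum_mono mult_right_mono mult_left_mono) auto
  also have "... = C i j * r ^ n" by (simp add: C_def sum_distrib_left sum_distrib_right mult_ac)
  also have "... <= (SUM i:UNIV. SUM j:UNIV. C i j) * r ^ n"
  proof (intro mult_right_mono)
  have "C i j <= (SUM j:UNIV. C i j)" using C0 by (intro member_le_sum) auto
  also have "... <= (SUM i:UNIV. SUM j:UNIV. C i j)"
  using C0 by (intro member_le_sum[of i UNIV "%i. SUM j:UNIV. C i j"]) (auto intro!: sum_nonneg)
  finally show "C i j <= (SUM i:UNIV. SUM j:UNIV. C i j)" .
  qed (use r s(2) in simp)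
  finally show ?thesis .
 qed
 thus ?thesis by blast
qed

text \<open>The bounded sequence of tuples of powers has two late terms close to each other;
  dividing by the earlier power, which has modulus one, shows that the difference of the two
  exponents works.\<close>

lemma unimodular_recurrence:
 fixes l :: "'k::finite => complex"
 assumes "ep > 0" shows "EX n>=N. ALL i. cmod (l i) = 1 --> cmod (l i ^ n - 1) < ep"
proof -
 define x :: "nat => complex ^ 'k" where "x = (%n. \<chi> i. if cmod (l i) = 1 then l i ^ n else 0)"
 have "norm (x n) <= (SUM i:(UNIV::'k set). 1)" for n
  unfolding norm_vec_def by (intro order_trans[OF L2_set_le_sum] sum_mono) (auto simp: x_def norm_power)
 hence "bounded (range x)" by (auto simp: bounded_iff)
 then obtain y g where g: "strict_mono g" "(x o g) \<longlonglongrightarrow> y"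
  using bounded_imp_convergent_subsequence by blast
 hence "Cauchy (x o g)" by (intro LIMSEQ_imp_Cauchy)
 then obtain M where M: "!!p q. p >= M ==> q >= M ==> dist (x (g p)) (x (g q)) < ep"
  using metric_CauchyD[OF _ assms] by (metis comp_apply)
 \<comment> \<open>Large enough that the index is past \<open>M\<close> and the difference
   \<open>g q - g M\<close> is at least \<open>N\<close>.\<close>
 define q where "q = M + N + g M"
 define n where "n = g q - g M"
 have gq: "q <= g q" by (rule strict_mono_imp_increasing[OF g(1)])
 hence "N <= n" "g q = g M + n" by (auto simp: n_def q_def)
 moreover have "cmod (l i ^ n - 1) < ep" if "cmod (l i) = 1" for i
 proof -
  have "cmod (l i ^ n - 1) = cmod (l i ^ g M * (l i ^ n - 1))" using that by (simp add: norm_mult norm_power)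
  also have "l i ^ g M * (l i ^ n - 1) = (x (g q) - x (g M)) $ i"
  using that \<open>g q = g M + n\<close> by (simp add: x_def power_add right_diff_distrib)
  also have "cmod ... <= dist (x (g q)) (x (g M))" unfolding dist_norm by (rule Finite_Cartesian_Product.norm_nth_le)
  also have "... < ep" by (rule M) (simp_all add: q_def)
  finally show ?thesis .
 qed
 ultimately show ?thesis by blast
qed

text \<open>Factors with \<open>|l| < 1\<close> are eventually at least \<open>1 / 2\<close>, those
  with \<open>|l| > 1\<close> at least half of \<open>|l| ^ n\<close>. Only modulus one restricts
  the exponents: if \<open>l ^ n\<close> is near \<open>1\<close>, then \<open>1 - l ^ Suc n\<close>
  is near \<open>1 - l\<close>.\<close>

lemma prod_one_minus_power_ge:
 fixes l :: "'k::finite => complex"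
 assumes "!!i. l i ~= 1"
 obtains c where "c > 0" "!!N. EX n>=N. c * (PROD i:UNIV. max 1 (cmod (l i))) ^ n <= cmod (PROD i:UNIV. 1 - l i ^ n)"
proof -
 have one: "EX c>0. EX N. ALL n>=N. (cmod (l i) = 1 --> cmod (l i ^ n - 1) < cmod (1 - l i) / 2) -->
  c * max 1 (cmod (l i)) ^ Suc n <= cmod (1 - l i ^ Suc n)" for i
 proof -
  consider "cmod (l i) = 1" | "cmod (l i) < 1" | "cmod (l i) > 1" by linarith
  thus ?thesis
  proof cases
  case 1
  have "cmod (1 - l i) / 2 <= cmod (1 - l i ^ Suc n)" if "cmod (l i ^ n - 1) < cmod (1 - l i) / 2" for n
  proof -
  have "cmod (1 - l i) <= cmod (1 - l i ^ Suc n) + cmod (l i ^ Suc n - l i)"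
  using norm_triangle_ineq[of "1 - l i ^ Suc n" "l i ^ Suc n - l i"] by simp
  moreover have "cmod (l i ^ Suc n - l i) = cmod (l i ^ n - 1)"
  proof -
  have "l i ^ Suc n - l i = l i * (l i ^ n - 1)" by (simp add: algebra_simps)
  thus ?thesis using 1 by (simp add: norm_mult)
  qed
  ultimately show ?thesis using that by linarith
  qed
  thus ?thesis using 1 assms[of i] by (intro exI[of _ "cmod (1 - l i) / 2"]) auto
  next
  case 2
  hence "(%n. cmod (l i) ^ n) \<longlonglongrightarrow> 0" by (intro LIMSEQ_realpow_zero) auto
  hence "\<forall>\<^sub>F n in sequentially. cmod (l i) ^ n < 1 / 2" by (rule order_tendstoD) simp
  then obtain N where N: "!!n. n >= N ==> cmod (l i) ^ n < 1 / 2" by (auto simp: eventually_sequentially)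
  have "1 / 2 <= cmod (1 - l i ^ n)" if "n >= N" for n
  using norm_triangle_ineq2[of 1 "l i ^ n"] N[OF that] by (simp add: norm_power)
  thus ?thesis using 2 by (intro exI[of _ "1 / 2"] conjI exI[of _ N]) (auto simp: max_absorb1 simp del: power_Suc)
  next
  case 3
  then obtain N where N: "2 < cmod (l i) ^ N" using real_arch_pow by blast
  have "1 / 2 * cmod (l i) ^ n <= cmod (1 - l i ^ n)" if "n >= N" for n
  proof -
  have "2 <= cmod (l i) ^ n" using N power_increasing[OF that, of "cmod (l i)"] 3 by linarith
  thus ?thesis using norm_triangle_ineq2[of "l i ^ n" 1] by (simp add: norm_power norm_minus_commute)
  qed
  thus ?thesis using 3 by (intro exI[of _ "1 / 2"] conjI exI[of _ N]) (auto simp: max_absorb2 simp del: power_Suc)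
  qed
 qed
 then obtain c N0 where c: "!!i. c i > 0" "!!i n. n >= N0 i ==> (cmod (l i) = 1 --> cmod (l i ^ n - 1) < cmod (1 - l i) / 2) ==>
  c i * max 1 (cmod (l i)) ^ Suc n <= cmod (1 - l i ^ Suc n)" by metis
 define ep where "ep = Min (range (%i. cmod (1 - l i) / 2))"
 have ep: "ep > 0" "ep <= cmod (1 - l i) / 2" for i
 proof -
  show "ep > 0" unfolding ep_def using assms by (subst Min_gr_iff) auto
  show "ep <= cmod (1 - l i) / 2" unfolding ep_def by (rule Min_le) auto
 qed
 show ?thesis
 proof
  show "(PROD i:UNIV. c i) > 0" using c(1) by (intro prod_pos) auto
  fix N
  obtain n where n: "n >= max N (Max (range N0))" "!!i. cmod (l i) = 1 ==> cmod (l i ^ n - 1) < ep"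
  using unimodular_recurrence[OF ep(1)] by blast
  have N0: "N0 i <= n" for i using n(1) Max_ge[of "range N0" "N0 i"] by simp
  have "(PROD i:UNIV. c i) * (PROD i:UNIV. max 1 (cmod (l i))) ^ Suc n = (PROD i:UNIV. c i * max 1 (cmod (l i)) ^ Suc n)"
  by (simp add: prod.distrib prod_power_distrib del: power_Suc)
  also have "... <= (PROD i:UNIV. cmod (1 - l i ^ Suc n))"
  proof (intro prod_mono conjI)
  fix i
  show "0 <= c i * max 1 (cmod (l i)) ^ Suc n" using c(1)[of i] by simp
  show "c i * max 1 (cmod (l i)) ^ Suc n <= cmod (1 - l i ^ Suc n)"
  by (rule c(2)[OF N0]) (use n(2) ep(2) in \<open>blast intro: less_le_trans\<close>)
  qed
  finally have "(PROD i:UNIV. c i) * (PROD i:UNIV. max 1 (cmod (l i))) ^ Suc n <= cmod (PROD i:UNIV. 1 - l i ^ Suc n)"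
  by (simp add: prod_norm del: power_Suc)
  moreover have "N <= Suc n" using n(1) by simp
  ultimately show "EX n>=N. (PROD i:UNIV. c i) * (PROD i:UNIV. max 1 (cmod (l i))) ^ n <= cmod (PROD i:UNIV. 1 - l i ^ n)"
  by blast
 qed
qed

section \<open>The complex exterior algebra\<close>

definition ssgn :: "'n::{finite,linorder} => 'n set => complex"
 where "ssgn i J = (- 1) ^ card {j : J. j < i}"

text \<open>Left exterior multiplication by the vector \<open>x\<close>: the coefficient at
  \<open>J\<close> sums over the ways to split one element off \<open>J\<close>, and
  \<open>ssgn i J\<close> is the sign of sorting this element into its place.\<close>

definition wvec :: "(complex, 'n) vec => complex ^ 'n set => complex ^ ('n::{finite,linorder}) set"
 where "wvec x u = (\<chi> J. SUM i:J. ssgn i J * x $ i * u $ (J - {i}))"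

definition wlist :: "('n => (complex, 'n) vec) => 'n list => complex ^ ('n::{finite,linorder}) set"
 where "wlist c is = foldr (%i. wvec (c i)) is (axis {} 1)"

lemma wlist_simps [simp]: "wlist c [] = axis {} 1" "wlist c (i # is) = wvec (c i) (wlist c is)"
 by (simp_all add: wlist_def)

text \<open>The complexification of \<open>ext_map\<close>, needed because eigenvectors are complex;
  the columns of \<open>A\<close> are the images of the basis vectors.\<close>

definition epow :: "((complex, 'n) vec, 'n) vec => complex ^ 'n set => complex ^ ('n::{finite,linorder}) set"
 where "epow A u = (SUM I:UNIV. u $ I *s wlist (%i. column i A) (sorted_list_of_set I))"

lemma wvec_add: "wvec (x + y) u = wvec x u + wvec y u" "wvec x (u + v) = wvec x u + wvec x v"
 by (simp_all add: wvec_def vec_eq_iff algebra_simps sum.distrib)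

lemma wvec_scale: "wvec (a *s x) u = a *s wvec x u" "wvec x (a *s u) = a *s wvec x u"
 by (simp_all add: wvec_def vec_eq_iff sum_distrib_left mult_ac)

lemma wvec_zero [simp]: "wvec 0 u = 0" "wvec x 0 = 0"
 by (simp_all add: wvec_def vec_eq_iff)

lemma wvec_sum: "wvec (SUM i:X. f i) u = (SUM i:X. wvec (f i) u)" "wvec x (SUM i:X. g i) = (SUM i:X. wvec x (g i))"
 by (induction X rule: infinite_finite_induct) (simp_all add: wvec_add)

lemma ssgn_min: "(!!j. j : J ==> ~ j < i) ==> ssgn i J = 1"
 using card.empty by (simp add: ssgn_def cong: conj_cong)

lemma mult_axis: "A *v axis i 1 = column i A"
 by (simp add: vec_eq_iff matrix_vector_mult_def column_def axis_def if_distrib sum.delta cong: if_cong)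

text \<open>Removing the smaller of the two elements changes the count for the larger one by one;
  removing the larger changes nothing for the smaller.\<close>

lemma ssgn_remove:
 assumes "i : J" "j : J" "i ~= j" shows "ssgn i J * ssgn j (J - {i}) = - (ssgn j J * ssgn i (J - {j}))"
proof -
 have *: "ssgn i J * ssgn j (J - {i}) = - (ssgn j J * ssgn i (J - {j}))" if "i : J" "j : J" "i < j" for i j
 proof -
  have "{k : J. k < j} = insert i {k : J - {i}. k < j}" using that by auto
  hence "card {k : J. k < j} = Suc (card {k : J - {i}. k < j})" by simp
  moreover have "{k : J - {j}. k < i} = {k : J. k < i}" using that by auto
  ultimately show ?thesis by (simp add: ssgn_def)
 qed
 show ?thesis using *[of i j] *[of j i] assms by (cases "i < j") auto
qed

lemma wvec_anticommute: "wvec x (wvec y u) = - wvec y (wvec x u)"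
proof -
 have e: "wvec x (wvec y u) $ J = (SUM i:J. SUM j:J. if i = j then 0 else
  ssgn i J * ssgn j (J - {i}) * (x $ i * y $ j) * u $ (J - {i} - {j}))" for x y J
 proof -
  have "wvec x (wvec y u) $ J = (SUM i:J. SUM j:J - {i}. ssgn i J * ssgn j (J - {i}) * (x $ i * y $ j) * u $ (J - {i} - {j}))"
  by (simp add: wvec_def sum_distrib_left mult_ac)
  also have "... = (SUM i:J. SUM j:J. if i = j then 0 else ssgn i J * ssgn j (J - {i}) * (x $ i * y $ j) * u $ (J - {i} - {j}))"
  by (intro sum.cong refl sum.mono_neutral_cong_left) auto
  finally show ?thesis .
 qed
 have "wvec x (wvec y u) $ J = - (wvec y (wvec x u) $ J)" for J
 proof -
  have "wvec y (wvec x u) $ J = (SUM i:J. SUM j:J. if j = i then 0 else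
  ssgn j J * ssgn i (J - {j}) * (y $ j * x $ i) * u $ (J - {j} - {i}))" unfolding e by (rule sum.swap)
  also have "... = (SUM i:J. SUM j:J. - (if i = j then 0 else
  ssgn i J * ssgn j (J - {i}) * (x $ i * y $ j) * u $ (J - {i} - {j})))"
  proof (intro sum.cong refl)
  fix i j assume "i : J" "j : J"
  moreover have "J - {j} - {i} = J - {i} - {j}" by auto
  ultimately show "(if j = i then 0 else ssgn j J * ssgn i (J - {j}) * (y $ j * x $ i) * u $ (J - {j} - {i})) =
  - (if i = j then 0 else ssgn i J * ssgn j (J - {i}) * (x $ i * y $ j) * u $ (J - {i} - {j}))"
  using ssgn_remove[of i J j] by (simp add: mult_ac)
  qed
  also have "... = - (wvec x (wvec y u) $ J)" unfolding e by (simp add: sum_negf)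
  finally show ?thesis by simp
 qed
 thus ?thesis by (simp add: vec_eq_iff)
qed

lemma wvec_self: "wvec x (wvec x u) = 0"
 using wvec_anticommute[of x x u] by (simp add: vec_eq_iff equation_minus_iff)

text \<open>The new factor moves to its sorted place by \<open>wvec_anticommute\<close>, with one
  sign for each smaller entry; if it meets its equal, the wedge vanishes.\<close>

lemma wvec_list:
 assumes "sorted is" "distinct is" shows "wvec (c i) (wlist c is) =
  (if i : set is then 0 else ssgn i (set is) *s wlist c (insort i is))" using assms
proof (induction "is")
 case Nil
 show ?case by (simp add: ssgn_def)
next
 case (Cons a "is")
 have IH: "wvec (c i) (wlist c is) = (if i : set is then 0 else ssgn i (set is) *s wlist c (insort i is))"
  using Cons by simp
 consider "i = a" | "i < a" | "a < i" by force
 thus ?case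
 proof cases
  case 1
  thus ?thesis by (simp add: wvec_self)
 next
  case 2
  have "j : set (a # is) ==> i < j" for j using Cons.prems 2 by auto
  hence "i ~: set (a # is)" "ssgn i (set (a # is)) = 1" by (blast, intro ssgn_min) (auto dest: less_asym)
  thus ?thesis using 2 less_imp_le[OF 2] by simp
 next
  case 3
  have "{j : set (a # is). j < i} = insert a {j : set is. j < i}" using 3 by auto
  hence "ssgn i (set (a # is)) = - ssgn i (set is)" using Cons.prems by (simp add: ssgn_def)
  moreover have "wvec (c i) (wlist c (a # is)) = - wvec (c a) (wvec (c i) (wlist c is))"
  unfolding wlist_simps by (rule wvec_anticommute)
  moreover have "~ i <= a" "i ~= a" using 3 by auto
  ultimately show ?thesis unfolding IH by (simp add: wvec_scale)
 qed
qed

lemma epow_add: "epow A (u + v) = epow A u + epow A v"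
 by (simp add: epow_def vec.scale_left_distrib sum.distrib)

lemma epow_scale: "epow A (a *s u) = a *s epow A u"
 by (simp add: epow_def vec.scale_sum_right)

lemma epow_zero [simp]: "epow A 0 = 0"
 by (simp add: epow_def)

lemma epow_sum: "epow A (SUM i:X. g i) = (SUM i:X. epow A (g i))"
 by (induction X rule: infinite_finite_induct) (simp_all add: epow_add)

lemma epow_axis: "epow A (axis I 1) = wlist (%i. column i A) (sorted_list_of_set I)"
proof -
 have "epow A (axis I 1) = (SUM K:UNIV. if K = I then wlist (%i. column i A) (sorted_list_of_set K) else 0)"
  unfolding epow_def by (intro sum.cong) (auto simp: axis_def)
 thus ?thesis by (simp add: sum.delta)
qed

lemma vec_expand: "(x :: complex ^ 'k) = (SUM i:UNIV. x $ i *s axis i 1)"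
 by (simp add: vec_eq_iff axis_def if_distrib sum.delta cong: if_cong)

lemma wvec_axis:
 "wvec (axis i 1) (axis I 1) = (if i : I then 0 else ssgn i I *s axis (insert i I) 1)"
proof -
 have "wvec (axis i 1) (axis I 1) $ J = (if i : I then 0 else ssgn i I *s axis (insert i I) 1) $ J" for J
 proof -
  have "wvec (axis i 1) (axis I 1) $ J = (SUM k:J. if k = i then (if J - {i} = I then ssgn i J else 0) else 0)"
  unfolding wvec_def vec_lambda_beta by (intro sum.cong refl) (auto simp: axis_def)
  also have "... = (if i : J & J - {i} = I then ssgn i J else 0)" by (simp add: sum.delta)
  also have "... = (if i : I then 0 else ssgn i I *s axis (insert i I) 1) $ J"
  proof (cases "i : J & J - {i} = I")
  case True
  hence "{j : J. j < i} = {j : I. j < i}" "J = insert i I" by auto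
  thus ?thesis using True by (auto simp: ssgn_def axis_def)
  next
  case False
  hence "i : I \<or> J ~= insert i I" by auto
  thus ?thesis using False by (auto simp: axis_def)
  qed
  finally show ?thesis .
 qed
 thus ?thesis by (subst vec_eq_iff) blast
qed

text \<open>Multiplicativity is checked on basis vectors, where \<open>wvec_list\<close> sorts the
  new column into the wedge. Functoriality (\<open>epow_mult\<close>) follows by applying it factor
  by factor.\<close>

theorem epow_wedge: "epow A (wvec x u) = wvec (A *v x) (epow A u)"
proof -
 have b: "epow A (wvec (axis i 1) (axis I 1)) = wvec (A *v axis i 1) (epow A (axis I 1))" for i I
 proof -
  have "wvec (A *v axis i 1) (epow A (axis I 1)) = wvec (column i A) (wlist (%i. column i A) (sorted_list_of_set I))"
  by (simp add: epow_axis mult_axis)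
  also have "... = (if i : I then 0 else ssgn i I *s wlist (%i. column i A) (insort i (sorted_list_of_set I)))"
  using wvec_list[of "sorted_list_of_set I" "%i. column i A" i] by simp
  also have "... = epow A (wvec (axis i 1) (axis I 1))" by (simp add: wvec_axis epow_scale epow_axis)
  finally show ?thesis by simp
 qed
 have x: "A *v x = (SUM i:UNIV. x $ i *s (A *v axis i 1))"
  by (subst vec_expand[of x]) (simp add: vec.linear_sum[OF matrix_vector_mul_linear_gen] vec.linear_scale[OF matrix_vector_mul_linear_gen])
 have "wvec x u = (SUM I:UNIV. SUM i:UNIV. (u $ I * x $ i) *s wvec (axis i 1) (axis I 1))"
  by (subst vec_expand[of x], subst vec_expand[of u]) (simp add: wvec_sum wvec_scale vec.scale_sum_right)
 moreover have "wvec (A *v x) (epow A u) = (SUM I:UNIV. SUM i:UNIV. (u $ I * x $ i) *s wvec (A *v axis i 1) (epow A (axis I 1)))"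
  unfolding x by (subst vec_expand[of u]) (simp add: wvec_sum wvec_scale epow_sum epow_scale vec.scale_sum_right)
 ultimately show ?thesis by (simp add: epow_sum epow_scale b)
qed

lemma epow_list: "epow A (wlist c is) = wlist (%i. A *v c i) is"
proof (induction "is")
 case Nil
 show ?case by (simp add: epow_axis)
qed (simp add: epow_wedge)

lemma epow_mult: "epow A (epow B u) = epow (A ** B) u"
proof -
 have "epow A (epow B (axis I 1)) = epow (A ** B) (axis I 1)" for I
  by (simp add: epow_axis epow_list flip: mult_axis matrix_vector_mul_assoc)
 thus ?thesis by (subst (1 2) vec_expand[of u]) (simp add: epow_sum epow_scale)
qed

lemma wlist_axis: "sorted is ==> distinct is ==> wlist (%i. axis i 1) is = axis (set is) 1"
proof (induction "is")
 case (Cons a "is")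
 hence "ssgn a (set is) = 1" by (intro ssgn_min) (auto simp: not_less)
 thus ?case using Cons by (simp add: wvec_axis)
qed simp

lemma epow_one:
 fixes u :: "complex ^ ('n::{finite,linorder}) set"
 shows "epow (mat 1) u = u"
proof -
 have c: "column i (mat 1) = (axis i 1 :: (complex, 'n) vec)" for i :: 'n
  by (simp add: column_def mat_def axis_def vec_eq_iff eq_commute)
 have "epow (mat 1) (axis I 1) = axis I 1" for I :: "'n set" by (simp add: epow_axis c wlist_axis)
 thus ?thesis by (subst (1 2) vec_expand[of u]) (simp add: epow_sum epow_scale)
qed

text \<open>Exterior powers inherit triangularity with respect to the sum of the ranks. Several sets
  may share a rank sum; the equality clause says that these do not interact.\<close>

lemma wlist_triangular:
 assumes U: "upper_tri rh U" and rh: "inj rh" and J: "wlist (%i. column i U) is $ J ~= 0" "distinct is"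
 shows "(SUM j:J. rh j) <= (SUM i:set is. rh i) & ((SUM j:J. rh j) = (SUM i:set is. rh i) --> J = set is)" using J
proof (induction "is" arbitrary: J)
 case Nil
 thus ?case by (simp add: axis_def split: if_splits)
next
 case (Cons a "is")
 obtain j where j: "j : J" "ssgn j J * column a U $ j * wlist (%i. column i U) is $ (J - {j}) ~= 0"
  using Cons.prems(1) unfolding wlist_simps wvec_def vec_lambda_beta by (rule sum.not_neutral_contains_not_neutral)
 have 1: "rh j <= rh a" using U j(2) by (force simp: upper_tri_def column_def not_le[symmetric])
 have 2: "(SUM j:J - {j}. rh j) <= (SUM i:set is. rh i)" "(SUM j:J - {j}. rh j) = (SUM i:set is. rh i) ==> J - {j} = set is"
  using Cons.IH[of "J - {j}"] j(2) Cons.prems(2) by auto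
 have 3: "(SUM j:J. rh j) = rh j + (SUM j:J - {j}. rh j)" using j(1) by (simp add: sum.remove)
 show ?case
 proof (intro conjI impI)
  show "(SUM j:J. rh j) <= (SUM i:set (a # is). rh i)" using 1 2(1) 3 Cons.prems(2) by simp
  assume "(SUM j:J. rh j) = (SUM i:set (a # is). rh i)"
  hence "rh j = rh a" "(SUM j:J - {j}. rh j) = (SUM i:set is. rh i)" using 1 2(1) 3 Cons.prems(2) by simp_all
  hence "j = a" "J - {j} = set is" using inj_eq[OF rh] 2(2) by simp_all
  thus "J = set (a # is)" using j(1) by auto
 qed
qed

lemma wlist_triangular_diag:
 assumes U: "upper_tri rh U" and rh: "inj rh" and "sorted is" "distinct is"
 shows "wlist (%i. column i U) is $ set is = (PROD i:set is. U $ i $ i)" using assms(3,4)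
proof (induction "is")
 case (Cons a "is")
 let ?w = "wlist (%i. column i U) is" and ?J = "insert a (set is)"
 have z: "ssgn j ?J * column a U $ j * ?w $ (?J - {j}) = 0" if j: "j : ?J" "j ~= a" for j
 proof (rule ccontr)
  assume n: "~ ?thesis"
  hence 1: "rh j <= rh a" using U by (force simp: upper_tri_def column_def not_le[symmetric])
  moreover have "(SUM j:?J - {j}. rh j) <= (SUM i:set is. rh i)"
  using wlist_triangular[OF U rh, of "is" "?J - {j}"] n Cons.prems(2) by simp
  moreover have "(SUM i:?J. rh i) = rh j + (SUM i:?J - {j}. rh i)" using j(1) by (intro sum.remove) auto
  moreover have "(SUM i:?J. rh i) = rh a + (SUM i:set is. rh i)" using Cons.prems(2) by simp
  ultimately have "rh j = rh a" by simp
  thus False using j(2) inj_eq[OF rh] by simp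
 qed
 have "ssgn a ?J = 1" using Cons.prems by (intro ssgn_min) (auto simp: not_less)
 moreover have "?J - {a} = set is" using Cons.prems(2) by auto
 moreover have "(SUM j:?J. ssgn j ?J * column a U $ j * ?w $ (?J - {j})) =
  (SUM j:{a}. ssgn j ?J * column a U $ j * ?w $ (?J - {j}))" using z by (intro sum.mono_neutral_right) blast+
 ultimately have "(SUM j:?J. ssgn j ?J * column a U $ j * ?w $ (?J - {j})) = U $ a $ a * ?w $ set is"
  by (simp add: column_def)
 thus ?case using Cons by (simp add: wvec_def)
qed simp

lemma wlist_card: "wlist c is $ J ~= 0 ==> card J = length is"
proof (induction "is" arbitrary: J)
 case Nil
 thus ?case by (simp add: axis_def split: if_splits)
next
 case (Cons a "is")
 obtain j where "j : J" "ssgn j J * c a $ j * wlist c is $ (J - {j}) ~= 0"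
  using Cons.prems unfolding wlist_simps wvec_def vec_lambda_beta by (rule sum.not_neutral_contains_not_neutral)
 thus ?case using Cons.IH[of "J - {j}"] card_Suc_Diff1[of J j] by simp
qed

text \<open>The top coefficient and the determinant are both multiplicative and hence invariant
  under conjugation, and on a triangular matrix both are the product of the diagonal.\<close>

theorem epow_top:
 fixes A :: "((complex, 'n::{finite,linorder}) vec, 'n) vec"
 shows "epow A (axis UNIV 1) = det A *s axis UNIV 1"
proof -
 define top where "top = (%A :: ((complex, 'n) vec, 'n) vec. epow A (axis UNIV 1) $ UNIV)"
 have top: "epow A (axis UNIV 1) = top A *s axis UNIV 1" for A :: "((complex, 'n) vec, 'n) vec"
 proof -
  have "epow A (axis UNIV 1) $ J = 0" if "J ~= UNIV" for J
  proof (rule ccontr)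
  assume "epow A (axis UNIV 1) $ J ~= 0"
  hence "card J = CARD('n)" using wlist_card by (force simp: epow_axis)
  hence "J = UNIV" by (simp add: card_eq_UNIV_imp_eq_UNIV)
  thus False using that by simp
  qed
  thus ?thesis by (auto simp: vec_eq_iff axis_def top_def)
 qed
 have mult: "top (A ** B) = top A * top B" for A B :: "((complex, 'n) vec, 'n) vec"
 proof -
  have "epow (A ** B) (axis UNIV 1) = (top B * top A) *s axis UNIV 1"
  unfolding epow_mult[symmetric] top[of B] epow_scale top[of A] by simp
  thus ?thesis by (simp add: top_def axis_def mult.commute)
 qed
 have one: "top (mat 1) = 1" by (simp add: top_def epow_one axis_def)
 obtain S S' U and rh :: "'n => nat" where S: "inj rh" "S ** S' = mat 1" "S' ** S = mat 1" "U = S' ** A ** S"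
  "upper_tri rh U" "!!i. U $ i $ i : eigvals A" by (rule triangular_form) (rule that; assumption)
 have "top U = top (S ** S') * top A" unfolding S(4) by (simp add: mult mult_ac)
 hence "top A = top U" by (simp add: S(2) one)
 also have "... = (PROD i:UNIV. U $ i $ i)"
  using wlist_triangular_diag[OF S(5,1), of "sorted_list_of_set UNIV"] by (simp add: top_def epow_axis)
 also have "... = det U" by (rule det_upper_tri[OF S(1,5), symmetric])
 also have "... = det A" unfolding S(4) by (rule det_conjugate[OF S(2)])
 finally show ?thesis using top by simp
qed

section \<open>The spectrum on the exterior algebra and the growth of minors and
  determinants\<close>

definition cplx :: "real ^ 'k ^ 'm => complex ^ 'k ^ 'm"
 where "cplx A = (\<chi> i j. complex_of_real (A $ i $ j))"

lemma cplx_mult: "cplx (A ** B) = cplx A ** cplx B"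
 by (simp add: cplx_def matrix_matrix_mult_def vec_eq_iff)

lemma cplx_one: "cplx (mat 1) = mat 1"
 by (simp add: cplx_def mat_def vec_eq_iff)

lemma cplx_diff: "cplx (A - B) = cplx A - cplx B"
 by (simp add: cplx_def vec_eq_iff)

lemma det_cplx: "det (cplx A) = complex_of_real (det A)"
 by (simp add: det_def cplx_def)

lemma cplx_funpow:
 assumes "linear L" shows "cplx (matrix (L ^^ n)) = mpow (cplx (matrix L)) n"
proof (induction n)
 case 0
 have "matrix (L ^^ 0) = mat 1" by (simp add: matrix_def mat_def axis_def vec_eq_iff)
 thus ?case by (simp only: cplx_one mpow_simps)
next
 case (Suc n)
 have l: "linear (L ^^ n)" for n
 proof (induction n)
  case (Suc n)
  thus ?case using linear_compose[OF Suc assms] by (simp add: o_def)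
 qed (simp add: linear_iff)
 have "matrix (L ^^ Suc n) = matrix L ** matrix (L ^^ n)" using matrix_compose[OF l assms] by simp
 thus ?case by (simp only: cplx_mult Suc mpow_simps)
qed

lemma spectrum_eq: "complex_spectrum T = eigvals (cplx (matrix T))"
 by (simp add: complex_spectrum_def eigvals_def cplx_def)

lemma wedge_ext_embed:
 "wedge (ext_embed x) u $ J = (SUM i:J. (- 1) ^ card {j : J. j < i} * x $ i * u $ (J - {i}))"
proof -
 have b: "(SUM K:UNIV. u $ K * wedge_basis {i} K $ J) = (if i : J then (- 1) ^ card {j : J. j < i} * u $ (J - {i}) else 0)" for i
 proof -
  have "u $ K * wedge_basis {i} K $ J = (if K = J - {i} then if i : J then (- 1) ^ card {j : J. j < i} * u $ (J - {i}) else 0 else 0)" for K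
  proof (cases "i ~: K & J = insert i K")
  case True
  hence J: "J = insert i K" and i: "i ~: K" by simp_all
  have "{(i', j). i' : {i} & j : K & j < i'} = Pair i ` {j : K. j < i}" by auto
  hence "card {(i', j). i' : {i} & j : K & j < i'} = card {j : K. j < i}" by (simp add: card_image inj_on_def)
  moreover have "{j : J. j < i} = {j : K. j < i}" unfolding J by auto
  ultimately have "wedge_basis {i} K $ J = (- 1) ^ card {j : J. j < i}"
  using i by (simp add: wedge_basis_def axis_def J)
  moreover have "J - {i} = K" "i : J" using i by (auto simp: J)
  ultimately show ?thesis by simp
  next
  case False
  have "wedge_basis {i} K $ J = 0"
  proof (cases "i : K")
  case iK: False
  hence "J ~= insert i K" using False by blast
  thus ?thesis by (simp add: wedge_basis_def axis_def)
  qed (simp add: wedge_basis_def)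
  moreover have "~ (K = J - {i} & i : J)" using False by auto
  ultimately show ?thesis by (metis mult_zero_right)
  qed
  thus ?thesis by (simp add: sum.delta)
 qed
 have "wedge (ext_embed x) u $ J = (SUM I:UNIV. SUM K:UNIV. (SUM i:UNIV. if I = {i} then x $ i else 0) * (u $ K * wedge_basis I K $ J))"
 proof -
  have "ext_embed x $ I = (SUM i:UNIV. if I = {i} then x $ i else 0)" for I
  unfolding ext_embed_def sum_component by (intro sum.cong refl) (auto simp: axis_def)
  thus ?thesis by (simp add: wedge_def mult.assoc)
 qed
 also have "... = (SUM I:UNIV. SUM i:UNIV. if I = {i} then x $ i * (SUM K:UNIV. u $ K * wedge_basis {i} K $ J) else 0)"
 proof (intro sum.cong refl)
  fix I
  have "(SUM K:UNIV. (SUM i:UNIV. if I = {i} then x $ i else 0) * (u $ K * wedge_basis I K $ J)) =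
  (SUM i:UNIV. if I = {i} then x $ i else 0) * (SUM K:UNIV. u $ K * wedge_basis I K $ J)"
  by (rule sum_distrib_left[symmetric])
  also have "... = (SUM i:UNIV. (if I = {i} then x $ i else 0) * (SUM K:UNIV. u $ K * wedge_basis I K $ J))"
  by (rule sum_distrib_right)
  also have "... = (SUM i:UNIV. if I = {i} then x $ i * (SUM K:UNIV. u $ K * wedge_basis {i} K $ J) else 0)"
  by (intro sum.cong refl) auto
  finally show "(SUM K:UNIV. (SUM i:UNIV. if I = {i} then x $ i else 0) * (u $ K * wedge_basis I K $ J)) =
  (SUM i:UNIV. if I = {i} then x $ i * (SUM K:UNIV. u $ K * wedge_basis {i} K $ J) else 0)" .
 qed
 also have "... = (SUM i:UNIV. x $ i * (SUM K:UNIV. u $ K * wedge_basis {i} K $ J))"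
  by (subst sum.swap) (simp add: sum.delta)
 also have "... = (SUM i:J. (- 1) ^ card {j : J. j < i} * x $ i * u $ (J - {i}))"
  unfolding b by (intro sum.mono_neutral_cong_right) auto
 finally show ?thesis .
qed

lemma foldr_wedge:
 "complex_of_real (foldr wedge (map (%i. ext_embed (T (axis i 1))) is) (axis {} 1) $ J) =
 wlist (%i. column i (cplx (matrix T))) is $ J"
proof (induction "is" arbitrary: J)
 case Nil
 show ?case by (simp add: axis_def)
next
 case (Cons a "is")
 thus ?case by (simp add: wedge_ext_embed wvec_def ssgn_def column_def cplx_def matrix_def)
qed

lemma cplx_ext_map: "cplx (matrix (ext_map T)) *v u = epow (cplx (matrix T)) u"
proof -
 have m: "matrix (ext_map T) $ J $ I = foldr wedge (map (%i. ext_embed (T (axis i 1))) (sorted_list_of_set I)) (axis {} 1) $ J" for I J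
 proof -
  have "ext_map T (axis I 1) = (SUM K:UNIV. if K = I then foldr wedge (map (%i. ext_embed (T (axis i 1))) (sorted_list_of_set K)) (axis {} 1) else 0)"
  unfolding ext_map_def by (intro sum.cong) (auto simp: axis_def)
  thus ?thesis by (simp add: matrix_def sum.delta)
 qed
 have "(cplx (matrix (ext_map T)) *v u) $ J = epow (cplx (matrix T)) u $ J" for J
  by (simp add: matrix_vector_mult_def cplx_def[of "matrix (ext_map T)"] m foldr_wedge epow_def mult.commute)
 thus ?thesis by (subst vec_eq_iff) blast
qed

text \<open>In triangular form, choose a set \<open>J\<close> of largest rank sum in the support of
  the eigenvector. By \<open>wlist_triangular\<close> no other set of the support contributes to the
  coordinate \<open>J\<close>, so the eigenvalue is the diagonal entry there, a product of diagonal
  entries of \<open>U\<close>.\<close>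

lemma epow_eigenvalue:
 fixes A U S S' :: "((complex, 'n::{finite,linorder}) vec, 'n) vec"
 assumes U: "upper_tri rh U" "inj rh" "U = S' ** A ** S" "S ** S' = mat 1" "S' ** S = mat 1"
  and v: "epow A v = z *s v" "v ~= 0" shows "EX J. z = (PROD i:J. U $ i $ i)"
proof -
 define w where "w = epow S' v"
 have "epow S w = v" by (simp add: w_def epow_mult U(4) epow_one)
 hence "w ~= 0" using v(2) by auto
 have "epow U w = epow S' (epow A (epow S w))" by (simp add: epow_mult U(3) matrix_mul_assoc)
 hence Uw: "epow U w = z *s w" unfolding \<open>epow S w = v\<close> v(1) epow_scale w_def[symmetric] .
 have "{SUM i:J. rh i |J. w $ J ~= 0} ~= {}" using \<open>w ~= 0\<close> by (auto simp: vec_eq_iff)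
 moreover have fin: "finite {SUM i:J. rh i |J. w $ J ~= 0}" by simp
 ultimately have "Max {SUM i:J. rh i |J. w $ J ~= 0} : {SUM i:J. rh i |J. w $ J ~= 0}" by (intro Max_in)
 then obtain J where J: "w $ J ~= 0" "(SUM i:J. rh i) = Max {SUM i:J. rh i |J. w $ J ~= 0}" by auto
 have max: "(SUM i:I. rh i) <= (SUM i:J. rh i)" if "w $ I ~= 0" for I
  unfolding J(2) using that fin by (intro Max_ge) auto
 have "epow U w $ J = (SUM I:UNIV. w $ I * wlist (%i. column i U) (sorted_list_of_set I) $ J)" by (simp add: epow_def)
 also have "... = (SUM I:{J}. w $ I * wlist (%i. column i U) (sorted_list_of_set I) $ J)"
 proof (rule sum.mono_neutral_right)
  show "ALL I:UNIV - {J}. w $ I * wlist (%i. column i U) (sorted_list_of_set I) $ J = 0"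
  proof (intro ballI, rule ccontr)
  fix I assume "I : UNIV - {J}" and n: "w $ I * wlist (%i. column i U) (sorted_list_of_set I) $ J ~= 0"
  thus False using wlist_triangular[OF U(1,2), of "sorted_list_of_set I" J] max[of I] by auto
  qed
 qed auto
 also have "... = w $ J * (PROD i:J. U $ i $ i)"
  using wlist_triangular_diag[OF U(1,2), of "sorted_list_of_set J"] by simp
 finally have "z = (PROD i:J. U $ i $ i)" using J(1) by (simp add: Uw)
 thus ?thesis by blast
qed

text \<open>Up to sign every wedge of columns of \<open>A\<close> and unit vectors is obtained from some
 \<open>\<Lambda>A (e\<^sub>I)\<close> by wedging with unit vectors, which only moves or deletes coordinates.\<close>

lemma max_minor_le:
 fixes A :: "((real, 'n::{finite,linorder}) vec, 'n) vec"
 assumes B: "!!I J. cmod (epow (cplx A) (axis I 1) $ J) <= B" shows "max_minor A <= B"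
proof -
 let ?A = "cplx A"
 define F where "F = (%ks v. foldr (%k. wvec (axis k 1)) ks v :: complex ^ 'n set)"
 have F: "F [] v = v" "F (k # ks) v = wvec (axis k 1) (F ks v)" for k ks v by (simp_all add: F_def)
 \<comment> \<open>All vectors reached from \<open>epow ?A\<close> of a basis vector by wedging with
   unit vectors, up to the factors \<open>0\<close>, \<open>1\<close> and \<open>-1\<close>. The set
   is closed under wedging with unit vectors and with columns of \<open>?A\<close>, so it contains
   every mixed wedge.\<close>
 define R where "R = (%(a, ks, I). a *s F ks (epow ?A (axis I 1))) ` ({0, 1, -1} \<times> UNIV \<times> UNIV)"
 have RI: "a *s F ks (epow ?A (axis I 1)) : R" if "a : {0, 1, -1}" for a ks I
  unfolding R_def by (rule image_eqI[of _ _ "(a, ks, I)"]) (use that in simp_all)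
 have RE: thesis if "u : R" "!!a ks I. a : {0, 1, -1} ==> u = a *s F ks (epow ?A (axis I 1)) ==> thesis" for u thesis
  using that unfolding R_def by auto
 have R1: "wvec (axis k 1) u : R" if u: "u : R" for u k
 proof (rule RE[OF u])
  fix a ks I assume "a : {0, 1, -1}" "u = a *s F ks (epow ?A (axis I 1))"
  thus ?thesis using RI[of a "k # ks" I] by (simp add: F wvec_scale)
 qed
 \<comment> \<open>Moving a vector past unit vectors costs only a sign; once a column of
   \<open>?A\<close> stands next to \<open>epow ?A\<close>, it is absorbed by
   \<open>epow_wedge\<close>.\<close>
 have mv: "EX a:{1, -1}. wvec x (F ks v) = a *s F ks (wvec x v)" for x v ks
 proof (induction ks)
  case Nil
  show ?case by (simp add: F)
 next
  case (Cons k ks)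
  then obtain a where a: "a : {1, -1}" "wvec x (F ks v) = a *s F ks (wvec x v)" by (elim bexE)
  have "wvec x (F (k # ks) v) = - wvec (axis k 1) (wvec x (F ks v))" unfolding F by (rule wvec_anticommute)
  also have "... = (- a) *s F (k # ks) (wvec x v)" unfolding a(2) F by (simp add: wvec_scale)
  finally show ?case using a(1) by (intro bexI[of _ "- a"]) auto
 qed
 have R2: "wvec (column k ?A) u : R" if u: "u : R" for u k
 proof (rule RE[OF u])
  fix a ks I assume u: "a : {0, 1, -1}" "u = a *s F ks (epow ?A (axis I 1))"
  obtain b where b: "b : {1, -1}" "wvec (column k ?A) (F ks (epow ?A (axis I 1))) =
  b *s F ks (wvec (column k ?A) (epow ?A (axis I 1)))" by (rule bexE[OF mv]) (rule that)
  define c where "c = (if k : I then 0 else ssgn k I)"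
  have "wvec (column k ?A) (epow ?A (axis I 1)) = epow ?A (wvec (axis k 1) (axis I 1))"
  by (simp add: epow_wedge mult_axis)
  also have "... = c *s epow ?A (axis (insert k I) 1)" by (simp add: wvec_axis epow_scale c_def)
  finally have e: "wvec (column k ?A) (epow ?A (axis I 1)) = c *s epow ?A (axis (insert k I) 1)" .
  have sc: "F ks (c *s v) = c *s F ks v" for v by (induction ks) (simp_all add: F wvec_scale)
  have "c : {0, 1, -1}" unfolding c_def ssgn_def by (cases "even (card {j : I. j < k})") auto
  hence "a * b * c : {0, 1, -1}" using u(1) b(1) by auto
  moreover have "wvec (column k ?A) u = (a * b * c) *s F ks (epow ?A (axis (insert k I) 1))"
  unfolding u(2) wvec_scale b(2) e sc by (simp add: mult.assoc)
  ultimately show ?thesis using RI by simp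
 qed
 have B0: "0 <= B" using B[of "{}" "{}"] norm_ge_zero order_trans by blast
 have bd: "cmod (F ks (epow ?A (axis I 1)) $ J) <= B" for ks I J
 proof (induction ks arbitrary: J)
  case Nil
  show ?case using B by (simp add: F)
 next
  case (Cons k ks)
  let ?v = "F ks (epow ?A (axis I 1))"
  have "wvec (axis k 1) ?v $ J = (SUM i:J. if i = k then ssgn k J * ?v $ (J - {k}) else 0)"
  unfolding wvec_def vec_lambda_beta by (intro sum.cong refl) (auto simp: axis_def)
  hence "cmod (wvec (axis k 1) ?v $ J) <= cmod (?v $ (J - {k}))"
  by (simp add: sum.delta norm_mult ssgn_def norm_power)
  thus ?case using Cons[of "J - {k}"] by (simp add: F)
 qed
 have RB: "cmod (u $ J) <= B" if u: "u : R" for u J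
 proof (rule RE[OF u])
  fix a ks I assume "a : {0, 1, -1}" "u = a *s F ks (epow ?A (axis I 1))"
  thus ?thesis using bd[of ks I J] B0 by (auto simp: norm_mult)
 qed
 have "\<bar>det (sel_cols A sg)\<bar> <= B" for sg
 proof -
  have col: "column j (cplx (sel_cols A sg)) = (case sg j of Inl k => column k ?A | Inr k => axis k 1)" for j
  by (auto simp: column_def cplx_def sel_cols_def axis_def mat_def vec_eq_iff split: sum.splits)
  have "wlist (%j. column j (cplx (sel_cols A sg))) is : R" for "is"
  proof (induction "is")
  case Nil
  show ?case using RI[of 1 "[]" "{}"] by (simp add: F epow_axis)
  next
  case (Cons j "is")
  thus ?case using R1 R2 by (auto simp: col split: sum.splits)
  qed
  hence "cmod (wlist (%j. column j (cplx (sel_cols A sg))) (sorted_list_of_set UNIV) $ UNIV) <= B" by (rule RB)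
  hence "cmod (det (cplx (sel_cols A sg))) <= B" by (simp add: epow_top flip: epow_axis)
  thus ?thesis by (simp add: det_cplx)
 qed
 moreover obtain sg where "max_minor A = \<bar>det (sel_cols A sg)\<bar>" by (rule max_minor_attained)
 ultimately show ?thesis by simp
qed

context
 fixes L :: "(real, 'n::{finite,linorder}) vec => (real, 'n) vec"
 assumes L: "linear L"
begin

text \<open>\<open>spectral_rad\<close> is a \<open>Max\<close> and is meaningful only on a finite
  nonempty set. The eigenvalue \<open>1\<close> comes from exterior degree zero.\<close>

lemma ext_map_spectrum:
 "finite (complex_spectrum (ext_map L))" "1 : complex_spectrum (ext_map L)"
proof -
 let ?A = "cplx (matrix L)"
 obtain S S' U and rh :: "'n => nat" where S: "inj rh" "S ** S' = mat 1" "S' ** S = mat 1" "U = S' ** ?A ** S"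
  "upper_tri rh U" "!!i. U $ i $ i : eigvals ?A" by (rule triangular_form) (rule that; assumption)
 have "complex_spectrum (ext_map L) <= range (%J. PROD i:J. U $ i $ i)"
 proof
  fix z assume "z : complex_spectrum (ext_map L)"
  then obtain v where "epow ?A v = z *s v" "v ~= 0" by (auto simp: spectrum_eq eigvals_def cplx_ext_map)
  thus "z : range (%J. PROD i:J. U $ i $ i)" using epow_eigenvalue[OF S(5,1,4,2,3)] by blast
 qed
 thus "finite (complex_spectrum (ext_map L))" by (rule finite_subset) simp
 show "1 : complex_spectrum (ext_map L)" unfolding spectrum_eq eigvals_def mem_Collect_eq cplx_ext_map
  by (intro exI[of _ "axis {} 1"]) (simp add: epow_axis axis_eq_0_iff)
qed

lemma spectral_rad_ext_map:
 "z : complex_spectrum (ext_map L) ==> cmod z <= spectral_rad (ext_map L)" "1 <= spectral_rad (ext_map L)"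
 using ext_map_spectrum(1) ext_map_spectrum(2)[THEN imageI, of cmod] by (auto simp: spectral_rad_def)

text \<open>The exterior map of \<open>L ^^ q\<close> is the \<open>q\<close>-th power of that of
  \<open>L\<close>, so \<open>power_growth\<close> bounds all its entries, and
  \<open>max_minor_le\<close> turns this into a bound for the minors.\<close>

theorem max_minor_growth:
 assumes "spectral_rad (ext_map L) < r" shows "EX C. ALL q. max_minor (matrix (L ^^ q)) <= C * r ^ q"
proof -
 let ?A = "cplx (matrix L)" and ?E = "cplx (matrix (ext_map L))"
 obtain C where C: "!!n i j. cmod (mpow ?E n $ i $ j) <= C * r ^ n"
  using power_growth[of ?E "spectral_rad (ext_map L)" r] spectral_rad_ext_map assms by (auto simp: spectrum_eq)
 have p: "mpow ?E n *v u = epow (mpow ?A n) u" for n u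
 proof (induction n arbitrary: u)
  case 0
  show ?case by (simp add: epow_one)
 next
  case (Suc n)
  show ?case by (simp add: Suc cplx_ext_map epow_mult flip: matrix_vector_mul_assoc)
 qed
 have "max_minor (matrix (L ^^ q)) <= C * r ^ q" for q
 proof (rule max_minor_le)
  fix I J
  have "epow (cplx (matrix (L ^^ q))) (axis I 1) = column I (mpow ?E q)"
  unfolding cplx_funpow[OF L] p[symmetric] mult_axis ..
  thus "cmod (epow (cplx (matrix (L ^^ q))) (axis I 1) $ J) <= C * r ^ q" using C by (simp add: column_def)
 qed
 thus ?thesis by blast
qed

text \<open>An eigenvalue on the exterior algebra is a product over some of the diagonal entries, so
  the spectral radius is at most the product of all \<open>max 1 |U i i|\<close>, whose powers
  \<open>prod_one_minus_power_ge\<close> compares with the determinant.\<close>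

theorem det_one_minus_power_growth:
 assumes "1 ~: complex_spectrum L"
 obtains c where "c > 0" "!!N. EX n>=N. c * spectral_rad (ext_map L) ^ n <= \<bar>det (matrix (%u. u - (L ^^ n) u))\<bar>"
proof -
 let ?A = "cplx (matrix L)"
 obtain S S' U and rh :: "'n => nat" where S: "inj rh" "S ** S' = mat 1" "S' ** S = mat 1" "U = S' ** ?A ** S"
  "upper_tri rh U" "!!i. U $ i $ i : eigvals ?A" by (rule triangular_form) (rule that; assumption)
 have "U $ i $ i ~= 1" for i using S(6)[of i] assms by (auto simp: spectrum_eq)
 then obtain c where c: "c > 0"
  "!!N. EX n>=N. c * (PROD i:UNIV. max 1 (cmod (U $ i $ i))) ^ n <= cmod (PROD i:UNIV. 1 - U $ i $ i ^ n)"
  by (rule prod_one_minus_power_ge) (rule that; assumption)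
 have det: "cmod (PROD i:UNIV. 1 - U $ i $ i ^ n) = \<bar>det (matrix (%u. u - (L ^^ n) u))\<bar>" for n
 proof -
  have "matrix (%u. u - (L ^^ n) u) = mat 1 - matrix (L ^^ n)" by (simp add: matrix_def mat_def axis_def vec_eq_iff)
  hence "cplx (matrix (%u. u - (L ^^ n) u)) = mat 1 - mpow ?A n" by (simp add: cplx_diff cplx_one cplx_funpow[OF L])
  hence "of_real (det (matrix (%u. u - (L ^^ n) u))) = det (mat 1 - mpow ?A n)" by (metis det_cplx)
  also have "... = det (S' ** (mat 1 - mpow ?A n) ** S)" by (rule det_conjugate[OF S(2), symmetric])
  also have "S' ** (mat 1 - mpow ?A n) ** S = mat 1 - mpow U n"
  unfolding S(4) conjugate_power[OF S(2,3)] by (simp add: matrix_diff_mult S(3))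
  also have "det ... = (PROD i:UNIV. (mat 1 - mpow U n) $ i $ i)" using upper_tri_power(1)[OF S(5,1), of n]
  by (intro det_upper_tri[OF S(1)]) (auto simp: upper_tri_def mat_def)
  also have "... = (PROD i:UNIV. 1 - U $ i $ i ^ n)" by (simp add: upper_tri_power(2)[OF S(5,1)] mat_def)
  finally show ?thesis by (metis norm_of_real)
 qed
 have s: "spectral_rad (ext_map L) <= (PROD i:UNIV. max 1 (cmod (U $ i $ i)))"
 proof -
  have "spectral_rad (ext_map L) : cmod ` complex_spectrum (ext_map L)"
  unfolding spectral_rad_def using ext_map_spectrum by (intro Max_in) auto
  then obtain z v where z: "spectral_rad (ext_map L) = cmod z" "epow ?A v = z *s v" "v ~= 0"
  by (auto simp: spectrum_eq eigvals_def cplx_ext_map)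
  then obtain J where "z = (PROD i:J. U $ i $ i)" using epow_eigenvalue[OF S(5,1,4,2,3)] by blast
  hence "cmod z = (PROD i:J. cmod (U $ i $ i))" by (simp add: prod_norm)
  also have "... <= (PROD i:J. max 1 (cmod (U $ i $ i)))" by (intro prod_mono) auto
  also have "... <= (PROD i:UNIV. max 1 (cmod (U $ i $ i)))" by (intro prod_mono2) auto
  finally show ?thesis using z(1) by simp
 qed
 show ?thesis
 proof
  fix N
  obtain n where n: "n >= N" "c * (PROD i:UNIV. max 1 (cmod (U $ i $ i))) ^ n <= cmod (PROD i:UNIV. 1 - U $ i $ i ^ n)"
  using c(2) by blast
  have "c * spectral_rad (ext_map L) ^ n <= c * (PROD i:UNIV. max 1 (cmod (U $ i $ i))) ^ n"
  using s spectral_rad_ext_map(2) c(1) by (intro mult_left_mono power_mono) auto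
  thus "EX n>=N. c * spectral_rad (ext_map L) ^ n <= \<bar>det (matrix (%u. u - (L ^^ n) u))\<bar>"
  using n unfolding det by (intro exI[of _ n]) linarith
 qed (rule c(1))
qed

end

section \<open>Fixed point index\<close>

text \<open>One choice of the embedding, the open set and the retraction over which
  \<open>fixed_point_index\<close> quantifies; the properties of degrees are proved for an arbitrary
  choice.\<close>

locale retr =
 fixes M :: "'m topology" and N :: nat and i :: "'m => nat => real" and r :: "(nat => real) => 'm" and Q
 assumes M: "compact_space M" "Hausdorff_space M"
  and i: "continuous_map M (eucl N) i" and Q: "openin (eucl N) Q" "i ` topspace M <= Q"
  and r: "continuous_map (esub N Q) M r" and ri: "!!x. x : topspace M ==> r (i x) = x"
begin

definition dom :: "'m set => (nat => real) set"
 where "dom V = {y : Q. r y : V}"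

definition displ :: "('m => 'm) => (nat => real) => nat => real"
 where "displ f y = (%j. y j - i (f (r y)) j)"

definition isolating :: "'m set => 'm set => ('m => 'm) => bool"
 where "isolating V K f <-> openin M V & continuous_map (subtopology M V) M f & compactin M K &
  {x : V. f x = x} <= K & K <= V"

definition fdeg :: "'m set => 'm set => ('m => 'm) => int => bool"
 where "fdeg V K f k <-> deg_along N (dom V) (i ` K) (displ f) k"

lemma Q_ecar: "Q <= ecar N"
 using Q(1) by (rule openin_subset)

lemma openin_dom: "openin M V ==> openin (eucl N) (dom V)"
 using openin_continuous_map_preimage[OF r] Q(1) Q_ecar by (simp add: dom_def Int_absorb1 openin_open_subtopology)

lemma continuous_r_dom: "continuous_map (esub N (dom V)) (subtopology M V) r"
 unfolding continuous_map_in_subtopology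
 by (intro conjI continuous_map_from_subtopology_mono[OF r]) (auto simp: dom_def)

text \<open>A zero satisfies \<open>y = i (f (r y))\<close>; it is therefore in the image of
  \<open>i\<close>, and applying \<open>r\<close> shows that \<open>r y\<close> is fixed.\<close>

lemma displ_zero:
 assumes "y : dom V" "displ f y = (%j. 0)" "V <= topspace M" "f ` V <= topspace M"
 shows "r y : V & f (r y) = r y & y = i (r y)"
proof -
 have "y = i (f (r y))" using assms(2) by (auto simp: displ_def fun_eq_iff)
 moreover have "f (r y) : topspace M" using assms(1,4) by (auto simp: dom_def)
 ultimately have "r y = f (r y)" using ri by metis
 thus ?thesis using \<open>y = i (f (r y))\<close> assms(1) by (auto simp: dom_def)
qed

text \<open>The parameter space \<open>T\<close> is arbitrary: a single point serves for one map,
  the unit interval for homotopies.\<close>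

lemma continuous_displ:
 assumes f: "continuous_map (prod_topology T (subtopology M V)) M (%(t, x). h t x)"
 shows "continuous_map (prod_topology T (esub N (dom V))) (eucl N) (%(t, y). displ (h t) y)"
proof -
 let ?X = "prod_topology T (esub N (dom V))"
 have s: "continuous_map ?X (eucl N) snd"
  using continuous_map_snd[of T "esub N (dom V)"] continuous_map_in_subtopology by blast
 have "continuous_map ?X (prod_topology T (subtopology M V)) (%z. (fst z, r (snd z)))"
  using continuous_map_compose[OF continuous_map_snd continuous_r_dom]
  by (simp add: continuous_map_pairwise continuous_map_fst o_def)
 from continuous_map_compose[OF continuous_map_compose[OF this f] i]
 have g: "continuous_map ?X (eucl N) (%z. i (h (fst z) (r (snd z))))" by (simp add: o_def split_beta)
 show ?thesis unfolding cmap_eucl_iff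
 proof (intro conjI allI funcsetI)
  fix j
  show "continuous_map ?X euclideanreal (%x. (case x of (t, y) => displ (h t) y) j)" unfolding displ_def split_beta
  using s g unfolding cmap_eucl_iff by (intro continuous_map_diff) auto
 next
  fix z assume "z : topspace ?X"
  moreover from this have "i (h (fst z) (r (snd z))) : ecar N" using continuous_map_funspace[OF g] by auto
  ultimately show "(case z of (t, y) => displ (h t) y) : ecar N" by (auto simp: topspace_Euclidean_space displ_def)
 qed
qed

lemma isolating_proper:
 assumes "isolating V K f" shows "pzeros N (dom V) (i ` K) (displ f)"
proof -
 have V: "openin M V" "V <= topspace M" and f: "continuous_map (subtopology M V) M f" and K: "compactin M K" "{x : V. f x = x} <= K" "K <= V"
  using assms openin_subset unfolding isolating_def by auto
 have fV: "f ` V <= topspace M" using continuous_map_image_subset_topspace[OF f] V(2) by (auto simp: Int_absorb1)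
 have "continuous_map (prod_topology (top_of_set {0::real}) (subtopology M V)) M (%(t, x). f x)"
  unfolding split_beta using continuous_map_compose[OF continuous_map_snd f] by (simp add: o_def)
 hence 1: "continuous_map (prod_topology (top_of_set {0::real}) (esub N (dom V))) (eucl N) (%(t, y). displ f y)"
  by (rule continuous_displ)
 have "continuous_map (esub N (dom V)) (prod_topology (top_of_set {0::real}) (esub N (dom V))) (%y. (0, y))"
  by (simp add: continuous_map_pairwise o_def)
 from continuous_map_compose[OF this 1]
 have c: "continuous_map (esub N (dom V)) (eucl N) (displ f)" by (simp add: o_def)
 have "i ` K <= dom V" using K(3) V(2) Q(2) ri by (auto simp: dom_def subset_iff)
 moreover have "{y : dom V. displ f y = (%j. 0)} <= i ` K" using displ_zero[OF _ _ V(2) fV] K(2) by blast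
 ultimately show ?thesis using c openin_dom[OF V(1)] image_compactin[OF K(1) i] by (simp add: pzeros_def)
qed

lemma fdeg_homotopy:
 assumes H: "continuous_map (cylinder (subtopology M V)) M (%(t, x). h t x)"
  and V: "openin M V" and z: "!!t x. t : {0..1} ==> x : V ==> h t x = x ==> x : K"
 shows "fdeg V K (h 0) k <-> fdeg V K (h 1) k"
proof -
 have VM: "V <= topspace M" using V by (rule openin_subset)
 have hV: "h t ` V <= topspace M" if "t : {0..1}" for t
 proof (rule image_subsetI)
  fix x assume "x : V"
  hence "(t, x) : topspace (cylinder (subtopology M V))" using that VM by auto
  from funcset_mem[OF continuous_map_funspace[OF H] this] show "h t x : topspace M" by simp
 qed
 show ?thesis unfolding fdeg_def
 proof (rule deg_along_homotopy[OF continuous_displ[OF H]])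
  show "dom V <= ecar N" using Q_ecar by (auto simp: dom_def)
  fix t :: real and y assume t: "t : {0..1}" "y : dom V" "(case (t, y) of (t, y) => displ (h t) y) = (%i. 0)"
  hence "r y : V & h t (r y) = r y & y = i (r y)" by (intro displ_zero[OF _ _ VM hV]) auto
  thus "y : i ` K" using z t(1) by blast
 qed auto
qed

lemma fdeg_localize:
 assumes p: "isolating V K f" and V': "openin M V'" "K <= V'" "V' <= V" shows "fdeg V' K f k <-> fdeg V K f k"
proof -
 have "K <= topspace M" using p openin_subset unfolding isolating_def by blast
 hence "i ` K <= dom V'" "dom V' <= dom V" using V' Q(2) ri by (auto simp: dom_def subset_iff)
 thus ?thesis unfolding fdeg_def using deg_along_localize[OF isolating_proper[OF p] openin_dom[OF V'(1)]] by blast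
qed

lemma fdeg_shrink:
 "isolating V K f ==> isolating V K' f ==> K <= K' ==> fdeg V K f k <-> fdeg V K' f k"
 unfolding fdeg_def by (intro deg_along_shrink isolating_proper image_mono)

lemma fdeg_cong:
 assumes "!!x. x : V ==> f x = g x" shows "fdeg V K f k <-> fdeg V K g k"
 unfolding fdeg_def using assms Q_ecar by (intro deg_along_cong) (auto simp: dom_def displ_def)

lemma fdeg_unique: "isolating V K f ==> fdeg V K f k ==> fdeg V K f k' ==> k = k'"
 unfolding fdeg_def using deg_along_unique[OF isolating_proper] by blast

lemma fdeg_empty: "isolating V {} f ==> fdeg V {} f k <-> k = 0"
 using isolating_proper[of V "{}" f] deg_along_empty[of N "dom V" "displ f"] fdeg_unique[of V "{}" f]
 by (auto simp: fdeg_def)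

text \<open>The displacement of a constant map is a translation, to which
  \<open>deg_along_translation\<close> applies.\<close>

lemma fdeg_const:
 assumes "openin M V" "a : V" shows "isolating V {a} (%_. a)" "fdeg V {a} (%_. a) k <-> k = 1"
proof -
 have a: "a : topspace M" using assms openin_subset by blast
 thus iso: "isolating V {a} (%_. a)" using assms by (auto simp: isolating_def)
 have "i a : dom V" using a assms Q(2) ri by (auto simp: dom_def)
 hence "fdeg V {a} (%_. a) 1"
  using deg_along_translation[OF openin_dom[OF assms(1)]] by (simp add: fdeg_def displ_def [abs_def])
 thus "fdeg V {a} (%_. a) k <-> k = 1" using fdeg_unique[OF iso] by blast
qed

lemma fdeg_diff:
 assumes p: "isolating V (K1 Un K2) f" and V: "openin M V1" "openin M V2" "V1 <= V" "V2 <= V" "V1 Int V2 = {}"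
  and K: "compactin M K1" "compactin M K2" "K1 <= V1" "K2 <= V2" and k: "fdeg V (K1 Un K2) f k" "fdeg V1 K1 f l"
 shows "fdeg V2 K2 f (k - l)"
proof -
 have "V1 <= topspace M" "V2 <= topspace M" using V(1,2) openin_subset by auto
 hence "i ` K1 <= dom V1" "i ` K2 <= dom V2" using K(3,4) Q(2) ri by (auto simp: dom_def subset_iff)
 moreover have "dom V1 <= dom V" "dom V2 <= dom V" "dom V1 Int dom V2 = {}" using V(3-5) by (auto simp: dom_def)
 ultimately show ?thesis using deg_along_diff[of N "dom V" "i ` K1" "i ` K2" "displ f" "dom V1" "dom V2" k l]
  isolating_proper[OF p] openin_dom V(1,2) image_compactin[OF K(1) i] image_compactin[OF K(2) i] k
  by (simp add: fdeg_def image_Un)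
qed

text \<open>Zeros of the displacement and fixed points correspond under \<open>i\<close>, and
  \<open>r\<close> carries compactness of the zero set back to \<open>M\<close>.\<close>

lemma local_degree_fdeg:
 assumes V: "openin M V" and f: "continuous_map M M f"
 shows "local_degree N {y : Q. r y : V} (%y j. y j - i (f (r y)) j) k <->
  compactin M {x : V. f x = x} & fdeg V {x : V. f x = x} f k"
proof -
 let ?F = "{x : V. f x = x}"
 have VM: "V <= topspace M" "f ` V <= topspace M" using openin_subset[OF V] continuous_map_funspace[OF f] by auto
 have F: "{y : dom V. displ f y = (%j. 0)} = i ` ?F"
 proof
  show "{y : dom V. displ f y = (%j. 0)} <= i ` ?F" using displ_zero[OF _ _ VM] by blast
  show "i ` ?F <= {y : dom V. displ f y = (%j. 0)}" using VM(1) Q(2) ri by (auto simp: dom_def displ_def subset_iff)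
 qed
 have cf: "continuous_map (subtopology M V) M f" by (rule continuous_map_from_subtopology[OF f])
 have iso: "isolating V ?F f" if "compactin M ?F" using that V cf by (auto simp: isolating_def)
 have eq: "{y : Q. r y : V} = dom V" "(%y j. y j - i (f (r y)) j) = displ f"
  by (auto simp: dom_def displ_def fun_eq_iff)
 have "compactin M ?F" if "pzeros N (dom V) (i ` ?F) (displ f)"
 proof -
  have iF: "i ` ?F <= Q" using Q(2) VM(1) by auto
  have "compactin (esub N Q) (i ` ?F)" using that iF by (auto simp: pzeros_def compactin_subtopology)
  hence "compactin M (r ` i ` ?F)" by (rule image_compactin[OF _ r])
  moreover have "r ` i ` ?F = ?F" using ri VM(1) by (force simp: image_image subset_iff)
  ultimately show ?thesis by simp
 qed
 thus ?thesis unfolding eq local_degree_eq F fdeg_def using isolating_proper[OF iso] by blast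
qed

end

section \<open>The degree of a fixed point in a chart\<close>

locale chart_data = retr M N i r Q
 for M :: "'m topology" and N i r Q +
 fixes c :: "real ^ 'n => 'm" and e :: "'m => real ^ 'n" and R :: real
 assumes R: "R > 0" and c: "continuous_map (top_of_set (ball 0 R)) M c" "openin M (c ` ball 0 R)"
  and e: "continuous_map (subtopology M (c ` ball 0 R)) euclidean e" and ec: "!!v. v : ball 0 R ==> e (c v) = v"
begin

definition chart_map :: "(real ^ 'n => real ^ 'n) => 'm => 'm"
 where "chart_map et x = c (et (e x))"

definition cdeg :: "(real ^ 'n) set => (real ^ 'n) set => (real ^ 'n => real ^ 'n) => int => bool"
 where "cdeg A K et k <-> fdeg (c ` A) (c ` K) (chart_map et) k"

definition cisolating :: "(real ^ 'n) set => (real ^ 'n) set => (real ^ 'n => real ^ 'n) => bool"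
 where "cisolating A K et <-> open A & A <= ball 0 R & continuous_on A et & et ` A <= ball 0 R &
  compact K & {v : A. et v = v} <= K & K <= A"

lemma c_image_Int: "A <= ball 0 R ==> B <= ball 0 R ==> c ` A Int c ` B = c ` (A Int B)"
 using ec by (intro inj_on_image_Int[symmetric, of c "ball 0 R"]) (auto intro: inj_on_inverseI[of _ e])

lemma openin_c_image:
 assumes "open A" "A <= ball 0 R" shows "openin M (c ` A)"
proof -
 have "openin (subtopology M (c ` ball 0 R)) {x : topspace (subtopology M (c ` ball 0 R)). e x : A}"
  using openin_continuous_map_preimage[OF e] assms(1) by simp
 moreover have "{x : topspace (subtopology M (c ` ball 0 R)). e x : A} = c ` A"
 proof -
  have "c v : topspace M" "e (c v) = v" if "v : ball 0 R" for v using openin_subset[OF c(2)] that ec by blast+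
  thus ?thesis using assms(2) by (auto simp del: mem_ball_0)
 qed
 ultimately show ?thesis using openin_trans_full c(2) by metis
qed

lemma compactin_c_image:
 assumes "compact K" "K <= ball 0 R" shows "compactin M (c ` K)"
 using image_compactin[OF _ c(1)] assms by (simp add: compactin_subtopology)

lemma cont_chart_homotopy:
 assumes A: "A <= ball 0 R" and h: "continuous_on ({0..1::real} \<times> A) (%(t, v). h t v)" "!!t v. t : {0..1} ==> v : A ==> h t v : ball 0 R"
 shows "continuous_map (cylinder (subtopology M (c ` A))) M (%(t, x). chart_map (h t) x)"
proof -
 let ?X = "cylinder (subtopology M (c ` A))"
 have sub: "c ` A <= topspace M" using A openin_subset[OF c(2)] by blast
 have eA: "continuous_map (subtopology M (c ` A)) (top_of_set A) e" unfolding continuous_map_in_subtopology using A ec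
  by (auto intro!: continuous_map_from_subtopology_mono[OF e])
 have "continuous_map ?X (cylinder (top_of_set A)) (%z. (fst z, e (snd z)))"
  unfolding continuous_map_pairwise using continuous_map_compose[OF continuous_map_snd eA]
  by (simp add: continuous_map_fst o_def)
 hence 1: "continuous_map ?X (top_of_set ({0..1} \<times> A)) (%z. (fst z, e (snd z)))"
  by (simp only: prod_topology_subtopology_eu)
 have 2: "continuous_map (top_of_set ({0..1} \<times> A)) (top_of_set (ball 0 R)) (%(t, v). h t v)"
  using h by (auto simp: continuous_map_in_subtopology)
 from continuous_map_compose[OF continuous_map_compose[OF 1 2] c(1)]
 show ?thesis by (simp add: chart_map_def o_def case_prod_unfold)
qed

lemma cisolating_isolating:
 assumes "cisolating A K et" shows "isolating (c ` A) (c ` K) (chart_map et)"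
proof -
 have A: "open A" "A <= ball 0 R" "continuous_on A et" "et ` A <= ball 0 R" "compact K" "{v : A. et v = v} <= K" "K <= A"
  using assms by (auto simp: cisolating_def)
 have "continuous_on ({0..1::real} \<times> A) (%(t, v). et v)"
  unfolding split_beta by (rule continuous_on_compose2[OF A(3)]) (auto intro!: continuous_intros)
 hence 1: "continuous_map (cylinder (subtopology M (c ` A))) M (%(t, x). chart_map et x)"
  by (rule cont_chart_homotopy[where h = "%_. et", OF A(2)]) (use A(4) in blast)
 have 2: "continuous_map (subtopology M (c ` A)) (cylinder (subtopology M (c ` A))) (%y. (0, y))"
  by (simp add: continuous_map_pairwise o_def)
 have "continuous_map (subtopology M (c ` A)) M (chart_map et)"
  using continuous_map_compose[OF 2 1] by (simp add: o_def)
 moreover have "v : K" if v: "v : A" "chart_map et (c v) = c v" for v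
 proof -
  have "v : ball 0 R" "et v : ball 0 R" using v(1) A by auto
  hence "et v = v" using v(2) ec unfolding chart_map_def by metis
  thus ?thesis using v(1) A(6) by blast
 qed
 ultimately show ?thesis
  using openin_c_image[OF A(1,2)] compactin_c_image[of K] A(2,5,7) by (auto simp: isolating_def)
qed

lemma cdeg_homotopy:
 assumes A: "open A" "A <= ball 0 R" and h: "continuous_on ({0..1::real} \<times> A) (%(t, v). h t v)" "!!t v. t : {0..1} ==> v : A ==> h t v : ball 0 R"
  and z: "!!t v. t : {0..1} ==> v : A ==> h t v = v ==> v : K" shows "cdeg A K (h 0) k <-> cdeg A K (h 1) k"
 unfolding cdeg_def
proof (rule fdeg_homotopy[OF cont_chart_homotopy[OF A(2) h] openin_c_image[OF A]])
 fix t :: real and x assume t: "t : {0..1}" "x : c ` A" "chart_map (h t) x = x"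
 then obtain v where v: "v : A" "x = c v" by blast
 hence "v : ball 0 R" "h t v : ball 0 R" using A(2) h(2) t(1) by auto
 hence "h t v = v" using t(3) ec unfolding chart_map_def v(2) by metis
 thus "x : c ` K" using z t(1) v by blast
qed

lemma cdeg_localize:
 "cisolating A K et ==> open A' ==> K <= A' ==> A' <= A ==> cdeg A' K et k <-> cdeg A K et k" unfolding cdeg_def
 by (intro fdeg_localize cisolating_isolating openin_c_image image_mono) (auto simp: cisolating_def)

lemma cdeg_shrink:
 "cisolating A K et ==> cisolating A K' et ==> K <= K' ==> cdeg A K et k <-> cdeg A K' et k"
 unfolding cdeg_def by (intro fdeg_shrink cisolating_isolating image_mono)

lemma cdeg_cong:
 assumes "!!v. v : A ==> et v = tht v" "A <= ball 0 R" shows "cdeg A K et k <-> cdeg A K tht k"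
 unfolding cdeg_def using assms ec by (intro fdeg_cong) (auto simp: chart_map_def subset_iff)

lemma cdeg_const:
 assumes "open A" "A <= ball 0 R" "a : A" shows "cdeg A {a} (%_. a) k <-> k = 1"
 using fdeg_const(2)[OF openin_c_image[OF assms(1,2)], of "c a" k] assms(3) by (simp add: cdeg_def chart_map_def [abs_def])

lemma cdeg_empty: "cisolating A {} et ==> cdeg A {} et k <-> k = 0"
 using fdeg_empty cisolating_isolating[of A "{}"] by (simp add: cdeg_def)

lemma cdeg_unique: "cisolating A K et ==> cdeg A K et k ==> cdeg A K et k' ==> k = k'"
 unfolding cdeg_def by (rule fdeg_unique[OF cisolating_isolating])

lemma cdeg_diff:
 assumes p: "cisolating A (K1 Un K2) et"
  and A: "open A1" "open A2" "A1 <= A" "A2 <= A" "A1 Int A2 = {}" and K: "compact K1" "compact K2" "K1 <= A1" "K2 <= A2"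
  and k: "cdeg A (K1 Un K2) et k" "cdeg A1 K1 et l" shows "cdeg A2 K2 et (k - l)"
proof -
 have AR: "A <= ball 0 R" using p by (simp add: cisolating_def)
 hence "c ` A1 Int c ` A2 = {}" using A c_image_Int[of A1 A2] by auto
 moreover have "compactin M (c ` K1)" "compactin M (c ` K2)" using A K AR by (auto intro!: compactin_c_image)
 ultimately show ?thesis
  using fdeg_diff[of "c ` A" "c ` K1" "c ` K2" "chart_map et" "c ` A1" "c ` A2" k l] cisolating_isolating[OF p] k A K
  openin_c_image[OF A(1)] openin_c_image[OF A(2)] AR by (simp add: cdeg_def image_Un image_mono subset_trans[OF _ AR])
qed

text \<open>Chosen so that \<open>v - double J v\<close> changes the signs of the coordinates in
  \<open>J\<close>; these sign changes are the normal forms of \<open>1 - L\<close>.\<close>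

definition double :: "'n set => real ^ 'n => real ^ 'n"
 where "double J v = (\<chi> i. if i : J then 2 * v $ i else 0)"

lemma norm_double: "norm (double J v) <= 2 * norm v"
proof -
 have "norm (double J v) <= norm (2 *\<^sub>R v)" by (rule norm_le_componentwise_cart) (simp add: double_def)
 thus ?thesis by simp
qed

lemma continuous_double [continuous_intros]: "continuous_on A f ==> continuous_on A (%x. double J (f x))"
 unfolding double_def
proof (intro continuous_on_vec_lambda)
 fix i assume "continuous_on A f"
 thus "continuous_on A (%x. if i : J then 2 * f x $ i else 0)" by (cases "i : J") (auto intro!: continuous_intros)
qed

text \<open>The map \<open>u \<mapsto> min (2 u) a\<close> of the \<open>j\<close>-th axis is doubling near its fixed point \<open>0\<close> and constant
 near its fixed point \<open>a\<close>, and both fixed points disappear when a constant is subtracted.\<close>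

lemma cdeg_double:
 assumes rh: "rh > 0" "8 * rh <= R" shows "cdeg (ball 0 rh) {0} (double J) k <-> k = (- 1) ^ card J"
 using finite[of J] rh
proof (induction J arbitrary: rh k rule: finite_induct)
 case empty
 have "cdeg (ball 0 rh) {0} (double {}) k <-> cdeg (ball 0 rh) {0} (%_. 0) k"
  using empty by (intro cdeg_cong) (auto simp: double_def vec_eq_iff)
 thus ?case using cdeg_const[of "ball 0 rh" 0 k] empty subset_ball[of rh R 0] by simp
next
 case (insert j J)
 let ?B = "ball 0 rh :: (real ^ 'n) set"
 have B: "?B <= ball 0 R" using insert.prems by auto
 define a where "a = rh / 2"
 define p where "p = axis j a"
 have a: "0 < a" "a < rh" "rh = 2 * a" using insert.prems by (auto simp: a_def)
 define K where "K = (%u. axis j u) ` {0..a}"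
 have contax: "continuous_on X f ==> continuous_on X (%x. axis j (f x :: real))" for X :: "'z::topological_space set" and f
  unfolding axis_def
 proof (intro continuous_on_vec_lambda)
  fix i assume "continuous_on X f"
  thus "continuous_on X (%x. if i = j then f x else 0)" by (cases "i = j") auto
 qed
 have norm_axis: "norm (axis j u :: real ^ 'n) = \<bar>u\<bar>" for u
 proof -
  have "axis j u = u *\<^sub>R (axis j 1 :: real ^ 'n)" by (simp add: axis_def vec_eq_iff)
  thus ?thesis by (simp add: norm_axis_1)
 qed
 have K: "compact K" "K <= ?B" "0 : K" "p : K"
 proof -
  show "compact K" unfolding K_def by (intro compact_continuous_image contax continuous_intros compact_Icc)
  show "K <= ?B" using a by (auto simp: K_def norm_axis)
  show "0 : K" "p : K" unfolding K_def p_def using a by (auto intro!: image_eqI[of _ _ 0] simp: axis_def vec_eq_iff)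
 qed
 \<comment> \<open>Subtracting \<open>s\<close> is the homotopy. For \<open>s >= 0\<close> all fixed
   points lie on the segment \<open>K\<close>, and at \<open>s = rh = 2 * a\<close> none is left, so
   the total degree is \<open>0\<close>.\<close>
 define ph where "ph = (%s v. double J v + axis j (min (2 * v $ j) a - s))"
 have jJ: "double J v $ j = 0" for v using insert.hyps(2) by (simp add: double_def)
 have fixJ: "v = axis j (v $ j) & f = v $ j" if "double J v + axis j f = v" for v f
 proof -
  have e: "double J v $ i + axis j f $ i = v $ i" for i unfolding vector_add_component[symmetric] that ..
  have "v $ i = axis j (v $ j) $ i" for i
  using e[of i] by (cases "i = j"; cases "i : J") (simp_all add: double_def axis_def)
  hence "v = axis j (v $ j)" unfolding vec_eq_iff ..
  moreover have "f = v $ j" using e[of j] jJ[of v] by (simp add: axis_def)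
  ultimately show ?thesis ..
 qed
 have vj: "\<bar>v $ j\<bar> < rh" if "v : ?B" for v using component_le_norm_cart[of v j] that by simp
 \<comment> \<open>Doubling contributes less than \<open>2 * rh\<close> and the added coordinate at
   most \<open>6 * rh\<close>, whence the hypothesis \<open>8 * rh <= R\<close>.\<close>
 have small: "double J v + axis j f : ball 0 R" if "v : ?B" "\<bar>f\<bar> <= 6 * rh" for v f
 proof -
  have "norm (double J v + axis j f) <= norm (double J v) + norm (axis j f :: real ^ 'n)" by (rule norm_triangle_ineq)
  also have "... < 2 * rh + 6 * rh" using norm_double[of J v] that by (simp add: norm_axis)
  finally show ?thesis using insert.prems by simp
 qed
 have q: "\<bar>min (2 * u) a - s\<bar> <= 6 * rh" if "\<bar>u\<bar> < rh" "0 <= s" "s <= rh" for u s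
  using that a(1,3) by linarith
 have fixph: "v : K & min (2 * v $ j) a - s = v $ j" if "ph s v = v" "0 <= s" for s v
 proof -
  have v: "v = axis j (v $ j) & min (2 * v $ j) a - s = v $ j" using that(1) unfolding ph_def by (rule fixJ)
  hence "v $ j : {0..a}" using that(2) a(1) by (auto simp: min_def split: if_splits)
  hence "axis j (v $ j) : K" unfolding K_def by (rule imageI)
  thus ?thesis using v by simp
 qed
 have contph: "continuous_on X (%z. ph (f z) (g z))" if "continuous_on X f" "continuous_on X g" for X :: "'z::topological_space set" and f g
  unfolding ph_def using that a by (intro continuous_intros contax) auto
 have iso: "cisolating ?B K' (ph s)" if "{v : ?B. ph s v = v} <= K'" "K' <= K" "compact K'" "0 <= s" "s <= rh" for K' s
  unfolding cisolating_def
 proof (intro conjI image_subsetI)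
  show "continuous_on ?B (ph s)" using contph[OF continuous_on_const continuous_on_id] by simp
  show "ph s v : ball 0 R" if "v : ?B" for v
  unfolding ph_def using that \<open>0 <= s\<close> \<open>s <= rh\<close> by (intro small q vj)
 qed (use that B K(2) in auto)
 have nofix: "ph rh v ~= v" for v
 proof
  assume "ph rh v = v"
  thus False using fixph[of rh v] a by (auto simp: min_def split: if_splits)
 qed
 have "cdeg ?B {} (ph rh) 0" using cdeg_empty[of ?B "ph rh" 0] iso[of rh "{}"] nofix insert.prems by simp
 hence "cdeg ?B K (ph rh) 0" using cdeg_shrink[of ?B "{}" "ph rh" K 0] iso[of rh] nofix K insert.prems by simp
 moreover have "cdeg ?B K (ph (0 * rh)) 0 <-> cdeg ?B K (ph (1 * rh)) 0"
 proof (rule cdeg_homotopy[OF open_ball B])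
  show "continuous_on ({0..1} \<times> ?B) (%(t, v). ph (t * rh) v)"
  unfolding split_beta by (intro contph continuous_intros)
  fix t :: real and v assume t: "t : {0..1}" "v : ?B"
  have trh: "0 <= t * rh" "t * rh <= rh" using t(1) insert.prems by (auto simp: mult_le_cancel_right1)
  show "ph (t * rh) v : ball 0 R" unfolding ph_def using t trh by (intro small q vj)
  show "v : K" if "ph (t * rh) v = v" using fixph[OF that trh(1)] ..
 qed
 ultimately have "cdeg ?B K (ph 0) 0" by simp
 moreover have iso0: "cisolating ?B ({p} Un {0}) (ph 0)"
 proof (rule iso)
  show "{v : ?B. ph 0 v = v} <= {p} Un {0}"
  proof
  fix v assume "v : {v : ?B. ph 0 v = v}"
  hence f: "v : K" "min (2 * v $ j) a = v $ j" using fixph[of 0 v] by simp_all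
  from f(2) have "v $ j = 0 \<or> v $ j = a" using a(1) by (auto simp: min_def split: if_splits)
  with f(1) show "v : {p} Un {0}" by (auto simp: K_def p_def axis_def vec_eq_iff)
 qed
 qed (use K insert.prems in auto)
 ultimately have tot: "cdeg ?B ({p} Un {0}) (ph 0) 0"
  using cdeg_shrink[OF iso0 iso[of 0 K]] K fixph insert.prems by auto
 let ?U = "ball p (a / 2)" and ?V = "ball 0 (a / 2) :: (real ^ 'n) set"
 have np: "norm p = a" using a by (simp add: p_def norm_axis)
 have UV: "?U <= ?B" "?V <= ?B" "?U Int ?V = {}" "0 ~: ?U"
 proof -
  have tri: "norm x <= norm p + dist p x" "norm p <= norm x + dist p x" for x
  using norm_triangle_ineq2[of x p] norm_triangle_ineq2[of p x] by (simp_all add: dist_norm norm_minus_commute)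
  show "?U <= ?B"
  proof
  fix x assume "x : ?U"
  thus "x : ?B" using tri(1)[of x] np a by simp
  qed
  show "?V <= ?B" using a by auto
  have "x ~: ?V" if "x : ?U" for x using tri(2)[of x] that np a by simp
  thus "?U Int ?V = {}" by blast
  show "0 ~: ?U" using np a by simp
 qed
 have IH: "cdeg ?B {0} (double J) k <-> k = (- 1) ^ card J" for k by (rule insert.IH) (use insert.prems in auto)
 \<comment> \<open>Near \<open>p\<close> the added coordinate is the constant \<open>a\<close>.
   Sliding this constant to \<open>0\<close> moves the fixed point from \<open>p\<close> to
   \<open>0\<close> and reduces the degree at \<open>p\<close> to the induction hypothesis for
   \<open>double J\<close>.\<close>
 have shift: "cisolating ?B K' (%v. double J v + axis j b)" if "0 <= b" "b <= a" "axis j b : K'" "K' <= K" "compact K'" for b K'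
  unfolding cisolating_def using that B K(2) a fixJ[of _ b] by (auto intro!: continuous_intros small) metis
 have ax0 [simp]: "axis j 0 = (0 :: real ^ 'n)" by (simp add: axis_def vec_eq_iff)
 have "cdeg ?B {p} (%v. double J v + axis j a) k <-> cdeg ?B K (%v. double J v + axis j a) k" for k
  using shift[of a] a K by (intro cdeg_shrink) (auto simp: p_def)
 moreover have "cdeg ?B K (%v. double J v + axis j (0 * a)) k <-> cdeg ?B K (%v. double J v + axis j (1 * a)) k" for k
 proof (rule cdeg_homotopy[OF open_ball B])
  fix t :: real and v assume t: "t : {0..1}" "v : ?B"
  have ta: "0 <= t * a" "t * a <= a" using t a by (auto simp: mult_le_cancel_right1)
  thus "double J v + axis j (t * a) : ball 0 R" using t a by (intro small) auto
  assume "double J v + axis j (t * a) = v"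
  from fixJ[OF this] show "v : K" unfolding K_def using ta by (intro image_eqI[of _ _ "v $ j"]) auto
 qed (auto simp: split_beta intro!: continuous_intros contax)
 moreover have "cdeg ?B {0} (%v. double J v + axis j 0) k <-> cdeg ?B K (%v. double J v + axis j 0) k" for k
  using cdeg_shrink[OF shift[of 0 "{0}"] shift[of 0 K]] a K by simp
 ultimately have "cdeg ?B {p} (%v. double J v + axis j a) k <-> k = (- 1) ^ card J" for k using IH[of k] by simp
 hence uA: "cdeg ?U {p} (%v. double J v + axis j a) k <-> k = (- 1) ^ card J" for k
  using cdeg_localize[OF shift[of a "{p}"] open_ball _ UV(1)] a K(4) by (simp add: p_def)
 have "cdeg ?U {p} (ph 0) k <-> cdeg ?U {p} (%v. double J v + axis j a) k" for k
 proof (rule cdeg_cong)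
  fix v assume v: "v : ?U"
  have "\<bar>v $ j - a\<bar> < a / 2"
  using component_le_norm_cart[of "p - v" j] v by (simp add: p_def dist_norm axis_def abs_minus_commute)
  hence "a < 2 * v $ j" by linarith
  thus "ph 0 v = double J v + axis j a" by (simp add: ph_def)
 qed (use UV(1) B in blast)
 hence "cdeg ?U {p} (ph 0) ((- 1) ^ card J)" using uA by simp
 \<comment> \<open>The total degree is \<open>0\<close> and the point \<open>p\<close> contributes
   \<open>(- 1) ^ card J\<close>, so \<open>0\<close> contributes the opposite sign.\<close>
 hence vA: "cdeg ?V {0} (ph 0) (0 - (- 1) ^ card J)"
  using a UV by (intro cdeg_diff[OF iso0 _ _ UV(1,2,3) _ _ _ _ tot]) auto
 have "cdeg ?V {0} (ph 0) k <-> cdeg ?V {0} (double (insert j J)) k" for k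
 proof (rule cdeg_cong)
  fix v assume v: "v : ?V"
  have "\<bar>v $ j\<bar> < a / 2" using component_le_norm_cart[of v j] v by simp
  hence "ph 0 v $ i = double (insert j J) v $ i" for i
  using jJ[of v] by (cases "i = j") (auto simp: ph_def min_def double_def axis_def)
  thus "ph 0 v = double (insert j J) v" unfolding vec_eq_iff ..
 qed (use UV(2) B in blast)
 hence V: "cdeg ?V {0} (double (insert j J)) (0 - (- 1) ^ card J)" using vA by simp
 have isoB: "cisolating ?B {0} (double (insert j J))" unfolding cisolating_def
 proof (intro conjI subsetI)
  show "continuous_on ?B (double (insert j J))" using continuous_double[OF continuous_on_id] by simp
  fix w assume "w : double (insert j J) ` ?B"
  thus "w : ball 0 R" using insert.prems norm_double[of "insert j J"] by (fastforce intro: le_less_trans)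
 next
  fix v assume "v : {v : ?B. double (insert j J) v = v}"
  hence "v $ i = 0" for i by (auto simp: double_def dest!: arg_cong[of _ _ "%w. w $ i"] split: if_splits)
  thus "v : {0}" by (simp add: vec_eq_iff)
 qed (use B insert.prems in auto)
 have "cdeg ?B {0} (double (insert j J)) (0 - (- 1) ^ card J)"
  using cdeg_localize[OF isoB open_ball _ UV(2)] V a by simp
 thus ?case using cdeg_unique[OF isoB] insert.hyps by auto
qed

end

section \<open>Deforming linear isomorphisms to changes of sign\<close>

definition negate :: "'n set => real ^ 'n => real ^ 'n"
 where "negate J v = (\<chi> i. if i : J then - v $ i else v $ i)"

text \<open>A path of linear isomorphisms from \<open>f\<close> to a change of signs; keeping
  \<open>J\<close> in the relation records the sign of the determinant as the parity of
  \<open>card J\<close>.\<close>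

definition lpath :: "(real ^ 'n => real ^ 'n) => 'n set => (real => real ^ 'n => real ^ 'n) => bool"
 where "lpath f J h <-> (ALL t:{0..1}. linear (h t) & inj (h t)) &
  continuous_on ({0..1} \<times> UNIV) (%(t, v). h t v) & h 0 = f & h 1 = negate J"

text \<open>Paths are composed pointwise; coordinates negated twice are not negated, hence the
  symmetric difference.\<close>

lemma lpath_compose:
 assumes "lpath f J h" "lpath g K k" shows "lpath (f o g) (J - K Un (K - J)) (%t. h t o k t)"
proof -
 have h: "continuous_on ({0..1} \<times> UNIV) (%(t, v). h t v)" and k: "continuous_on ({0..1} \<times> UNIV) (%(t, v). k t v)"
  using assms by (auto simp: lpath_def)
 have "continuous_on ({0..1} \<times> UNIV) (%z. (%(t, v). h t v) (fst z, (%(t, v). k t v) z))"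
  by (rule continuous_on_compose2[OF h]) (auto intro!: continuous_intros k)
 moreover have "negate J o negate K = negate (J - K Un (K - J))" by (auto simp: negate_def fun_eq_iff vec_eq_iff)
 ultimately show ?thesis
  using assms by (auto simp: lpath_def split_beta o_def intro: linear_compose[unfolded o_def] inj_compose[unfolded o_def])
qed

lemma lpath_negate:
 fixes J :: "'n::finite set"
 shows "lpath (negate J) J (%_. negate J)"
proof -
 have "negate J (negate J v) = v" for v :: "real ^ 'n" by (simp add: negate_def vec_eq_iff)
 hence "inj (negate J)" by (metis injI)
 moreover have "linear (negate J)" by (auto simp: negate_def linear_iff vec_eq_iff)
 moreover from this have "continuous_on ({0..1} \<times> UNIV) (%z. negate J (snd z))"
  by (intro continuous_on_compose2[OF linear_continuous_on continuous_on_snd]) (auto simp: linear_linear intro: continuous_on_id)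
 ultimately show ?thesis by (simp add: lpath_def split_beta)
qed

lemma lpath_idplus:
 fixes m n :: "'n::finite"
 assumes "m ~= n"
 shows "lpath (%x. \<chi> i. if i = m then x $ m + x $ n else x $ i) {} (%t x. \<chi> i. if i = m then x $ m + (1 - t) * x $ n else x $ i)"
 unfolding lpath_def
proof (intro conjI ballI)
 fix t :: real
 show "linear (%x::real^'n. \<chi> i. if i = m then x $ m + (1 - t) * x $ n else x $ i)"
  by (auto simp: linear_iff vec_eq_iff algebra_simps)
 have "x = y" if "ALL i. (if i = m then x $ m + (1 - t) * x $ n else x $ i) = (if i = m then y $ m + (1 - t) * y $ n else y $ i)" for x y :: "real ^ 'n"
 proof -
  have "x $ i = y $ i" for i using that assms by (cases "i = m") (metis add_right_cancel)+
  thus ?thesis by (simp add: vec_eq_iff)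
 qed
 thus "inj (%x::real^'n. \<chi> i. if i = m then x $ m + (1 - t) * x $ n else x $ i)"
  by (auto simp: inj_def vec_eq_iff[of "vec_lambda _"])
 show "continuous_on ({0..1} \<times> UNIV) (%(t, x::real^'n). \<chi> i. if i = m then x $ m + (1 - t) * x $ n else x $ i)"
  unfolding split_beta
 proof (intro continuous_on_vec_lambda)
  fix i show "continuous_on ({0..1} \<times> UNIV) (%z::real \<times> (real^'n). if i = m then snd z $ m + (1 - fst z) * snd z $ n else snd z $ i)"
  by (cases "i = m") (auto intro!: continuous_intros)
 qed
qed (auto simp: negate_def fun_eq_iff vec_eq_iff)

lemma lpath_const:
 fixes c :: "'n::finite => real"
 assumes c: "!!i. c i ~= 0"
 shows "lpath (%x. \<chi> i. c i * x $ i) {i. c i < 0} (%t x. \<chi> i. ((1 - t) * c i + t * sgn (c i)) * x $ i)"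
 unfolding lpath_def
proof (intro conjI ballI)
 fix t :: real assume t: "t : {0..1}"
 show "linear (%x::real^'n. \<chi> i. ((1 - t) * c i + t * sgn (c i)) * x $ i)"
  by (auto simp: linear_iff vec_eq_iff algebra_simps)
 have "(1 - t) * c i + t * sgn (c i) ~= 0" for i
 proof -
  have "(1 - t) * c i + t * sgn (c i) = sgn (c i) * ((1 - t) * \<bar>c i\<bar> + t)"
  using c[of i] by (cases "c i > 0") (simp_all add: sgn_if algebra_simps)
  moreover have "(1 - t) * \<bar>c i\<bar> + t > 0" using t c[of i] by (cases "t = 1") (auto intro!: add_pos_nonneg)
  ultimately show ?thesis using c[of i] by (simp add: sgn_eq_0_iff)
 qed
 thus "inj (%x::real^'n. \<chi> i. ((1 - t) * c i + t * sgn (c i)) * x $ i)" by (auto simp: inj_def vec_eq_iff)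
next
 show "continuous_on ({0..1} \<times> UNIV) (%(t, x::real^'n). \<chi> i. ((1 - t) * c i + t * sgn (c i)) * x $ i)"
  unfolding split_beta by (intro continuous_on_vec_lambda continuous_intros)
qed (use c in \<open>auto simp: negate_def fun_eq_iff vec_eq_iff sgn_if\<close>)

text \<open>Every linear map is a composite of elementary ones. Shears contract to the identity,
  diagonal maps to their signs, maps that kill a coordinate are not injective, and the factors of an
  injective composite are injective.\<close>

lemma lpath_exists:
 fixes f :: "real ^ 'n => real ^ 'n"
 assumes "linear f" "inj f" shows "EX J h. lpath f J h"
proof -
 have "inj f --> (EX J h. lpath f J h)"
 proof (rule induct_linear_elementary[OF assms(1)])
  fix f g :: "real ^ 'n => real ^ 'n"
  assume fg: "linear f" "linear g" "inj f --> (EX J h. lpath f J h)" "inj g --> (EX J h. lpath g J h)"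
  have "inj f & inj g" if i: "inj (f o g)"
  proof -
  have g: "inj g" using i by (rule inj_on_imageI2)
  have "surj (f o g)" by (rule linear_injective_imp_surjective[OF linear_compose[OF fg(2,1)] i]) simp
  moreover have "range (f o g) <= range f" by auto
  ultimately have "surj f" by blast
  thus ?thesis using g linear_surjective_imp_injective[OF fg(1)] by blast
  qed
  thus "inj (f o g) --> (EX J h. lpath (f o g) J h)" using fg(3,4) lpath_compose by blast
 next
  fix f :: "real ^ 'n => real ^ 'n" and i assume f: "linear f" "!!x. f x $ i = 0"
  have "~ inj f"
  proof
  assume "inj f"
  then obtain x where "f x = axis i 1" using linear_injective_imp_surjective[OF f(1)] by (metis surjD)
  thus False using f(2)[of x] by (simp add: axis_def)
  qed
  thus "inj f --> (EX J h. lpath f J h)" by blast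
 next
  fix c :: "'n => real"
  have "c i ~= 0" if "inj (%x::real^'n. \<chi> i. c i * x $ i)" for i
  proof
  assume "c i = 0"
  hence "(\<chi> k. c k * (axis i 1 :: real ^ 'n) $ k) = (\<chi> k. c k * (0 :: real ^ 'n) $ k)" by (simp add: axis_def vec_eq_iff)
  hence "axis i 1 = (0 :: real ^ 'n)" using injD[OF that] by blast
  thus False by (simp add: axis_eq_0_iff)
  qed
  thus "inj (%x::real^'n. \<chi> i. c i * x $ i) --> (EX J h. lpath (%x. \<chi> i. c i * x $ i) J h)"
  using lpath_const by blast
 next
  fix m n :: 'n assume mn: "m ~= n"
  define A where "A = (%m n (x :: real ^ 'n). \<chi> i. if i = m then x $ m + x $ n else x $ i)"
  have p: "EX J h. lpath (A m n) J h" if "m ~= n" for m n unfolding A_def using lpath_idplus[OF that] by blast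
  show "inj (%x. \<chi> i. if i = m then x $ m + x $ n else x $ i) --> (EX J h. lpath (%x. \<chi> i. if i = m then x $ m + x $ n else x $ i) J h)"
  using lpath_idplus[OF mn] by blast
  \<comment> \<open>A transposition is made of three shears, the middle one conjugated by a sign
    change, and a final sign change, so its path is a composite of known ones.\<close>
  have "(%x. \<chi> i. x $ Transposition.transpose m n i) = negate {n} o A m n o (negate {n} o A n m o negate {n}) o A m n"
  using mn by (auto simp: fun_eq_iff vec_eq_iff A_def negate_def Transposition.transpose_def)
  moreover have "EX J h. lpath (negate {n} o A m n o (negate {n} o A n m o negate {n}) o A m n) J h"
  using p[OF mn] p[OF mn[symmetric]] lpath_negate[of "{n}"] lpath_compose by meson
  ultimately show "inj (%x. \<chi> i. x $ Transposition.transpose m n i) --> (EX J h. lpath (%x. \<chi> i. x $ Transposition.transpose m n i) J h)"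
  by simp
 qed
 thus ?thesis using assms(2) by blast
qed

context chart_data begin

text \<open>Along the path the map \<open>v - h t v\<close> fixes only \<open>0\<close>, because
  \<open>h t\<close> is injective, and a small ball keeps all images inside the chart. The path ends
  at \<open>double J\<close>, whose degree is known.\<close>

lemma cdeg_linear:
 assumes L: "lpath (%v. v - L v) J h"
 obtains rh0 where "rh0 > 0" "!!rh k. 0 < rh ==> rh <= rh0 ==> cdeg (ball 0 rh) {0} L k <-> k = (- 1) ^ card J"
proof -
 have h: "!!t. t : {0..1} ==> linear (h t)" "!!t. t : {0..1} ==> inj (h t)"
  "continuous_on ({0..1} \<times> UNIV) (%(t, v). h t v)" "h 0 = (%v. v - L v)" "h 1 = negate J"
  using L by (auto simp: lpath_def)
 have "compact ((%(t, v). h t v) ` ({0..1} \<times> cball 0 1))"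
  by (intro compact_continuous_image compact_Times compact_cball compact_Icc continuous_on_subset[OF h(3)]) auto
 then obtain B where B0: "B > 0" "ALL x:(%(t, v). h t v) ` ({0..1} \<times> cball 0 1). norm x <= B"
  using compact_imp_bounded bounded_pos by metis
 have B: "B > 0" "norm (h t v) <= B" if "t : {0..1}" "norm v <= 1" for t v
  using B0(1) bspec[OF B0(2) imageI[of "(t, v)"]] that by simp_all
 have hB: "norm (h t v) <= B * norm v" if t: "t : {0..1}" for t v
 proof (cases "v = 0")
  case False
  have "norm (h t ((1 / norm v) *\<^sub>R v)) <= B" by (rule B(2)[OF t]) (simp add: False)
  thus ?thesis using False by (simp add: linear_cmul[OF h(1)[OF t]] divide_le_eq)
 qed (simp add: linear_0[OF h(1)[OF t]])
 \<comment> \<open>The \<open>8\<close> serves \<open>cdeg_double\<close>; \<open>B\<close> bounds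
   the operator norms along the path, so images of the ball have norm at most
   \<open>(1 + B) * rh\<close>, which is below \<open>R\<close>.\<close>
 define rh0 where "rh0 = R / (8 + B)"
 show ?thesis
 proof (rule that[of rh0])
  show "rh0 > 0" using R B0(1) by (simp add: rh0_def)
  fix rh k assume rh: "0 < rh" "rh <= rh0"
  hence "rh * (8 + B) <= R" using B0(1) by (simp add: rh0_def le_divide_eq)
  hence rhR: "8 * rh + B * rh <= R" by (simp add: algebra_simps)
  moreover have "B * rh > 0" using B0(1) rh(1) by simp
  ultimately have 8: "8 * rh <= R" and sub: "ball 0 rh <= ball (0 :: real ^ 'n) R" using rh(1) by auto
  have "cdeg (ball 0 rh) {0} (%v. v - h 0 v) k <-> cdeg (ball 0 rh) {0} (%v. v - h 1 v) k"
  proof (rule cdeg_homotopy[OF open_ball sub])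
  have "continuous_on ({0..1} \<times> ball 0 rh) (%(t, v). h t v)" by (rule continuous_on_subset[OF h(3)]) auto
  thus "continuous_on ({0..1} \<times> ball 0 rh) (%(t, v). v - h t v)"
  unfolding split_beta by (intro continuous_intros)
  fix t :: real and v :: "real ^ 'n" assume t: "t : {0..1}" "v : ball 0 rh"
  have "norm (v - h t v) <= norm v + norm (h t v)" by (rule norm_triangle_ineq4)
  also have "... <= norm v + B * norm v" using hB[OF t(1)] by simp
  also have "... <= rh + B * rh" using t(2) B0(1) by (intro add_mono mult_left_mono) auto
  also have "... < R" using rhR rh(1) by linarith
  finally show "v - h t v : ball 0 R" by simp
  assume "v - h t v = v"
  hence "h t v = h t 0" by (simp add: linear_0[OF h(1)[OF t(1)]])
  thus "v : {0}" using injD[OF h(2)[OF t(1)]] by blast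
  qed
  moreover have "(%v. v - h 1 v) = double J" by (auto simp: h(5) double_def negate_def fun_eq_iff vec_eq_iff)
  ultimately show "cdeg (ball 0 rh) {0} L k <-> k = (- 1) ^ card J" using cdeg_double[OF rh(1) 8] by (simp add: h(4))
 qed
qed

text \<open>\<open>v - L v\<close> is bounded below by \<open>b\<close> times the norm, and near
  \<open>0\<close> the map \<open>et\<close> deviates from \<open>L\<close> by at most
  \<open>b / 2\<close> times it, so the straight homotopy from \<open>L\<close> to \<open>et\<close>
  has no fixed point except \<open>0\<close>.\<close>

lemma cdeg_nondegenerate:
 assumes path: "lpath (%v. v - L v) J h" and L: "linear L" and et: "et 0 = 0" "(et has_derivative L) (at 0)"
  and A: "open A" "0 : A" "continuous_on A et"
 obtains rh where "0 < rh" "ball 0 rh <= A" "ball (0 :: real ^ 'n) rh <= ball 0 R" "cisolating (ball 0 rh) {0} et"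
  "!!k. cdeg (ball 0 rh) {0} et k <-> k = (- 1) ^ card J"
proof -
 obtain rh0 where rh0: "rh0 > 0" "!!rh k. 0 < rh ==> rh <= rh0 ==> cdeg (ball 0 rh) {0} L k <-> k = (- 1) ^ card J"
  by (rule cdeg_linear[OF path]) blast
 have "linear (%v. v - L v)" "inj (%v. v - L v)" using path unfolding lpath_def by force+
 then obtain b where b: "b > 0" "!!v. b * norm v <= norm (v - L v)" using linear_inj_bounded_below_pos by blast
 obtain B where B: "B > 0" "!!v. norm (L v) <= B * norm v" using linear_bounded_pos[OF L] by blast
 obtain d where d: "d > 0" "!!v. norm v < d ==> norm (et v - L v) <= b / 2 * norm v"
  using et b(1) unfolding has_derivative_at_alt by (auto dest!: spec[of _ "b / 2"])
 obtain d' where d': "d' > 0" "ball 0 d' <= A" using A(1,2) open_contains_ball by blast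
 define rh where "rh = Min {rh0, d, d', R / (1 + B + b)}"
 have "R / (1 + B + b) > 0" using R b(1) B(1) by simp
 hence rh: "0 < rh" "rh <= rh0" "rh <= d" "rh <= d'" "rh <= R / (1 + B + b)"
  using rh0(1) d(1) d'(1) by (auto simp: rh_def)
 have rhR: "rh * (1 + B + b) <= R" using rh(5) b(1) B(1) by (simp add: le_divide_eq)
 have "rh * 1 <= rh * (1 + B + b)" using rh(1) B(1) b(1) by (intro mult_left_mono) auto
 hence sub: "ball 0 rh <= ball (0 :: real ^ 'n) R" "ball 0 rh <= A" using rhR rh(4) d'(2) by auto
 have cet: "continuous_on (ball 0 rh) et" using A(3) sub(2) by (rule continuous_on_subset)
 define k where "k = (%t v. L v + t *\<^sub>R (et v - L v))"
 have est: "norm (k t v - L v) <= b / 2 * norm v" if "t : {0..1}" "v : ball 0 rh" for t v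
 proof -
  have "norm (k t v - L v) = t * norm (et v - L v)" using that(1) by (simp add: k_def)
  also have "... <= 1 * (b / 2 * norm v)" using that d(2)[of v] rh(3) by (intro mult_mono) auto
  finally show ?thesis by simp
 qed
 have kR: "k t v : ball 0 R" if t: "t : {0..1}" "v : ball 0 rh" for t v
 proof -
  have "norm (k t v) <= norm (L v) + norm (k t v - L v)" by norm
  also have "... <= B * norm v + b / 2 * norm v" using B(2) est[OF t] by (intro add_mono) auto
  also have "... <= norm v * (B + b)" using b(1) by (simp add: algebra_simps)
  also have "... <= rh * (B + b)" using t(2) B(1) b(1) by (intro mult_right_mono) auto
  also have "... < rh * (1 + B + b)" using rh(1) by simp
  finally show ?thesis using rhR by simp
 qed
 have kfix: "v = 0" if t: "t : {0..1}" "v : ball 0 rh" "k t v = v" for t v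
 proof -
  have "b * norm v <= b / 2 * norm v" using b(2)[of v] est[OF t(1,2)] t(3) by simp
  thus ?thesis using b(1) by simp
 qed
 have k1: "k 1 = et" and k0: "k 0 = L" by (auto simp: k_def fun_eq_iff)
 show ?thesis
 proof (rule that)
  show "0 < rh" "ball 0 rh <= A" "ball 0 rh <= ball (0 :: real ^ 'n) R" using rh(1) sub by auto
  show "cisolating (ball 0 rh) {0} et"
  unfolding cisolating_def using sub cet kR[of 1] kfix[of 1] rh(1) unfolding k1 by auto
  fix l
  have "cdeg (ball 0 rh) {0} (k 0) l <-> cdeg (ball 0 rh) {0} (k 1) l"
  proof (rule cdeg_homotopy[OF open_ball sub(1) _ kR])
  have "continuous_on ({0..1} \<times> ball 0 rh) (%z. et (snd z))" if "continuous_on (ball 0 rh) et" for et :: "real ^ 'n => real ^ 'n"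
  by (rule continuous_on_compose2[OF that]) (auto intro!: continuous_intros)
  from this[OF cet] this[OF linear_continuous_on[of L]]
  show "continuous_on ({0..1} \<times> ball 0 rh) (%(t, v). k t v)"
  unfolding k_def split_beta using L by (intro continuous_intros) (auto simp: linear_linear)
  qed (use kfix in auto)
  thus "cdeg (ball 0 rh) {0} et l <-> l = (- 1) ^ card J" using rh0(2)[OF rh(1,2)] by (simp add: k0 k1)
 qed
qed

end

section \<open>The fixed point index and its homotopy invariance\<close>

lemma fixed_point_index_fdeg:
 assumes M: "compact_space M" "Hausdorff_space M" and f: "continuous_map M M f"
 shows "fixed_point_index M f F = (THE k. EX N i r Q. retr M N i r Q &
  (EX V. openin M V & {x : V. f x = x} = F & compactin M F & retr.fdeg N i r Q V F f k))"
proof -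
 have "(EX V. continuous_map M (eucl N) i & openin (eucl N) Q & i ` topspace M <= Q &
  continuous_map (esub N Q) M r & (ALL x:topspace M. r (i x) = x) &
  openin M V & {x : V. f x = x} = F & local_degree N {y : Q. r y : V} (%y j. y j - i (f (r y)) j) k) <->
  retr M N i r Q & (EX V. openin M V & {x : V. f x = x} = F & compactin M F & retr.fdeg N i r Q V F f k)" for N i r Q k
 proof (cases "retr M N i r Q")
  case True
  have V: "openin M V & {x : V. f x = x} = F & local_degree N {y : Q. r y : V} (%y j. y j - i (f (r y)) j) k <->
  openin M V & {x : V. f x = x} = F & compactin M F & retr.fdeg N i r Q V F f k" for V
  using retr.local_degree_fdeg[OF True _ f, of V k] by (intro conj_cong refl) simp
  have "continuous_map M (eucl N) i" "openin (eucl N) Q" "i ` topspace M <= Q"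
  "continuous_map (esub N Q) M r" "ALL x:topspace M. r (i x) = x" using True unfolding retr_def by simp_all
  thus ?thesis unfolding V[symmetric] by (simp add: True)
 next
  case False
  moreover have "retr M N i r Q <-> continuous_map M (eucl N) i & openin (eucl N) Q & i ` topspace M <= Q &
  continuous_map (esub N Q) M r & (ALL x:topspace M. r (i x) = x)" using M by (simp add: retr_def Ball_def)
  ultimately show ?thesis by blast
 qed
 thus ?thesis unfolding fixed_point_index_def by simp
qed

context retr begin

definition deg_at :: "('m => 'm) => 'm set => int => bool"
 where "deg_at f F k <-> (EX V. openin M V & {x : V. f x = x} = F & compactin M F & fdeg V F f k)"

lemma isolating_exact:
 "continuous_map M M f ==> openin M V ==> {x : V. f x = x} = F ==> compactin M F ==> isolating V F f"
 unfolding isolating_def by (auto intro: continuous_map_from_subtopology)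

text \<open>Any two isolating neighbourhoods are compared with their intersection, to which the
  degree localizes from both.\<close>

lemma deg_at_eq:
 assumes f: "continuous_map M M f" and V: "openin M V" "{x : V. f x = x} = F" "compactin M F"
 shows "deg_at f F k <-> fdeg V F f k"
proof -
 have "fdeg V' F f k <-> fdeg V F f k" if V': "openin M V'" "{x : V'. f x = x} = F" for V'
 proof -
  have "F <= V Int V'" "openin M (V Int V')" using V V' by auto
  thus ?thesis using fdeg_localize[OF isolating_exact[OF f V], of "V Int V'" k]
  fdeg_localize[OF isolating_exact[OF f V'(1,2) V(3)], of "V Int V'" k] by simp
 qed
 thus ?thesis unfolding deg_at_def using V by blast
qed

text \<open>\<open>F t\<close> and the remaining fixed points are closed families, so open sets that
  separate them at one time still do so at nearby times. On one such open set the degree is constant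
  by \<open>fdeg_homotopy\<close>; being locally constant, it is constant on the interval.\<close>

theorem deg_at_homotopy:
 assumes H: "continuous_map (cylinder M) M (%(t, x). H t x)"
  and F: "closedin (cylinder M) {(t, x). t : {0..1} & x : F t}"
  "closedin (cylinder M) {(t, x). t : {0..1} & x : topspace M & H t x = x & x ~: F t}"
  "!!t. t : {0..1} ==> F t <= {x : topspace M. H t x = x}" shows "deg_at (H 0) (F 0) k <-> deg_at (H 1) (F 1) k"
proof -
 let ?X = "cylinder M"
 let ?F = "{(t, x). t : {0..1} & x : F t}" and ?G = "{(t, x). t : {0..1} & x : topspace M & H t x = x & x ~: F t}"
 define G where "G = (%t. {x : topspace M. H t x = x & x ~: F t})"
 have X: "compact_space ?X" using M(1) by (simp add: compact_space_prod_topology compact_space_subtopology)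
 have Ht: "continuous_map M M (H t)" if "t : {0..1}" for t
 proof -
  have "continuous_map M ?X (%x. (t, x))" using that by (simp add: continuous_map_pairwise o_def)
  from continuous_map_compose[OF this H] show ?thesis by (simp add: o_def)
 qed
 have slice: "compactin M (snd ` (C Int (S \<times> topspace M)))" if "closedin ?X C" "closed S" for C S
 proof -
  have "closedin ?X (({0..1} Int S) \<times> topspace M)"
  using that(2) by (simp add: closedin_prod_Times_iff closed_Int closedin_subtopology) blast
  hence "closedin ?X (C Int (({0..1} Int S) \<times> topspace M))" using that(1) by blast
  hence "compactin M (snd ` (C Int (({0..1} Int S) \<times> topspace M)))"
  by (intro image_compactin[OF closedin_compact_space[OF X] continuous_map_snd])
  moreover have "C Int (({0..1} Int S) \<times> topspace M) = C Int (S \<times> topspace M)"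
  using closedin_subset[OF that(1)] by auto
  ultimately show ?thesis by simp
 qed
 have FG: "compactin M (F t)" "compactin M (G t)" if t: "t : {0..1}" for t
 proof -
  have "snd ` (?F Int ({t} \<times> topspace M)) = F t" "snd ` (?G Int ({t} \<times> topspace M)) = G t"
  using F(3)[OF t] t by (force simp: G_def image_iff)+
  thus "compactin M (F t)" "compactin M (G t)"
  using slice[OF F(1) closed_singleton[of t]] slice[OF F(2) closed_singleton[of t]] by simp_all
 qed
 have "ALL s:{0..1}. \<forall>\<^sub>F t in at s within {0..1}. deg_at (H s) (F s) k = deg_at (H t) (F t) k"
 proof
  fix s :: real assume s: "s : {0..1}"
  have "disjnt (F s) (G s)" by (auto simp: G_def disjnt_def)
  then obtain V V' where V: "openin M V" "openin M V'" "F s <= V" "G s <= V'" "disjnt V V'"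
  using Hausdorff_space_compact_separation[OF M(2) FG[OF s]] by blast
  \<comment> \<open>\<open>C\<close> collects the points of the two families that have left their
    neighbourhoods. Compactness of \<open>M\<close> makes its projection to the interval closed;
    \<open>s\<close> is not in it, so neither is any \<open>t\<close> close to
    \<open>s\<close>.\<close>
  define C where "C = ?F Int ({0..1} \<times> (topspace M - V)) Un ?G Int ({0..1} \<times> (topspace M - V'))"
  have "closedin ?X C"
  unfolding C_def using V(1,2) F(1,2) by (intro closedin_Un closedin_Int) (auto simp: closedin_prod_Times_iff)
  hence "closedin (top_of_set {0..1}) (fst ` C)" using closed_map_fst[OF M(1)] by (auto simp: closed_map_def)
  hence "openin (top_of_set {0..1}) ({0..1} - fst ` C)" using openin_diff[OF openin_topspace] by force
  moreover have "s : {0..1} - fst ` C" using s V(3,4) by (auto simp: C_def G_def)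
  ultimately have "EX dl>0. ALL t:{0..1}. dist t s < dl --> t : {0..1} - fst ` C"
  unfolding openin_euclidean_subtopology_iff by (elim conjE) (rule bspec)
  then obtain dl where "dl > 0 & (ALL t:{0..1}. dist t s < dl --> t : {0..1} - fst ` C)" ..
  hence dl: "dl > 0" "!!t. t : {0..1} ==> dist t s < dl ==> t : {0..1} - fst ` C" by blast+
  have Vt: "{x : V. H t x = x} = F t" "F t <= V" if t: "t : {0..1}" "dist t s < dl" for t
  proof -
  have n: "t ~: fst ` C" using dl(2)[OF t] by simp
  have F': "x : V" if "x : F t" for x
  proof (rule ccontr)
  assume "x ~: V"
  hence "(t, x) : C" using that t F(3)[OF t(1)] by (auto simp: C_def)
  thus False using n by force
  qed
  have G': "x : V'" if "x : G t" for x
  proof (rule ccontr)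
  assume "x ~: V'"
  hence "(t, x) : C" using that t by (auto simp: C_def G_def)
  thus False using n by force
  qed
  show "F t <= V" using F' by blast
  show "{x : V. H t x = x} = F t"
  proof (intro Set.equalityI subsetI)
  fix x assume x: "x : {x : V. H t x = x}"
  show "x : F t"
  proof (rule ccontr)
  assume "x ~: F t"
  hence "x : V'" using G' x openin_subset[OF V(1)] by (auto simp: G_def)
  thus False using x V(5) by (auto simp: disjnt_iff)
  qed
  qed (use F' F(3)[OF t(1)] in auto)
  qed
  have "deg_at (H s) (F s) k = deg_at (H t) (F t) k" if t: "t : {0..1}" "dist t s < dl" for t
  proof -
  have seg: "u : {0..1} & dist u s < dl" if "u : closed_segment s t" for u
  using that s t by (auto simp: closed_segment_eq_real_ivl dist_real_def split: if_splits)
  \<comment> \<open>One compact set that contains \<open>F u\<close> for all \<open>u\<close>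
    between \<open>s\<close> and \<open>t\<close>, so that a single degree on \<open>V\<close> is
    deformed.\<close>
  define K where "K = snd ` (?F Int (closed_segment s t \<times> topspace M))"
  have K: "compactin M K" "K <= V"
  proof -
  show "compactin M K" unfolding K_def by (rule slice[OF F(1) closed_segment])
  show "K <= V"
  proof
  fix x assume "x : K"
  then obtain u where "u : closed_segment s t" "x : F u" unfolding K_def by auto
  thus "x : V" using Vt(2)[of u] seg[of u] by auto
  qed
  qed
  have FK: "F u <= K" if "u : closed_segment s t" for u
  proof
  fix x assume "x : F u"
  hence "(u, x) : ?F Int (closed_segment s t \<times> topspace M)" using that seg[OF that] F(3)[of u] by auto
  thus "x : K" unfolding K_def by (rule image_eqI [rotated]) simp
  qed
  have iso: "isolating V K (H u)" "isolating V (F u) (H u)" if u: "u : closed_segment s t" for u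
  proof -
  have u': "u : {0..1}" "dist u s < dl" using seg[OF u] by auto
  show "isolating V (F u) (H u)" using isolating_exact[OF Ht[OF u'(1)] V(1) Vt(1)[OF u'] FG(1)[OF u'(1)]] .
  thus "isolating V K (H u)" using FK[OF u] K unfolding isolating_def by blast
  qed
  have at: "deg_at (H u) (F u) k <-> fdeg V K (H u) k" if u: "u : closed_segment s t" for u
  proof -
  have u': "u : {0..1}" "dist u s < dl" using seg[OF u] by auto
  show ?thesis
  using deg_at_eq[OF Ht[OF u'(1)] V(1) Vt(1)[OF u'] FG(1)[OF u'(1)]] fdeg_shrink[OF iso(2,1)[OF u] FK[OF u]] by simp
  qed
  let ?h = "%u. H ((1 - u) * s + u * t)"
  have useg: "(1 - u) * s + u * t : closed_segment s t" if "u : {0..1}" for u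
  using that by (auto simp: closed_segment_def)
  have "fdeg V K (?h 0) k <-> fdeg V K (?h 1) k"
  proof (rule fdeg_homotopy[OF _ V(1)])
  have "continuous_on {0..1} (%u. (1 - u) * s + u * t)" by (intro continuous_intros)
  moreover have "(%u. (1 - u) * s + u * t) ` {0..1} <= {0..1}" using useg seg by blast
  ultimately have "continuous_map (top_of_set {0..1}) (top_of_set {0..1}) (%u. (1 - u) * s + u * t)"
  by (auto simp: continuous_map_in_subtopology)
  from continuous_map_compose[OF continuous_map_fst[of _ "subtopology M V"] this] continuous_map_into_fulltopology[OF continuous_map_snd[of "top_of_set {0..1::real}" "subtopology M V"]]
  have "continuous_map (cylinder (subtopology M V)) ?X (%z. ((1 - fst z) * s + fst z * t, snd z))"
  unfolding continuous_map_pairwise by (simp add: o_def)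
  from continuous_map_compose[OF this H]
  show "continuous_map (cylinder (subtopology M V)) M (%(u, x). ?h u x)" by (simp add: o_def case_prod_unfold)
  fix u :: real and x assume "u : {0..1}" "x : V" "?h u x = x"
  thus "x : K" using iso(1)[OF useg] unfolding isolating_def by blast
  qed
  thus ?thesis using at[of s] at[of t] by simp
  qed
  thus "\<forall>\<^sub>F t in at s within {0..1}. deg_at (H s) (F s) k = deg_at (H t) (F t) k"
  unfolding eventually_at using dl(1) by blast
 qed
 thus ?thesis by (intro connected_local_const[of "{0..1::real}" 0 1]) auto
qed

end

theorem fixed_point_index_homotopy:
 assumes M: "compact_space M" "Hausdorff_space M" and H: "continuous_map (cylinder M) M (%(t, x). H t x)"
  and F: "closedin (cylinder M) {(t, x). t : {0..1} & x : F t}"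
  "closedin (cylinder M) {(t, x). t : {0..1} & x : topspace M & H t x = x & x ~: F t}"
  "!!t. t : {0..1} ==> F t <= {x : topspace M. H t x = x}"
 shows "fixed_point_index M (H 0) (F 0) = fixed_point_index M (H 1) (F 1)"
proof -
 have Ht: "continuous_map M M (H t)" if "t : {0..1}" for t
 proof -
  have "continuous_map M (cylinder M) (%x. (t, x))" using that by (simp add: continuous_map_pairwise o_def)
  from continuous_map_compose[OF this H] show ?thesis by (simp add: o_def)
 qed
 have "retr M N i r Q & (EX V. openin M V & {x : V. H 0 x = x} = F 0 & compactin M (F 0) & retr.fdeg N i r Q V (F 0) (H 0) k) <->
  retr M N i r Q & (EX V. openin M V & {x : V. H 1 x = x} = F 1 & compactin M (F 1) & retr.fdeg N i r Q V (F 1) (H 1) k)" for N i r Q k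
 proof (rule conj_cong[OF refl])
  assume rd: "retr M N i r Q"
  show "(EX V. openin M V & {x : V. H 0 x = x} = F 0 & compactin M (F 0) & retr.fdeg N i r Q V (F 0) (H 0) k) <->
  (EX V. openin M V & {x : V. H 1 x = x} = F 1 & compactin M (F 1) & retr.fdeg N i r Q V (F 1) (H 1) k)"
  using retr.deg_at_homotopy[OF rd H F, of k] unfolding retr.deg_at_def[OF rd] .
 qed
 thus ?thesis
  unfolding fixed_point_index_fdeg[OF M Ht[of 0, simplified]] fixed_point_index_fdeg[OF M Ht[of 1, simplified]] by simp
qed

lemma fixed_point_index_unique:
 assumes M: "compact_space M" "Hausdorff_space M" and f: "continuous_map M M f" and ex: "EX N i r Q. retr M N i r Q"
  and k: "!!N i r Q l. retr M N i r Q ==> retr.deg_at M N i r Q f F l <-> l = k"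
 shows "fixed_point_index M f F = k" unfolding fixed_point_index_fdeg[OF M f]
proof (rule the_equality)
 let ?D = "%N i r Q l. EX V. openin M V & {x : V. f x = x} = F & compactin M F & retr.fdeg N i r Q V F f l"
 have D: "?D N i r Q l <-> l = k" if rd: "retr M N i r Q" for N i r Q l
  using k[OF rd, of l] unfolding retr.deg_at_def[OF rd] .
 obtain N i r Q where rd: "retr M N i r Q" using ex by (elim exE)
 hence "retr M N i r Q & ?D N i r Q k" using D[OF rd, of k] by simp
 thus "EX N i r Q. retr M N i r Q & ?D N i r Q k" by (intro exI)
 show "l = k" if "EX N i r Q. retr M N i r Q & ?D N i r Q l" for l using that
 proof (elim exE)
  fix N i r Q assume a: "retr M N i r Q & ?D N i r Q l"
  show "l = k" by (rule iffD1[OF D[OF conjunct1[OF a]] conjunct2[OF a]])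
 qed
qed

lemma fixed_point_index_empty:
 assumes M: "compact_space M" "Hausdorff_space M" and f: "continuous_map M M f" and ex: "EX N i r Q. retr M N i r Q"
 shows "fixed_point_index M f {} = 0"
proof (rule fixed_point_index_unique[OF M f ex])
 fix N i r Q l assume "retr M N i r Q"
 then interpret retr M N i r Q .
 show "deg_at f {} l <-> l = 0"
  using deg_at_eq[OF f openin_empty, of "{}" l] fdeg_empty[OF isolating_exact[OF f openin_empty]] by simp
qed

lemma (in chart_data) deg_at_nondegenerate:
 assumes path: "lpath (%v. v - L v) J h" and L: "linear L" and f: "continuous_map M M f"
  and A: "open A" "0 : A" "continuous_on A et" "!!v. v : A ==> f (c v) = c (et v)"
  and et: "et 0 = 0" "(et has_derivative L) (at 0)" shows "deg_at f {c 0} l <-> l = (- 1) ^ card J"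
proof -
 obtain rh where rh: "0 < rh" "ball 0 rh <= A" "ball (0 :: real ^ 'n) rh <= ball 0 R" "cisolating (ball 0 rh) {0} et"
  "!!k. cdeg (ball 0 rh) {0} et k <-> k = (- 1) ^ card J" by (rule cdeg_nondegenerate[OF path L et A(1-3)]) blast
 have fc: "f x = chart_map et x" if x: "x : c ` ball 0 rh" for x
 proof -
  obtain v where v: "v : ball 0 rh" "x = c v" using x by blast
  hence "v : A" "e (c v) = v" using rh(2,3) ec by blast+
  thus ?thesis using A(4) v(2) by (simp add: chart_map_def)
 qed
 have iso: "isolating (c ` ball 0 rh) (c ` {0}) (chart_map et)" by (rule cisolating_isolating[OF rh(4)])
 have c0: "c 0 : c ` ball 0 rh" "f (c 0) = c 0" using rh(1) A(4)[OF A(2)] et(1) by auto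
 have sub: "{x : c ` ball 0 rh. chart_map et x = x} <= {c 0}" and o: "openin M (c ` ball 0 rh)"
  using iso by (auto simp: isolating_def)
 have "compactin M (c ` {0})" using iso unfolding isolating_def by (elim conjE)
 hence o3: "compactin M {c 0}" unfolding image_insert image_empty .
 have o2: "{x : c ` ball 0 rh. f x = x} = {c 0}"
 proof (intro Set.equalityI subsetI)
  fix x assume "x : {x : c ` ball 0 rh. f x = x}"
  thus "x : {c 0}" using fc[of x] sub by auto
 qed (use c0 in auto)
 have "deg_at f {c 0} l <-> fdeg (c ` ball 0 rh) {c 0} f l" by (rule deg_at_eq[OF f o o2 o3])
 also have "... <-> fdeg (c ` ball 0 rh) {c 0} (chart_map et) l" by (rule fdeg_cong[OF fc])
 also have "... <-> l = (- 1) ^ card J" using rh(5) by (simp add: cdeg_def)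
 finally show ?thesis .
qed

text \<open>The path of isomorphisms, and with it \<open>J\<close>, is fixed before any retraction
  is considered, so all retractions give the same sign.\<close>

theorem fixed_point_index_nondegenerate:
 fixes c :: "real ^ 'n => 'm"
 assumes M: "compact_space M" "Hausdorff_space M" and f: "continuous_map M M f" and ex: "EX N i r Q. retr M N i r Q"
  and R: "R > 0" and c: "continuous_map (top_of_set (ball 0 R)) M c" "openin M (c ` ball 0 R)"
  and e: "continuous_map (subtopology M (c ` ball 0 R)) euclidean e" and ec: "!!v. v : ball 0 R ==> e (c v) = v"
  and A: "open A" "0 : A" "continuous_on A et" "!!v. v : A ==> f (c v) = c (et v)"
  and et: "et 0 = 0" "(et has_derivative L) (at 0)" and L: "linear L" "inj (%v. v - L v)"
 shows "fixed_point_index M f {c 0} ~= 0"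
proof -
 have "linear (%v. v - L v)" by (intro linear_compose_sub linear_ident L)
 from lpath_exists[OF this L(2)] obtain J h where path: "lpath (%v. v - L v) J h" by (elim exE)
 have "fixed_point_index M f {c 0} = (- 1) ^ card J"
 proof (rule fixed_point_index_unique[OF M f ex])
  fix N i r Q l assume rd: "retr M N i r Q"
  have "chart_data M N i r Q c e R"
  by (rule chart_data.intro[OF rd chart_data_axioms.intro]) (rule R, rule c(1), rule c(2), rule e, rule ec)
  from chart_data.deg_at_nondegenerate[OF this path L(1) f A et]
  show "retr.deg_at M N i r Q f {c 0} l <-> l = (- 1) ^ card J" .
 qed
 thus ?thesis by simp
qed

section \<open>Nielsen numbers\<close>

text \<open>Proper discontinuity is required for pairs of points: this yields the Hausdorff property
  of the orbit space as well as small neighbourhoods disjoint from their nontrivial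
  translates.\<close>

locale deck_action =
 fixes T :: "('s::t2_space => 's) set" and F :: "'s set" and p :: "'s => 's set" and M :: "'s set topology"
 assumes one: "id : T" and comp: "!!g h. g : T ==> h : T ==> g o h : T"
  and inverse: "!!g. g : T ==> EX h:T. h o g = id & g o h = id" and cont: "!!g. g : T ==> continuous_on UNIV g"
  and free: "!!g x. g : T ==> g x = x ==> g = id"
  and pd: "!!x y. EX U V. open U & open V & x : U & y : V & finite {g : T. g ` U Int V ~= {}}"
  and F: "compact F" "!!x. EX g:T. g x : F" and con: "connected (UNIV :: 's set)"
  and p: "!!x. p x = (%g. g x) ` T" and M: "M = quotient_topology p"
begin

lemma p_deck [simp]: "g : T ==> p (g x) = p x"
proof -
 assume g: "g : T"
 obtain h where h: "h : T" "h o g = id" using inverse[OF g] by blast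
 have e: "(k o h) (g x) = k x" for k using fun_cong[OF h(2), of x] by simp
 show "p (g x) = p x" unfolding p
 proof (intro Set.equalityI image_subsetI)
  fix k assume k: "k : T"
  show "k (g x) : (%g. g x) ` T" using comp[OF k g] by (intro image_eqI[of _ _ "k o g"]) auto
  show "k x : (%k. k (g x)) ` T" using comp[OF k h(1)] e[of k] by (intro image_eqI[of _ _ "k o h"]) auto
 qed
qed

lemma p_eq_iff: "p x = p y <-> (EX g:T. y = g x)"
proof
 assume "p x = p y"
 moreover have "y : p y" unfolding p by (rule image_eqI[OF _ one]) simp
 ultimately show "EX g:T. y = g x" unfolding p by auto
next
 assume "EX g:T. y = g x"
 thus "p x = p y" by (elim bexE) simp
qed

lemma eq_if_eq_at: "g : T ==> h : T ==> g x = h x ==> g = h"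
proof -
 assume g: "g : T" "h : T" "g x = h x"
 obtain k where k: "k : T" "k o h = id" "h o k = id" using inverse[OF g(2)] by blast
 have "(k o g) x = x" using g(3) fun_cong[OF k(2), of x] by simp
 hence "k o g = id" by (rule free[OF comp[OF k(1) g(1)]])
 moreover have "(h o k) o g = h o (k o g)" by (rule comp_assoc)
 ultimately show "g = h" unfolding k(3) by (simp only: id_comp comp_id)
qed

text \<open>Only finitely many group elements bring points near \<open>x\<close> to points near
  \<open>y\<close>; for each of them that does not send \<open>x\<close> to \<open>y\<close>, the
  two neighbourhoods are shrunk to exclude it.\<close>

lemma separate:
 obtains U V where "open U" "open V" "x : U" "y : V" "!!g u. g : T ==> u : U ==> g u : V ==> g x = y"
proof -
 obtain U V where UV: "open U" "open V" "x : U" "y : V" "finite {g : T. g ` U Int V ~= {}}"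
  using pd[of x y] by (elim exE conjE)
 define Z where "Z = {g : T. g ` U Int V ~= {} & g x ~= y}"
 have "ALL g:Z. EX A. open (fst A) & open (snd A) & g x : fst A & y : snd A & fst A Int snd A = {}"
 proof
  fix g assume "g : Z"
  hence "g x ~= y" by (simp add: Z_def)
  from hausdorff[OF this] obtain A B where "open A" "open B" "g x : A" "y : B" "A Int B = {}" by (elim exE conjE)
  thus "EX A. open (fst A) & open (snd A) & g x : fst A & y : snd A & fst A Int snd A = {}"
  by (intro exI[of _ "(A, B)"]) simp
 qed
 from bchoice[OF this] obtain A where A: "ALL g:Z. open (fst (A g)) & open (snd (A g)) & g x : fst (A g) & y : snd (A g) & fst (A g) Int snd (A g) = {}" ..
 have fZ: "finite Z" using UV(5) by (rule rev_finite_subset) (auto simp: Z_def)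
 have ZT: "g : T" if "g : Z" for g using that by (simp add: Z_def)
 show ?thesis
 proof (rule that[of "U Int (INT g:Z. g -` fst (A g))" "V Int (INT g:Z. snd (A g))"])
  show "open (U Int (INT g:Z. g -` fst (A g)))"
  using UV(1) fZ A ZT cont by (intro open_Int open_INT ballI open_vimage) auto
  show "open (V Int (INT g:Z. snd (A g)))" using UV(2) fZ A by (intro open_Int open_INT ballI) auto
  fix g u assume g: "g : T" "u : U Int (INT g:Z. g -` fst (A g))" "g u : V Int (INT g:Z. snd (A g))"
  show "g x = y"
  proof (rule ccontr)
  assume "g x ~= y"
  hence "g : Z" using g by (auto simp: Z_def)
  hence "g u : fst (A g)" "g u : snd (A g)" "fst (A g) Int snd (A g) = {}" using A g(2,3) by blast+
  thus False by blast
  qed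
 qed (use UV A in auto)
qed

lemma small: obtains U where "open U" "x : U" "!!g u. g : T ==> u : U ==> g u : U ==> g = id"
proof -
 obtain U V where UV: "open U" "open V" "x : U" "x : V" "!!g u. g : T ==> u : U ==> g u : V ==> g x = x"
  by (rule separate[of x x]) (rule that; assumption)
 show ?thesis
 proof (rule that[of "U Int V"])
  fix g u assume g: "g : T" "u : U Int V" "g u : U Int V"
  hence "g x = x" by (intro UV(5)[of g u]) auto
  thus "g = id" by (rule free[OF g(1)])
 qed (use UV in auto)
qed

lemma inj_on_p: "(!!g u. g : T ==> u : U ==> g u : U ==> g = id) ==> inj_on p U"
proof (rule inj_onI)
 fix x y assume a: "!!g u. g : T ==> u : U ==> g u : U ==> g = id" "x : U" "y : U" "p x = p y"
 obtain g where g: "g : T" "y = g x" using a(4) unfolding p_eq_iff by (elim bexE)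
 have "g = id" using a(1)[OF g(1) a(2)] a(3) g(2) by simp
 thus "x = y" using g(2) by simp
qed

lemma openin_p: "open U ==> openin M (p ` U)"
proof -
 assume U: "open U"
 have "p -` p ` U = (UN g:T. g -` U)"
 proof (intro Set.equalityI subsetI)
  fix x assume "x : p -` p ` U"
  then obtain u where u: "u : U" "p x = p u" by blast
  from u(2) obtain g where "g : T" "u = g x" unfolding p_eq_iff by (elim bexE)
  thus "x : (UN g:T. g -` U)" using u(1) by blast
 next
  fix x assume "x : (UN g:T. g -` U)"
  then obtain g where "g : T" "g x : U" by blast
  thus "x : p -` p ` U" using p_deck[of g x] by (metis imageI vimageI)
 qed
 moreover have "open (UN g:T. g -` U)" using cont U by (intro open_UN ballI open_vimage)
 ultimately show "openin M (p ` U)" by (simp add: M openin_quotient_topology image_mono)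
qed

lemma topspace_M: "topspace M = range p"
 by (simp add: M topspace_quotient_topology)

lemma continuous_p: "continuous_map euclidean M p"
 using quotient_map_quotient_topology[of p] by (simp add: M quotient_imp_continuous_map)

lemma compact_M: "compact_space M"
proof -
 have "p x : p ` F" for x
 proof -
  obtain g where "g : T" "g x : F" using F(2) by blast
  thus ?thesis using p_deck[of g x] by (metis imageI)
 qed
 hence "p ` F = topspace M" by (auto simp: topspace_M)
 thus ?thesis using image_compactin[OF _ continuous_p, of F] F(1) by (simp add: compact_space_def)
qed

lemma Hausdorff_M: "Hausdorff_space M"
 unfolding Hausdorff_space_def topspace_M
proof (intro allI impI)
 fix m n assume mn: "m : range p & n : range p & m ~= n"
 then obtain x y where xy: "m = p x" "n = p y" by blast
 obtain U V where UV: "open U" "open V" "x : U" "y : V" "!!g u. g : T ==> u : U ==> g u : V ==> g x = y"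
  by (rule separate[of x y]) (rule that; assumption)
 have "disjnt (p ` U) (p ` V)" unfolding disjnt_iff
 proof (intro allI notI)
  fix m assume "m : p ` U & m : p ` V"
  then obtain u v where u: "u : U" "v : V" "p u = p v" by auto
  then obtain g where g: "g : T" "v = g u" unfolding p_eq_iff by blast
  hence "g x = y" using UV(5) u by blast
  thus False using mn xy p_deck[OF g(1), of x] by simp
 qed
 thus "EX U V. openin M U & openin M V & m : U & n : V & disjnt U V"
  using openin_p[OF UV(1)] openin_p[OF UV(2)] UV(3,4) by (intro exI[of _ "p ` U"] exI[of _ "p ` V"]) (simp add: xy)
qed

text \<open>Over the image of a small open set the projection is inverted on that set; composing
  with a group element moves the section to any other point of the fibre.\<close>

lemma covering: "sec_cover p M"
 unfolding sec_cover_def topspace_M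
proof (intro conjI ballI allI continuous_p)
 fix x
 obtain U where U: "open U" "x : U" "!!g u. g : T ==> u : U ==> g u : U ==> g = id"
  by (rule small) (rule that; assumption)
 thus "EX V. open V & x : V & inj_on p V" using inj_on_p by blast
next
 fix m assume "m : range p"
 then obtain a where a: "m = p a" by blast
 obtain U where U: "open U" "a : U" "!!g u. g : T ==> u : U ==> g u : U ==> g = id"
  by (rule small) (rule that; assumption)
 have inj: "inj_on p U" by (rule inj_on_p[OF U(3)])
 show "EX W. openin M W & m : W & (ALL x. p x : W -->
  (EX q. continuous_map (subtopology M W) euclidean q & q (p x) = x & (ALL y:W. p (q y) = y)))"
 proof (intro exI[of _ "p ` U"] conjI allI impI)
  fix x assume "p x : p ` U"
  then obtain u where u: "u : U" "p u = p x" by auto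
  then obtain g where g: "g : T" "x = g u" unfolding p_eq_iff by blast
  let ?q = "%m. g (inv_into U p m)"
  have inv: "inv_into U p (p v) = v" if "v : U" for v using inv_into_f_f[OF inj that] .
  have "continuous_map (subtopology M (p ` U)) euclidean ?q" unfolding continuous_map_def
  proof (intro conjI allI impI)
  fix W :: "'s set" assume "openin euclidean W"
  hence "open (U Int g -` W)" using U(1) cont[OF g(1)] by (intro open_Int open_vimage) auto
  hence "openin M (p ` (U Int g -` W))" by (rule openin_p)
  moreover have "{m : topspace (subtopology M (p ` U)). ?q m : W} = p ` (U Int g -` W)"
  proof (intro Set.equalityI subsetI)
  fix m assume "m : {m : topspace (subtopology M (p ` U)). ?q m : W}"
  then obtain v where "v : U" "m = p v" "g (inv_into U p m) : W" by auto
  thus "m : p ` (U Int g -` W)" using inv[of v] by simp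
  next
  fix m assume "m : p ` (U Int g -` W)"
  then obtain v where v: "v : U" "g v : W" "m = p v" by blast
  thus "m : {m : topspace (subtopology M (p ` U)). ?q m : W}" using inv[of v] by (simp add: topspace_M)
  qed
  moreover have "p ` (U Int g -` W) = p ` (U Int g -` W) Int p ` U" by auto
  ultimately show "openin (subtopology M (p ` U)) {m : topspace (subtopology M (p ` U)). ?q m : W}"
  unfolding openin_subtopology by metis
  qed simp
  thus "EX q. continuous_map (subtopology M (p ` U)) euclidean q & q (p x) = x & (ALL y:p ` U. p (q y) = y)"
  proof (intro exI[of _ ?q] conjI ballI)
  show "?q (p x) = x" using inv[OF u(1)] u(2) g(2) by simp
  show "p (?q y) = y" if y: "y : p ` U" for y
  proof -
  obtain v where "v : U" "y = p v" using y by blast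
  thus ?thesis using inv[of v] p_deck[OF g(1)] by simp
  qed
  qed
 next
  show "openin M (p ` U)" "m : p ` U" using openin_p[OF U(1)] a U(2) by simp_all
 qed
qed

text \<open>At one point the two lifts differ by an element of \<open>T\<close>; composing with it
  reduces the claim to uniqueness of lifts on a connected set.\<close>

lemma unique_lift:
 fixes f g :: "'z::topological_space => 's"
 assumes f: "continuous_on A f" and g: "continuous_on A g" and eq: "!!z. z : A ==> p (f z) = p (g z)" and A: "connected A" "A ~= {}"
 shows "EX t:T. ALL z:A. g z = t (f z)"
proof -
 obtain a where a: "a : A" using A by blast
 obtain t where t: "t : T" "g a = t (f a)" using eq[OF a] unfolding p_eq_iff by blast
 have c: "continuous_on A (%z. t (f z))" by (rule continuous_on_compose2[OF cont[OF t(1)] f]) simp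
 have "g z = t (f z)" if z: "z : A" for z
  by (rule sec_cover_unique[OF covering g c _ a _ A(1) z]) (simp_all add: eq t(1) t(2) flip: eq)
 thus ?thesis using t(1) by blast
qed

lemma lifts_eq:
 assumes k: "k : lifts p f" shows "lifts p f = (%t. t o k) ` T"
proof (intro Set.equalityI subsetI)
 fix g assume g: "g : lifts p f"
 have "EX t:T. ALL z:UNIV. g z = t (k z)" by (rule unique_lift) (use k g con in \<open>auto simp: lifts_def\<close>)
 then obtain t where "t : T" "!!z. g z = t (k z)" by blast
 thus "g : (%t. t o k) ` T" by (intro image_eqI[of _ _ t]) auto
next
 fix g assume "g : (%t. t o k) ` T"
 thus "g : lifts p f" using k cont by (auto simp: lifts_def o_def intro: continuous_on_compose2)
qed

lemma deck_eq: "deck_transformations p = T"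
proof (intro Set.equalityI subsetI)
 fix h assume "h : deck_transformations p"
 hence h: "continuous_on UNIV h" "p o h = p" unfolding deck_transformations_def homeomorphism_def by auto
 have eq: "p z = p (h z)" for z using h(2) by (metis comp_apply)
 have "EX t:T. ALL z:UNIV. h z = t z" by (rule unique_lift[of UNIV "%z. z" h]) (use h(1) eq con in auto)
 then obtain t where "t : T" "!!z. h z = t z" by blast
 moreover from this(2) have "h = t" by (rule ext)
 ultimately show "h : T" by simp
next
 fix h assume h: "h : T"
 obtain k where k: "k : T" "k o h = id" "h o k = id" using inverse[OF h] by blast
 have "homeomorphism UNIV UNIV h k"
  using cont h k pointfree_idE[OF k(2)] pointfree_idE[OF k(3)] surjI[of h k] surjI[of k h] by (simp add: homeomorphism_def)
 moreover have "p o h = p" using p_deck[OF h] by (simp add: fun_eq_iff)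
 ultimately show "h : deck_transformations p" unfolding deck_transformations_def by blast
qed

text \<open>Every lift is \<open>t o k\<close> with a unique \<open>t\<close> in \<open>T\<close>,
  so lifting classes become classes of this twisted conjugacy on \<open>T\<close>. Unlike the lifts,
  \<open>T\<close> stays the same under a homotopy of the map, so classes at its two ends can be
  compared.\<close>

definition conj_rel :: "('s => 's) => (('s => 's) \<times> ('s => 's)) set"
 where "conj_rel k = {(s, t). s : T & t : T & (EX h:T. ALL z. t (k (h z)) = h (s (k z)))}"

definition fix_index :: "('s set => 's set) => ('s => 's) => ('s => 's) => int"
 where "fix_index f k t = fixed_point_index M f (p ` {z. t (k z) = z})"

lemma lift_inj: "s : T ==> t : T ==> s o k = t o k ==> s = t"
 by (metis comp_apply eq_if_eq_at)

lemma nielsen_eq: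
 assumes k: "k : lifts p f" shows "nielsen_number M p f = card {c : T // conj_rel k. EX t:c. fix_index f k t ~= 0}"
proof -
 let ?i = "%t. t o k"
 have c: "(?i s, ?i t) : lift_conj p f <-> (s, t) : conj_rel k" if "s : T" "t : T" for s t
  unfolding lift_conj_def conj_rel_def deck_eq lifts_eq[OF k] using that by (auto simp: fun_eq_iff)
 have cl: "lift_conj p f `` {?i t} = ?i ` (conj_rel k `` {t})" if t: "t : T" for t
 proof (intro Set.equalityI subsetI)
  fix g assume g: "g : lift_conj p f `` {?i t}"
  hence "g : lifts p f" by (auto simp: lift_conj_def)
  then obtain s where "s : T" "g = ?i s" unfolding lifts_eq[OF k] by blast
  thus "g : ?i ` (conj_rel k `` {t})" using g c[OF t] by blast
 next
  fix g assume "g : ?i ` (conj_rel k `` {t})"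
  then obtain s where s: "(t, s) : conj_rel k" "g = ?i s" by blast
  hence "s : T" by (simp add: conj_rel_def)
  thus "g : lift_conj p f `` {?i t}" using c[OF t] s by blast
 qed
 have "{c : lifts p f // lift_conj p f. EX g:c. fixed_point_index M f (p ` {x. g x = x}) ~= 0} =
  (`) ?i ` {c : T // conj_rel k. EX t:c. fix_index f k t ~= 0}"
 proof -
  have "(EX g:?i ` c. fixed_point_index M f (p ` {x. g x = x}) ~= 0) <-> (EX t:c. fix_index f k t ~= 0)" for c
  by (simp add: fix_index_def)
  moreover have "lifts p f // lift_conj p f = (`) ?i ` (T // conj_rel k)"
  unfolding quotient_def lifts_eq[OF k] by (simp add: image_UN cl)
  ultimately show ?thesis by (auto simp: fix_index_def intro!: imageI)
 qed
 moreover have "inj_on ((`) ?i) {c : T // conj_rel k. EX t:c. fix_index f k t ~= 0}"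
 proof (rule inj_on_subset[OF inj_on_image_Pow])
  show "inj_on ?i T" using lift_inj by (auto intro: inj_onI)
  show "{c : T // conj_rel k. EX t:c. fix_index f k t ~= 0} <= Pow T" by (auto simp: quotient_def conj_rel_def)
 qed
 ultimately show ?thesis unfolding nielsen_number_def by (simp add: card_image)
qed

lemma equiv_conj_rel: "equiv T (conj_rel k)"
proof (rule equivI)
 show "conj_rel k <= T \<times> T" by (auto simp: conj_rel_def)
 show "refl_on T (conj_rel k)" using one by (auto simp: refl_on_def conj_rel_def intro!: bexI[of _ id])
 show "sym (conj_rel k)"
 proof (rule symI)
  fix s t assume "(s, t) : conj_rel k"
  then obtain h where h: "s : T" "t : T" "h : T" "!!z. t (k (h z)) = h (s (k z))" by (auto simp: conj_rel_def)
  obtain g where g: "g : T" "g o h = id" "h o g = id" using inverse[OF h(3)] by blast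
  hence "s (k (g z)) = g (t (k z))" for z using h(4)[of "g z"] by (metis comp_apply id_apply)
  thus "(t, s) : conj_rel k" using h g by (auto simp: conj_rel_def)
 qed
 show "trans (conj_rel k)"
 proof (rule transI)
  fix r s t assume "(r, s) : conj_rel k" "(s, t) : conj_rel k"
  then obtain g h where "r : T" "s : T" "t : T" "g : T" "h : T" "!!z. s (k (g z)) = g (r (k z))" "!!z. t (k (h z)) = h (s (k z))"
  by (auto simp: conj_rel_def)
  thus "(r, t) : conj_rel k" using comp[of h g] by (auto simp: conj_rel_def intro!: bexI[of _ "h o g"])
 qed
qed

context
 fixes f k assumes f: "continuous_map M M f" and k: "k : lifts p f" and enr: "EX N i r Q. retr M N i r Q"
begin

definition essential where "essential = {c : T // conj_rel k. EX t:c. fix_index f k t ~= 0}"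

text \<open>An essential class contains some \<open>t\<close> whose lift has a fixed point, since
  the empty set has index \<open>0\<close>; conjugation moves this point into \<open>F\<close>.
  Different classes are disjoint, so the representatives found in \<open>X\<close> are
  different.\<close>

lemma essential_le:
 assumes X: "finite X" "!!t x. t : T ==> x : F ==> t (k x) = x ==> t : X"
 shows "finite essential" "nielsen_number M p f <= card X"
proof -
 have "ALL c:essential. EX t. t : c & t : X"
 proof
  fix c assume c: "c : essential"
  obtain t where t: "c : T // conj_rel k" "t : c" "fix_index f k t ~= 0" using c by (auto simp: essential_def)
  then obtain x where x: "t (k x) = x"
  using fixed_point_index_empty[OF compact_M Hausdorff_M f enr] by (fastforce simp: fix_index_def)
  have tT: "t : T" using t(1,2) by (auto simp: quotient_def conj_rel_def)
  obtain h where h: "h : T" "h x : F" using F(2) by blast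
  obtain g where g: "g : T" "g o h = id" "h o g = id" using inverse[OF h(1)] by blast
  have "(%z. h (t (k (g z)))) : lifts p f"
  proof -
  have "continuous_on UNIV (%z. k (g z))"
  by (rule continuous_on_compose2[of UNIV k]) (use k cont[OF g(1)] in \<open>auto simp: lifts_def\<close>)
  hence "continuous_on UNIV (%z. h (t (k (g z))))"
  by (intro continuous_on_compose2[OF cont[OF h(1)]] continuous_on_compose2[OF cont[OF tT]]) auto
  thus ?thesis using k p_deck[OF h(1)] p_deck[OF tT] p_deck[OF g(1)] by (simp add: lifts_def)
  qed
  then obtain s where s: "s : T" "!!z. h (t (k (g z))) = s (k z)" unfolding lifts_eq[OF k] by (auto simp: fun_eq_iff)
  have gh: "g (h z) = z" for z using g(2) by (metis comp_apply id_apply)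
  have "(t, s) : conj_rel k" using tT s(1) h(1) gh by (auto simp: conj_rel_def intro!: bexI[of _ h] simp flip: s(2))
  hence "s : c" using in_quotient_imp_closed[OF equiv_conj_rel t(1,2)] by blast
  moreover have "s (k (h x)) = h x" using gh x by (simp flip: s(2))
  ultimately show "EX t. t : c & t : X" using X(2)[OF s(1) h(2)] by blast
 qed
 from bchoice[OF this] obtain w where w: "ALL c:essential. w c : c & w c : X" ..
 have "inj_on w essential"
 proof (rule inj_onI)
  fix c d assume cd: "c : essential" "d : essential" "w c = w d"
  have "w c : c" using w cd(1) by blast
  moreover have "w c : d" unfolding cd(3) using w cd(2) by blast
  ultimately have "c Int d ~= {}" by blast
  thus "c = d" using quotient_disj[OF equiv_conj_rel[of k]] cd by (auto simp: essential_def)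
 qed
 thus "finite essential" "nielsen_number M p f <= card X"
  using w X(1) card_inj_on_le[of w essential X] finite_imageD[of w essential] finite_subset[of "w ` essential" X]
  unfolding nielsen_eq[OF k] essential_def[symmetric] by auto
qed

text \<open>The lift \<open>t y\<close> has \<open>y\<close> as its only fixed point, so its class
  is essential and determines \<open>p y\<close>; at most \<open>r\<close> points of
  \<open>Y\<close> have the same image.\<close>

lemma essential_ge:
 assumes fin: "finite essential" and Y: "finite Y" "!!y. y : Y ==> EX t:T. ALL z. t (k z) = z <-> z = y"
  "!!y. y : Y ==> fixed_point_index M f {p y} ~= 0" and r: "!!y. card {y' : Y. p y' = p y} <= r"
 shows "card Y <= r * nielsen_number M p f"
proof -
 have "ALL y:Y. EX t. t : T & (ALL z. t (k z) = z <-> z = y)" using Y(2) by blast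
 from bchoice[OF this] obtain t where "ALL y:Y. t y : T & (ALL z. t y (k z) = z <-> z = y)" ..
 hence t: "!!y. y : Y ==> t y : T" "!!y z. y : Y ==> t y (k z) = z <-> z = y" by blast+
 define cl where "cl = (%y. conj_rel k `` {t y})"
 have e: "cl y : essential" if "y : Y" for y
 proof -
  have "{z. t y (k z) = z} = {y}" using t(2)[OF that] by auto
  hence "fix_index f k (t y) ~= 0" using Y(3)[OF that] by (simp add: fix_index_def)
  moreover have "t y : cl y" using equiv_class_self[OF equiv_conj_rel t(1)[OF that]] by (simp add: cl_def)
  ultimately show ?thesis using t(1)[OF that] by (auto simp: essential_def cl_def quotient_def)
 qed
 have same: "p y' = p y" if y: "y : Y" "y' : Y" "cl y' = cl y" for y y'
 proof -
  have "(t y, t y') : conj_rel k"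
  using y(3) eq_equiv_class[OF _ equiv_conj_rel t(1)[OF y(2)], of k "t y"] by (simp add: cl_def)
  then obtain h where h: "h : T" "!!z. t y' (k (h z)) = h (t y (k z))" by (auto simp: conj_rel_def)
  have "t y (k y) = y" using t(2)[OF y(1)] by blast
  hence "t y' (k (h y)) = h y" using h(2)[of y] by simp
  hence "h y = y'" using t(2)[OF y(2)] by blast
  thus ?thesis using p_deck[OF h(1), of y] by simp
 qed
 have "card Y = (SUM c:cl ` Y. card {y : Y. cl y = c})" using sum.group[of Y "cl ` Y" cl "%_. 1 :: nat"] Y(1) by simp
 also have "... <= (SUM c:cl ` Y. r)"
 proof (rule sum_mono)
  fix c assume "c : cl ` Y"
  then obtain y where y: "y : Y" "c = cl y" by blast
  have "card {y : Y. cl y = c} <= card {y' : Y. p y' = p y}" using same[OF y(1)] y(2) Y(1) by (intro card_mono) auto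
  thus "card {y : Y. cl y = c} <= r" using r[of y] by simp
 qed
 also have "... <= r * card essential" using e card_mono[OF fin, of "cl ` Y"] by (simp add: image_subset_iff)
 finally show ?thesis unfolding nielsen_eq[OF k] essential_def[symmetric] .
qed

end

text \<open>The homotopy is lifted starting from \<open>k\<close>. By uniqueness of lifts an
  identity between deck translates of the lifted homotopy holds at one end if it holds at the other,
  so the twisted conjugacy relations agree. The indices agree by
  \<open>fixed_point_index_homotopy\<close>, applied to the fixed points that belong to one
  lift.\<close>

theorem nielsen_homotopy:
 assumes H: "continuous_map (cylinder M) M (%(t, x). H t x)" and k: "k : lifts p (H 0)"
 shows "nielsen_number M p (H 0) = nielsen_number M p (H 1)"
proof -
 have kc: "continuous_on UNIV k" "!!z. p (k z) = H 0 (p z)" using k by (auto simp: lifts_def)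
 have "continuous_map (top_of_set ({0..1::real} \<times> UNIV)) (cylinder M) (%z. (fst z, p (snd z)))"
 proof -
  have "continuous_map (cylinder euclidean) M (p o snd)"
  by (rule continuous_map_compose[OF continuous_map_snd continuous_p])
  moreover have "cylinder (euclidean :: 's topology) = top_of_set ({0..1} \<times> UNIV)"
  using prod_topology_subtopology_eu[of "{0..1::real}" "UNIV :: 's set"] by simp
  ultimately show ?thesis
  using continuous_map_fst[of "top_of_set {0..1::real}" "euclidean :: 's topology"] by (simp add: continuous_map_pairwise o_def)
 qed
 from continuous_map_compose[OF this H]
 have HC: "continuous_map (top_of_set ({0..1::real} \<times> UNIV)) M (%z. H (fst z) (p (snd z)))" by (simp add: o_def)
 have H0: "p (k z) = H (fst (0::real, z)) (p (snd (0::real, z)))" for z using kc(2) by simp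
 obtain K where K': "continuous_on ({0..1::real} \<times> UNIV) K" "!!t z. t : {0..1} ==> p (K (t, z)) = H (fst (t, z)) (p (snd (t, z)))" "!!z. K (0, z) = k z"
  by (rule sec_cover_lift_homotopy[OF covering HC kc(1) H0]) (rule that; assumption)
 note K = K'(1) K'(2)[unfolded fst_conv snd_conv] K'(3)
 have Kc: "continuous_on A (%x. K (f x, g x))" if "continuous_on A f" "continuous_on A g" "f ` A <= {0..1}" for A :: "'z::topological_space set" and f g
  using that by (intro continuous_on_compose2[OF K(1)] continuous_intros) auto
 have tK: "continuous_on A (%x. t (K (f x, g x)))" if "t : T" "continuous_on A f" "continuous_on A g" "f ` A <= {0..1}" for t f g and A :: "'z::topological_space set"
  by (rule continuous_on_compose2[OF cont[OF that(1)] Kc[OF that(2-4)]]) simp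
 define k1 where "k1 = (%z. K (1, z))"
 have "continuous_on UNIV (%z. K (1, z))" by (rule Kc) (auto intro: continuous_intros)
 hence k1: "k1 : lifts p (H 1)" using K(2) by (auto simp: k1_def lifts_def)
 have ends: "t (K (1, h z)) = h' (s (K (1, z)))" if "t (K (0, h z)) = h' (s (K (0, z)))" "s : T" "t : T" "h : T" "h' : T" for s t h h' z
  by (rule sec_cover_unique[OF covering, of "{0..1::real}" "%u. t (K (u, h z))" "%u. h' (s (K (u, z)))" 0 1])
  (use that K(2) in \<open>auto intro!: tK continuous_on_compose2[OF cont[of h']] continuous_intros\<close>)
 have ends': "t (K (0, h z)) = h' (s (K (0, z)))" if "t (K (1, h z)) = h' (s (K (1, z)))" "s : T" "t : T" "h : T" "h' : T" for s t h h' z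
  by (rule sec_cover_unique[OF covering, of "{0..1::real}" "%u. t (K (u, h z))" "%u. h' (s (K (u, z)))" 1 0])
  (use that K(2) in \<open>auto intro!: tK continuous_on_compose2[OF cont[of h']] continuous_intros\<close>)
 have "(ALL z. t (K (0, h z)) = h (s (K (0, z)))) <-> (ALL z. t (K (1, h z)) = h (s (K (1, z))))" if "s : T" "t : T" "h : T" for s t h
  using ends[OF _ that(1,2,3,3)] ends'[OF _ that(1,2,3,3)] by (intro iffI allI) simp_all
 hence "(s, t) : conj_rel k <-> (s, t) : conj_rel k1" for s t
  unfolding conj_rel_def k1_def K(3)[symmetric] mem_Collect_eq prod.case by (intro conj_cong bex_cong refl)
 hence rel: "conj_rel k = conj_rel k1" by (intro Set.equalityI subrelI) simp_all
 have ph: "EX g:T. ALL t:{0..1}. ALL z. K (t, h z) = g (K (t, z))" if h: "h : T" for h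
 proof -
  have "continuous_on ({0..1::real} \<times> UNIV) (%x. h (snd x))"
  by (rule continuous_on_compose2[OF cont[OF h]]) (auto intro: continuous_intros)
  hence c: "continuous_on ({0..1::real} \<times> UNIV) (%x. K (fst x, h (snd x)))"
  by (rule Kc [rotated]) (auto intro: continuous_intros)
  have "connected ({0..1::real} \<times> (UNIV :: 's set))" using con by (intro connected_Times) auto
  hence "EX g:T. ALL x:{0..1} \<times> UNIV. K (fst x, h (snd x)) = g (K x)"
  by (intro unique_lift[OF K(1) c]) (use h K(2) in auto)
  then obtain g where "g : T" "!!x. x : {0..1} \<times> UNIV ==> K (fst x, h (snd x)) = g (K x)" by blast
  thus ?thesis by (intro bexI[of _ g]) force+
 qed
 have "fix_index (H 0) k s = fix_index (H 1) k1 s" if s: "s : T" for s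
 proof -
  \<comment> \<open>\<open>Fx t z\<close> expresses that \<open>p z\<close> lies in the class of
    \<open>s\<close> at time \<open>t\<close>. Fixed points arbitrarily near \<open>(t0, z0)\<close>
    force \<open>p z0\<close> to be fixed at time \<open>t0\<close> and to share their membership in
    the class, so the class and the remaining fixed points are both closed in the cylinder.\<close>
  define Fx where "Fx = (%t z. EX h:T. s (K (t, h z)) = h z)"
  have local: "EX U W. open U & open W & t0 : U & z0 : W & (ALL t:U Int {0..1}. ALL z:W. p (K (t, z)) = p z -->
  p (K (t0, z0)) = p z0 & (Fx t z <-> Fx t0 z0))" if t0: "t0 : {0..1}" for t0 z0
  proof -
  obtain U V where UV: "open U" "open V" "z0 : U" "K (t0, z0) : V" "!!g u. g : T ==> u : U ==> g u : V ==> g z0 = K (t0, z0)"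
  by (rule separate[of z0 "K (t0, z0)"]) (rule that; assumption)
  obtain A where A: "open A" "A Int ({0..1} \<times> UNIV) = K -` V Int ({0..1} \<times> UNIV)"
  using K(1) UV(2) unfolding continuous_on_open_invariant by blast
  have "(t0, z0) : A" using A(2) t0 UV(4) by auto
  then obtain B C where BC: "open B" "open C" "t0 : B" "z0 : C" "B \<times> C <= A"
  using A(1) by (elim open_prod_elim) auto
  have "p (K (t0, z0)) = p z0 & (Fx t z <-> Fx t0 z0)" if tz: "t : B Int {0..1}" "z : C Int U" "p (K (t, z)) = p z" for t z
  proof -
  obtain g where g: "g : T" "K (t, z) = g z" using tz(3)[symmetric] unfolding p_eq_iff by blast
  have "K (t, z) : V" using A(2) BC(5) tz by blast
  hence g0: "g z0 = K (t0, z0)" using UV(5)[OF g(1), of z] g(2) tz(2) by simp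
  have "s (K (t, h z)) = h z <-> s (K (t0, h z0)) = h z0" if h: "h : T" for h
  proof -
  obtain f where f: "f : T" "ALL t:{0..1}. ALL z. K (t, h z) = f (K (t, z))" using ph[OF h] by blast
  have e: "s o (f o g) : T" by (intro comp s f g)
  have "s (K (t, h z)) = (s o (f o g)) z" "s (K (t0, h z0)) = (s o (f o g)) z0"
  using f(2) tz(1) t0 g(2) g0 by simp_all
  thus ?thesis using eq_if_eq_at[OF e h] by metis
  qed
  thus ?thesis using g0 p_deck[OF g(1), of z0] unfolding Fx_def by auto
  qed
  thus ?thesis using BC UV(1,3) by (intro exI[of _ B] exI[of _ "C Int U"]) auto
  qed
  have Fx: "p z : p ` {z. s (K (t, z)) = z} <-> Fx t z" for t z
  proof -
  have "p z : p ` {z. s (K (t, z)) = z} <-> (EX w. s (K (t, w)) = w & p z = p w)" by blast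
  thus ?thesis unfolding Fx_def p_eq_iff by blast
  qed
  let ?X = "cylinder M"
  have closed: "closedin ?X {(t, m). t : {0..1} & m : topspace M & H t m = m & (m : p ` {z. s (K (t, z)) = z} <-> b)}" for b
  unfolding closedin_def openin_prod_topology_alt
  proof (intro conjI allI impI)
  fix t0 m0 assume m0: "(t0, m0) : topspace ?X - {(t, m). t : {0..1} & m : topspace M & H t m = m & (m : p ` {z. s (K (t, z)) = z} <-> b)}"
  then obtain z0 where z0: "m0 = p z0" "t0 : {0..1}" by (auto simp: topspace_M)
  hence n: "~ (p (K (t0, z0)) = p z0 & (Fx t0 z0 <-> b))" using m0 K(2) Fx by (auto simp: topspace_M)
  obtain U W where UW: "open U" "open W" "t0 : U" "z0 : W" "ALL t:U Int {0..1}. ALL z:W. p (K (t, z)) = p z -->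
  p (K (t0, z0)) = p z0 & (Fx t z <-> Fx t0 z0)" using local[OF z0(2), of z0] by (elim exE conjE)
  show "EX U V. openin (top_of_set {0..1}) U & openin M V & t0 : U & m0 : V &
  U \<times> V <= topspace ?X - {(t, m). t : {0..1} & m : topspace M & H t m = m & (m : p ` {z. s (K (t, z)) = z} <-> b)}"
  proof (intro exI conjI subsetI)
  show "openin (top_of_set {0..1}) ({0..1} Int U)" using UW(1) by (simp add: openin_open_Int)
  show "openin M (p ` W)" by (rule openin_p[OF UW(2)])
  fix x assume "x : ({0..1} Int U) \<times> p ` W"
  then obtain t z where x: "x = (t, p z)" "t : U Int {0..1}" "z : W" by auto
  thus "x : topspace ?X - {(t, m). t : {0..1} & m : topspace M & H t m = m & (m : p ` {z. s (K (t, z)) = z} <-> b)}"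
  using UW(5) n K(2) Fx by (simp add: topspace_M)
  qed (use UW z0 in auto)
  qed (auto simp: topspace_M)
  let ?F = "%t. p ` {z. s (K (t, z)) = z}"
  have sub: "?F t <= {x : topspace M. H t x = x}" if "t : {0..1}" for t
  proof (rule image_subsetI)
  fix z assume "z : {z. s (K (t, z)) = z}"
  thus "p z : {x : topspace M. H t x = x}" using K(2)[OF that, of z] p_deck[OF s, of "K (t, z)"] by (simp add: topspace_M)
  qed
  have "{(t, m). t : {0..1} & m : ?F t} = {(t, m). t : {0..1} & m : topspace M & H t m = m & (m : ?F t <-> True)}"
  using sub by auto
  hence "fixed_point_index M (H 0) (?F 0) = fixed_point_index M (H 1) (?F 1)"
  using fixed_point_index_homotopy[OF compact_M Hausdorff_M H, of ?F] closed[of True] closed[of False] sub by simp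
  thus ?thesis by (simp add: fix_index_def k1_def K(3))
 qed
 moreover have "t : T" if "c : T // conj_rel k1" "t : c" for c t using that by (auto simp: quotient_def conj_rel_def)
 ultimately have "{c : T // conj_rel k1. EX t:c. fix_index (H 0) k t ~= 0} = {c : T // conj_rel k1. EX t:c. fix_index (H 1) k1 t ~= 0}"
  by (intro Collect_cong conj_cong bex_cong refl) auto
 thus ?thesis unfolding nielsen_eq[OF k] nielsen_eq[OF k1] rel by simp
qed

end

section \<open>Infra-solvmanifolds\<close>

context infra_solvmanifold_R begin

abbreviation "SD == semidirect G C"

abbreviation "act == affine_act G"
abbreviation "Ga == translation_part P"

lemma C_end: "A : C ==> diff_end A (lie_differential G \<A> A)"
 using C_smooth by (intro lie_End_diff_end) blast

lemma C_id: "id : C"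
 using subgroup.one_closed[OF C_subgroup] by (simp add: AutoGroup_def BijGroup_def carrier_UNIV id_def restrict_def)

lemma C_inv:
 assumes A: "A : C"
 obtains B where "B : C" "B o A = id"
proof -
 have A': "A : carrier (AutoGroup G)" using subgroup.mem_carrier[OF C_subgroup A] .
 let ?B = "inv\<^bsub>AutoGroup G\<^esub> A"
 have B: "?B : C" by (rule subgroup.m_inv_closed[OF C_subgroup A])
 hence B': "?B : carrier (AutoGroup G)" using subgroup.mem_carrier[OF C_subgroup] by blast
 have "?B \<otimes>\<^bsub>AutoGroup G\<^esub> A = \<one>\<^bsub>AutoGroup G\<^esub>" by (rule group.l_inv[OF AutoGroup A'])
 moreover have "A : Bij UNIV" "?B : Bij UNIV" using A' B' by (simp_all add: AutoGroup_def auto_def carrier_UNIV)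
 moreover have "X \<otimes>\<^bsub>AutoGroup G\<^esub> A = X o A" "\<one>\<^bsub>AutoGroup G\<^esub> = id" if "X : Bij UNIV" for X
  using that \<open>A : Bij UNIV\<close> by (simp_all add: AutoGroup_def BijGroup_def carrier_UNIV compose_def restrict_def o_def id_def)
 ultimately have "?B o A = id" by metis
 thus ?thesis using that B by blast
qed

lemma semidirect_simps [simp]:
 "carrier (SD) = UNIV \<times> C" "(a, A) \<otimes>\<^bsub>SD\<^esub> (b, B) = (a *. A b, A o B)" "\<one>\<^bsub>SD\<^esub> = (\<one>, id)"
 by (simp_all add: semidirect_def carrier_UNIV)

lemma C_comp: "A : C ==> B : C ==> A o B : C"
proof -
 assume AB: "A : C" "B : C"
 hence "A \<otimes>\<^bsub>AutoGroup G\<^esub> B : C" by (rule subgroup.m_closed[OF C_subgroup])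
 moreover have "A : Bij UNIV" "B : Bij UNIV"
  using subgroup.mem_carrier[OF C_subgroup] AB by (auto simp: AutoGroup_def auto_def carrier_UNIV)
 ultimately show "A o B : C" by (simp add: AutoGroup_def BijGroup_def carrier_UNIV compose_def o_def restrict_def)
qed

lemma group_semidirect: "group (SD)"
proof (rule groupI)
 fix x assume "x : carrier (SD)"
 then obtain a A where x: "x = (a, A)" "A : C" by auto
 obtain B where B: "B : C" "B o A = id" by (rule C_inv[OF x(2)])
 show "EX y:carrier (SD). y \<otimes>\<^bsub>SD\<^esub> x = \<one>\<^bsub>SD\<^esub>"
  using B x by (intro bexI[of _ "(inv (B a), B)"]) simp_all
qed (auto simp: C_comp C_id m_assoc o_assoc diff_end_mult[OF C_end] diff_end_one[OF C_end])

lemma P_C: "(a, A) : P ==> A : C"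
 using subgroup.mem_carrier[OF P_subgroup] by force

lemma act_simp: "act (a, A) x = a *. A x"
 by (simp add: affine_act_def)

lemma act_mult: "al : P ==> act (al \<otimes>\<^bsub>SD\<^esub> bt) = act al o act bt"
 using P_C by (cases al; cases bt) (auto simp: act_simp fun_eq_iff m_assoc diff_end_mult[OF C_end])

lemma act_one: "act \<one>\<^bsub>SD\<^esub> = id"
 by (simp add: act_simp fun_eq_iff)

lemma continuous_act: "al : P ==> continuous_on UNIV (act al)"
 using P_C C_end by (cases al) (auto simp: act_simp diff_end_def intro!: group_cont)

lemma translation_mem: "ga : Ga <-> (ga, id) : P"
 by (simp add: translation_part_def)

lemma Ga_subgroup: "subgroup Ga G"
 using lattice by (simp add: lattice_subgroup_def)

lemma Ga_isolated: obtains W where "open W" "W Int Ga = {\<one>}"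
proof -
 have "openin (subtopology euclidean Ga) {\<one>}"
  using lattice subgroup.one_closed[OF Ga_subgroup] by (simp add: lattice_subgroup_def discrete_subset_def)
 thus ?thesis using that by (auto simp: openin_subtopology)
qed

text \<open>Compactness of the quotient leaves finitely many translates of a coordinate ball whose
  images cover it; the corresponding closed balls, which are compact, form \<open>F\<close>.\<close>

lemma fundamental_compact: obtains F where "compact F" "!!x. EX ga:Ga. EX y:F. x = ga *. y"
proof -
 define q where "q = (%x. Ga #> x)"
 have q: "EX ga:Ga. x = ga *. y" if xy: "q x = q y" for x y
 proof -
  have "\<one> *. x : q x" unfolding q_def r_coset_def using subgroup.one_closed[OF Ga_subgroup] by blast
  thus ?thesis unfolding xy unfolding q_def r_coset_def by (elim UN_E) auto
 qed
 have qg: "q (ga *. x) = q x" if "ga : Ga" for ga x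
 proof -
  have "Ga #> ga = Ga" by (rule coset_join2[OF _ Ga_subgroup that]) simp
  thus ?thesis unfolding q_def using coset_mult_assoc[OF subgroup.subset[OF Ga_subgroup], of ga x] by simp
 qed
 obtain r where r: "r > 0" "cball 0 r <= cdom" "!!u. u : cball 0 r ==> loc u : UNIV"
  by (rule loc_near[OF open_UNIV UNIV_I]) (rule that; assumption)
 define U where "U = (%x. {y. inv x *. y : loc ` ball 0 r})"
 have oU: "open (U x)" for x unfolding U_def using r(2) by (intro open_ltrans open_loc_image) auto
 have xU: "x : U x" for x using r(1) by (auto simp: U_def intro!: image_eqI[of _ _ 0])
 have oq: "openin (quotient_topology q) (q ` U x)" for x
 proof -
  have "q -` q ` U x = (UN ga:Ga. {y. ga *. y : U x})"
  proof (intro Set.equalityI subsetI)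
  fix y assume "y : q -` q ` U x"
  then obtain u where u: "u : U x" "q u = q y" by force
  thus "y : (UN ga:Ga. {y. ga *. y : U x})" using q by blast
  next
  fix y assume "y : (UN ga:Ga. {y. ga *. y : U x})"
  then obtain ga where "ga : Ga" "ga *. y : U x" by blast
  thus "y : q -` q ` U x" using qg[of ga y] by (metis imageI vimageI)
  qed
  thus ?thesis using oU by (auto simp: openin_quotient_topology intro!: open_UN open_ltrans)
 qed
 have cq: "compactin (quotient_topology q) (range q)"
  using lattice by (simp add: lattice_subgroup_def q_def compact_space_def topspace_quotient_topology)
 have sq: "range q <= \<Union>((%x. q ` U x) ` UNIV)" using xU by blast
 have "EX \<F>. finite \<F> & \<F> <= (%x. q ` U x) ` UNIV & range q <= \<Union>\<F>"
  by (rule compactinD[OF cq _ sq]) (use oq in blast)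
 then obtain \<F> where F: "finite \<F>" "\<F> <= (%x. q ` U x) ` UNIV" "range q <= \<Union>\<F>" by (elim exE conjE)
 obtain X where X: "finite X" "\<F> = (%x. q ` U x) ` X" using finite_subset_image[OF F(1,2)] by (elim exE conjE)
 show ?thesis
 proof
  show "compact (UN x:X. (%v. x *. loc v) ` cball 0 r)"
  using X(1) r(2) by (intro compact_UN compact_continuous_image group_cont continuous_loc' compact_cball) auto
  fix y
  have "q y : \<Union>((%x. q ` U x) ` X)" using F(3) rangeI[of q y] unfolding X(2) by (rule subsetD)
  then obtain x u where u: "x : X" "u : U x" "q y = q u" by (elim UN_E imageE)
  obtain v where v: "v : ball 0 r" "inv x *. u = loc v" using u(2) unfolding U_def by (elim CollectE imageE)
  have ux: "u = x *. loc v" using v(2) mult_inv_cancel(1) by metis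
  obtain ga where ga: "ga : Ga" "y = ga *. u" using q[OF u(3)] by (elim bexE)
  have "u : (UN x:X. (%v. x *. loc v) ` cball 0 r)" unfolding ux using v(1) by (intro UN_I[OF u(1)] imageI) simp
  thus "EX ga:Ga. EX u:(UN x:X. (%v. x *. loc v) ` cball 0 r). y = ga *. u"
  using ga by (intro bexI[of _ ga] bexI[of _ u])
 qed
qed

lemma finite_reps: obtains R where "finite R" "R <= P" "!!al. al : P ==> EX ga:Ga. EX rh:R. al = (ga *. fst rh, snd rh)"
proof -
 let ?G = "(SD)\<lparr>carrier := P\<rparr>" and ?H = "Ga \<times> {id}"
 have "rcosets\<^bsub>?G\<^esub> ?H = (%rh. ?H #>\<^bsub>?G\<^esub> rh) ` P" by (auto simp: RCOSETS_def)
 then obtain R where R: "finite R" "R <= P" "(%rh. ?H #>\<^bsub>?G\<^esub> rh) ` P = (%rh. ?H #>\<^bsub>?G\<^esub> rh) ` R"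
  using finite_extension finite_subset_image[of "(%rh. ?H #>\<^bsub>?G\<^esub> rh) ` P" "%rh. ?H #>\<^bsub>?G\<^esub> rh" P] by auto
 show ?thesis
 proof (rule that[OF R(1,2)])
  fix al assume "al : P"
  hence "?H #>\<^bsub>?G\<^esub> al : (%rh. ?H #>\<^bsub>?G\<^esub> rh) ` R" using R(3) by blast
  then obtain rh where rh: "rh : R" "?H #>\<^bsub>?G\<^esub> al = ?H #>\<^bsub>?G\<^esub> rh" by blast
  have "(\<one>, id) \<otimes>\<^bsub>SD\<^esub> al : ?H #>\<^bsub>?G\<^esub> al"
  using subgroup.one_closed[OF Ga_subgroup] by (auto simp: r_coset_def)
  then obtain ga where "ga : Ga" "(\<one>, id) \<otimes>\<^bsub>SD\<^esub> al = (ga, id) \<otimes>\<^bsub>SD\<^esub> rh"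
  unfolding rh(2) by (auto simp: r_coset_def)
  thus "EX ga:Ga. EX rh:R. al = (ga *. fst rh, snd rh)"
  using rh(1) by (intro bexI[of _ ga] bexI[of _ rh]) (cases al; cases rh; simp)+
 qed
qed

text \<open>An element of \<open>P\<close> is \<open>ga\<close> times one of finitely many
  representatives \<open>rh\<close>. If it moves \<open>u\<close> to \<open>v\<close>, then
  \<open>ga = v *. inv (act rh u)\<close> is close to \<open>y *. inv (act rh x)\<close>; two such
  \<open>ga\<close> differ by an element of \<open>W\<close> and hence coincide, so each
  representative occurs at most once.\<close>

lemma properly_discontinuous: "EX U V. open U & open V & x : U & y : V & finite {al : P. act al ` U Int V ~= {}}"
proof -
 obtain W where W: "open W" "W Int Ga = {\<one>}" by (rule Ga_isolated)
 hence W1: "\<one> : W" by blast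
 obtain R where R: "finite R" "R <= P" "!!al. al : P ==> EX ga:Ga. EX rh:R. al = (ga *. fst rh, snd rh)"
  by (rule finite_reps) (rule that; assumption)
 obtain V1 where V1: "open V1" "\<one> : V1" "!!a b. a : V1 ==> b : V1 ==> a *. inv b : W"
  by (rule small_quotients[OF W(1) W1]) (rule that; assumption)
 have cq: "continuous_on UNIV (%(u, v). v *. inv (act rh u) *. inv (y *. inv (act rh x)))" if "rh : R" for rh
 proof -
  have "continuous_on UNIV (act rh)" using continuous_act R(2) that by blast
  hence "continuous_on UNIV (%z::'s \<times> 's. act rh (fst z))"
  by (rule continuous_on_compose2) (auto intro: continuous_on_fst continuous_on_id)
  thus ?thesis unfolding split_beta by (intro group_cont continuous_on_snd continuous_on_id continuous_on_const)
 qed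
 have "ALL rh:R. EX A. open (fst A) & open (snd A) & x : fst A & y : snd A &
  (ALL u:fst A. ALL v:snd A. v *. inv (act rh u) *. inv (y *. inv (act rh x)) : V1)"
 proof
  fix rh assume "rh : R"
  have op: "open ((%(u, v). v *. inv (act rh u) *. inv (y *. inv (act rh x))) -` V1)"
  by (rule open_vimage[OF V1(1) cq[OF \<open>rh : R\<close>]])
  have "(x, y) : (%(u, v). v *. inv (act rh u) *. inv (y *. inv (act rh x))) -` V1"
  using V1(2) r_inv[OF in_carrier] by (simp del: inv_mult_group)
  with op obtain A B where "open A" "open B" "(x, y) : A \<times> B" "A \<times> B <= (%(u, v). v *. inv (act rh u) *. inv (y *. inv (act rh x))) -` V1"
  by (rule open_prod_elim)
  thus "EX A. open (fst A) & open (snd A) & x : fst A & y : snd A &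
  (ALL u:fst A. ALL v:snd A. v *. inv (act rh u) *. inv (y *. inv (act rh x)) : V1)"
  by (intro exI[of _ "(A, B)"]) (simp add: mem_Times_iff subset_iff)
 qed
 from bchoice[OF this] obtain A where A: "ALL rh:R. open (fst (A rh)) & open (snd (A rh)) & x : fst (A rh) & y : snd (A rh) &
  (ALL u:fst (A rh). ALL v:snd (A rh). v *. inv (act rh u) *. inv (y *. inv (act rh x)) : V1)" ..
 define U V where "U = (INT rh:R. fst (A rh))" and "V = (INT rh:R. snd (A rh))"
 let ?Z = "{al : P. act al ` U Int V ~= {}}"
 have "ALL al:?Z. EX rh. rh : R & (EX u:U. EX v:V. snd al = snd rh & fst al = v *. inv (act rh u) *. fst rh & v *. inv (act rh u) : Ga)"
 proof
  fix al assume al: "al : ?Z"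
  hence aP: "al : P" by simp
  obtain ga rh where g: "ga : Ga" "rh : R" "al = (ga *. fst rh, snd rh)" using R(3)[OF aP] by (elim bexE)
  obtain u where u: "u : U" "act al u : V" using al by blast
  have "act al u = ga *. act rh u" using g(3) by (cases rh) (simp add: act_simp m_assoc)
  hence e: "act al u *. inv (act rh u) = ga" by (simp add: m_assoc)
  have "snd al = snd rh & fst al = act al u *. inv (act rh u) *. fst rh & act al u *. inv (act rh u) : Ga"
  unfolding e using g by simp
  thus "EX rh. rh : R & (EX u:U. EX v:V. snd al = snd rh & fst al = v *. inv (act rh u) *. fst rh & v *. inv (act rh u) : Ga)"
  by (intro exI[of _ rh] conjI[OF g(2)] bexI[OF _ u(1)] bexI[OF _ u(2)])
 qed
 from bchoice[OF this] obtain rep where rep: "ALL al:?Z. rep al : R & (EX u:U. EX v:V. snd al = snd (rep al) &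
  fst al = v *. inv (act (rep al) u) *. fst (rep al) & v *. inv (act (rep al) u) : Ga)" ..
 have "inj_on rep ?Z"
 proof (rule inj_onI)
  fix al bt assume ab: "al : ?Z" "bt : ?Z" "rep al = rep bt"
  define rh where "rh = rep al"
  obtain u v where u: "u : U" "v : V" "snd al = snd rh" "fst al = v *. inv (act rh u) *. fst rh" "v *. inv (act rh u) : Ga" and rh: "rh : R"
  using bspec[OF rep ab(1)] unfolding rh_def by (elim conjE bexE)
  obtain u' v' where u': "u' : U" "v' : V" "snd bt = snd rh" "fst bt = v' *. inv (act rh u') *. fst rh" "v' *. inv (act rh u') : Ga"
  using bspec[OF rep ab(2)] unfolding rh_def ab(3) by (elim conjE bexE)
  let ?a = "v *. inv (act rh u)" and ?b = "v' *. inv (act rh u')" and ?c = "y *. inv (act rh x)"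
  have A': "u : fst (A rh) ==> v : snd (A rh) ==> v *. inv (act rh u) *. inv ?c : V1" for u v
  using bspec[OF A rh] by simp
  have "u : fst (A rh)" "v : snd (A rh)" "u' : fst (A rh)" "v' : snd (A rh)"
  using u(1,2) u'(1,2) rh unfolding U_def V_def by simp_all
  hence "?a *. inv ?c : V1" "?b *. inv ?c : V1" by (simp_all only: A')
  from V1(3)[OF this] have "?a *. inv ?b : W" by (simp add: inv_mult_group m_assoc)
  moreover have "?a *. inv ?b : Ga"
  by (intro subgroup.m_closed[OF Ga_subgroup] subgroup.m_inv_closed[OF Ga_subgroup] u(5) u'(5))
  ultimately have "?a *. inv ?b = \<one>" using W(2) by blast
  hence "inv (inv ?b) = ?a" by (rule inv_equality) simp_all
  hence "?a = ?b" by simp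
  hence "fst al = fst bt" unfolding u(4) u'(4) by (rule arg_cong)
  thus "al = bt" using u(3) u'(3) by (simp add: prod_eq_iff)
 qed
 moreover have "rep ` ?Z <= R" by (rule image_subsetI) (use bspec[OF rep] in \<open>rule conjunct1\<close>)
 ultimately have "finite ?Z" using R(1) by (rule inj_on_finite)
 moreover have "open U" "open V" unfolding U_def V_def by (rule open_INT[OF R(1)], use A in simp)+
 moreover have "x : U" "y : V" unfolding U_def V_def using A by simp_all
 ultimately show ?thesis by (intro exI conjI)
qed

lemma P_closed: "al : P ==> bt : P ==> al \<otimes>\<^bsub>SD\<^esub> bt : P"
 by (rule subgroup.m_closed[OF P_subgroup])

text \<open>By proper discontinuity only finitely many elements fix \<open>x\<close>. All powers of
  \<open>al\<close> are among them, so two powers coincide, and torsion-freeness makes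
  \<open>al\<close> trivial.\<close>

lemma act_free:
 assumes al: "al : P" "act al x = x" shows "act al = id"
proof -
 have ac: "al : carrier (SD)" using subgroup.mem_carrier[OF P_subgroup al(1)] .
 have ms: "monoid (SD)" by (rule group.is_monoid[OF group_semidirect])
 have pw: "al [^]\<^bsub>SD\<^esub> (n::nat) : P & act (al [^]\<^bsub>SD\<^esub> n) x = x" for n
 proof (induction n)
  case 0
  thus ?case using subgroup.one_closed[OF P_subgroup] act_one by simp
 next
  case (Suc n)
  thus ?case using P_closed al act_mult by (simp add: monoid.nat_pow_Suc[OF ms])
 qed
 obtain U V where UV: "x : U" "x : V" "finite {al : P. act al ` U Int V ~= {}}"
  using properly_discontinuous[of x x] by (elim exE conjE)
 have "act bt ` U Int V ~= {}" if "act bt x = x" for bt using UV(1,2) imageI[of x U "act bt"] that by auto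
 hence "finite {bt : P. act bt x = x}" by (intro rev_finite_subset[OF UV(3)]) blast
 hence "finite (range (%n::nat. al [^]\<^bsub>SD\<^esub> n))" by (rule rev_finite_subset) (use pw in blast)
 hence "~ inj (%n::nat. al [^]\<^bsub>SD\<^esub> n)" using finite_imageD infinite_UNIV_nat by blast
 then obtain i j :: nat where ij: "i < j" "al [^]\<^bsub>SD\<^esub> i = al [^]\<^bsub>SD\<^esub> j"
  unfolding inj_def by (metis linorder_neqE_nat)
 have "al [^]\<^bsub>SD\<^esub> i \<otimes>\<^bsub>SD\<^esub> al [^]\<^bsub>SD\<^esub> (j - i) = al [^]\<^bsub>SD\<^esub> i"
  using monoid.nat_pow_mult[OF ms ac, of i "j - i"] ij by simp
 hence "al [^]\<^bsub>SD\<^esub> (j - i) = \<one>\<^bsub>SD\<^esub>"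
  using group.l_cancel_one[OF group_semidirect] monoid.nat_pow_closed[OF ms ac] by blast
 hence "al = \<one>\<^bsub>SD\<^esub>" using ij(1) by (intro P_torsion_free[OF al(1), of "j - i"]) simp_all
 thus ?thesis using act_one by simp
qed

theorem deck_action_infra:
 assumes F: "compact F" "!!x. EX ga:Ga. EX y:F. x = ga *. y"
 shows "deck_action (act ` P) F (infra_proj G C P) (infra_manifold G C P)"
proof (rule deck_action.intro)
 show "id : act ` P" using subgroup.one_closed[OF P_subgroup] act_one by (metis imageI)
 show "g o h : act ` P" if gh: "g : act ` P" "h : act ` P" for g h
 proof -
  obtain al bt where "al : P" "bt : P" "g = act al" "h = act bt" using gh by blast
  thus ?thesis using P_closed[of al bt] act_mult[of al bt] by (metis imageI)
 qed
 show "EX h:act ` P. h o g = id & g o h = id" if g: "g : act ` P" for g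
 proof -
  obtain al where al: "al : P" "g = act al" using g by blast
  have ac: "al : carrier (SD)" using subgroup.mem_carrier[OF P_subgroup al(1)] .
  let ?b = "inv\<^bsub>SD\<^esub> al"
  have b: "?b : P" by (rule subgroup.m_inv_closed[OF P_subgroup al(1)])
  have "act ?b o g = id" "g o act ?b = id"
  unfolding al(2) act_mult[OF b, symmetric] act_mult[OF al(1), symmetric] group.l_inv[OF group_semidirect ac] group.r_inv[OF group_semidirect ac] by (rule act_one)+
  thus ?thesis using b by blast
 qed
 show "continuous_on UNIV g" if "g : act ` P" for g using that continuous_act by blast
 show "g = id" if g: "g : act ` P" "g x = x" for g x
 proof -
  obtain al where "al : P" "g = act al" using g(1) by blast
  thus ?thesis using act_free[of al x] g(2) by simp
 qed
 show "EX U V. open U & open V & x : U & y : V & finite {g : act ` P. g ` U Int V ~= {}}" for x y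
 proof -
  obtain U V where "open U" "open V" "x : U" "y : V" "finite {al : P. act al ` U Int V ~= {}}"
  using properly_discontinuous[of x y] by (elim exE conjE)
  moreover have "{g : act ` P. g ` U Int V ~= {}} = act ` {al : P. act al ` U Int V ~= {}}" by blast
  ultimately show ?thesis by (intro exI[of _ U] exI[of _ V]) simp
 qed
 show "compact F" by (rule F)
 show "EX g:act ` P. g x : F" for x
 proof -
  obtain ga y where g: "ga : Ga" "y : F" "x = ga *. y" using F(2) by blast
  have "(inv ga, id) : P" using subgroup.m_inv_closed[OF Ga_subgroup g(1)] by (simp add: translation_mem)
  moreover have "act (inv ga, id) x = y" by (simp add: act_simp g(3))
  ultimately show ?thesis using g(2) by (intro bexI[of _ "act (inv ga, id)"]) auto
 qed
 show "infra_proj G C P x = (%g. g x) ` act ` P" for x by (auto simp: infra_proj_def orbit_def)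
qed (rule connected refl)+

end

section \<open>The quotient manifold and the index of its affine maps\<close>

locale infra_fund = infra_solvmanifold_R G \<A> C P
 for G :: "'s::{t2_space, second_countable_topology} monoid" (structure)
  and \<A> :: "('s, 'n::finite) chart set" and C P +
 fixes F :: "'s set"
 assumes F_compact: "compact F" and F_meets: "!!x. EX ga:translation_part P. EX y:F. x = ga *. y"
begin

abbreviation "pr == infra_proj G C P"
abbreviation "M == infra_manifold G C P"

sublocale deck: deck_action "act ` P" F pr M by (rule deck_action_infra[OF F_compact F_meets])

lemma manifold_chart:
 obtains R e where "R > 0" "ball 0 R <= cdom" "continuous_map (top_of_set (ball 0 R)) M (%v. pr (x *. loc v))"
  "openin M ((%v. pr (x *. loc v)) ` ball 0 R)"
  "continuous_map (subtopology M ((%v. pr (x *. loc v)) ` ball 0 R)) euclidean e"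
  "!!v. v : ball 0 R ==> e (pr (x *. loc v)) = v"
proof -
 obtain U where U: "open U" "x : U" "!!g u. g : act ` P ==> u : U ==> g u : U ==> g = id"
  by (rule deck.small[of x]) (rule that; assumption)
 have "open {h. x *. h : U}" "\<one> : {h. x *. h : U}" using U(1,2) by (auto intro: open_ltrans)
 then obtain R where R: "R > 0" "cball 0 R <= cdom" "!!u. u : cball 0 R ==> loc u : {h. x *. h : U}"
  by (rule loc_near) (rule that; assumption)
 define c where "c = (%v. pr (x *. loc v))"
 let ?B = "ball 0 R :: (real ^ 'n) set"
 have B: "?B <= cdom" using R(2) ball_subset_cball by blast
 have oc: "openin M (c ` V)" if V: "open V" "V <= ?B" for V
 proof -
  have "(%v. x *. loc v) ` V = {y. inv x *. y : loc ` V}" by (auto simp: image_iff) (metis mult_inv_cancel(1))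
  moreover have "open {y. inv x *. y : loc ` V}" using V B by (intro open_ltrans open_loc_image) auto
  ultimately have "openin M (pr ` (%v. x *. loc v) ` V)" using deck.openin_p by simp
  thus ?thesis by (simp add: c_def image_image)
 qed
 have inj: "inj_on c ?B"
 proof (rule inj_onI)
  fix v w assume vw: "v : ?B" "w : ?B" "c v = c w"
  have "x *. loc v : U" "x *. loc w : U" using R(3) vw(1,2) by auto
  moreover have "inj_on pr U" by (rule deck.inj_on_p[OF U(3)])
  ultimately have "x *. loc v = x *. loc w" using vw(3) by (simp add: inj_on_def c_def)
  hence "loc v = loc w" by simp
  thus "v = w" using vw B crd_loc by (metis subsetD)
 qed
  have "continuous_on ?B (%v. x *. loc v)" using B by (intro group_cont continuous_loc') auto
  hence "continuous_map (top_of_set ?B) M (pr o (%v. x *. loc v))"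
  by (intro continuous_map_compose[OF _ deck.continuous_p]) simp
  hence c1: "continuous_map (top_of_set ?B) M c" by (simp add: c_def o_def)
  have c2: "openin M (c ` ?B)" by (rule oc) auto
  have c4: "inv_into ?B c (c v) = v" if "v : ?B" for v using inv_into_f_f[OF inj that] .
  have c3: "continuous_map (subtopology M (c ` ?B)) euclidean (inv_into ?B c)" unfolding continuous_map_def
  proof (intro conjI allI impI funcsetI UNIV_I)
  fix W :: "(real ^ 'n) set" assume W: "openin euclidean W"
  have "openin M (c ` (?B Int W))" using W by (intro oc) auto
  moreover have "{m : topspace (subtopology M (c ` ?B)). inv_into ?B c m : W} = c ` (?B Int W)"
  using openin_subset[OF oc[OF open_ball order_refl]] by (auto simp: inv_into_f_f[OF inj])
  ultimately show "openin (subtopology M (c ` ?B)) {m : topspace (subtopology M (c ` ?B)). inv_into ?B c m : W}"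
  using oc[OF open_ball order_refl] by (auto simp: openin_open_subtopology)
  qed simp
 show ?thesis by (rule that[OF R(1) B c1[unfolded c_def] c2[unfolded c_def] c3[unfolded c_def] c4[unfolded c_def]])
qed

lemma manifold_ENR: "EX N i r Q. retr M N i r Q"
proof -
 have ch: "EX U ph ps. openin M U & m : U & homeomorphic_maps (subtopology M U) (euclidean :: (real ^ 'n) topology) ph ps"
  if m: "m : topspace M" for m
 proof -
  obtain x where x: "m = pr x" using m by (auto simp: deck.topspace_M)
  obtain R e where R: "R > 0" "ball 0 R <= cdom" "continuous_map (top_of_set (ball 0 R)) M (%v. pr (x *. loc v))"
  "openin M ((%v. pr (x *. loc v)) ` ball 0 R)"
  "continuous_map (subtopology M ((%v. pr (x *. loc v)) ` ball 0 R)) euclidean e"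
  "!!v. v : ball 0 R ==> e (pr (x *. loc v)) = v" by (rule manifold_chart[of x]) (rule that; assumption)
  let ?B = "ball 0 R :: (real ^ 'n) set" and ?c = "%v. pr (x *. loc v)"
  have "?B homeomorphic (UNIV :: (real ^ 'n) set)"
  using homeomorphic_trans[OF homeomorphic_balls(1)[OF R(1) zero_less_one] homeomorphic_ball01_UNIV] .
  then obtain h h' where "homeomorphism ?B (UNIV :: (real ^ 'n) set) h h'" unfolding homeomorphic_def by blast
  hence h: "continuous_on ?B h" "continuous_on UNIV h'" "!!v. h' v : ?B" "!!v. v : ?B ==> h' (h v) = v" "!!v. h (h' v) = v"
  by (auto simp: homeomorphism_def)
  have ts: "topspace (subtopology M (?c ` ?B)) = ?c ` ?B" using openin_subset[OF R(4)] by auto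
  have "homeomorphic_maps (subtopology M (?c ` ?B)) euclidean (h o e) (?c o h')" unfolding homeomorphic_maps_def
  proof (intro conjI ballI)
  have "continuous_map (subtopology M (?c ` ?B)) (top_of_set ?B) e"
  using R(5,6) ts by (auto simp: continuous_map_in_subtopology)
  thus "continuous_map (subtopology M (?c ` ?B)) euclidean (h o e)"
  by (rule continuous_map_compose) (use h(1) in simp)
  have "continuous_map euclidean (top_of_set ?B) h'" using h(2,3) by (auto simp: continuous_map_in_subtopology)
  thus "continuous_map euclidean (subtopology M (?c ` ?B)) (?c o h')"
  by (rule continuous_map_compose) (use R(3) in \<open>auto simp: continuous_map_in_subtopology\<close>)
  show "(?c o h') ((h o e) m) = m" if "m : topspace (subtopology M (?c ` ?B))" for m
  using that R(6) h(4) unfolding ts by (elim imageE) simp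
  show "(h o e) ((?c o h') v) = v" if "v : topspace euclidean" for v using R(6)[OF h(3)] h(5) by simp
  qed
  moreover have "m : ?c ` ?B" using R(1) by (intro image_eqI[of _ _ 0]) (simp_all add: x)
  ultimately show ?thesis using R(4) by (intro exI[of _ "?c ` ?B"] exI[of _ "h o e"] exI[of _ "?c o h'"] conjI)
 qed
 obtain N i r Q where "continuous_map M (eucl N) i" "openin (eucl N) Q"
  "i ` topspace M <= Q" "continuous_map (esub N Q) M r" "!!x. x : topspace M ==> r (i x) = x"
  by (rule compact_manifold_ENR[OF deck.compact_M deck.Hausdorff_M ch]) (assumption, (rule that; assumption))
 from retr.intro[OF deck.compact_M deck.Hausdorff_M this] show ?thesis by (intro exI)
qed

text \<open>Since \<open>ga *. (b *. E y) = y\<close>, this lift sends \<open>y *. h\<close> to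
  \<open>y *. E h\<close>. In the chart translated to \<open>y\<close> the map is thus
  \<open>E\<close> itself, whose derivative \<open>L\<close> fixes no nonzero vector.\<close>

lemma index_nonzero:
 assumes f: "continuous_map M M f" "!!x. f (pr x) = pr (b *. E x)" and E: "diff_end E L" "inj (%v. v - L v)"
  and y: "ga : Ga" "ga *. (b *. E y) = y" shows "fixed_point_index M f {pr y} ~= 0"
proof -
 obtain R e where R: "R > 0" "ball 0 R <= cdom" "continuous_map (top_of_set (ball 0 R)) M (%v. pr (y *. loc v))"
  "openin M ((%v. pr (y *. loc v)) ` ball 0 R)"
  "continuous_map (subtopology M ((%v. pr (y *. loc v)) ` ball 0 R)) euclidean e"
  "!!v. v : ball 0 R ==> e (pr (y *. loc v)) = v" by (rule manifold_chart[of y]) (rule that; assumption)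
 let ?A = "{v : cdom. E (loc v) : nbh}"
 have cE: "continuous_on UNIV E" using E(1) by (simp add: diff_end_def)
 have g: "pr (ga *. z) = pr z" for z
  using deck.p_deck[of "act (ga, id)" z] y(1) by (simp add: translation_mem act_simp)
 have "fixed_point_index M f {pr (y *. loc 0)} ~= 0"
 proof (rule fixed_point_index_nondegenerate[OF deck.compact_M deck.Hausdorff_M f(1) manifold_ENR R(1,3-6)])
  show "open ?A" by (rule open_loc_vimage[OF cE nbh(1)])
  show "0 : ?A" using cdom(2) nbh(2) diff_end_one[OF E(1)] by simp
  have "continuous_on ?A (%v. E (loc v))"
  by (rule continuous_on_compose2[OF cE continuous_loc'[OF continuous_on_id]]) auto
  thus "continuous_on ?A (%v. crd (E (loc v)))" by (rule continuous_on_compose2[OF continuous_crd]) auto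
  show "f (pr (y *. loc v)) = pr (y *. loc (crd (E (loc v))))" if "v : ?A" for v
  proof -
  have "ga *. (b *. E (y *. loc v)) = ga *. (b *. E y) *. E (loc v)" by (simp add: diff_end_mult[OF E(1)] m_assoc)
  hence "ga *. (b *. E (y *. loc v)) = y *. E (loc v)" by (simp only: y(2))
  hence "pr (b *. E (y *. loc v)) = pr (y *. E (loc v))" using g[of "b *. E (y *. loc v)"] by simp
  thus ?thesis using that by (simp add: f(2) loc_crd)
  qed
  show "crd (E (loc 0)) = 0" using diff_end_one[OF E(1)] by simp
  show "((%v. crd (E (loc v))) has_derivative L) (at 0)" using E(1) by (simp add: diff_end_def)
  show "linear L" using bounded_linear.linear[OF diff_end_linear[OF E(1)]] .
 qed (assumption, rule E(2))
 thus ?thesis by simp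
qed

end

section \<open>The two bounds for Nielsen numbers of affine maps\<close>

context infra_fund begin

text \<open>Points of one fibre differ by elements of \<open>P\<close>, of which there are finitely
  many up to \<open>Ga\<close>. Two points with the same representative lie in one orbit of
  \<open>Ga\<close>, and \<open>Y\<close> meets each orbit at most once.\<close>

lemma fibre_card:
 obtains r where "!!Y y. finite Y ==> ALL u:Y. ALL v:Y. ALL ga:Ga. v = ga *. u --> v = u ==>
  card {y' : Y. pr y' = pr y} <= r"
proof -
 obtain R where R: "finite R" "R <= P" "!!al. al : P ==> EX ga:Ga. EX rh:R. al = (ga *. fst rh, snd rh)"
  by (rule finite_reps) (rule that; assumption)
 show ?thesis
 proof (rule that[of "card R"])
  fix Y y assume Y: "finite Y" "ALL u:Y. ALL v:Y. ALL ga:Ga. v = ga *. u --> v = u"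
  let ?Z = "{y' : Y. pr y' = pr y}"
  have "ALL u:?Z. EX rh. rh : R & (EX ga:Ga. u = ga *. act rh y)"
  proof
  fix u assume "u : ?Z"
  hence "pr y = pr u" by simp
  then obtain g where g: "g : act ` P" "u = g y" unfolding deck.p_eq_iff by (elim bexE)
  obtain al where al: "al : P" "u = act al y" using g by blast
  obtain ga rh where rh: "ga : Ga" "rh : R" "al = (ga *. fst rh, snd rh)" using R(3)[OF al(1)] by (elim bexE)
  have "u = ga *. act rh y" unfolding al(2) rh(3) by (cases rh) (simp add: act_simp m_assoc)
  thus "EX rh. rh : R & (EX ga:Ga. u = ga *. act rh y)" using rh(1,2) by blast
  qed
  from bchoice[OF this] obtain h where h: "ALL u:?Z. h u : R & (EX ga:Ga. u = ga *. act (h u) y)" ..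
  have "inj_on h ?Z"
  proof (rule inj_onI)
  fix u v assume uv: "u : ?Z" "v : ?Z" "h u = h v"
  obtain ga where ga: "ga : Ga" "u = ga *. act (h v) y" using bspec[OF h uv(1)] unfolding uv(3) by (elim conjE bexE)
  obtain dl where dl: "dl : Ga" "v = dl *. act (h v) y" using bspec[OF h uv(2)] by (elim conjE bexE)
  have "u = (ga *. inv dl) *. (dl *. act (h v) y)" using ga(2) by (simp add: m_assoc)
  hence "u = (ga *. inv dl) *. v" unfolding dl(2)[symmetric] .
  moreover have "ga *. inv dl : Ga"
  by (intro subgroup.m_closed[OF Ga_subgroup] subgroup.m_inv_closed[OF Ga_subgroup] ga(1) dl(1))
  moreover have "v : Y" "u : Y" using uv(1,2) by simp_all
  ultimately show "u = v" using Y(2) by blast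
  qed
  moreover have "h ` ?Z <= R" by (rule image_subsetI) (use bspec[OF h] in \<open>rule conjunct1\<close>)
  ultimately show "card ?Z <= card R" using R(1) by (rule card_inj_on_le)
 qed
qed

lemma affine_lift:
 assumes "diff_end E L" "!!x. f (pr x) = pr (b *. E x)" shows "(%x. b *. E x) : lifts pr f"
 using assms by (auto simp: lifts_def diff_end_def intro!: group_cont)

text \<open>If \<open>ga *. (b *. E y) = y\<close>, any other fixed point \<open>z\<close> of this
  lift makes \<open>inv y *. z\<close> a fixed point of \<open>E\<close>, hence the identity. The
  constant \<open>r\<close> bounds the number of points of \<open>Y\<close> over one point of the
  quotient and does not depend on the map.\<close>

lemma nielsen_lower:
 obtains r where "!!f b E L Y. continuous_map M M f ==> ALL x. f (pr x) = pr (b *. E x) ==> diff_end E L ==>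
  det1 L ~= 0 ==> finite (deck.essential f (%x. b *. E x)) ==> finite Y ==>
  (ALL y:Y. EX ga:Ga. ga *. (b *. E y) = y) ==> (ALL y:Y. ALL y':Y. ALL ga:Ga. y' = ga *. y --> y' = y) ==>
  card Y <= r * nielsen_number M pr f"
proof -
 obtain r where r: "!!Y y. finite Y ==> ALL u:Y. ALL v:Y. ALL ga:Ga. v = ga *. u --> v = u ==>
  card {y' : Y. pr y' = pr y} <= r" by (rule fibre_card) (rule that; assumption)
 show ?thesis
 proof (rule that)
  fix f b E L Y assume fM: "continuous_map M M f" "ALL x. f (pr x) = pr (b *. E x)" and E: "diff_end E L"
  and L: "det1 L ~= 0" and fin: "finite (deck.essential f (%x. b *. E x))" and Y: "finite Y"
  and fixed: "ALL y:Y. EX ga:Ga. ga *. (b *. E y) = y" and orb: "ALL y:Y. ALL y':Y. ALL ga:Ga. y' = ga *. y --> y' = y"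
  note f = fM(1) spec[OF fM(2)]
  have "linear (%u. u - L u)"
  by (intro linear_compose_sub linear_ident bounded_linear.linear[OF diff_end_linear[OF E]])
  hence inj: "inj (%u. u - L u)" by (rule linear_det_inj[OF _ L])
  show "card Y <= r * nielsen_number M pr f"
  proof (rule deck.essential_ge[OF f(1) affine_lift[OF E f(2)] manifold_ENR fin Y])
  fix y assume y: "y : Y"
  obtain ga where ga: "ga : Ga" "ga *. (b *. E y) = y" using bspec[OF fixed y] by (elim bexE)
  show "fixed_point_index M f {pr y} ~= 0" by (rule index_nonzero[OF f E inj ga])
  show "EX t:act ` P. ALL z. t (b *. E z) = z <-> z = y"
  proof (intro bexI[of _ "act (ga, id)"] allI iffI)
  show "act (ga, id) : act ` P" using ga(1) by (simp add: translation_mem)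
  show "act (ga, id) (b *. E z) = z" if "z = y" for z using ga(2) that by (simp add: act_simp)
  fix z assume z: "act (ga, id) (b *. E z) = z"
  have "E z = E y *. E (inv y *. z)" using diff_end_mult[OF E, of y "inv y *. z"] by simp
  hence "z = ga *. (b *. E y) *. E (inv y *. z)" using z by (simp add: act_simp m_assoc)
  hence "z = y *. E (inv y *. z)" unfolding ga(2) .
  hence "inv y *. z = inv y *. (y *. E (inv y *. z))" by (rule arg_cong)
  hence "E (inv y *. z) = inv y *. z" by simp
  hence "inv y *. z = \<one>" by (rule fixed_trivial[OF E L])
  hence "y *. (inv y *. z) = y *. \<one>" by (rule arg_cong)
  thus "z = y" by simp
  qed
  next
  show "card {y' : Y. pr y' = pr y} <= r" for y by (rule r[OF Y orb])
  qed
 qed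
qed

text \<open>Small displacements exclude nontrivial elements near each point; finitely many such
  neighbourhoods cover the compact set \<open>F\<close>, and their bounds are intersected.\<close>

lemma uniformly_free:
 obtains V where "open V" "\<one> : V" "!!al x. al : P ==> x : F ==> inv x *. act al x : V ==> act al = id"
proof -
 have "ALL x. EX S. open (fst S) & open (snd S) & x : fst S & \<one> : snd S &
  (ALL y:fst S. ALL h:snd S. ALL al:P. act al y = y *. h --> act al = id)"
 proof
  fix x
  obtain U where U: "open U" "x : U" "!!g u. g : act ` P ==> u : U ==> g u : U ==> g = id"
  by (rule deck.small[of x]) (rule that; assumption)
  have "continuous_on UNIV (%(y, h). y *. h)" unfolding split_beta by (intro group_cont)
  from open_vimage[OF U(1) this] have "open ((%(y, h). y *. h) -` U)" .
  moreover have "(x, \<one>) : (%(y, h). y *. h) -` U" using U(2) by simp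
  ultimately obtain A B where AB: "open A" "open B" "(x, \<one>) : A \<times> B" "A \<times> B <= (%(y, h). y *. h) -` U"
  by (rule open_prod_elim)
  have "y *. h : U" if "y : A" "h : B" for y h using subsetD[OF AB(4), of "(y, h)"] that by simp
  hence "act al = id" if "y : A Int U" "h : B" "al : P" "act al y = y *. h" for y h al
  using U(3)[of "act al" y] that by simp
  thus "EX S. open (fst S) & open (snd S) & x : fst S & \<one> : snd S &
  (ALL y:fst S. ALL h:snd S. ALL al:P. act al y = y *. h --> act al = id)"
  using AB(1-3) U(1,2) by (intro exI[of _ "(A Int U, B)"]) auto
 qed
 from choice[OF this] obtain S where S: "ALL x. open (fst (S x)) & open (snd (S x)) & x : fst (S x) & \<one> : snd (S x) &
  (ALL y:fst (S x). ALL h:snd (S x). ALL al:P. act al y = y *. h --> act al = id)" ..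
 have S': "open (fst (S x))" "open (snd (S x))" "x : fst (S x)" "\<one> : snd (S x)"
  "y : fst (S x) ==> h : snd (S x) ==> al : P ==> act al y = y *. h ==> act al = id" for x y h al
  using spec[OF S, of x] by simp_all
 obtain X where X: "finite X" "F <= (UN x:X. fst (S x))"
 proof (rule compactE_image[OF F_compact, of F "%x. fst (S x)"])
  show "F <= (UN x:F. fst (S x))" using S'(3) by blast
 qed (rule S'(1), (rule that; assumption))
 show ?thesis
 proof (rule that[of "INT x:X. snd (S x)"])
  show "open (INT x:X. snd (S x))" using X(1) S'(2) by (intro open_INT) auto
  show "\<one> : (INT x:X. snd (S x))" using S'(4) by blast
  fix al z assume a: "al : P" "z : F" "inv z *. act al z : (INT x:X. snd (S x))"
  obtain x where x: "x : X" "z : fst (S x)" using X(2) a(2) by blast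
  have "act al z = z *. (inv z *. act al z)" by simp
  from S'(5)[OF x(2) _ a(1) this] show "act al = id" using a(3) x(1) by blast
 qed
qed

text \<open>With \<open>u = inv x *. y\<close>, the lift of \<open>al\<close> sends \<open>y\<close>
  to a point that differs from \<open>y\<close> by \<open>inv u *. A (E u)\<close>, where
  \<open>A\<close> is the automorphism part of \<open>al\<close>. This is small, uniformly, as only
  finitely many automorphisms occur. Hence \<open>al\<close> composed with the inverse of
  \<open>bt\<close> moves \<open>y\<close> very little and is the identity by
  \<open>uniformly_free\<close>.\<close>

lemma lift_determined:
 obtains V where "open V" "\<one> : V"
  "!!E L b al bt x y. diff_end E L ==> al : P ==> bt : P ==> y : F ==> act al (b *. E x) = x ==> act bt (b *. E y) = y ==>
  inv x *. y : V ==> E (inv x *. y) : V ==> act al = act bt"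
proof -
 obtain R where R: "finite R" "R <= P" "!!al. al : P ==> EX ga:Ga. EX rh:R. al = (ga *. fst rh, snd rh)"
  by (rule finite_reps) (rule that; assumption)
 obtain V where V: "open V" "\<one> : V" "!!al x. al : P ==> x : F ==> inv x *. act al x : V ==> act al = id"
  by (rule uniformly_free) (rule that; assumption)
 have RC: "diff_end (snd rh) (lie_differential G \<A> (snd rh))" if "rh : R" for rh
  using that R(2) P_C[of "fst rh" "snd rh"] by (intro C_end) auto
 have "ALL rh:R. EX W. open W & \<one> : W & (ALL u:W. ALL v:W. inv u *. snd rh v : V)"
 proof
  fix rh assume rh: "rh : R"
  have "continuous_on UNIV (snd rh)" using RC[OF rh] by (simp add: diff_end_def)
  hence "continuous_on UNIV (%z::'s \<times> 's. snd rh (snd z))"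
  by (rule continuous_on_compose2) (auto intro: continuous_on_snd continuous_on_id)
  hence "continuous_on UNIV (%(u, v). inv u *. snd rh v)"
  unfolding split_beta by (intro group_cont continuous_on_fst continuous_on_id)
  from open_vimage[OF V(1) this] have "open ((%(u, v). inv u *. snd rh v) -` V)" .
  moreover have "(\<one>, \<one>) : (%(u, v). inv u *. snd rh v) -` V" using V(2) diff_end_one[OF RC[OF rh]] by simp
  ultimately obtain A B where AB: "open A" "open B" "(\<one>, \<one>) : A \<times> B" "A \<times> B <= (%(u, v). inv u *. snd rh v) -` V"
  by (rule open_prod_elim)
  have "inv u *. snd rh v : V" if "u : A Int B" "v : A Int B" for u v using subsetD[OF AB(4), of "(u, v)"] that by simp
  thus "EX W. open W & \<one> : W & (ALL u:W. ALL v:W. inv u *. snd rh v : V)"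
  using AB(1-3) by (intro exI[of _ "A Int B"]) auto
 qed
 from bchoice[OF this] obtain W where W: "ALL rh:R. open (W rh) & \<one> : W rh & (ALL u:W rh. ALL v:W rh. inv u *. snd rh v : V)" ..
 show ?thesis
 proof (rule that[of "INT rh:R. W rh"])
  show "open (INT rh:R. W rh)" by (rule open_INT[OF R(1)]) (use W in simp)
  show "\<one> : (INT rh:R. W rh)" using W by simp
  fix E L b al bt x y
  assume E: "diff_end E L" and a: "al : P" "bt : P" and y: "y : F" and fx: "act al (b *. E x) = x" "act bt (b *. E y) = y"
  and u: "inv x *. y : (INT rh:R. W rh)" "E (inv x *. y) : (INT rh:R. W rh)"
  let ?u = "inv x *. y"
  obtain ga rh where rh: "ga : Ga" "rh : R" "al = (ga *. fst rh, snd rh)" using R(3)[OF a(1)] by (elim bexE)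
  have "E y = E x *. E ?u" using diff_end_mult[OF E, of x ?u] by simp
  hence "act al (b *. E y) = act al (b *. E x) *. snd rh (E ?u)"
  by (simp add: rh(3) act_simp m_assoc diff_end_mult[OF RC[OF rh(2)]])
  hence e: "inv y *. act al (b *. E y) = inv ?u *. snd rh (E ?u)"
  unfolding fx(1) by (simp add: inv_mult_group m_assoc)
  have "?u : W rh" "E ?u : W rh" using u rh(2) by blast+
  hence in_V: "inv ?u *. snd rh (E ?u) : V" using bspec[OF W rh(2)] by simp
  have ab: "act al : act ` P" "act bt : act ` P" using a by simp_all
  obtain g where g: "g : act ` P" "g o act bt = id" "act bt o g = id" using deck.inverse[OF ab(2)] by (elim bexE conjE)
  have "act al o g : act ` P" by (rule deck.comp[OF ab(1) g(1)])
  then obtain dl where dl: "act al o g = act dl" "dl : P" by (rule imageE)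
  have "g y = b *. E y" using fun_cong[OF g(2), of "b *. E y"] by (simp add: fx(2))
  hence "act dl y = act al (b *. E y)" using fun_cong[OF dl(1), of y] by simp
  hence "act dl = id" using in_V e by (intro V(3)[OF dl(2) y]) simp
  hence "act al o (g o act bt) = act bt" using dl(1) by (simp only: o_assoc) simp
  thus "act al = act bt" unfolding g(2) by simp
 qed
qed

text \<open>Every lift with a fixed point in \<open>F\<close> gets the code of one such point; by
  \<open>lift_determined\<close> different lifts get different codes, so the number of codes bounds
  the number of essential classes.\<close>

lemma nielsen_upper:
 assumes D: "diff_end D L" and q: "q > 0"
 obtains K N where "N > 0" "real N <= cover_bound (L ^^ q)"
  "!!f b n. continuous_map M M f ==> ALL x. f (pr x) = pr (b *. (D ^^ n) x) ==>
  finite (deck.essential f (%x. b *. (D ^^ n) x)) & nielsen_number M pr f <= K * N ^ (n div q)"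
proof -
 obtain V where V: "open V" "\<one> : V"
  "!!E L b al bt x y. diff_end E L ==> al : P ==> bt : P ==> y : F ==> act al (b *. E x) = x ==> act bt (b *. E y) = y ==>
  inv x *. y : V ==> E (inv x *. y) : V ==> act al = act bt" by (rule lift_determined) (rule that; assumption)
 obtain K N where N: "N > 0" "real N <= cover_bound (L ^^ q)"
  and K: "!!n. EX c :: 's => nat. (ALL x:F. c x < K * N ^ (n div q)) &
  (ALL x:F. ALL y:F. c x = c y --> inv x *. y : V & (D ^^ n) (inv x *. y) : V)"
  by (rule itineraries[OF D F_compact V(1,2) q]) (rule that; assumption)
 show ?thesis
 proof (rule that[OF N])
  fix f b n assume fM: "continuous_map M M f" "ALL x. f (pr x) = pr (b *. (D ^^ n) x)"
  note f = fM(1) spec[OF fM(2)]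
  have Dn: "diff_end (D ^^ n) (L ^^ n)" by (rule diff_end_funpow[OF D])
  obtain c :: "'s => nat" where c: "ALL x:F. c x < K * N ^ (n div q)"
  "ALL x:F. ALL y:F. c x = c y --> inv x *. y : V & (D ^^ n) (inv x *. y) : V" using K[of n] by (elim exE conjE)
  define X where "X = {t : act ` P. EX x:F. t (b *. (D ^^ n) x) = x}"
  have "ALL t:X. EX x. x : F & t (b *. (D ^^ n) x) = x" unfolding X_def by blast
  from bchoice[OF this] obtain h where h: "ALL t:X. h t : F & t (b *. (D ^^ n) (h t)) = h t" ..
  have "inj_on (%t. c (h t)) X"
  proof (rule inj_onI)
  fix s t assume st: "s : X" "t : X" "c (h s) = c (h t)"
  have hs: "h s : F" "s (b *. (D ^^ n) (h s)) = h s" "h t : F" "t (b *. (D ^^ n) (h t)) = h t"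
  using bspec[OF h st(1)] bspec[OF h st(2)] by simp_all
  have v: "inv (h s) *. h t : V" "(D ^^ n) (inv (h s) *. h t) : V" using c(2) hs(1,3) st(3) by blast+
  obtain al bt where a: "al : P" "bt : P" "s = act al" "t = act bt" using st(1,2) unfolding X_def by blast
  show "s = t" using V(3)[OF Dn a(1,2) hs(3) _ _ v, of b] hs(2,4) unfolding a(3,4) by simp
  qed
  moreover have "(%t. c (h t)) ` X <= {..<K * N ^ (n div q)}" by (rule image_subsetI) (use c(1) h in simp)
  ultimately have X: "finite X" "card X <= K * N ^ (n div q)"
  using inj_on_finite[of "%t. c (h t)" X "{..<K * N ^ (n div q)}"] card_inj_on_le[of "%t. c (h t)" X "{..<K * N ^ (n div q)}"]
  by simp_all
  have XX: "t : X" if "t : act ` P" "x : F" "t (b *. (D ^^ n) x) = x" for t x using that unfolding X_def by blast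
  have "finite (deck.essential f (%x. b *. (D ^^ n) x))"
  by (rule deck.essential_le(1)[OF f(1) affine_lift[OF Dn f(2)] manifold_ENR X(1)]) (rule XX)
  moreover have "nielsen_number M pr f <= card X"
  by (rule deck.essential_le(2)[OF f(1) affine_lift[OF Dn f(2)] manifold_ENR X(1)]) (rule XX)
  ultimately show "finite (deck.essential f (%x. b *. (D ^^ n) x)) & nielsen_number M pr f <= K * N ^ (n div q)"
  using X(2) by (intro conjI) (assumption, rule order_trans)
 qed
qed

end

section \<open>Growth rates and the conclusion\<close>

lemma growth_eqI:
 fixes a :: "nat => nat"
 assumes s: "1 <= s" and upper: "!!r. s < r ==> EX K. ALL n. real (a n) <= K * r ^ n"
  and c: "c > 0" "ALL N. EX n>=N. c * s ^ n <= real (a n)" shows "growth (%n. of_nat (a n)) = ereal s"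
proof -
 let ?X = "%n. ereal (root n (real (a n)))"
 have le: "limsup ?X <= ereal r" if r: "s < r" for r
 proof -
  obtain K where K: "!!n. real (a n) <= K * r ^ n" using upper[OF r] by blast
  \<comment> \<open>\<open>K\<close> may fail to be positive; the \<open>n\<close>-th root of a
    positive constant tends to \<open>1\<close>.\<close>
  let ?K = "max K 1"
  have r0: "r > 0" using r s by simp
  have "eventually (%n. ?X n <= ereal (root n ?K * r)) sequentially" using eventually_gt_at_top[of 0]
  proof eventually_elim
  fix n :: nat assume n: "0 < n"
  have "real (a n) <= ?K * r ^ n" by (rule order_trans[OF K]) (use r0 in \<open>simp add: mult_right_mono\<close>)
  hence "root n (real (a n)) <= root n (?K * r ^ n)" using n by simp
  also have "... = root n ?K * r" using n r0 by (simp add: real_root_mult real_root_power_cancel)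
  finally show "?X n <= ereal (root n ?K * r)" by simp
  qed
  hence "limsup ?X <= limsup (%n. ereal (root n ?K * r))" by (rule Limsup_mono)
  also have "(%n. root n ?K * r) \<longlonglongrightarrow> 1 * r" by (intro tendsto_intros LIMSEQ_root_const) simp
  hence "limsup (%n. ereal (root n ?K * r)) = ereal r" by (intro lim_imp_Limsup) auto
  finally show ?thesis .
 qed
 have "limsup ?X <= ereal s"
 proof (rule ereal_le_epsilon2)
  show "limsup ?X <= ereal s + ereal e" if "0 < e" for e using le[of "s + e"] that by simp
 qed
 moreover have "ereal s <= limsup ?X"
 proof (rule ccontr)
  assume "~ ereal s <= limsup ?X"
  then obtain t where t: "limsup ?X < ereal t" "t < s"
  using ereal_dense2[of "limsup ?X" "ereal s"] by (auto simp: not_le)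
  have "(%n. root n c * s) \<longlonglongrightarrow> 1 * s" by (intro tendsto_intros LIMSEQ_root_const c)
  hence "eventually (%n. t < root n c * s) sequentially" using t(2) order_tendstoD(1) by fastforce
  moreover have "eventually (%n. ?X n < ereal t) sequentially" using Limsup_lessD[OF t(1)] .
  ultimately have "eventually (%n. root n (real (a n)) < root n c * s) sequentially" by eventually_elim simp
  then obtain N where N: "!!n. n >= N ==> root n (real (a n)) < root n c * s"
  unfolding eventually_sequentially by blast
  obtain n where n: "n >= Suc N" "c * s ^ n <= real (a n)" using c(2) by blast
  have "root n c * s = root n (c * s ^ n)" using n(1) s by (simp add: real_root_mult real_root_power_cancel)
  also have "... <= root n (real (a n))" using n by simp
  finally show False using N[of n] n(1) by simp
 qed
 ultimately have "limsup ?X = ereal s" by (rule antisym)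
 thus ?thesis using s by (simp add: growth_def max_def)
qed

lemma homotopic_with_funpow:
 assumes "homotopic_with (%_. True) X X h f" shows "homotopic_with (%_. True) X X (h ^^ n) (f ^^ n)"
proof (induction n)
 case 0
 show ?case by (simp add: homotopic_with_refl continuous_map_id[unfolded id_def] id_def)
next
 case (Suc n)
 have c: "continuous_map X X h" "continuous_map X X (f ^^ n)"
  using homotopic_with_imp_continuous_maps[OF assms] homotopic_with_imp_continuous_maps[OF Suc] by simp_all
 have "homotopic_with (%_. True) X X (h o h ^^ n) (h o f ^^ n)"
  by (rule homotopic_with_compose_continuous_map_left[OF Suc c(1)]) simp
 moreover have "homotopic_with (%_. True) X X (h o f ^^ n) (f o f ^^ n)"
  by (rule homotopic_with_compose_continuous_map_right[OF assms c(2)]) simp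
 ultimately show ?case unfolding funpow.simps by (rule homotopic_with_trans)
qed

lemma continuous_map_funpow: "continuous_map X X h ==> continuous_map X X (h ^^ n)"
 by (induction n) (auto intro: continuous_map_compose simp: continuous_map_id[unfolded id_def] id_def)

context infra_fund begin

lemma affine_funpow:
 assumes D: "diff_end D L"
 obtains b where "(%x. d *. D x) ^^ n = (%x. b *. (D ^^ n) x)"
proof -
 have "EX b. (%x. d *. D x) ^^ n = (%x. b *. (D ^^ n) x)"
 proof (induction n)
  case 0
  show ?case by (intro exI[of _ \<one>]) (simp add: fun_eq_iff)
 next
  case (Suc n)
  then obtain b where "(%x. d *. D x) ^^ n = (%x. b *. (D ^^ n) x)" ..
  thus ?case by (intro exI[of _ "d *. D b"]) (simp add: fun_eq_iff diff_end_mult[OF D] m_assoc)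
 qed
 thus ?thesis using that by blast
qed

lemma nielsen_homotopic:
 assumes "homotopic_with (%_. True) M M h f" "k : lifts pr h" shows "nielsen_number M pr f = nielsen_number M pr h"
proof -
 obtain H where H: "continuous_map (cylinder M) M H"
  "!!x. H (0, x) = h x" "!!x. H (1, x) = f x" using assms(1) unfolding homotopic_with_def by blast
 have e: "(%x. H (0, x)) = h" "(%x. H (1, x)) = f" using H(2,3) by auto
 have "(%(t, x). H (t, x)) = H" by auto
 thus ?thesis using deck.nielsen_homotopy[of "%t x. H (t, x)" k] H(1) assms(2) e by simp
qed

end

theorem theorem4p3:
 fixes G :: "'s::{t2_space, second_countable_topology} monoid"
  and \<A> :: "('s, 'n::{finite, linorder}) chart set"
  and C :: "('s \<Rightarrow> 's) set"
  and P :: "('s \<times> ('s \<Rightarrow> 's)) set"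
  and f :: "'s set \<Rightarrow> 's set"
  and d :: 's and D :: "'s \<Rightarrow> 's"
 assumes "infra_solvmanifold_R G \<A> C P"
  and "continuous_map (infra_manifold G C P) (infra_manifold G C P) f"
  and "affine_homotopy_lift G \<A> C P f d D"
  and "1 \<notin> complex_spectrum (lie_differential G \<A> D)"
 shows "asymptotic_nielsen_number (infra_manifold G C P) (infra_proj G C P) f =
  ereal (spectral_rad (ext_map (lie_differential G \<A> D)))"
proof -
 obtain F where F: "compact F" "!!x. EX ga:translation_part P. EX y:F. x = ga \<otimes>\<^bsub>G\<^esub> y"
  by (rule infra_solvmanifold_R.fundamental_compact[OF assms(1)]) (rule that; assumption)
 interpret infra_fund G \<A> C P F
  by (rule infra_fund.intro[OF assms(1) infra_fund_axioms.intro[OF F]])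
 let ?L = "lie_differential G \<A> D"
 define s where "s = spectral_rad (ext_map ?L)"
 have DE: "D : lie_End G \<A>" using assms(3) by (simp add: affine_homotopy_lift_def semidirect_def)
 have D: "diff_end D ?L" by (rule lie_End_diff_end[OF DE])
 have L: "linear ?L" using bounded_linear.linear[OF diff_end_linear[OF D]] .
 have s1: "1 <= s" unfolding s_def by (rule spectral_rad_ext_map(2)[OF L])
 have Dn: "diff_end (D ^^ n) (?L ^^ n)" for n by (rule diff_end_funpow[OF D])
 obtain h where h: "continuous_map M M h" "!!x. h (pr x) = pr (d \<otimes>\<^bsub>G\<^esub> D x)" "homotopic_with (%_. True) M M h f"
  using assms(3) unfolding affine_homotopy_lift_def by (auto simp: act_simp)
 have "ALL n. EX b. (%x. d \<otimes>\<^bsub>G\<^esub> D x) ^^ n = (%x. b \<otimes>\<^bsub>G\<^esub> (D ^^ n) x)"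
  using affine_funpow[OF D] by metis
 from choice[OF this] obtain b where b: "!!n. (%x. d \<otimes>\<^bsub>G\<^esub> D x) ^^ n = (%x. b n \<otimes>\<^bsub>G\<^esub> (D ^^ n) x)"
  by blast
 have "(h ^^ n) (pr x) = pr (((%x. d \<otimes>\<^bsub>G\<^esub> D x) ^^ n) x)" for n x by (induction n) (simp_all add: h(2))
 hence hn: "(h ^^ n) (pr x) = pr (b n \<otimes>\<^bsub>G\<^esub> (D ^^ n) x)" for n x by (simp add: b)
 hence hn': "ALL x. (h ^^ n) (pr x) = pr (b n \<otimes>\<^bsub>G\<^esub> (D ^^ n) x)" for n by simp
 have hc: "continuous_map M M (h ^^ n)" for n by (rule continuous_map_funpow[OF h(1)])
 have N: "nielsen_number M pr (f ^^ n) = nielsen_number M pr (h ^^ n)" for n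
  by (rule nielsen_homotopic[OF homotopic_with_funpow[OF h(3)] affine_lift[OF Dn hn]])
 have upper: "EX K. ALL n. real (nielsen_number M pr (f ^^ n)) <= K * r ^ n" if r: "s < r" for r
 proof -
  \<comment> \<open>An intermediate rate: minors grow at most like \<open>t ^ q\<close>, and the gap
    between \<open>t\<close> and \<open>r\<close> pays for the constants.\<close>
  define t where "t = (s + r) / 2"
  have t: "s < t" "t < r" "0 < t" using r s1 by (simp_all add: t_def)
  obtain B where B: "!!q. max_minor (matrix (?L ^^ q)) <= B * t ^ q"
  using max_minor_growth[OF L, of t] t(1) unfolding s_def by blast
  let ?m = "(24 * real CARD('n)) ^ CARD('n)"
  have "1 < r / t" using t by simp
  \<comment> \<open>The maximum with \<open>1\<close> forces \<open>q > 0\<close>, and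
    \<open>?m * B < (r / t) ^ q\<close> lets \<open>r ^ q\<close> absorb the constant factor of
    \<open>cover_bound\<close>.\<close>
  then obtain q where q: "max (?m * B) 1 < (r / t) ^ q" using real_arch_pow by blast
  have q0: "q > 0" using q by (cases q) auto
  have "?m * B < r ^ q / t ^ q"  using q by (simp add: power_divide)
  hence rq: "?m * B * t ^ q <= r ^ q" using t(3) by (simp add: pos_less_divide_eq)
  obtain K N where KN: "N > 0" "real N <= ?m * max_minor (matrix (?L ^^ q))"
  "!!f b n. continuous_map M M f ==> ALL x. f (pr x) = pr (b \<otimes>\<^bsub>G\<^esub> (D ^^ n) x) ==>
  finite (deck.essential f (%x. b \<otimes>\<^bsub>G\<^esub> (D ^^ n) x)) & nielsen_number M pr f <= K * N ^ (n div q)"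
  by (rule nielsen_upper[OF D q0]) (rule that; assumption)
  have "?m * max_minor (matrix (?L ^^ q)) <= ?m * (B * t ^ q)" using B by (intro mult_left_mono) simp_all
  hence Nr: "real N <= r ^ q" using KN(2) rq unfolding mult.assoc[symmetric] by linarith
  have "real (nielsen_number M pr (h ^^ n)) <= real K * r ^ n" for n
  proof -
  have "nielsen_number M pr (h ^^ n) <= K * N ^ (n div q)" using KN(3)[OF hc hn'] by blast
  hence "real (nielsen_number M pr (h ^^ n)) <= real K * real N ^ (n div q)"
  by (metis of_nat_le_iff of_nat_mult of_nat_power)
  also have "... <= real K * (r ^ q) ^ (n div q)" using Nr by (intro mult_left_mono power_mono) simp_all
  also have "... = real K * r ^ (q * (n div q))" by (simp add: power_mult)
  also have "... <= real K * r ^ n" using r s1 by (intro mult_left_mono power_increasing) simp_all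
  finally show ?thesis .
  qed
  thus ?thesis unfolding N by blast
 qed
 \<comment> \<open>This instance with \<open>q = 1\<close> supplies the finiteness of the essential
   classes for the lower bound, where a \<open>card\<close> of an infinite set would count as
   \<open>0\<close>.\<close>
 obtain K N where fin: "!!f b n. continuous_map M M f ==> ALL x. f (pr x) = pr (b \<otimes>\<^bsub>G\<^esub> (D ^^ n) x) ==>
  finite (deck.essential f (%x. b \<otimes>\<^bsub>G\<^esub> (D ^^ n) x)) & nielsen_number M pr f <= K * N ^ (n div 1)"
  by (rule nielsen_upper[OF D zero_less_one]) (rule that; assumption)
 obtain r where r: "!!f b E L Y. continuous_map M M f ==> ALL x. f (pr x) = pr (b \<otimes>\<^bsub>G\<^esub> E x) ==> diff_end E L ==>
  det1 L ~= 0 ==> finite (deck.essential f (%x. b \<otimes>\<^bsub>G\<^esub> E x)) ==> finite Y ==>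
  (ALL y:Y. EX ga:Ga. ga \<otimes>\<^bsub>G\<^esub> (b \<otimes>\<^bsub>G\<^esub> E y) = y) ==> (ALL y:Y. ALL y':Y. ALL ga:Ga. y' = ga \<otimes>\<^bsub>G\<^esub> y --> y' = y) ==>
  card Y <= r * nielsen_number M pr f" by (rule nielsen_lower) (rule that; assumption)
 obtain W where W: "open W" "W Int Ga = {\<one>\<^bsub>G\<^esub>}" by (rule Ga_isolated)
 obtain c where c: "c > 0" "!!E L b. diff_end E L ==> det1 L ~= 0 ==>
  EX Y. finite Y & c * \<bar>det1 L\<bar> <= real (card Y) &
  (ALL y:Y. EX ga:Ga. ga \<otimes>\<^bsub>G\<^esub> (b \<otimes>\<^bsub>G\<^esub> E y) = y) & (ALL y:Y. ALL y':Y. ALL ga:Ga. y' = ga \<otimes>\<^bsub>G\<^esub> y --> y' = y)"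
  by (rule many_fixed_orbits[OF Ga_subgroup W F]) (rule that; assumption)
 obtain c' where c': "c' > 0" "!!N. EX n>=N. c' * s ^ n <= \<bar>det (matrix (%u. u - (?L ^^ n) u))\<bar>"
  by (rule det_one_minus_power_growth[OF L assms(4)]) (rule that[unfolded s_def]; assumption)
 \<comment> \<open>\<open>Suc r\<close> in place of \<open>r\<close> avoids division by
   zero.\<close>
 have lower: "EX n>=N. c * c' / real (Suc r) * s ^ n <= real (nielsen_number M pr (f ^^ n))" for N
 proof -
  obtain n where n: "n >= N" "c' * s ^ n <= \<bar>det (matrix (%u. u - (?L ^^ n) u))\<bar>" using c'(2) by blast
  have "0 < c' * s ^ n" using c'(1) s1 by simp
  hence det: "det (matrix (%u. u - (?L ^^ n) u)) ~= 0" using n(2) by linarith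
  obtain Y where Y: "finite Y" "c * \<bar>det (matrix (%u. u - (?L ^^ n) u))\<bar> <= real (card Y)"
  "ALL y:Y. EX ga:Ga. ga \<otimes>\<^bsub>G\<^esub> (b n \<otimes>\<^bsub>G\<^esub> (D ^^ n) y) = y" "ALL y:Y. ALL y':Y. ALL ga:Ga. y' = ga \<otimes>\<^bsub>G\<^esub> y --> y' = y"
  using c(2)[OF Dn det, of "b n"] by (elim exE conjE)
  have "c * (c' * s ^ n) <= c * \<bar>det (matrix (%u. u - (?L ^^ n) u))\<bar>" using n(2) c(1) by (intro mult_left_mono) simp_all
  also note Y(2)
  also have "card Y <= r * nielsen_number M pr (h ^^ n)"
  by (rule r[OF hc hn' Dn det conjunct1[OF fin[OF hc hn']] Y(1,3,4)])
  hence "real (card Y) <= real (Suc r) * real (nielsen_number M pr (h ^^ n))"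
  unfolding of_nat_mult[symmetric] of_nat_le_iff by simp
  finally show ?thesis using n(1) unfolding N by (intro exI[of _ n]) (simp add: field_simps)
 qed
 show ?thesis unfolding asymptotic_nielsen_number_def s_def[symmetric]
  by (rule growth_eqI[OF s1 upper, of "c * c' / real (Suc r)"]) (use lower c(1) c'(1) in simp_all)
qed

end
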